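(* Let $(\Gamma,\epsilon)$ be a finite orientifold group, $X$ an orientifold for $(\Gamma,\epsilon)$, and $V\to X$ a real oriented $\Gamma$-equivariant vector bundle of rank $n$ on which $\Gamma$ acts by orientation-preserving isometries of an invariant fibre metric. A given $\mathrm{Spin}^\kappa$-structure for $V$ is unique up to tensoring by $\Gamma$-semi-equivariant principal $(U(1),\kappa_\epsilon)$-bundles: if $\varphi:P\to\mathrm{Fr}(V)$ and $\varphi':P'\to\mathrm{Fr}(V)$ are $\mathrm{Spin}^\kappa$-structures for $V$, then there is a $\Gamma$-semi-equivariant principal $(U(1),\kappa_\epsilon)$-bundle $L\to X$ such that $P'\cong P\otimes L$ as $\mathrm{Spin}^\kappa$-structures.
   Context: An orientifold group $(\Gamma,\epsilon)$ is a Lie group $\Gamma$ with a non-trivial homomorphism $\epsilon:\Gamma\to\mathbb Z_2=\{\pm1\}$. An orientifold is a compact smooth manifold with a smooth action of a finite orientifold group. A $\Gamma$-group $(G,\theta)$ is a Lie group $G$ with an action $\theta$ of $\Gamma$ by automorphisms, written $\gamma g$. $\mathrm{id}_\epsilon$ is the trivial action; $\kappa_\epsilon$ on $U(1)$ is complex conjugation if $\epsilon(\gamma)=-1$ and the identity otherwise. $\mathrm{Spin}^c(n)=(\mathrm{Spin}(n)\times U(1))/\{\pm(1,1)\}$ carries the action $\kappa_\epsilon[g,z]=[g,\kappa_\epsilon(z)]$, and $\mathrm{Ad}^c[g,z]=\mathrm{Ad}(g)\in SO(n)$, with $\mathrm{Ad}:\mathrm{Spin}(n)\to SO(n)$ the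 double cover. A $\Gamma$-semi-equivariant principal $(G,\theta)$-bundle over $X$ is a smooth principal $G$-bundle $P\to X$ with a left $\Gamma$-action covering that on $X$ with $\gamma(pg)=(\gamma p)(\gamma g)$. $\mathrm{Fr}(V)$ is the bundle of oriented orthonormal frames of $V$, a $\Gamma$-semi-equivariant principal $(SO(n),\mathrm{id}_\epsilon)$-bundle. A $\mathrm{Spin}^\kappa$-structure for $V$ is a $\Gamma$-semi-equivariant principal $(\mathrm{Spin}^c(n),\kappa_\epsilon)$-bundle $P$ with a $\Gamma$-equivariant smooth map $\varphi:P\to\mathrm{Fr}(V)$ over $\mathrm{id}_X$ with $\varphi(pg)=\varphi(p)\mathrm{Ad}^c(g)$; an isomorphism of $\mathrm{Spin}^\kappa$-structures is a $\Gamma$-equivariant isomorphism of principal $\mathrm{Spin}^c(n)$-bundles commuting with the maps to $\mathrm{Fr}(V)$. Tensor product: $P\otimes L:=(P\times_XL)/\big((pz,l)\sim(p,lz),\ z\in U(1)\big)$, where $U(1)\subset\mathrm{Spin}^c(n)$ is the central subgroup $\{[1,z]\}$, with right action $[p,l]g=[pg,l]$, $\Gamma$-action $\gamma[p,l]=[\gamma p,\gamma l]$, and map $[p,l]\mapsto\varphi(p)$ to $\mathrm{Fr}(V)$. *)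

theory Defs
  imports
    "HOL-Analysis.Function_Topology"
    "HOL-Analysis.Abstract_Topological_Spaces"
    "HOL-Algebra.Coset"
    "HOL-Algebra.Group_Action"
    "Jordan_Normal_Form.Determinant"
begin

section \<open>Smooth manifolds\<close>

text \<open>
  Dimensions vary inside the development (total spaces, Lie groups, Clifford algebras), so
  Euclidean space is \<open>\<real>\<^sup>I\<close> for a finite index set \<open>I\<close>, i.e. the extensional functions
  \<open>I \<rightarrow> \<real>\<close> with the product topology; a function is \<open>C\<^sup>k\<close> on the open set \<open>U\<close> if its iterated partial
  derivatives up to order \<open>k\<close> exist and are continuous on \<open>U\<close>.
\<close>

primrec Ck_on :: "'i set \<Rightarrow> nat \<Rightarrow> ('i \<Rightarrow> real) set \<Rightarrow> (('i \<Rightarrow> real) \<Rightarrow> real) \<Rightarrow> bool" where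
  "Ck_on I 0 U f \<longleftrightarrow> continuous_map (subtopology (powertop_real I) U) euclideanreal f"
| "Ck_on I (Suc k) U f \<longleftrightarrow>
     continuous_map (subtopology (powertop_real I) U) euclideanreal f \<and>
     (\<forall>i\<in>I. \<exists>g. (\<forall>x\<in>U. ((\<lambda>t. f (x(i := t))) has_real_derivative g x) (at (x i))) \<and> Ck_on I k U g)"

definition smooth_on :: "'i set \<Rightarrow> ('i \<Rightarrow> real) set \<Rightarrow> (('i \<Rightarrow> real) \<Rightarrow> real) \<Rightarrow> bool" where
  "smooth_on I U f \<longleftrightarrow> openin (powertop_real I) U \<and> (\<forall>k. Ck_on I k U f)"

text \<open>
  A manifold is given by its topology and its sheaf of smooth real functions
  (Bredon, \<^emph>\<open>Topology and Geometry\<close>, Section II.2): \<open>fsm M U f\<close> says that \<open>f\<close> is a smooth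
  function on the open set \<open>U\<close>; the values of \<open>f\<close> outside \<open>U\<close> are irrelevant.
\<close>

record 'a fspace =
  ftop :: "'a topology"
  fsm :: "'a set \<Rightarrow> ('a \<Rightarrow> real) \<Rightarrow> bool"

abbreviation points :: "'a fspace \<Rightarrow> 'a set" where
  "points M \<equiv> topspace (ftop M)"

definition functional_space :: "'a fspace \<Rightarrow> bool" where
  "functional_space M \<longleftrightarrow>
     (\<forall>U f. fsm M U f \<longrightarrow> openin (ftop M) U \<and> continuous_map (subtopology (ftop M) U) euclideanreal f) \<and>
     (\<forall>U f g. fsm M U f \<and> (\<forall>x\<in>U. g x = f x) \<longrightarrow> fsm M U g) \<and>
     (\<forall>U c. openin (ftop M) U \<longrightarrow> fsm M U (\<lambda>_. c)) \<and>
     (\<forall>U f g. fsm M U f \<and> fsm M U g \<longrightarrow> fsm M U (\<lambda>x. f x + g x) \<and> fsm M U (\<lambda>x. f x * g x)) \<and>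
     (\<forall>U V f. fsm M U f \<and> openin (ftop M) V \<and> V \<subseteq> U \<longrightarrow> fsm M V f) \<and>
     (\<forall>\<U> f. (\<forall>U\<in>\<U>. fsm M U f) \<longrightarrow> fsm M (\<Union>\<U>) f)"

definition smooth_map :: "'a fspace \<Rightarrow> 'b fspace \<Rightarrow> ('a \<Rightarrow> 'b) \<Rightarrow> bool" where
  "smooth_map M N f \<longleftrightarrow>
     continuous_map (ftop M) (ftop N) f \<and>
     (\<forall>V g. fsm N V g \<longrightarrow> fsm M {x \<in> points M. f x \<in> V} (g \<circ> f))"

definition diffeo :: "'a fspace \<Rightarrow> 'b fspace \<Rightarrow> ('a \<Rightarrow> 'b) \<Rightarrow> bool" where
  "diffeo M N f \<longleftrightarrow>
     smooth_map M N f \<and>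
     (\<exists>g. smooth_map N M g \<and> (\<forall>x\<in>points M. g (f x) = x) \<and> (\<forall>y\<in>points N. f (g y) = y))"

definition euclidean_fspace :: "'i set \<Rightarrow> ('i \<Rightarrow> real) fspace" where
  "euclidean_fspace I = \<lparr>ftop = powertop_real I, fsm = smooth_on I\<rparr>"

text \<open>
  Smooth functions on a set mapped to \<open>M\<close> by \<open>e\<close> are those that locally factor through
  smooth functions of \<open>M\<close>. For \<open>e\<close> an inclusion this is the structure of an open subset or of an
  embedded submanifold.
\<close>

definition pull_space :: "'a set \<Rightarrow> ('a \<Rightarrow> 'b) \<Rightarrow> 'b fspace \<Rightarrow> 'a fspace" where
  "pull_space S e M =
     \<lparr>ftop = pullback_topology S e (ftop M),
      fsm = (\<lambda>W f. openin (pullback_topology S e (ftop M)) W \<and>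
              (\<forall>p\<in>W. \<exists>A a. fsm M A a \<and> e p \<in> A \<and> (\<forall>q\<in>W. e q \<in> A \<longrightarrow> f q = a (e q))))\<rparr>"

definition sub_space :: "'a fspace \<Rightarrow> 'a set \<Rightarrow> 'a fspace" where
  "sub_space M S = pull_space S (\<lambda>x. x) M"

definition smooth_manifold :: "'a fspace \<Rightarrow> bool" where
  "smooth_manifold M \<longleftrightarrow>
     functional_space M \<and> Hausdorff_space (ftop M) \<and> second_countable (ftop M) \<and>
     (\<exists>m::nat. \<forall>x\<in>points M. \<exists>U V \<psi>.
        openin (ftop M) U \<and> x \<in> U \<and> openin (powertop_real {..<m}) V \<and>
        diffeo (sub_space M U) (sub_space (euclidean_fspace {..<m}) V) \<psi>)"

text \<open>
  Products: smooth functions are locally \<open>h(c\<^sub>0,\<dots>,c\<^sub>r\<^sub>-\<^sub>1)\<close> with \<open>h\<close> smooth on an open subset of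
  \<open>\<real>\<^sup>r\<close> and each \<open>c\<^sub>j\<close> a smooth function of one factor. Taking the \<open>c\<^sub>j\<close> to be
  chart coordinates shows that this is the usual product structure on a product of manifolds.
\<close>

definition gen_smooth ::
  "'a topology \<Rightarrow> ('a set \<Rightarrow> ('a \<Rightarrow> real) \<Rightarrow> bool) \<Rightarrow> 'a set \<Rightarrow> ('a \<Rightarrow> real) \<Rightarrow> bool" where
  "gen_smooth T B W f \<longleftrightarrow>
     openin T W \<and>
     (\<forall>p\<in>W. \<exists>V (r::nat) c D h.
        openin T V \<and> p \<in> V \<and> V \<subseteq> W \<and> (\<forall>j<r. B V (c j)) \<and> smooth_on {..<r} D h \<and>
        (\<forall>q\<in>V. (\<lambda>j\<in>{..<r}. c j q) \<in> D \<and> f q = h (\<lambda>j\<in>{..<r}. c j q)))"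

definition prod_space :: "'a fspace \<Rightarrow> 'b fspace \<Rightarrow> ('a \<times> 'b) fspace" where
  "prod_space M N =
     \<lparr>ftop = prod_topology (ftop M) (ftop N),
      fsm = gen_smooth (prod_topology (ftop M) (ftop N))
        (\<lambda>V c. (\<exists>A a. fsm M A a \<and> (\<forall>q\<in>V. fst q \<in> A \<and> c q = a (fst q))) \<or>
               (\<exists>A a. fsm N A a \<and> (\<forall>q\<in>V. snd q \<in> A \<and> c q = a (snd q))))\<rparr>"

definition power_space :: "'i set \<Rightarrow> 'a fspace \<Rightarrow> ('i \<Rightarrow> 'a) fspace" where
  "power_space I M =
     \<lparr>ftop = product_topology (\<lambda>_. ftop M) I,
      fsm = gen_smooth (product_topology (\<lambda>_. ftop M) I)
        (\<lambda>V c. \<exists>i\<in>I. \<exists>A a. fsm M A a \<and> (\<forall>q\<in>V. q i \<in> A \<and> c q = a (q i)))\<rparr>"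

text \<open>Quotient along a map \<open>q\<close>: a function is smooth iff its pullback along \<open>q\<close> is.\<close>

definition quot_topology :: "'a topology \<Rightarrow> ('a \<Rightarrow> 'b) \<Rightarrow> 'b topology" where
  "quot_topology T q = topology (\<lambda>U. U \<subseteq> q ` topspace T \<and> openin T {x \<in> topspace T. q x \<in> U})"

lemma openin_quot_topology:
  "openin (quot_topology T q) U \<longleftrightarrow> U \<subseteq> q ` topspace T \<and> openin T {x \<in> topspace T. q x \<in> U}"
proof -
  have "istopology (\<lambda>U. U \<subseteq> q ` topspace T \<and> openin T {x \<in> topspace T. q x \<in> U})"
  proof (unfold istopology_def, intro conjI allI impI)
    fix S R
    assume "S \<subseteq> q ` topspace T \<and> openin T {x \<in> topspace T. q x \<in> S}"
      and "R \<subseteq> q ` topspace T \<and> openin T {x \<in> topspace T. q x \<in> R}"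
    moreover have "{x \<in> topspace T. q x \<in> S \<inter> R} =
        {x \<in> topspace T. q x \<in> S} \<inter> {x \<in> topspace T. q x \<in> R}" by blast
    ultimately show "S \<inter> R \<subseteq> q ` topspace T" "openin T {x \<in> topspace T. q x \<in> S \<inter> R}"
      by auto
  next
    fix K
    assume K: "\<forall>U\<in>K. U \<subseteq> q ` topspace T \<and> openin T {x \<in> topspace T. q x \<in> U}"
    have "{x \<in> topspace T. q x \<in> \<Union>K} = (\<Union>U\<in>K. {x \<in> topspace T. q x \<in> U})" by blast
    then show "openin T {x \<in> topspace T. q x \<in> \<Union>K}" using K by auto
    show "\<Union>K \<subseteq> q ` topspace T" using K by blast
  qed
  then show ?thesis unfolding quot_topology_def by (simp add: topology_inverse')
qed

definition quot_space :: "'a fspace \<Rightarrow> ('a \<Rightarrow> 'b) \<Rightarrow> 'b fspace" where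
  "quot_space M q =
     \<lparr>ftop = quot_topology (ftop M) q,
      fsm = (\<lambda>U f. openin (quot_topology (ftop M) q) U \<and> fsm M {x \<in> points M. q x \<in> U} (f \<circ> q))\<rparr>"


section \<open>Lie groups and orientifolds\<close>

record 'g lie = "'g monoid" +
  lsp :: "'g fspace"

definition lie_group :: "'g lie \<Rightarrow> bool" where
  "lie_group G \<longleftrightarrow>
     group G \<and> smooth_manifold (lsp G) \<and> points (lsp G) = carrier G \<and>
     smooth_map (prod_space (lsp G) (lsp G)) (lsp G) (\<lambda>(a, b). a \<otimes>\<^bsub>G\<^esub> b) \<and>
     smooth_map (lsp G) (lsp G) (\<lambda>a. inv\<^bsub>G\<^esub> a)"

text \<open>
  A finite group has exactly one structure of a Lie group, the discrete one. Hence \<open>\<Gamma>\<close> is a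
  plain group, \<open>\<epsilon>\<close> is automatically smooth, and a smooth action is one by smooth maps.
\<close>

definition finite_orientifold_group :: "'c monoid \<Rightarrow> ('c \<Rightarrow> int) \<Rightarrow> bool" where
  "finite_orientifold_group \<Gamma> \<epsilon> \<longleftrightarrow>
     group \<Gamma> \<and> finite (carrier \<Gamma>) \<and>
     \<epsilon> \<in> hom \<Gamma> \<lparr>carrier = {1, -1}, monoid.mult = (*), one = 1\<rparr> \<and>
     (\<exists>\<gamma>\<in>carrier \<Gamma>. \<epsilon> \<gamma> = -1)"

definition smooth_action :: "'c monoid \<Rightarrow> 'a fspace \<Rightarrow> ('c \<Rightarrow> 'a \<Rightarrow> 'a) \<Rightarrow> bool" where
  "smooth_action \<Gamma> M \<rho> \<longleftrightarrow>
     group_action \<Gamma> (points M) \<rho> \<and> (\<forall>\<gamma>\<in>carrier \<Gamma>. smooth_map M M (\<rho> \<gamma>))"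

definition orientifold :: "'c monoid \<Rightarrow> ('c \<Rightarrow> int) \<Rightarrow> 'x fspace \<Rightarrow> ('c \<Rightarrow> 'x \<Rightarrow> 'x) \<Rightarrow> bool" where
  "orientifold \<Gamma> \<epsilon> X \<rho> \<longleftrightarrow>
     finite_orientifold_group \<Gamma> \<epsilon> \<and> smooth_manifold X \<and> compact_space (ftop X) \<and>
     smooth_action \<Gamma> X \<rho>"

definition gamma_group :: "'c monoid \<Rightarrow> 'g lie \<Rightarrow> ('c \<Rightarrow> 'g \<Rightarrow> 'g) \<Rightarrow> bool" where
  "gamma_group \<Gamma> G \<theta> \<longleftrightarrow>
     lie_group G \<and> smooth_action \<Gamma> (lsp G) \<theta> \<and> (\<forall>\<gamma>\<in>carrier \<Gamma>. \<theta> \<gamma> \<in> iso G G)"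


section \<open>Semi-equivariant principal bundles\<close>

record ('c, 'x, 'g, 'p) pbundle =
  tot :: "'p fspace"
  proj :: "'p \<Rightarrow> 'x"
  ract :: "'p \<Rightarrow> 'g \<Rightarrow> 'p"
  gact :: "'c \<Rightarrow> 'p \<Rightarrow> 'p"

definition principal_bundle :: "'x fspace \<Rightarrow> 'g lie \<Rightarrow> ('c, 'x, 'g, 'p) pbundle \<Rightarrow> bool" where
  "principal_bundle X G P \<longleftrightarrow>
     smooth_manifold (tot P) \<and>
     smooth_map (tot P) X (proj P) \<and>
     smooth_map (prod_space (tot P) (lsp G)) (tot P) (\<lambda>(p, g). ract P p g) \<and>
     (\<forall>p\<in>points (tot P). ract P p \<one>\<^bsub>G\<^esub> = p) \<and>
     (\<forall>p\<in>points (tot P). \<forall>g\<in>carrier G. \<forall>h\<in>carrier G.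
        ract P (ract P p g) h = ract P p (g \<otimes>\<^bsub>G\<^esub> h)) \<and>
     (\<forall>p\<in>points (tot P). \<forall>g\<in>carrier G. proj P (ract P p g) = proj P p) \<and>
     (\<forall>x\<in>points X. \<exists>U \<psi>. openin (ftop X) U \<and> x \<in> U \<and>
        diffeo (sub_space (tot P) {p \<in> points (tot P). proj P p \<in> U})
          (prod_space (sub_space X U) (lsp G)) \<psi> \<and>
        (\<forall>p\<in>points (tot P). proj P p \<in> U \<longrightarrow>
           fst (\<psi> p) = proj P p \<and>
           (\<forall>g\<in>carrier G. \<psi> (ract P p g) = (proj P p, snd (\<psi> p) \<otimes>\<^bsub>G\<^esub> g))))"

definition semi_equivariant_bundle ::
  "'c monoid \<Rightarrow> 'x fspace \<Rightarrow> ('c \<Rightarrow> 'x \<Rightarrow> 'x) \<Rightarrow> 'g lie \<Rightarrow> ('c \<Rightarrow> 'g \<Rightarrow> 'g) \<Rightarrow>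
   ('c, 'x, 'g, 'p) pbundle \<Rightarrow> bool" where
  "semi_equivariant_bundle \<Gamma> X \<rho> G \<theta> P \<longleftrightarrow>
     gamma_group \<Gamma> G \<theta> \<and> principal_bundle X G P \<and> smooth_action \<Gamma> (tot P) (gact P) \<and>
     (\<forall>\<gamma>\<in>carrier \<Gamma>. \<forall>p\<in>points (tot P). proj P (gact P \<gamma> p) = \<rho> \<gamma> (proj P p)) \<and>
     (\<forall>\<gamma>\<in>carrier \<Gamma>. \<forall>p\<in>points (tot P). \<forall>g\<in>carrier G.
        gact P \<gamma> (ract P p g) = ract P (gact P \<gamma> p) (\<theta> \<gamma> g))"


section \<open>Equivariant vector bundles and their frames\<close>

text \<open>
  \<open>vorient V x\<close> is the set of positively oriented ordered bases of the fibre over \<open>x\<close>, a basis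
  being a function on \<open>{..<n}\<close>.
\<close>

record ('c, 'x, 'v) vbundle =
  vtot :: "'v fspace"
  vproj :: "'v \<Rightarrow> 'x"
  vadd :: "'v \<Rightarrow> 'v \<Rightarrow> 'v"
  vscale :: "real \<Rightarrow> 'v \<Rightarrow> 'v"
  vmetric :: "'v \<Rightarrow> 'v \<Rightarrow> real"
  vorient :: "'x \<Rightarrow> (nat \<Rightarrow> 'v) set"
  vgact :: "'c \<Rightarrow> 'v \<Rightarrow> 'v"

definition fibre :: "('c, 'x, 'v) vbundle \<Rightarrow> 'x \<Rightarrow> 'v set" where
  "fibre V x = {v \<in> points (vtot V). vproj V v = x}"

text \<open>
  The vector space axioms of the fibres are not listed: they follow from the fibrewise linear
  bijections with \<open>\<real>\<^sup>n\<close> given by the trivialisations.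
\<close>

definition oriented_vector_bundle :: "'x fspace \<Rightarrow> nat \<Rightarrow> ('c, 'x, 'v) vbundle \<Rightarrow> bool" where
  "oriented_vector_bundle X n V \<longleftrightarrow>
     smooth_manifold (vtot V) \<and> smooth_map (vtot V) X (vproj V) \<and>
     (\<forall>x\<in>points X. \<forall>v\<in>fibre V x. \<forall>w\<in>fibre V x. vadd V v w \<in> fibre V x) \<and>
     (\<forall>x\<in>points X. \<forall>v\<in>fibre V x. \<forall>a. vscale V a v \<in> fibre V x) \<and>
     (\<forall>x\<in>points X. \<exists>U \<psi>. openin (ftop X) U \<and> x \<in> U \<and>
        diffeo (sub_space (vtot V) {v \<in> points (vtot V). vproj V v \<in> U})
          (prod_space (sub_space X U) (euclidean_fspace {..<n})) \<psi> \<and>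
        (\<forall>y\<in>U.
           (\<forall>v\<in>fibre V y. fst (\<psi> v) = y) \<and>
           (\<forall>v\<in>fibre V y. \<forall>w\<in>fibre V y. \<forall>i<n.
              snd (\<psi> (vadd V v w)) i = snd (\<psi> v) i + snd (\<psi> w) i) \<and>
           (\<forall>v\<in>fibre V y. \<forall>a. \<forall>i<n. snd (\<psi> (vscale V a v)) i = a * snd (\<psi> v) i) \<and>
           vorient V y = {f \<in> {..<n} \<rightarrow>\<^sub>E fibre V y. det (mat n n (\<lambda>(i, j). snd (\<psi> (f j)) i)) > 0}))"

definition fibre_metric :: "'x fspace \<Rightarrow> ('c, 'x, 'v) vbundle \<Rightarrow> bool" where
  "fibre_metric X V \<longleftrightarrow>
     (\<forall>x\<in>points X. \<forall>u\<in>fibre V x. \<forall>v\<in>fibre V x. \<forall>w\<in>fibre V x. \<forall>a.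
        vmetric V v w = vmetric V w v \<and>
        vmetric V (vadd V u v) w = vmetric V u w + vmetric V v w \<and>
        vmetric V (vscale V a v) w = a * vmetric V v w \<and>
        (v \<noteq> vscale V 0 v \<longrightarrow> vmetric V v v > 0)) \<and>
     (let D = {(v, w). v \<in> points (vtot V) \<and> w \<in> points (vtot V) \<and> vproj V v = vproj V w}
      in fsm (sub_space (prod_space (vtot V) (vtot V)) D) D (\<lambda>(v, w). vmetric V v w))"

definition oriented_isometric_vector_bundle ::
  "'c monoid \<Rightarrow> 'x fspace \<Rightarrow> ('c \<Rightarrow> 'x \<Rightarrow> 'x) \<Rightarrow> nat \<Rightarrow> ('c, 'x, 'v) vbundle \<Rightarrow> bool" where
  "oriented_isometric_vector_bundle \<Gamma> X \<rho> n V \<longleftrightarrow>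
     oriented_vector_bundle X n V \<and> fibre_metric X V \<and>
     smooth_action \<Gamma> (vtot V) (vgact V) \<and>
     (\<forall>\<gamma>\<in>carrier \<Gamma>. \<forall>x\<in>points X.
        (\<forall>v\<in>fibre V x. vproj V (vgact V \<gamma> v) = \<rho> \<gamma> x) \<and>
        (\<forall>v\<in>fibre V x. \<forall>w\<in>fibre V x.
           vgact V \<gamma> (vadd V v w) = vadd V (vgact V \<gamma> v) (vgact V \<gamma> w) \<and>
           vmetric V (vgact V \<gamma> v) (vgact V \<gamma> w) = vmetric V v w) \<and>
        (\<forall>v\<in>fibre V x. \<forall>a. vgact V \<gamma> (vscale V a v) = vscale V a (vgact V \<gamma> v)) \<and>
        (\<forall>f\<in>vorient V x. (\<lambda>j\<in>{..<n}. vgact V \<gamma> (f j)) \<in> vorient V (\<rho> \<gamma> x)))"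

text \<open>
  \<open>(f A)\<^sub>j = \<Sum>\<^sub>i A\<^sub>i\<^sub>j f\<^sub>i\<close>; the sum is formed in the fibre and starts from its
  zero vector \<open>0 \<cdot> f\<^sub>j\<close>.
\<close>

definition frame_mult :: "nat \<Rightarrow> ('c, 'x, 'v) vbundle \<Rightarrow> (nat \<Rightarrow> 'v) \<Rightarrow> real mat \<Rightarrow> nat \<Rightarrow> 'v" where
  "frame_mult n V f A =
     (\<lambda>j\<in>{..<n}. foldr (\<lambda>i. vadd V (vscale V (A $$ (i, j)) (f i))) [0..<n] (vscale V 0 (f j)))"

text \<open>
  Frames are paired with their base point, so that the bundle also makes sense for \<open>n = 0\<close>.
\<close>

definition Fr :: "'x fspace \<Rightarrow> ('c \<Rightarrow> 'x \<Rightarrow> 'x) \<Rightarrow> nat \<Rightarrow> ('c, 'x, 'v) vbundle \<Rightarrow>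
    ('c, 'x, real mat, 'x \<times> (nat \<Rightarrow> 'v)) pbundle" where
  "Fr X \<rho> n V =
     (let F = {(x, f). x \<in> points X \<and> f \<in> vorient V x \<and>
                 (\<forall>i<n. \<forall>j<n. vmetric V (f i) (f j) = (if i = j then 1 else 0))}
      in \<lparr>tot = sub_space (prod_space X (power_space {..<n} (vtot V))) F,
          proj = fst,
          ract = (\<lambda>(x, f) A. (x, frame_mult n V f A)),
          gact = (\<lambda>\<gamma>. \<lambda>(x, f)\<in>F. (\<rho> \<gamma> x, \<lambda>j\<in>{..<n}. vgact V \<gamma> (f j)))\<rparr>)"


section \<open>The groups U(1), Spin(n) and Spin$^c$(n)\<close>

definition U1 :: "complex lie" where
  "U1 = \<lparr>carrier = {z. cmod z = 1}, monoid.mult = (*), one = 1,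
         lsp = pull_space {z. cmod z = 1} (\<lambda>z. \<lambda>i\<in>{..<2::nat}. if i = 0 then Re z else Im z)
                 (euclidean_fspace {..<2})\<rparr>"

definition kappa_U1 :: "('c \<Rightarrow> int) \<Rightarrow> 'c \<Rightarrow> complex \<Rightarrow> complex" where
  "kappa_U1 \<epsilon> \<gamma> = (\<lambda>z\<in>carrier U1. if \<epsilon> \<gamma> = -1 then cnj z else z)"

text \<open>
  The Clifford algebra of \<open>\<real>\<^sup>n\<close> with \<open>v\<^sup>2 = - |v|\<^sup>2\<close>. An element is its family of coefficients with
  respect to the basis \<open>e\<^sub>S = e\<^sub>i \<cdots> e\<^sub>j\<close> (\<open>i < \<dots> < j\<close> the elements of \<open>S \<subseteq> {..<n}\<close>), where
  \<open>e\<^sub>S e\<^sub>T = cl_sign S T \<cdot> e\<^bsub>S \<triangle> T\<^esub>\<close>.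
\<close>

type_synonym clifford = "nat set \<Rightarrow> real"

definition cl_sign :: "nat set \<Rightarrow> nat set \<Rightarrow> real" where
  "cl_sign S T = (-1) ^ (card {(i, j). i \<in> S \<and> j \<in> T \<and> j < i} + card (S \<inter> T))"

definition cl_mult :: "nat \<Rightarrow> clifford \<Rightarrow> clifford \<Rightarrow> clifford" where
  "cl_mult n a b =
     (\<lambda>U\<in>Pow {..<n}. \<Sum>S\<in>Pow {..<n}. cl_sign S (sym_diff S U) * a S * b (sym_diff S U))"

definition cl_basis :: "nat \<Rightarrow> nat set \<Rightarrow> clifford" where
  "cl_basis n T = (\<lambda>S\<in>Pow {..<n}. if S = T then 1 else 0)"

text \<open>The anti-automorphism fixing all vectors: reversing \<open>k\<close> factors has sign \<open>(-1)\<^bsup>k(k-1)/2\<^esup>\<close>.\<close>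

definition cl_reverse :: "nat \<Rightarrow> clifford \<Rightarrow> clifford" where
  "cl_reverse n a = (\<lambda>S\<in>Pow {..<n}. (-1) ^ (card S * (card S - 1) div 2) * a S)"

definition cl_elements :: "nat \<Rightarrow> clifford set" where
  "cl_elements n = (Pow {..<n} \<rightarrow>\<^sub>E UNIV)"

definition cl_even :: "nat \<Rightarrow> clifford set" where
  "cl_even n = {a \<in> cl_elements n. \<forall>S\<subseteq>{..<n}. odd (card S) \<longrightarrow> a S = 0}"

definition cl_vectors :: "nat \<Rightarrow> clifford set" where
  "cl_vectors n = {a \<in> cl_elements n. \<forall>S\<subseteq>{..<n}. card S \<noteq> 1 \<longrightarrow> a S = 0}"

text \<open>
  The even elements of spinor norm one of the Clifford group (Atiyah--Bott--Shapiro), with the smooth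
  structure of a submanifold of the Clifford algebra. Since \<open>a a\<^sup>t = 1\<close>, the reversal \<open>a\<^sup>t\<close> is the
  inverse of \<open>a\<close>.
\<close>

definition Spin :: "nat \<Rightarrow> clifford lie" where
  "Spin n =
     (let S = {a \<in> cl_even n. cl_mult n a (cl_reverse n a) = cl_basis n {} \<and>
                 (\<forall>v\<in>cl_vectors n. cl_mult n (cl_mult n a v) (cl_reverse n a) \<in> cl_vectors n)}
      in \<lparr>carrier = S, monoid.mult = cl_mult n, one = cl_basis n {},
          lsp = sub_space (euclidean_fspace (Pow {..<n})) S\<rparr>)"

text \<open>The matrix of \<open>v \<mapsto> g v g\<^sup>-\<^sup>1\<close> on \<open>\<real>\<^sup>n\<close>.\<close>

definition Ad :: "nat \<Rightarrow> clifford \<Rightarrow> real mat" where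
  "Ad n g = mat n n (\<lambda>(i, j).
     cl_mult n (cl_mult n g (cl_basis n {j})) (inv\<^bsub>Spin n\<^esub> g) {i})"

definition spinc_kernel :: "nat \<Rightarrow> (clifford \<times> complex) set" where
  "spinc_kernel n = {(cl_basis n {}, 1), (\<lambda>S\<in>Pow {..<n}. - cl_basis n {} S, -1)}"

text \<open>The class \<open>[g, z]\<close>.\<close>

definition spinc_class :: "nat \<Rightarrow> clifford \<times> complex \<Rightarrow> (clifford \<times> complex) set" where
  "spinc_class n gz = spinc_kernel n #>\<^bsub>Spin n \<times>\<times> U1\<^esub> gz"

definition SpinC :: "nat \<Rightarrow> (clifford \<times> complex) set lie" where
  "SpinC n =
     (let Q = (Spin n \<times>\<times> U1) Mod spinc_kernel n
      in \<lparr>carrier = carrier Q, monoid.mult = monoid.mult Q, one = one Q,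
          lsp = quot_space (prod_space (lsp (Spin n)) (lsp U1)) (spinc_class n)\<rparr>)"

definition kappa_SpinC ::
  "nat \<Rightarrow> ('c \<Rightarrow> int) \<Rightarrow> 'c \<Rightarrow> (clifford \<times> complex) set \<Rightarrow> (clifford \<times> complex) set" where
  "kappa_SpinC n \<epsilon> \<gamma> =
     (\<lambda>A\<in>carrier (SpinC n). \<Union>(g, z)\<in>A. spinc_class n (g, kappa_U1 \<epsilon> \<gamma> z))"

definition AdC :: "nat \<Rightarrow> (clifford \<times> complex) set \<Rightarrow> real mat" where
  "AdC n A = the_elem ((\<lambda>(g, z). Ad n g) ` A)"

definition central_U1 :: "nat \<Rightarrow> complex \<Rightarrow> (clifford \<times> complex) set" where
  "central_U1 n z = spinc_class n (\<one>\<^bsub>Spin n\<^esub>, z)"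


section \<open>Spin$^\kappa$-structures\<close>

type_synonym ('c, 'x, 'p) spinc_bundle = "('c, 'x, (clifford \<times> complex) set, 'p) pbundle"

definition spin_kappa_structure ::
  "'c monoid \<Rightarrow> ('c \<Rightarrow> int) \<Rightarrow> 'x fspace \<Rightarrow> ('c \<Rightarrow> 'x \<Rightarrow> 'x) \<Rightarrow> nat \<Rightarrow> ('c, 'x, 'v) vbundle \<Rightarrow>
   ('c, 'x, 'p) spinc_bundle \<Rightarrow> ('p \<Rightarrow> 'x \<times> (nat \<Rightarrow> 'v)) \<Rightarrow> bool" where
  "spin_kappa_structure \<Gamma> \<epsilon> X \<rho> n V P \<phi> \<longleftrightarrow>
     semi_equivariant_bundle \<Gamma> X \<rho> (SpinC n) (kappa_SpinC n \<epsilon>) P \<and>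
     smooth_map (tot P) (tot (Fr X \<rho> n V)) \<phi> \<and>
     (\<forall>p\<in>points (tot P). proj (Fr X \<rho> n V) (\<phi> p) = proj P p) \<and>
     (\<forall>\<gamma>\<in>carrier \<Gamma>. \<forall>p\<in>points (tot P). \<phi> (gact P \<gamma> p) = gact (Fr X \<rho> n V) \<gamma> (\<phi> p)) \<and>
     (\<forall>p\<in>points (tot P). \<forall>g\<in>carrier (SpinC n). \<phi> (ract P p g) = ract (Fr X \<rho> n V) (\<phi> p) (AdC n g))"

definition spin_kappa_isomorphic ::
  "'c monoid \<Rightarrow> nat \<Rightarrow>
   ('c, 'x, 'p) spinc_bundle \<Rightarrow> ('p \<Rightarrow> 'x \<times> (nat \<Rightarrow> 'v)) \<Rightarrow>
   ('c, 'x, 'q) spinc_bundle \<Rightarrow> ('q \<Rightarrow> 'x \<times> (nat \<Rightarrow> 'v)) \<Rightarrow> bool" where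
  "spin_kappa_isomorphic \<Gamma> n P \<phi> Q \<psi> \<longleftrightarrow>
     (\<exists>f. diffeo (tot P) (tot Q) f \<and>
        (\<forall>p\<in>points (tot P). proj Q (f p) = proj P p) \<and>
        (\<forall>p\<in>points (tot P). \<forall>g\<in>carrier (SpinC n). f (ract P p g) = ract Q (f p) g) \<and>
        (\<forall>\<gamma>\<in>carrier \<Gamma>. \<forall>p\<in>points (tot P). f (gact P \<gamma> p) = gact Q \<gamma> (f p)) \<and>
        (\<forall>p\<in>points (tot P). \<psi> (f p) = \<phi> p))"

definition fibre_product ::
  "('c, 'x, 'g, 'p) pbundle \<Rightarrow> ('c, 'x, 'h, 'l) pbundle \<Rightarrow> ('p \<times> 'l) set" where
  "fibre_product P L = {(p, l). p \<in> points (tot P) \<and> l \<in> points (tot L) \<and> proj P p = proj L l}"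

definition tensor_rel ::
  "nat \<Rightarrow> ('c, 'x, 'p) spinc_bundle \<Rightarrow> ('c, 'x, complex, 'l) pbundle \<Rightarrow> (('p \<times> 'l) \<times> ('p \<times> 'l)) set" where
  "tensor_rel n P L =
     {((ract P p (central_U1 n z), l), (p, ract L l z)) | p l z.
        (p, l) \<in> fibre_product P L \<and> z \<in> carrier U1}"

definition tensor_bundle ::
  "nat \<Rightarrow> ('c, 'x, 'p) spinc_bundle \<Rightarrow> ('c, 'x, complex, 'l) pbundle \<Rightarrow>
   ('c, 'x, ('p \<times> 'l) set) spinc_bundle" where
  "tensor_bundle n P L =
     (let R = tensor_rel n P L
      in \<lparr>tot = quot_space (sub_space (prod_space (tot P) (tot L)) (fibre_product P L)) (\<lambda>pl. R `` {pl}),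
          proj = (\<lambda>A. the_elem ((\<lambda>(p, l). proj P p) ` A)),
          ract = (\<lambda>A g. \<Union>(p, l)\<in>A. R `` {(ract P p g, l)}),
          gact = (\<lambda>\<gamma>. \<lambda>A \<in> fibre_product P L // R. \<Union>(p, l)\<in>A. R `` {(gact P \<gamma> p, gact L \<gamma> l)})\<rparr>)"

definition tensor_map :: "('p \<Rightarrow> 'f) \<Rightarrow> ('p \<times> 'l) set \<Rightarrow> 'f" where
  "tensor_map \<phi> A = the_elem ((\<lambda>(p, l). \<phi> p) ` A)"

end

theory Submission
  imports Defs "HOL-Analysis.Derivative"
begin

text \<open>
  The bundle \<open>L\<close> consists of the isomorphisms \<open>P\<^sub>x \<rightarrow> P'\<^sub>x\<close> of \<open>Spin\<^sup>c\<close>-torsors over the frames of \<open>V\<^sub>x\<close>, each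
  represented by its graph, that is, by an orbit of the diagonal action on the pairs \<open>(p, p')\<close> with
  \<open>\<phi> p = \<phi>' p'\<close>. Since the kernel of \<open>Ad\<^sup>c\<close> is the central \<open>U(1)\<close>, two such isomorphisms differ by
  an element of \<open>U(1)\<close>, and evaluation \<open>[p, [p, p']] \<mapsto> p'\<close> identifies \<open>P \<otimes> L\<close> with \<open>P'\<close>.

  Local triviality of \<open>L\<close> needs local sections \<open>s\<close>, \<open>s'\<close> of \<open>P\<close>, \<open>P'\<close> with \<open>\<phi> s = \<phi>' s'\<close>. The frames of
  arbitrary sections differ by a smooth map to \<open>SO(n)\<close>, which is lifted to \<open>Spin(n)\<close> by an explicit
  formula near the identity. Smoothness of maps is handled by universal properties; they rest on the
  closure of the smooth functions under smooth composition, that is, on the chain rule for \<open>C\<^sup>k\<close>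
  functions of several variables.
\<close>

section \<open>Calculus of several variables\<close>

text \<open>That Spin(n) is a group, that reversal inverts its elements on both sides and that the
  operations of Spin^c(n) are smooth is extracted from the hypothesis that \<open>P\<close> is a
  bundle for the Lie group Spin^c(n). What remains to be computed in the Clifford algebra is the
  exactness of U(1) -> Spin^c(n) -> SO(n): the kernel by comparing coefficients, surjectivity in the
  form that plane rotations act transitively on the oriented orthonormal frames of one fibre. SO(n)
  and the frame bundle are never given charts; the rotation between two frames is represented by its
  entries, the inner products of the frame vectors, as functions on the base.

  The obstacle is that the sets on which maps must be shown smooth (pairs of points with equal
  frames, orbits, tensor classes) are subsets and quotients whose charts come late or never.
  Smoothness is therefore treated for spaces whose functions are closed under smooth composition, a
  property inherited by subsets, products and quotients. Charts are built by hand only for U(1) and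
  \<open>L\<close>; the tensor product receives those of \<open>P'\<close>.\<close>

lemma continuous_map_into_real_local:
  assumes "\<And>x. x \<in> W \<Longrightarrow> \<exists>U. openin T U \<and> x \<in> U \<and> continuous_map (subtopology T U) euclideanreal f"
  shows "continuous_map (subtopology T W) euclideanreal f"
proof -
  define I where "I = {U. openin T U \<and> continuous_map (subtopology T U) euclideanreal f}"
  show ?thesis
  proof (rule pasting_lemma[where I=I and T="\<lambda>U. W \<inter> U" and f="\<lambda>_. f"])
    fix U assume U: "U \<in> I"
    show "openin (subtopology T W) (W \<inter> U)"
      using U by (auto simp: I_def openin_subtopology)
    show "continuous_map (subtopology (subtopology T W) (W \<inter> U)) euclideanreal f"
      using U by (auto simp: I_def subtopology_subtopology intro: continuous_map_from_subtopology_mono)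
  next
    fix x assume "x \<in> topspace (subtopology T W)"
    then show "\<exists>j. j \<in> I \<and> x \<in> W \<inter> j \<and> f x = f x"
      using assms by (auto simp: I_def)
  qed auto
qed

section \<open>Closure properties of \<open>C\<^sup>k\<close> functions\<close>

lemma continuous_map_upd:
  assumes "x \<in> topspace (powertop_real I)" "i \<in> I"
  shows "continuous_map euclideanreal (powertop_real I) (\<lambda>t. x(i := t))"
  using assms by (auto simp: continuous_map_componentwise PiE_def extensional_def)

lemma open_slice:
  assumes "openin (powertop_real I) U" "x \<in> U" "i \<in> I"
  shows "open {t. x(i := t) \<in> U}"
proof -
  have "x \<in> topspace (powertop_real I)" using assms openin_subset by blast
  from openin_continuous_map_preimage[OF continuous_map_upd[OF this assms(3)] assms(1)]
  show ?thesis by simp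
qed

lemma Ck_on_imp_continuous:
  "Ck_on I k U f \<Longrightarrow> continuous_map (subtopology (powertop_real I) U) euclideanreal f"
  by (cases k) auto

lemma Ck_on_SucD: "Ck_on I (Suc k) U f \<Longrightarrow> Ck_on I k U f"
proof (induction k arbitrary: f)
  case (Suc k)
  have cont: "continuous_map (subtopology (powertop_real I) U) euclideanreal f"
    using Suc.prems by (rule Ck_on_imp_continuous)
  have "\<exists>g. (\<forall>x\<in>U. ((\<lambda>t. f (x(i := t))) has_real_derivative g x) (at (x i))) \<and> Ck_on I k U g"
    if i: "i \<in> I" for i
  proof -
    obtain g where "\<forall>x\<in>U. ((\<lambda>t. f (x(i := t))) has_real_derivative g x) (at (x i))" "Ck_on I (Suc k) U g"
      using Suc.prems i Ck_on.simps(2)[of I "Suc k" U f] by auto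
    then show ?thesis using Suc.IH by blast
  qed
  with cont show ?case by simp
qed auto

lemma Ck_on_subset: "Ck_on I k U f \<Longrightarrow> V \<subseteq> U \<Longrightarrow> Ck_on I k V f"
proof (induction k arbitrary: f)
  case 0 then show ?case by (auto intro: continuous_map_from_subtopology_mono)
next
  case (Suc k)
  then show ?case 
    by (auto intro: continuous_map_from_subtopology_mono) (meson subsetD)
qed

text \<open>A partial derivative is a limit along a whole coordinate line, so the values on
  \<open>U\<close> determine it only because the slices of the open set \<open>U\<close> are
  open.\<close>

lemma Ck_on_cong:
  assumes "Ck_on I k U f" "openin (powertop_real I) U" "\<And>x. x \<in> U \<Longrightarrow> g x = f x"
  shows "Ck_on I k U g"
proof -
  have cont: "continuous_map (subtopology (powertop_real I) U) euclideanreal g"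
    using Ck_on_imp_continuous[OF assms(1)] by (rule continuous_map_eq) (simp add: assms(3))
  show ?thesis
  proof (cases k)
    case (Suc l)
    have "((\<lambda>t. g (x(i := t))) has_real_derivative d) (at (x i))"
      if "i \<in> I" "x \<in> U" "((\<lambda>t. f (x(i := t))) has_real_derivative d) (at (x i))" for i x d
      by (rule has_field_derivative_transform_within_open[OF that(3) open_slice[OF assms(2) that(2,1)]])
        (use that assms(3) in auto)
    then show ?thesis using assms(1) cont Suc by simp metis
  qed (use cont assms in simp)
qed

lemma Ck_on_const: "Ck_on I k U (\<lambda>_. c)"
  by (induction k arbitrary: c) (auto intro!: exI[of _ "\<lambda>_. 0"])

lemma continuous_map_coord:
  "i \<in> I \<Longrightarrow> continuous_map (subtopology (powertop_real I) U) euclideanreal (\<lambda>x. x i)"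
  by (rule continuous_map_from_subtopology, rule continuous_map_product_projection)

lemma Ck_on_coord: "i \<in> I \<Longrightarrow> Ck_on I k U (\<lambda>x. x i)"
proof (cases k)
  case (Suc l)
  assume i: "i \<in> I"
  have "((\<lambda>t. (x(j := t)) i) has_real_derivative (if j = i then 1 else 0)) (at (x j))" for x :: "'a \<Rightarrow> real" and j
    by auto
  then have "\<exists>g. (\<forall>x\<in>U. ((\<lambda>t. (x(j := t)) i) has_real_derivative g x) (at (x j))) \<and> Ck_on I l U g" for j
    by (intro exI[of _ "\<lambda>_. if j = i then 1 else 0"]) (auto intro: Ck_on_const simp del: fun_upd_apply)
  then show ?thesis using i Suc by (simp add: continuous_map_coord del: fun_upd_apply)
qed (simp add: continuous_map_coord)

lemma Ck_on_add: "Ck_on I k U f \<Longrightarrow> Ck_on I k U g \<Longrightarrow> Ck_on I k U (\<lambda>x. f x + g x)"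
proof (induction k arbitrary: f g)
  case 0 then show ?case by (auto intro: continuous_map_add)
next
  case (Suc k)
  have "\<exists>d. (\<forall>x\<in>U. ((\<lambda>t. f (x(i := t)) + g (x(i := t))) has_real_derivative d x) (at (x i))) \<and> Ck_on I k U d"
    if "i \<in> I" for i
  proof -
    obtain f' g' where "\<forall>x\<in>U. ((\<lambda>t. f (x(i := t))) has_real_derivative f' x) (at (x i))" "Ck_on I k U f'"
      "\<forall>x\<in>U. ((\<lambda>t. g (x(i := t))) has_real_derivative g' x) (at (x i))" "Ck_on I k U g'"
      using Suc.prems \<open>i \<in> I\<close> by auto blast
    then show ?thesis
      by (intro exI[of _ "\<lambda>x. f' x + g' x"]) (auto intro: Suc.IH DERIV_add)
  qed
  then show ?case using Suc.prems by (auto intro: continuous_map_add)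
qed

lemma Ck_on_mult: "Ck_on I k U f \<Longrightarrow> Ck_on I k U g \<Longrightarrow> Ck_on I k U (\<lambda>x. f x * g x)"
proof (induction k arbitrary: f g)
  case 0 then show ?case by (auto intro: continuous_map_real_mult)
next
  case (Suc k)
  have "\<exists>d. (\<forall>x\<in>U. ((\<lambda>t. f (x(i := t)) * g (x(i := t))) has_real_derivative d x) (at (x i))) \<and> Ck_on I k U d"
    if "i \<in> I" for i
  proof -
    obtain f' g' where fg: "\<forall>x\<in>U. ((\<lambda>t. f (x(i := t))) has_real_derivative f' x) (at (x i))" "Ck_on I k U f'"
      "\<forall>x\<in>U. ((\<lambda>t. g (x(i := t))) has_real_derivative g' x) (at (x i))" "Ck_on I k U g'"
      using Suc.prems \<open>i \<in> I\<close> by auto blast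
    have "((\<lambda>t. f (x(i := t)) * g (x(i := t))) has_real_derivative (f' x * g x + g' x * f x)) (at (x i))"
      if "x \<in> U" for x
      using DERIV_mult[of "\<lambda>t. f (x(i := t))" "f' x" "x i" UNIV "\<lambda>t. g (x(i := t))" "g' x"] fg that by simp
    then show ?thesis
      using Suc.prems fg
      by (intro exI[of _ "\<lambda>x. f' x * g x + g' x * f x"])
        (auto intro!: Suc.IH Ck_on_add simp del: Ck_on.simps dest: Ck_on_SucD)
  qed
  then show ?case using Suc.prems by (auto intro: continuous_map_real_mult)
qed

lemma Ck_on_sum:
  "finite K \<Longrightarrow> (\<And>j. j \<in> K \<Longrightarrow> Ck_on I k U (f j)) \<Longrightarrow> Ck_on I k U (\<lambda>x. \<Sum>j\<in>K. f j x)"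
  by (induction K rule: finite_induct) (auto intro: Ck_on_const Ck_on_add)

lemma Ck_on_Union:
  "(\<And>U. U \<in> \<U> \<Longrightarrow> openin (powertop_real I) U \<and> Ck_on I k U f) \<Longrightarrow> Ck_on I k (\<Union>\<U>) f"
proof (induction k arbitrary: f)
  case 0
  then show ?case by (auto intro!: continuous_map_into_real_local)
next
  case (Suc k)
  have cont: "continuous_map (subtopology (powertop_real I) (\<Union>\<U>)) euclideanreal f"
    by (rule continuous_map_into_real_local) (use Suc.prems in \<open>auto\<close>)
  have "\<exists>g. (\<forall>x\<in>\<Union>\<U>. ((\<lambda>t. f (x(i := t))) has_real_derivative g x) (at (x i))) \<and> Ck_on I k (\<Union>\<U>) g"
    if i: "i \<in> I" for i
  proof -
    \<comment> \<open>Each member of the cover supplies its own derivative function. They agree on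
      overlaps by uniqueness of derivatives, so the global choice \<open>deriv\<close> restricts to
      each of them.\<close>
    define g where "g x = deriv (\<lambda>t. f (x(i := t))) (x i)" for x :: "'a \<Rightarrow> real"
    have "(\<forall>x\<in>U. ((\<lambda>t. f (x(i := t))) has_real_derivative g x) (at (x i))) \<and> Ck_on I k U g"
      if U: "U \<in> \<U>" for U
    proof -
      obtain g' where g': "\<forall>x\<in>U. ((\<lambda>t. f (x(i := t))) has_real_derivative g' x) (at (x i))" "Ck_on I k U g'"
        using Suc.prems[OF U] i by auto
      then have "\<forall>x\<in>U. g x = g' x" by (auto simp: g_def intro: DERIV_imp_deriv)
      then show ?thesis using g' Suc.prems[OF U] Ck_on_cong[OF g'(2), of g] by auto
    qed
    then show ?thesis using Suc.IH[of g] Suc.prems by (intro exI[of _ g]) blast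
  qed
  with cont show ?case by simp
qed

section \<open>The chain rule and powers\<close>

lemma powertop_box:
  assumes "finite J" "openin (powertop_real J) O'" "y0 \<in> O'"
  shows "\<exists>r>0. \<forall>y\<in>extensional J. (\<forall>i\<in>J. \<bar>y i - y0 i\<bar> < r) \<longrightarrow> y \<in> O'"
proof -
  obtain U where U: "\<forall>i\<in>J. open (U i)" "y0 \<in> Pi\<^sub>E J U" "Pi\<^sub>E J U \<subseteq> O'"
    using assms(2)[unfolded openin_product_topology_alt, rule_format, OF assms(3)] by auto
  have "\<forall>i\<in>J. \<exists>r>0. \<forall>t. \<bar>t - y0 i\<bar> < r \<longrightarrow> t \<in> U i"
    using U by (auto simp: open_real PiE_iff)
  then obtain r where r: "\<forall>i\<in>J. r i > 0 \<and> (\<forall>t. \<bar>t - y0 i\<bar> < r i \<longrightarrow> t \<in> U i)" by metis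
  \<comment> \<open>The entry 1 keeps the minimum defined and positive when \<open>J\<close> is
    empty.\<close>
  define R where "R = Min (insert 1 (r ` J))"
  have "R > 0" "\<forall>i\<in>J. R \<le> r i" using assms(1) r by (auto simp: R_def)
  then show ?thesis
    using U(3) r by (intro exI[of _ R]) (meson PiE_iff less_le_trans subsetD)
qed

text \<open>The increments of the arguments are added one at a time, each being controlled by the
  mean value theorem and the continuity of the corresponding partial derivative.\<close>

lemma DERIV_chain_partials:
  fixes h :: "('j \<Rightarrow> real) \<Rightarrow> real"
  assumes J: "finite J" and D: "openin (powertop_real J) D"
    and dh: "\<And>j y. j \<in> J \<Longrightarrow> y \<in> D \<Longrightarrow> ((\<lambda>t. h (y(j := t))) has_real_derivative dh j y) (at (y j))"
    and cont: "\<And>j. j \<in> J \<Longrightarrow> continuous_map (subtopology (powertop_real J) D) euclideanreal (dh j)"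
    and \<gamma>: "\<And>j. j \<in> J \<Longrightarrow> (\<gamma> j has_real_derivative \<gamma>' j) (at t0)"
    and y0: "(\<lambda>j\<in>J. \<gamma> j t0) \<in> D"
  shows "((\<lambda>t. h (\<lambda>j\<in>J. \<gamma> j t)) has_real_derivative (\<Sum>j\<in>J. dh j (\<lambda>j\<in>J. \<gamma> j t0) * \<gamma>' j)) (at t0)"
proof -
  define y0 where "y0 = (\<lambda>j\<in>J. \<gamma> j t0)"
  \<comment> \<open>Only the arguments in \<open>K\<close> move with \<open>t\<close>, the others
    are frozen at \<open>t0\<close>. Adding one index \<open>j\<close> to \<open>K\<close> changes a
    single argument, to which a one-variable estimate applies.\<close>
  define F where "F K t = h (\<lambda>j\<in>J. if j \<in> K then \<gamma> j t else \<gamma> j t0)" for K t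
  have "finite K \<Longrightarrow> K \<subseteq> J \<Longrightarrow> (F K has_real_derivative (\<Sum>j\<in>K. dh j y0 * \<gamma>' j)) (at t0)" for K
  proof (induction K rule: finite_induct)
    case empty
    show ?case by (simp add: F_def[abs_def])
  next
    case (insert j K)
    then have j: "j \<in> J" by auto
    \<comment> \<open>The error of replacing the increment caused by argument \<open>j\<close> by
      its linear part at \<open>y0\<close>. It is of smaller order than \<open>t - t0\<close>,
      although the arguments in \<open>K\<close> have already moved away from
      \<open>y0\<close>.\<close>
    define R where "R t = F (insert j K) t - F K t - dh j y0 * (\<gamma> j t - \<gamma> j t0)" for t
    have bound: "eventually (\<lambda>t. \<bar>R t\<bar> \<le> e * \<bar>\<gamma> j t - \<gamma> j t0\<bar>) (at t0)" if e: "e > 0" for e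
    proof -
      define O' where "O' = {y \<in> D. dist (dh j y) (dh j y0) < e}"
      have "openin (subtopology (powertop_real J) D) {y \<in> topspace (subtopology (powertop_real J) D). dh j y \<in> ball (dh j y0) e}"
        by (rule openin_continuous_map_preimage[OF cont[OF j]]) simp
      also have "{y \<in> topspace (subtopology (powertop_real J) D). dh j y \<in> ball (dh j y0) e} = O'"
        using openin_subset[OF D] by (auto simp: O'_def dist_commute)
      finally have "openin (powertop_real J) O'" using D openin_trans_full by blast
      moreover have "y0 \<in> O'" using y0 e by (simp add: O'_def y0_def)
      ultimately obtain r where r: "r > 0" "\<And>y. y \<in> extensional J \<Longrightarrow> (\<forall>i\<in>J. \<bar>y i - y0 i\<bar> < r) \<Longrightarrow> y \<in> O'"
        using powertop_box[OF J] by metis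
      have "eventually (\<lambda>t. \<bar>\<gamma> i t - \<gamma> i t0\<bar> < r) (at t0)" if "i \<in> J" for i
      proof -
        have "(\<gamma> i \<longlongrightarrow> \<gamma> i t0) (at t0)"
          using DERIV_isCont[OF \<gamma>[OF that]] by (simp add: isCont_def)
        from tendstoD[OF this r(1)] show ?thesis by (simp add: dist_real_def)
      qed
      then have "eventually (\<lambda>t. \<forall>i\<in>J. \<bar>\<gamma> i t - \<gamma> i t0\<bar> < r) (at t0)"
        using J by (simp add: eventually_ball_finite)
      then show ?thesis
      proof eventually_elim
        case (elim t)
        define z where "z = (\<lambda>i\<in>J. if i \<in> K then \<gamma> i t else \<gamma> i t0)"
        define B where "B = {s. \<bar>s - \<gamma> j t0\<bar> < r}"
        have zO: "z(j := s) \<in> O'" if "s \<in> B" for s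
          using that elim r(1) j
          by (intro r(2)) (auto simp: z_def y0_def B_def extensional_def)
        have F1: "F (insert j K) t = h (z(j := \<gamma> j t))" 
          unfolding F_def z_def using j by (intro arg_cong[of _ _ h]) (auto simp: fun_eq_iff)
        have F2: "F K t = h (z(j := \<gamma> j t0))"
          unfolding F_def z_def using j \<open>j \<notin> K\<close> by (intro arg_cong[of _ _ h]) (auto simp: fun_eq_iff)
        \<comment> \<open>The mean value inequality for \<open>h\<close> minus its linear part, on
          an interval around \<open>\<gamma> j t0\<close> on which \<open>dh j\<close> stays within
          \<open>e\<close> of its value at \<open>y0\<close>.\<close>
        have "norm ((h (z(j := \<gamma> j t)) - dh j y0 * \<gamma> j t) - (h (z(j := \<gamma> j t0)) - dh j y0 * \<gamma> j t0))
            \<le> e * norm (\<gamma> j t - \<gamma> j t0)"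
        proof (rule field_differentiable_bound[where S=B and f="\<lambda>s. h (z(j := s)) - dh j y0 * s"
              and f'="\<lambda>s. dh j (z(j := s)) - dh j y0"])
          have "B = ball (\<gamma> j t0) r" by (auto simp: B_def dist_real_def)
          then show "convex B" by simp
          show "\<gamma> j t \<in> B" "\<gamma> j t0 \<in> B" using elim j r(1) by (auto simp: B_def)
          fix s assume s: "s \<in> B"
          have "((\<lambda>u. h ((z(j := s))(j := u))) has_real_derivative dh j (z(j := s))) (at ((z(j := s)) j))"
            using dh[OF j, of "z(j := s)"] zO[OF s] by (simp add: O'_def)
          then have "((\<lambda>u. h (z(j := u))) has_real_derivative dh j (z(j := s))) (at s)" by simp
          then have "((\<lambda>s. h (z(j := s)) - dh j y0 * s) has_real_derivative dh j (z(j := s)) - dh j y0) (at s)"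
            by (auto intro!: derivative_eq_intros)
          then show "((\<lambda>s. h (z(j := s)) - dh j y0 * s) has_real_derivative dh j (z(j := s)) - dh j y0) (at s within B)"
            by (rule has_field_derivative_at_within)
          show "norm (dh j (z(j := s)) - dh j y0) \<le> e"
            using zO[OF s] by (simp add: O'_def dist_real_def)
        qed
        then show ?case by (simp add: R_def F1 F2 algebra_simps)
      qed
    qed
    have "(R has_real_derivative 0) (at t0)"
      unfolding has_field_derivative_iff
    proof (rule tendstoI)
      fix e :: real assume e: "e > 0"
      \<comment> \<open>An upper bound for the difference quotient of \<open>\<gamma> j\<close> near
        \<open>t0\<close>; the summand 1 makes the bound strict and \<open>B\<close>
        positive.\<close>
      define B where "B = \<bar>\<gamma>' j\<bar> + 1"
      have B: "B > 0" by (simp add: B_def)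
      have R0: "R t0 = 0" by (simp add: R_def F_def)
      have "((\<lambda>t. (\<gamma> j t - \<gamma> j t0) / (t - t0)) \<longlongrightarrow> \<gamma>' j) (at t0)"
        using \<gamma>[OF j] by (simp add: has_field_derivative_iff)
      from tendsto_rabs[OF this]
      have "eventually (\<lambda>t. \<bar>(\<gamma> j t - \<gamma> j t0) / (t - t0)\<bar> < B) (at t0)"
        by (rule order_tendstoD) (simp add: B_def)
      moreover have "eventually (\<lambda>t. \<bar>R t\<bar> \<le> (e / B) * \<bar>\<gamma> j t - \<gamma> j t0\<bar>) (at t0)"
        by (rule bound) (use e B in simp)
      ultimately show "eventually (\<lambda>t. dist ((R t - R t0) / (t - t0)) 0 < e) (at t0)"
      proof eventually_elim
        case (elim t)
        have "\<bar>R t / (t - t0)\<bar> \<le> (e / B) * \<bar>(\<gamma> j t - \<gamma> j t0) / (t - t0)\<bar>"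
          using divide_right_mono[OF elim(2), of "\<bar>t - t0\<bar>"] by (simp add: abs_divide)
        also have "\<dots> < (e / B) * B" using elim(1) e B by (intro mult_strict_left_mono) auto
        finally show ?case using B R0 by simp
      qed
    qed
    moreover have "F (insert j K) = (\<lambda>t. F K t + (R t + dh j y0 * (\<gamma> j t - \<gamma> j t0)))"
      by (auto simp: R_def)
    moreover have "((\<lambda>t. F K t + (R t + dh j y0 * (\<gamma> j t - \<gamma> j t0))) has_real_derivative
        (\<Sum>j\<in>K. dh j y0 * \<gamma>' j) + (0 + dh j y0 * (\<gamma>' j - 0))) (at t0)"
      using insert \<open>(R has_real_derivative 0) (at t0)\<close>
      by (intro DERIV_add DERIV_cmult DERIV_diff \<gamma> j) auto
    ultimately show ?case using insert by (simp add: add.commute)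
  qed
  from this[OF J order_refl]
  have "(F J has_real_derivative (\<Sum>j\<in>J. dh j y0 * \<gamma>' j)) (at t0)" .
  moreover have "F J = (\<lambda>t. h (\<lambda>j\<in>J. \<gamma> j t))"
    unfolding F_def by (intro ext arg_cong[of _ _ h]) (auto simp: fun_eq_iff)
  ultimately show ?thesis by (simp add: y0_def)
qed

lemma continuous_map_into_powertop:
  assumes "\<And>j. j \<in> J \<Longrightarrow> continuous_map T euclideanreal (c j)"
  shows "continuous_map T (powertop_real J) (\<lambda>x. \<lambda>j\<in>J. c j x)"
  unfolding continuous_map_componentwise
proof (intro conjI ballI)
  fix k assume "k \<in> J"
  then have "(\<lambda>x. (\<lambda>j\<in>J. c j x) k) = c k" by auto
  then show "continuous_map T euclideanreal (\<lambda>x. (\<lambda>j\<in>J. c j x) k)"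
    using assms \<open>k \<in> J\<close> by metis
qed auto

text \<open>A partial derivative of the composite is a sum of products of \<open>dh j\<close>,
  composed with \<open>c\<close>, and \<open>dc j\<close>. The first factors are again composites,
  with an outer function of one order less, so the induction on \<open>k\<close> runs over all outer
  functions \<open>h\<close>.\<close>

lemma Ck_on_compose:
  assumes "finite J" "openin (powertop_real J) D" "openin (powertop_real I) W"
    and "\<And>j. j \<in> J \<Longrightarrow> Ck_on I k W (c j)" "Ck_on J k D h"
    and "\<And>x. x \<in> W \<Longrightarrow> (\<lambda>j\<in>J. c j x) \<in> D"
  shows "Ck_on I k W (\<lambda>x. h (\<lambda>j\<in>J. c j x))"
  using assms(4,5)
proof (induction k arbitrary: h)
  case 0
  have "continuous_map (subtopology (powertop_real I) W) (subtopology (powertop_real J) D) (\<lambda>x. \<lambda>j\<in>J. c j x)"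
    using 0 assms(6) by (auto simp: continuous_map_in_subtopology intro!: continuous_map_into_powertop)
  from continuous_map_compose[OF this Ck_on_imp_continuous[OF 0(2)]] show ?case by (simp only: o_def Ck_on.simps(1))
next
  case (Suc k)
  have "continuous_map (subtopology (powertop_real I) W) (subtopology (powertop_real J) D) (\<lambda>x. \<lambda>j\<in>J. c j x)"
    using Suc.prems(1)[THEN Ck_on_imp_continuous] assms(6)
    by (auto simp: continuous_map_in_subtopology intro!: continuous_map_into_powertop)
  from continuous_map_compose[OF this Ck_on_imp_continuous[OF Suc.prems(2)]]
  have cont: "continuous_map (subtopology (powertop_real I) W) euclideanreal (\<lambda>x. h (\<lambda>j\<in>J. c j x))"
    by (simp only: o_def)
  obtain dh where dh: "\<And>j. j \<in> J \<Longrightarrow> (\<forall>y\<in>D. ((\<lambda>t. h (y(j := t))) has_real_derivative dh j y) (at (y j))) \<and> Ck_on J k D (dh j)"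
    using Suc.prems(2) by simp metis
  have "\<exists>g. (\<forall>x\<in>W. ((\<lambda>t. h (\<lambda>j\<in>J. c j (x(i := t)))) has_real_derivative g x) (at (x i))) \<and> Ck_on I k W g"
    if i: "i \<in> I" for i
  proof -
    have "\<forall>j\<in>J. \<exists>g. (\<forall>x\<in>W. ((\<lambda>t. c j (x(i := t))) has_real_derivative g x) (at (x i))) \<and> Ck_on I k W g"
      using Suc.prems(1) i by auto
    then obtain dc where dc: "\<And>j. j \<in> J \<Longrightarrow> (\<forall>x\<in>W. ((\<lambda>t. c j (x(i := t))) has_real_derivative dc j x) (at (x i))) \<and> Ck_on I k W (dc j)"
      by metis
    define g where "g x = (\<Sum>j\<in>J. dh j (\<lambda>j\<in>J. c j x) * dc j x)" for x
    have "((\<lambda>t. h (\<lambda>j\<in>J. c j (x(i := t)))) has_real_derivative g x) (at (x i))" if x: "x \<in> W" for x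
      unfolding g_def
      using DERIV_chain_partials[OF assms(1,2), of h dh "\<lambda>j t. c j (x(i := t))" "\<lambda>j. dc j x" "x i"]
        dh dc x assms(6)[OF x] Ck_on_imp_continuous[of J k D] by fastforce
    moreover have "Ck_on I k W g"
      unfolding g_def
      by (intro Ck_on_sum Ck_on_mult Suc.IH assms(1)) (use dh dc Ck_on_SucD[OF Suc.prems(1)] in blast)+
    ultimately show ?thesis by blast
  qed
  with cont show ?case unfolding Ck_on.simps(2) by blast
qed

text \<open>Differentiation turns \<open>C * t powr a\<close> into
  \<open>C * a * t powr (a - 1)\<close>, so the induction goes through once factor and exponent are
  arbitrary. The exponents used later are 1/2, for the charts of U(1), and -1/2, for normalising a
  lift to Spin(n).\<close>

lemma Ck_on_powr:
  assumes "i \<in> I" "\<And>x. x \<in> U \<Longrightarrow> x i > 0"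
  shows "Ck_on I k U (\<lambda>x. C * x i powr a)"
proof (induction k arbitrary: a C)
  case 0
  have "continuous_map (subtopology (powertop_real I) U) (top_of_set {0<..}) (\<lambda>x. x i)"
    using assms by (auto simp: continuous_map_in_subtopology continuous_map_coord)
  moreover have "continuous_map (top_of_set {0<..}) euclideanreal (\<lambda>t::real. C * t powr a)"
    by (auto intro!: continuous_intros)
  ultimately have "continuous_map (subtopology (powertop_real I) U) euclideanreal ((\<lambda>t. C * t powr a) \<circ> (\<lambda>x. x i))"
    by (rule continuous_map_compose)
  then show ?case by (simp only: o_def Ck_on.simps(1))
next
  case (Suc k)
  have "continuous_map (subtopology (powertop_real I) U) euclideanreal (\<lambda>x. C * x i powr a)"
    using Suc[of C a] by (rule Ck_on_imp_continuous)
  moreover have "\<exists>g. (\<forall>x\<in>U. ((\<lambda>t. C * (x(j := t)) i powr a) has_real_derivative g x) (at (x j))) \<and> Ck_on I k U g" for j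
  proof (cases "j = i")
    case True
    have "((\<lambda>t. C * t powr a) has_real_derivative (C * a) * x i powr (a - 1)) (at (x i))" if "x \<in> U" for x
      using assms(2)[OF that] by (auto intro!: derivative_eq_intros)
    then show ?thesis using Suc[of "C * a" "a - 1"] True 
      by (intro exI[of _ "\<lambda>x. (C * a) * x i powr (a - 1)"]) simp
  next
    case False
    then show ?thesis by (intro exI[of _ "\<lambda>_. 0"]) (auto simp: Ck_on_const)
  qed
  ultimately show ?case by simp
qed

lemma smooth_on_compose:
  assumes "finite J" "openin (powertop_real I) W" "smooth_on J D h"
    and "\<And>j. j \<in> J \<Longrightarrow> smooth_on I W (c j)" "\<And>x. x \<in> W \<Longrightarrow> (\<lambda>j\<in>J. c j x) \<in> D"
  shows "smooth_on I W (\<lambda>x. h (\<lambda>j\<in>J. c j x))"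
  using assms unfolding smooth_on_def by (blast intro: Ck_on_compose)

lemma smooth_on_coord: "openin (powertop_real I) W \<Longrightarrow> i \<in> I \<Longrightarrow> smooth_on I W (\<lambda>x. x i)"
  by (simp add: smooth_on_def Ck_on_coord)

lemma smooth_on_const: "openin (powertop_real I) W \<Longrightarrow> smooth_on I W (\<lambda>_. c)"
  by (simp add: smooth_on_def Ck_on_const)

lemma smooth_on_add: "smooth_on I W f \<Longrightarrow> smooth_on I W g \<Longrightarrow> smooth_on I W (\<lambda>x. f x + g x)"
  by (simp add: smooth_on_def Ck_on_add)

lemma smooth_on_mult: "smooth_on I W f \<Longrightarrow> smooth_on I W g \<Longrightarrow> smooth_on I W (\<lambda>x. f x * g x)"
  by (simp add: smooth_on_def Ck_on_mult)

lemma smooth_on_cong: "smooth_on I W f \<Longrightarrow> (\<And>x. x \<in> W \<Longrightarrow> g x = f x) \<Longrightarrow> smooth_on I W g"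
  unfolding smooth_on_def by (blast intro: Ck_on_cong)

lemma smooth_on_subset: "smooth_on I W f \<Longrightarrow> openin (powertop_real I) V \<Longrightarrow> V \<subseteq> W \<Longrightarrow> smooth_on I V f"
  unfolding smooth_on_def by (blast intro: Ck_on_subset)

lemma smooth_on_Union: "(\<And>U. U \<in> \<U> \<Longrightarrow> smooth_on I U f) \<Longrightarrow> smooth_on I (\<Union>\<U>) f"
  unfolding smooth_on_def by (blast intro: Ck_on_Union)

lemma smooth_on_imp_openin: "smooth_on I W f \<Longrightarrow> openin (powertop_real I) W"
  by (simp add: smooth_on_def)

lemma smooth_on_imp_continuous:
  "smooth_on I W f \<Longrightarrow> continuous_map (subtopology (powertop_real I) W) euclideanreal f"
  unfolding smooth_on_def by (blast intro: Ck_on_imp_continuous)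

section \<open>Spaces with smooth functions\<close>

lemma
  assumes "functional_space M"
  shows fspace_openin: "fsm M U f \<Longrightarrow> openin (ftop M) U"
    and fspace_continuous: "fsm M U f \<Longrightarrow> continuous_map (subtopology (ftop M) U) euclideanreal f"
    and fspace_cong: "fsm M U f \<Longrightarrow> (\<And>x. x \<in> U \<Longrightarrow> g x = f x) \<Longrightarrow> fsm M U g"
    and fspace_restrict: "fsm M U f \<Longrightarrow> openin (ftop M) V \<Longrightarrow> V \<subseteq> U \<Longrightarrow> fsm M V f"
    and fspace_Union: "(\<And>U. U \<in> \<U> \<Longrightarrow> fsm M U f) \<Longrightarrow> fsm M (\<Union>\<U>) f"
    and fspace_const: "openin (ftop M) U \<Longrightarrow> fsm M U (\<lambda>_. c)"
    and fspace_add: "fsm M U f \<Longrightarrow> fsm M U g \<Longrightarrow> fsm M U (\<lambda>x. f x + g x)"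
    and fspace_mult: "fsm M U f \<Longrightarrow> fsm M U g \<Longrightarrow> fsm M U (\<lambda>x. f x * g x)"
proof -
  note * = assms[unfolded functional_space_def]
  note c1 = *[THEN conjunct1] and c2 = *[THEN conjunct2, THEN conjunct1]
    and c3 = *[THEN conjunct2, THEN conjunct2, THEN conjunct1]
    and c4 = *[THEN conjunct2, THEN conjunct2, THEN conjunct2, THEN conjunct1]
    and c5 = *[THEN conjunct2, THEN conjunct2, THEN conjunct2, THEN conjunct2, THEN conjunct1]
    and c6 = *[THEN conjunct2, THEN conjunct2, THEN conjunct2, THEN conjunct2, THEN conjunct2]
  show "fsm M U f \<Longrightarrow> openin (ftop M) U"
    and "fsm M U f \<Longrightarrow> continuous_map (subtopology (ftop M) U) euclideanreal f" using c1 by blast+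
  show "fsm M U f \<Longrightarrow> (\<And>x. x \<in> U \<Longrightarrow> g x = f x) \<Longrightarrow> fsm M U g" using c2 by blast
  show "fsm M U f \<Longrightarrow> openin (ftop M) V \<Longrightarrow> V \<subseteq> U \<Longrightarrow> fsm M V f" using c5 by blast
  show "(\<And>U. U \<in> \<U> \<Longrightarrow> fsm M U f) \<Longrightarrow> fsm M (\<Union>\<U>) f" using c6 by blast
  show "openin (ftop M) U \<Longrightarrow> fsm M U (\<lambda>_. c)" using c3 by blast
  show "fsm M U f \<Longrightarrow> fsm M U g \<Longrightarrow> fsm M U (\<lambda>x. f x + g x)"
    and "fsm M U f \<Longrightarrow> fsm M U g \<Longrightarrow> fsm M U (\<lambda>x. f x * g x)" using c4 by blast+
qed

lemma openin_powertop_UNIV [simp]: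
  "openin (powertop_real I) (I \<rightarrow>\<^sub>E UNIV)" "openin (powertop_real {}) {\<lambda>_. undefined}"
  using openin_topspace[of "powertop_real I"] openin_topspace[of "powertop_real {}"] by simp_all

lemma fspace_local:
  assumes "functional_space M" "\<And>x. x \<in> W \<Longrightarrow> \<exists>U g. fsm M U g \<and> x \<in> U \<and> U \<subseteq> W \<and> (\<forall>y\<in>U. f y = g y)"
  shows "fsm M W f"
proof -
  have "\<exists>U. fsm M U f \<and> x \<in> U \<and> U \<subseteq> W" if "x \<in> W" for x
    using assms(2)[OF that] fspace_cong[OF assms(1)] by metis
  then have "W = \<Union>{U. fsm M U f \<and> U \<subseteq> W}" by blast
  then show ?thesis using fspace_Union[OF assms(1), of "{U. fsm M U f \<and> U \<subseteq> W}" f] by auto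
qed

text \<open>The axioms of a \<open>functional_space\<close> provide sums and products only, while
  coordinate expressions need arbitrary smooth functions of finitely many smooth functions. Charts
  give this closure on manifolds; as a property of its own it passes to subsets, products and
  quotients without any charts.\<close>

definition smooth_space :: "'a fspace \<Rightarrow> bool" where
  "smooth_space M \<longleftrightarrow> functional_space M \<and>
     (\<forall>W (r::nat) c D h. openin (ftop M) W \<and> (\<forall>j<r. fsm M W (c j)) \<and> smooth_on {..<r} D h \<and>
        (\<forall>q\<in>W. (\<lambda>j\<in>{..<r}. c j q) \<in> D) \<longrightarrow> fsm M W (\<lambda>q. h (\<lambda>j\<in>{..<r}. c j q)))"

lemma smooth_space_functional: "smooth_space M \<Longrightarrow> functional_space M"
  by (simp add: smooth_space_def)

lemma smooth_space_compose_lessThan: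
  fixes r :: nat
  assumes "smooth_space M" "openin (ftop M) W" "\<And>j. j < r \<Longrightarrow> fsm M W (c j)" "smooth_on {..<r} D h"
    "\<And>q. q \<in> W \<Longrightarrow> (\<lambda>j\<in>{..<r}. c j q) \<in> D"
  shows "fsm M W (\<lambda>q. h (\<lambda>j\<in>{..<r}. c j q))"
  using assms unfolding smooth_space_def by blast

lemma smooth_on_reindex:
  assumes "finite J" "smooth_on J D h" "\<And>j. j \<in> J \<Longrightarrow> b j \<in> I"
  shows "smooth_on I {y \<in> topspace (powertop_real I). (\<lambda>j\<in>J. y (b j)) \<in> D} (\<lambda>y. h (\<lambda>j\<in>J. y (b j)))"
proof -
  have "continuous_map (powertop_real I) (powertop_real J) (\<lambda>y. \<lambda>j\<in>J. y (b j))"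
    by (intro continuous_map_into_powertop continuous_map_product_projection assms)
  from openin_continuous_map_preimage[OF this smooth_on_imp_openin[OF assms(2)]]
  have "openin (powertop_real I) {y \<in> topspace (powertop_real I). (\<lambda>j\<in>J. y (b j)) \<in> D}" .
  then show ?thesis
    by (intro smooth_on_compose[OF assms(1) _ assms(2)]) (auto intro: smooth_on_coord assms)
qed

text \<open>Numbering the elements of \<open>J\<close> reduces an arbitrary finite index set, such
  as the subsets of \<open>{..<n}\<close> that index the Clifford algebra, to the initial segments
  in the definition of \<open>smooth_space\<close>.\<close>

lemma smooth_space_compose:
  assumes M: "smooth_space M" and "finite J" "openin (ftop M) W" "\<And>j. j \<in> J \<Longrightarrow> fsm M W (c j)" "smooth_on J D h"
    "\<And>q. q \<in> W \<Longrightarrow> (\<lambda>j\<in>J. c j q) \<in> D"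
  shows "fsm M W (\<lambda>q. h (\<lambda>j\<in>J. c j q))"
proof -
  obtain r :: nat and e where e: "bij_betw e J {..<r}"
    using ex_bij_betw_finite_nat[OF assms(2)] by (auto simp: lessThan_atLeast0)
  define b where "b = inv_into J e"
  have b: "b j \<in> J" "e (b j) = j" if "j < r" for j
    using that e by (auto simp: b_def bij_betw_def inv_into_into f_inv_into_f)
  have e': "e j < r" "b (e j) = j" if "j \<in> J" for j
    using that e by (auto simp: b_def bij_betw_def)
  have eq: "(\<lambda>j\<in>J. (\<lambda>j\<in>{..<r}. c (b j) q) (e j)) = (\<lambda>j\<in>J. c j q)" for q
    using e' by (auto simp: fun_eq_iff)
  have "fsm M W (\<lambda>q. h (\<lambda>j\<in>J. (\<lambda>j\<in>{..<r}. c (b j) q) (e j)))"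
    by (rule smooth_space_compose_lessThan[OF M assms(3) _ smooth_on_reindex[OF assms(2,5), of e "{..<r}"]])
      (use b e' assms in \<open>auto simp: eq simp del: restrict_apply\<close>)
  then show ?thesis unfolding eq .
qed

lemma openin_compose_domain:
  assumes M: "functional_space M" and "openin (ftop M) W" "\<And>j. j \<in> J \<Longrightarrow> fsm M W (c j)" "openin (powertop_real J) D"
  shows "openin (ftop M) {q \<in> W. (\<lambda>j\<in>J. c j q) \<in> D}"
proof -
  have "continuous_map (subtopology (ftop M) W) (powertop_real J) (\<lambda>q. \<lambda>j\<in>J. c j q)"
    by (intro continuous_map_into_powertop fspace_continuous[OF M] assms)
  from openin_continuous_map_preimage[OF this assms(4)]
  have "openin (subtopology (ftop M) W) {q \<in> topspace (subtopology (ftop M) W). (\<lambda>j\<in>J. c j q) \<in> D}" .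
  moreover have tW: "topspace (subtopology (ftop M) W) = W" using openin_subset[OF assms(2)] by auto
  ultimately have "openin (subtopology (ftop M) W) {q \<in> W. (\<lambda>j\<in>J. c j q) \<in> D}" unfolding tW by simp
  then show ?thesis using assms(2) by (rule openin_trans_full)
qed

lemma smooth_spaceI:
  assumes openin: "\<And>U f. fsm M U f \<Longrightarrow> openin (ftop M) U"
    and cont: "\<And>U f. fsm M U f \<Longrightarrow> continuous_map (subtopology (ftop M) U) euclideanreal f"
    and cong: "\<And>U f g. fsm M U f \<Longrightarrow> (\<And>x. x \<in> U \<Longrightarrow> g x = f x) \<Longrightarrow> fsm M U g"
    and restrict: "\<And>U V f. fsm M U f \<Longrightarrow> openin (ftop M) V \<Longrightarrow> V \<subseteq> U \<Longrightarrow> fsm M V f"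
    and Union: "\<And>\<U> f. (\<And>U. U \<in> \<U> \<Longrightarrow> fsm M U f) \<Longrightarrow> fsm M (\<Union>\<U>) f"
    and comp: "\<And>W (r::nat) c D h. openin (ftop M) W \<Longrightarrow> (\<And>j. j < r \<Longrightarrow> fsm M W (c j)) \<Longrightarrow> smooth_on {..<r} D h \<Longrightarrow>
        (\<And>q. q \<in> W \<Longrightarrow> (\<lambda>j\<in>{..<r}. c j q) \<in> D) \<Longrightarrow> fsm M W (\<lambda>q. h (\<lambda>j\<in>{..<r}. c j q))"
  shows "smooth_space M"
proof -
  \<comment> \<open>A constant is a composite with no arguments, its outer function living on the
    one-point space of functions on the empty set. Sums and products are composites with two
    arguments.\<close>
  have const: "fsm M U (\<lambda>_. c)" if "openin (ftop M) U" for U c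
    by (rule comp[of U 0 _ "topspace (powertop_real {..<0})" "\<lambda>_. c"]) (auto intro!: smooth_on_const that)
  have add: "fsm M U (\<lambda>x. f x + g x)" if "fsm M U f" "fsm M U g" for U f g
    using comp[of U 2 "\<lambda>j. if j = 0 then f else g" "topspace (powertop_real {..<2})" "\<lambda>y. y 0 + y 1", OF openin[OF that(1)]] that
    by (simp add: smooth_on_add smooth_on_coord)
  have mult: "fsm M U (\<lambda>x. f x * g x)" if "fsm M U f" "fsm M U g" for U f g
    using comp[of U 2 "\<lambda>j. if j = 0 then f else g" "topspace (powertop_real {..<2})" "\<lambda>y. y 0 * y 1", OF openin[OF that(1)]] that
    by (simp add: smooth_on_mult smooth_on_coord)
  have "functional_space M"
    unfolding functional_space_def
    by (intro conjI allI impI; (elim conjE)?;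
        (erule openin | erule cont | erule const | erule (1) add | erule (1) mult
          | (erule cong, blast) | (erule restrict; assumption) | (rule Union, blast)))
  then show ?thesis unfolding smooth_space_def using comp by blast
qed

lemma smooth_space_euclidean:
  "smooth_space (euclidean_fspace I)"
proof (rule smooth_spaceI)
  fix W c D h and r :: nat
  assume "openin (ftop (euclidean_fspace I)) W" "\<And>j. j < r \<Longrightarrow> fsm (euclidean_fspace I) W (c j)"
    "smooth_on {..<r} D h" "\<And>q. q \<in> W \<Longrightarrow> (\<lambda>j\<in>{..<r}. c j q) \<in> D"
  then show "fsm (euclidean_fspace I) W (\<lambda>q. h (\<lambda>j\<in>{..<r}. c j q))"
    by (auto simp: euclidean_fspace_def intro!: smooth_on_compose[of "{..<r}" I W D h c])
qed (auto simp: euclidean_fspace_def intro: smooth_on_imp_openin smooth_on_imp_continuous smooth_on_cong smooth_on_subset smooth_on_Union)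

section \<open>Pullbacks and subspaces\<close>

lemma ftop_pull_space [simp]: "ftop (pull_space S e M) = pullback_topology S e (ftop M)"
  by (simp add: pull_space_def)

lemma ftop_sub_space [simp]: "ftop (sub_space M S) = subtopology (ftop M) S"
  by (auto simp: sub_space_def topology_eq openin_pullback_topology openin_subtopology)

lemma fsm_pull_space:
  "fsm (pull_space S e M) W f \<longleftrightarrow> openin (pullback_topology S e (ftop M)) W \<and>
     (\<forall>p\<in>W. \<exists>A a. fsm M A a \<and> e p \<in> A \<and> (\<forall>q\<in>W. e q \<in> A \<longrightarrow> f q = a (e q)))"
  by (simp add: pull_space_def)

lemma openin_pull_preimage: "openin T A \<Longrightarrow> openin (pullback_topology S e T) (e -` A \<inter> S)"
  by (auto simp: openin_pullback_topology)

lemma smooth_space_pull: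
  assumes M: "smooth_space M"
  shows "smooth_space (pull_space S e M)"
proof (rule smooth_spaceI, unfold ftop_pull_space)
  note fM = smooth_space_functional[OF M]
  let ?T = "pullback_topology S e (ftop M)"
  fix U f
  assume f: "fsm (pull_space S e M) U f"
  then show U: "openin ?T U" by (simp add: fsm_pull_space)
  have US: "U \<subseteq> S" using openin_subset[OF U] by (auto simp: topspace_pullback_topology)
  show "continuous_map (subtopology ?T U) euclideanreal f"
  proof (rule continuous_map_into_real_local)
    fix p assume p: "p \<in> U"
    then obtain A a where A: "fsm M A a" "e p \<in> A" "\<And>q. q \<in> U \<Longrightarrow> e q \<in> A \<Longrightarrow> f q = a (e q)"
      using f by (auto simp: fsm_pull_space)
    let ?V = "U \<inter> (e -` A \<inter> S)"
    have V: "openin ?T ?V"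
      using U openin_pull_preimage[OF fspace_openin[OF fM A(1)]] by (rule openin_Int)
    have "continuous_map ?T (ftop M) (id \<circ> e)"
      using continuous_map_pullback[of "ftop M" "ftop M" id] by simp
    then have "continuous_map (subtopology ?T ?V) (subtopology (ftop M) A) e"
      by (auto simp: continuous_map_in_subtopology continuous_map_from_subtopology)
    from continuous_map_compose[OF this fspace_continuous[OF fM A(1)]]
    have "continuous_map (subtopology ?T ?V) euclideanreal f"
      by (rule continuous_map_eq) (use A in auto)
    then show "\<exists>V. openin ?T V \<and> p \<in> V \<and> continuous_map (subtopology ?T V) euclideanreal f"
      using V p US A(2) by blast
  qed
  show "fsm (pull_space S e M) U g" if "\<And>x. x \<in> U \<Longrightarrow> g x = f x" for g
    using f that unfolding fsm_pull_space by metis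
  show "fsm (pull_space S e M) V f" if "openin ?T V" "V \<subseteq> U" for V
    using f that unfolding fsm_pull_space by (meson subsetD)
next
  note fM = smooth_space_functional[OF M]
  let ?T = "pullback_topology S e (ftop M)"
  fix \<U> f
  assume *: "\<And>U. U \<in> \<U> \<Longrightarrow> fsm (pull_space S e M) U f"
  have "openin ?T (\<Union>\<U>)" using * by (auto simp: fsm_pull_space)
  moreover have "\<exists>A a. fsm M A a \<and> e p \<in> A \<and> (\<forall>q\<in>\<Union>\<U>. e q \<in> A \<longrightarrow> f q = a (e q))" if p: "p \<in> \<Union>\<U>" for p
  proof -
    from p obtain U where U: "U \<in> \<U>" "p \<in> U" by blast
    then obtain A a where A: "fsm M A a" "e p \<in> A" "\<And>q. q \<in> U \<Longrightarrow> e q \<in> A \<Longrightarrow> f q = a (e q)"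
      using *[OF U(1)] unfolding fsm_pull_space by blast
    \<comment> \<open>On other members of the union the extension \<open>a\<close> says nothing
      about \<open>f\<close>. Intersecting its domain with the open set that cuts out
      \<open>U\<close> excludes their points.\<close>
    obtain B where B: "openin (ftop M) B" "U = e -` B \<inter> S"
      using *[OF U(1)] unfolding fsm_pull_space openin_pullback_topology by blast
    have "fsm M (A \<inter> B) a"
      using A B fspace_openin[OF fM A(1)] by (intro fspace_restrict[OF fM A(1)]) auto
    moreover have "f q = a (e q)" if "q \<in> \<Union>\<U>" "e q \<in> A \<inter> B" for q
    proof -
      have "q \<in> S" using \<open>openin ?T (\<Union>\<U>)\<close> that openin_subset by (fastforce simp: topspace_pullback_topology)
      then show ?thesis using A B that by auto
    qed
    ultimately show ?thesis using A B U by (intro exI[of _ "A \<inter> B"] exI[of _ a]) auto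
  qed
  ultimately show "fsm (pull_space S e M) (\<Union>\<U>) f" by (simp add: fsm_pull_space)
next
  note fM = smooth_space_functional[OF M]
  let ?T = "pullback_topology S e (ftop M)"
  fix W c D h and r :: nat
  assume W: "openin ?T W" and c: "\<And>j. j < r \<Longrightarrow> fsm (pull_space S e M) W (c j)" and h: "smooth_on {..<r} D h"
    and D: "\<And>q. q \<in> W \<Longrightarrow> (\<lambda>j\<in>{..<r}. c j q) \<in> D"
  have "\<exists>A a. fsm M A a \<and> e p \<in> A \<and> (\<forall>q\<in>W. e q \<in> A \<longrightarrow> h (\<lambda>j\<in>{..<r}. c j q) = a (e q))" if p: "p \<in> W" for p
  proof -
    have "\<forall>j\<in>{..<r}. \<exists>A a. fsm M A a \<and> e p \<in> A \<and> (\<forall>q\<in>W. e q \<in> A \<longrightarrow> c j q = a (e q))"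
      using c p unfolding fsm_pull_space by blast
    then obtain A a where A: "\<forall>j\<in>{..<r}. fsm M (A j) (a j) \<and> e p \<in> A j \<and> (\<forall>q\<in>W. e q \<in> A j \<longrightarrow> c j q = a j (e q))"
      by metis
    \<comment> \<open>The factor \<open>points M\<close> covers \<open>r = 0\<close>, where the
      intersection over no indices would be the whole type.\<close>
    define B where "B = points M \<inter> (\<Inter>j\<in>{..<r}. A j)"
    have pB: "e p \<in> B" using A p openin_subset[OF W] by (auto simp: B_def topspace_pullback_topology)
    have B: "openin (ftop M) B" unfolding B_def
    proof (cases "r = 0")
      case False
      then have "openin (ftop M) (\<Inter>j\<in>{..<r}. A j)"
        using A fspace_openin[OF fM] by (intro openin_INT2) auto
      then show "openin (ftop M) (points M \<inter> (\<Inter>j\<in>{..<r}. A j))" by blast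
    qed auto
    have aB: "fsm M B (a j)" if "j \<in> {..<r}" for j
      using A that by (intro fspace_restrict[OF fM _ B, of "A j"]) (auto simp: B_def)
    \<comment> \<open>The extensions \<open>a j\<close> are known to take values in the domain of
      \<open>h\<close> only along the image of \<open>e\<close>, so they are restricted to the open
      set where they do.\<close>
    define C where "C = {q \<in> B. (\<lambda>j\<in>{..<r}. a j q) \<in> D}"
    have C: "openin (ftop M) C"
      unfolding C_def by (rule openin_compose_domain[OF fM B aB smooth_on_imp_openin[OF h]])
    have eq: "(\<lambda>j\<in>{..<r}. c j q) = (\<lambda>j\<in>{..<r}. a j (e q))" if "q \<in> W" "e q \<in> B" for q
      using A that by (auto simp: fun_eq_iff B_def)
    have "fsm M C (\<lambda>y. h (\<lambda>j\<in>{..<r}. a j y))"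
      by (rule smooth_space_compose[OF M _ C _ h])
        (auto simp: C_def intro: fspace_restrict[OF fM aB C[unfolded C_def]] simp del: restrict_apply)
    moreover have "e p \<in> C" using pB D[OF p] eq[OF p pB] by (simp add: C_def)
    ultimately show ?thesis using eq by (intro exI[of _ C] exI[of _ "\<lambda>y. h (\<lambda>j\<in>{..<r}. a j y)"]) (auto simp: C_def simp del: restrict_apply)
  qed
  then show "fsm (pull_space S e M) W (\<lambda>q. h (\<lambda>j\<in>{..<r}. c j q))" using W by (simp add: fsm_pull_space)
qed

lemma smooth_space_sub: "smooth_space M \<Longrightarrow> smooth_space (sub_space M S)"
  by (simp add: sub_space_def smooth_space_pull)

text \<open>On an open subset the local extensions are themselves smooth functions and glue. The
  lemma is stated for a \<open>functional_space\<close> since it serves to prove, through charts,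
  that a manifold is a \<open>smooth_space\<close>.\<close>

lemma functional_space_sub_open_iff:
  assumes M: "functional_space M" and U: "openin (ftop M) U"
  shows "fsm (sub_space M U) W f \<longleftrightarrow> W \<subseteq> U \<and> fsm M W f"
proof
  assume f: "fsm (sub_space M U) W f"
  then have W: "openin (subtopology (ftop M) U) W"
    by (simp add: sub_space_def fsm_pull_space flip: ftop_pull_space) (simp flip: sub_space_def)
  then have W': "openin (ftop M) W" "W \<subseteq> U" using U openin_trans_full openin_imp_subset by blast+
  have "fsm M W f"
  proof (rule fspace_local[OF M])
    fix x assume x: "x \<in> W"
    then obtain A a where A: "fsm M A a" "x \<in> A" "\<And>q. q \<in> W \<Longrightarrow> q \<in> A \<Longrightarrow> f q = a q"
      using f by (auto simp: sub_space_def fsm_pull_space)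
    have "fsm M (W \<inter> A) a"
      using A W' fspace_openin[OF M] by (intro fspace_restrict[OF M A(1)]) auto
    then show "\<exists>U g. fsm M U g \<and> x \<in> U \<and> U \<subseteq> W \<and> (\<forall>y\<in>U. f y = g y)"
      using A x by (intro exI[of _ "W \<inter> A"] exI[of _ a]) auto
  qed
  then show "W \<subseteq> U \<and> fsm M W f" using W' by blast
next
  assume f: "W \<subseteq> U \<and> fsm M W f"
  then have "openin (subtopology (ftop M) U) W"
    using fspace_openin[OF M, of W f] U by (simp add: openin_open_subtopology)
  then have "openin (pullback_topology U (\<lambda>x. x) (ftop M)) W"
    using ftop_sub_space[of M U] by (simp add: sub_space_def del: ftop_sub_space)
  then show "fsm (sub_space M U) W f"
    unfolding sub_space_def fsm_pull_space using f by blast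
qed

text \<open>Substituting the local expressions \<open>h l\<close> into \<open>H\<close> gives one
  expression in all their generators together. The pairs \<open>(l, j)\<close> are numbered by
  \<open>e\<close>, and the domain \<open>D'\<close> consists of the points where every
  \<open>h l\<close> is defined and the values lie in the domain \<open>E\<close> of
  \<open>H\<close>.\<close>

lemma gen_smooth_compose:
  fixes s :: nat
  assumes W: "openin T W" and f: "\<And>l. l < s \<Longrightarrow> gen_smooth T B W (f l)"
    and H: "smooth_on {..<s} E H" and E: "\<And>q. q \<in> W \<Longrightarrow> (\<lambda>l\<in>{..<s}. f l q) \<in> E"
    and restr: "\<And>V V' c. B V c \<Longrightarrow> V' \<subseteq> V \<Longrightarrow> B V' c"
  shows "gen_smooth T B W (\<lambda>q. H (\<lambda>l\<in>{..<s}. f l q))"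
  unfolding gen_smooth_def
proof (intro conjI ballI)
  fix p assume p: "p \<in> W"
  have "\<forall>l\<in>{..<s}. \<exists>V (r::nat) c D h. openin T V \<and> p \<in> V \<and> V \<subseteq> W \<and> (\<forall>j<r. B V (c j)) \<and> smooth_on {..<r} D h \<and>
        (\<forall>q\<in>V. (\<lambda>j\<in>{..<r}. c j q) \<in> D \<and> f l q = h (\<lambda>j\<in>{..<r}. c j q))"
    using f p unfolding gen_smooth_def by auto
  then obtain V and r :: "nat \<Rightarrow> nat" and c D h where
    V: "\<forall>l\<in>{..<s}. openin T (V l) \<and> p \<in> V l \<and> V l \<subseteq> W \<and> (\<forall>j<r l. B (V l) (c l j)) \<and> smooth_on {..<r l} (D l) (h l) \<and>
        (\<forall>q\<in>V l. (\<lambda>j\<in>{..<r l}. c l j q) \<in> D l \<and> f l q = h l (\<lambda>j\<in>{..<r l}. c l j q))"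
    by metis
  define V' where "V' = W \<inter> (\<Inter>l\<in>{..<s}. V l)"
  have V': "openin T V'" unfolding V'_def
  proof (cases "s = 0")
    case False
    then have "openin T (\<Inter>l\<in>{..<s}. V l)" using V by (intro openin_INT2) auto
    then show "openin T (W \<inter> (\<Inter>l\<in>{..<s}. V l))" using W by blast
  qed (use W in auto)
  have fin: "finite (Sigma {..<s} (\<lambda>l. {..<r l}))" by auto
  obtain R :: nat and e where e: "bij_betw e (Sigma {..<s} (\<lambda>l. {..<r l})) {..<R}"
    using ex_bij_betw_finite_nat[OF fin] by (auto simp: lessThan_atLeast0)
  define b where "b = inv_into (Sigma {..<s} (\<lambda>l. {..<r l})) e"
  have b: "b k \<in> Sigma {..<s} (\<lambda>l. {..<r l})" if "k < R" for k
    using that e by (auto simp: b_def bij_betw_def intro!: inv_into_into)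
  have e': "e (l, j) < R" "b (e (l, j)) = (l, j)" if "l < s" "j < r l" for l j
  proof -
    have "(l, j) \<in> Sigma {..<s} (\<lambda>l. {..<r l})" using that by simp
    then show "e (l, j) < R" "b (e (l, j)) = (l, j)"
      using e unfolding b_def by (auto simp: bij_betw_def simp del: mem_Sigma_iff)
  qed
  define C where "C k q = c (fst (b k)) (snd (b k)) q" for k q
  define Dl where "Dl l = {y \<in> topspace (powertop_real {..<R}). (\<lambda>j\<in>{..<r l}. y (e (l, j))) \<in> D l}" for l
  define hl where "hl l y = h l (\<lambda>j\<in>{..<r l}. y (e (l, j)))" for l y
  have hl: "smooth_on {..<R} (Dl l) (hl l)" if "l < s" for l
    unfolding hl_def[abs_def] Dl_def by (rule smooth_on_reindex) (use V that e' in auto)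
  define D0 where "D0 = topspace (powertop_real {..<R}) \<inter> (\<Inter>l\<in>{..<s}. Dl l)"
  have D0: "openin (powertop_real {..<R}) D0" unfolding D0_def
  proof (cases "s = 0")
    case False
    then have "openin (powertop_real {..<R}) (\<Inter>l\<in>{..<s}. Dl l)"
      using hl smooth_on_imp_openin by (intro openin_INT2) auto
    then show "openin (powertop_real {..<R}) (topspace (powertop_real {..<R}) \<inter> (\<Inter>l\<in>{..<s}. Dl l))" by blast
  qed auto
  define D' where "D' = {y \<in> D0. (\<lambda>l\<in>{..<s}. hl l y) \<in> E}"
  have sm: "smooth_on {..<R} D0 (hl l)" if "l < s" for l
    by (rule smooth_on_subset[OF hl[OF that] D0]) (use that in \<open>auto simp: D0_def\<close>)
  have D': "openin (powertop_real {..<R}) D'"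
    using openin_compose_domain[OF smooth_space_functional[OF smooth_space_euclidean], of "{..<R}" D0 "{..<s}" hl E]
      D0 sm smooth_on_imp_openin[OF H] by (simp add: D'_def euclidean_fspace_def)
  have "smooth_on {..<R} D' (\<lambda>y. H (\<lambda>l\<in>{..<s}. hl l y))"
    by (rule smooth_on_compose[OF _ D' H])
      (auto simp: D'_def intro: smooth_on_subset[OF sm D'[unfolded D'_def]] simp del: restrict_apply)
  moreover have hq: "hl l (\<lambda>k\<in>{..<R}. C k q) = f l q \<and> (\<lambda>k\<in>{..<R}. C k q) \<in> Dl l" if "l < s" "q \<in> V'" for l q
  proof -
    have "(\<lambda>j\<in>{..<r l}. (\<lambda>k\<in>{..<R}. C k q) (e (l, j))) = (\<lambda>j\<in>{..<r l}. c l j q)"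
      using e' that by (auto simp: fun_eq_iff C_def)
    moreover have "q \<in> V l" using that by (simp add: V'_def)
    ultimately show ?thesis using V that by (auto simp: hl_def Dl_def simp del: restrict_apply)
  qed
  moreover have "(\<lambda>k\<in>{..<R}. C k q) \<in> D' \<and> H (\<lambda>l\<in>{..<s}. f l q) = H (\<lambda>l\<in>{..<s}. hl l (\<lambda>k\<in>{..<R}. C k q))"
    if q: "q \<in> V'" for q
  proof -
    have "(\<lambda>l\<in>{..<s}. hl l (\<lambda>k\<in>{..<R}. C k q)) = (\<lambda>l\<in>{..<s}. f l q)"
      using hq[OF _ q] by (intro restrict_ext) simp
    moreover have "(\<lambda>k\<in>{..<R}. C k q) \<in> D0" using hq[OF _ q] by (auto simp: D0_def simp del: restrict_apply)
    moreover have "q \<in> W" using q by (simp add: V'_def)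
    ultimately show ?thesis using E[of q] unfolding D'_def by simp
  qed
  moreover have "B V' (C k)" if "k < R" for k
  proof -
    have l: "fst (b k) < s" "snd (b k) < r (fst (b k))" using b[OF that] by auto
    then have "B (V (fst (b k))) (c (fst (b k)) (snd (b k)))" using V by auto
    then show ?thesis unfolding C_def[abs_def] by (rule restr) (use l in \<open>auto simp: V'_def\<close>)
  qed
  moreover have "p \<in> V'" using V p by (auto simp: V'_def)
  moreover have "V' \<subseteq> W" by (auto simp: V'_def)
  ultimately show "\<exists>V (R::nat) c D h. openin T V \<and> p \<in> V \<and> V \<subseteq> W \<and> (\<forall>j<R. B V (c j)) \<and> smooth_on {..<R} D h \<and>
      (\<forall>q\<in>V. (\<lambda>j\<in>{..<R}. c j q) \<in> D \<and> H (\<lambda>l\<in>{..<s}. f l q) = h (\<lambda>j\<in>{..<R}. c j q))"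
    using V'
    by (intro exI[of _ V'] exI[of _ R] exI[of _ C] exI[of _ D'] exI[of _ "\<lambda>y. H (\<lambda>l\<in>{..<s}. hl l y)"]) blast
qed (rule W)

lemma smooth_space_gen:
  assumes M: "ftop M = T" "fsm M = gen_smooth T B"
    and restr: "\<And>V V' c. B V c \<Longrightarrow> V' \<subseteq> V \<Longrightarrow> B V' c"
    and cont: "\<And>V c. openin T V \<Longrightarrow> B V c \<Longrightarrow> continuous_map (subtopology T V) euclideanreal c"
  shows "smooth_space M"
proof (rule smooth_spaceI, unfold M)
  fix U f
  assume f: "gen_smooth T B U f"
  then show U: "openin T U" by (simp add: gen_smooth_def)
  show "continuous_map (subtopology T U) euclideanreal f"
  proof (rule continuous_map_into_real_local)
    fix p assume "p \<in> U"
    then obtain V c D h and r :: nat where V: "openin T V" "p \<in> V" "V \<subseteq> U" "\<And>j. j < r \<Longrightarrow> B V (c j)" "smooth_on {..<r} D h"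
        "\<And>q. q \<in> V \<Longrightarrow> (\<lambda>j\<in>{..<r}. c j q) \<in> D" "\<And>q. q \<in> V \<Longrightarrow> f q = h (\<lambda>j\<in>{..<r}. c j q)"
      using f unfolding gen_smooth_def by metis
    have "continuous_map (subtopology T V) (subtopology (powertop_real {..<r}) D) (\<lambda>q. \<lambda>j\<in>{..<r}. c j q)"
      using V cont by (auto simp: continuous_map_in_subtopology intro!: continuous_map_into_powertop simp del: restrict_apply)
    from continuous_map_compose[OF this smooth_on_imp_continuous[OF V(5)]]
    have "continuous_map (subtopology T V) euclideanreal f"
      by (rule continuous_map_eq) (use V(7) in auto)
    then show "\<exists>V. openin T V \<and> p \<in> V \<and> continuous_map (subtopology T V) euclideanreal f"
      using V by blast
  qed
  show "gen_smooth T B U g" if "\<And>x. x \<in> U \<Longrightarrow> g x = f x" for g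
    unfolding gen_smooth_def
  proof (intro conjI ballI U)
    fix p assume "p \<in> U"
    then obtain V c D h and r :: nat where V: "openin T V" "p \<in> V" "V \<subseteq> U" "\<forall>j<r. B V (c j)" "smooth_on {..<r} D h"
        "\<And>q. q \<in> V \<Longrightarrow> (\<lambda>j\<in>{..<r}. c j q) \<in> D \<and> f q = h (\<lambda>j\<in>{..<r}. c j q)"
      using f unfolding gen_smooth_def by metis
    moreover have "(\<lambda>j\<in>{..<r}. c j q) \<in> D \<and> g q = h (\<lambda>j\<in>{..<r}. c j q)" if "q \<in> V" for q
      using V(3) V(6)[OF that] \<open>\<And>x. x \<in> U \<Longrightarrow> g x = f x\<close>[of q] that by auto
    ultimately show "\<exists>V (r::nat) c D h. openin T V \<and> p \<in> V \<and> V \<subseteq> U \<and> (\<forall>j<r. B V (c j)) \<and> smooth_on {..<r} D h \<and>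
        (\<forall>q\<in>V. (\<lambda>j\<in>{..<r}. c j q) \<in> D \<and> g q = h (\<lambda>j\<in>{..<r}. c j q))"
      by blast
  qed
  show "gen_smooth T B V f" if V: "openin T V" "V \<subseteq> U" for V
    unfolding gen_smooth_def
  proof (intro conjI ballI V)
    fix p assume "p \<in> V"
    then have "p \<in> U" using V by blast
    then obtain V' c D h and r :: nat where V': "openin T V'" "p \<in> V'" "V' \<subseteq> U" "\<And>j. j < r \<Longrightarrow> B V' (c j)" "smooth_on {..<r} D h"
        "\<And>q. q \<in> V' \<Longrightarrow> (\<lambda>j\<in>{..<r}. c j q) \<in> D" "\<And>q. q \<in> V' \<Longrightarrow> f q = h (\<lambda>j\<in>{..<r}. c j q)"
      using f unfolding gen_smooth_def by metis
    then have "openin T (V' \<inter> V)" "\<And>j. j < r \<Longrightarrow> B (V' \<inter> V) (c j)" using V restr by blast+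
    then show "\<exists>V' (r::nat) c D h. openin T V' \<and> p \<in> V' \<and> V' \<subseteq> V \<and> (\<forall>j<r. B V' (c j)) \<and> smooth_on {..<r} D h \<and>
        (\<forall>q\<in>V'. (\<lambda>j\<in>{..<r}. c j q) \<in> D \<and> f q = h (\<lambda>j\<in>{..<r}. c j q))"
      using V' \<open>p \<in> V\<close> by (intro exI[of _ "V' \<inter> V"] exI[of _ r] exI[of _ c] exI[of _ D] exI[of _ h]) blast
  qed
next
  fix \<U> f
  assume *: "\<And>U. U \<in> \<U> \<Longrightarrow> gen_smooth T B U f"
  show "gen_smooth T B (\<Union>\<U>) f"
    unfolding gen_smooth_def
  proof (intro conjI ballI)
    show "openin T (\<Union>\<U>)" using * by (auto simp: gen_smooth_def)
    fix p assume "p \<in> \<Union>\<U>"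
    then obtain U where U: "U \<in> \<U>" "p \<in> U" by blast
    then obtain V c D h and r :: nat where V: "openin T V" "p \<in> V" "V \<subseteq> U" "\<And>j. j < r \<Longrightarrow> B V (c j)" "smooth_on {..<r} D h"
        "\<And>q. q \<in> V \<Longrightarrow> (\<lambda>j\<in>{..<r}. c j q) \<in> D" "\<And>q. q \<in> V \<Longrightarrow> f q = h (\<lambda>j\<in>{..<r}. c j q)"
      using *[OF U(1)] unfolding gen_smooth_def by metis
    then show "\<exists>V (r::nat) c D h. openin T V \<and> p \<in> V \<and> V \<subseteq> \<Union>\<U> \<and> (\<forall>j<r. B V (c j)) \<and> smooth_on {..<r} D h \<and>
        (\<forall>q\<in>V. (\<lambda>j\<in>{..<r}. c j q) \<in> D \<and> f q = h (\<lambda>j\<in>{..<r}. c j q))"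
      using U by (intro exI[of _ V] exI[of _ r] exI[of _ c] exI[of _ D] exI[of _ h]) blast
  qed
qed (rule gen_smooth_compose, auto intro: restr)

lemma gen_smooth_generator:
  assumes "openin T W" "B W c"
  shows "gen_smooth T B W c"
  unfolding gen_smooth_def
proof (intro conjI ballI assms)
  fix p assume "p \<in> W"
  then show "\<exists>V (r::nat) c' D h. openin T V \<and> p \<in> V \<and> V \<subseteq> W \<and> (\<forall>j<r. B V (c' j)) \<and> smooth_on {..<r} D h \<and>
        (\<forall>q\<in>V. (\<lambda>j\<in>{..<r}. c' j q) \<in> D \<and> c q = h (\<lambda>j\<in>{..<r}. c' j q))"
    using assms
    by (intro exI[of _ W] exI[of _ 1] exI[of _ "\<lambda>_. c"] exI[of _ "topspace (powertop_real {..<1})"] exI[of _ "\<lambda>y. y 0"])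
      (auto intro: smooth_on_coord)
qed

section \<open>Products and powers\<close>

lemma ftop_prod_space [simp]: "ftop (prod_space M N) = prod_topology (ftop M) (ftop N)"
  by (simp add: prod_space_def)

lemma ftop_power_space [simp]: "ftop (power_space I M) = product_topology (\<lambda>_. ftop M) I"
  by (simp add: power_space_def)

lemma continuous_map_factor:
  assumes "functional_space M" "fsm M A a" "continuous_map T (ftop M) e" "\<And>q. q \<in> V \<Longrightarrow> e q \<in> A \<and> c q = a (e q)"
  shows "continuous_map (subtopology T V) euclideanreal c"
proof -
  have "continuous_map (subtopology T V) (subtopology (ftop M) A) e"
    using assms by (auto simp: continuous_map_in_subtopology continuous_map_from_subtopology)
  from continuous_map_compose[OF this fspace_continuous[OF assms(1,2)]]
  show ?thesis by (rule continuous_map_eq) (use assms(4) in auto)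
qed

lemma smooth_space_prod:
  assumes "functional_space M" "functional_space N"
  shows "smooth_space (prod_space M N)"
proof (rule smooth_space_gen)
  show "fsm (prod_space M N) = gen_smooth (prod_topology (ftop M) (ftop N))
        (\<lambda>V c. (\<exists>A a. fsm M A a \<and> (\<forall>q\<in>V. fst q \<in> A \<and> c q = a (fst q))) \<or>
               (\<exists>A a. fsm N A a \<and> (\<forall>q\<in>V. snd q \<in> A \<and> c q = a (snd q))))"
    by (simp add: prod_space_def)
next
  fix V c
  assume "(\<exists>A a. fsm M A a \<and> (\<forall>q\<in>V. fst q \<in> A \<and> c q = a (fst q))) \<or>
               (\<exists>A a. fsm N A a \<and> (\<forall>q\<in>V. snd q \<in> A \<and> c q = a (snd q)))"
  then show "continuous_map (subtopology (prod_topology (ftop M) (ftop N)) V) euclideanreal c"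
  proof (elim disjE exE conjE)
    fix A a assume "fsm M A a" "\<forall>q\<in>V. fst q \<in> A \<and> c q = a (fst q)"
    then show ?thesis by (intro continuous_map_factor[OF assms(1) _ continuous_map_fst]) auto
  next
    fix A a assume "fsm N A a" "\<forall>q\<in>V. snd q \<in> A \<and> c q = a (snd q)"
    then show ?thesis by (intro continuous_map_factor[OF assms(2) _ continuous_map_snd]) auto
  qed
qed (simp, meson subsetD)

lemma smooth_space_power:
  assumes "functional_space M"
  shows "smooth_space (power_space I M)"
proof (rule smooth_space_gen)
  show "fsm (power_space I M) = gen_smooth (product_topology (\<lambda>_. ftop M) I)
        (\<lambda>V c. \<exists>i\<in>I. \<exists>A a. fsm M A a \<and> (\<forall>q\<in>V. q i \<in> A \<and> c q = a (q i)))"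
    by (simp add: power_space_def)
next
  fix V c
  assume "\<exists>i\<in>I. \<exists>A a. fsm M A a \<and> (\<forall>q\<in>V. q i \<in> A \<and> c q = a (q i))"
  then obtain i A a where "i \<in> I" "fsm M A a" "\<And>q. q \<in> V \<Longrightarrow> q i \<in> A \<and> c q = a (q i)" by blast
  with continuous_map_factor[OF assms, of A a "product_topology (\<lambda>_. ftop M) I" "\<lambda>q. q i" V c]
  show "continuous_map (subtopology (product_topology (\<lambda>_. ftop M) I) V) euclideanreal c"
    using continuous_map_product_projection[of i I "\<lambda>_. ftop M"] by blast
qed (simp, blast)

section \<open>Quotients\<close>

lemma ftop_quot_space [simp]: "ftop (quot_space M q) = quot_topology (ftop M) q"
  by (simp add: quot_space_def)

lemma topspace_quot_topology [simp]: "topspace (quot_topology T q) = q ` topspace T"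
proof -
  have "{x \<in> topspace T. q x \<in> q ` topspace T} = topspace T" by auto
  then have "openin (quot_topology T q) (q ` topspace T)" by (simp add: openin_quot_topology)
  then show ?thesis
    using openin_subset[of "quot_topology T q"] openin_topspace[of "quot_topology T q", unfolded openin_quot_topology] by blast
qed

lemma continuous_map_quot_topology: "continuous_map T (quot_topology T q) q"
  by (auto simp: continuous_map_def openin_quot_topology)

lemma smooth_space_quot:
  assumes M: "smooth_space M"
  shows "smooth_space (quot_space M q)"
proof (rule smooth_spaceI, unfold ftop_quot_space)
  note fM = smooth_space_functional[OF M]
  let ?T = "quot_topology (ftop M) q"
  let ?p = "\<lambda>U. {x \<in> points M. q x \<in> U}"
  have fsm: "fsm (quot_space M q) U f \<longleftrightarrow> openin ?T U \<and> fsm M (?p U) (f \<circ> q)" for U f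
    by (simp add: quot_space_def)
  {
    fix U f
    assume "fsm (quot_space M q) U f"
    then have f: "openin ?T U" "fsm M (?p U) (f \<circ> q)" by (auto simp: fsm)
    show "openin ?T U" by fact
    show "continuous_map (subtopology ?T U) euclideanreal f"
      unfolding continuous_map
    proof (intro conjI allI impI)
      fix S :: "real set" assume S: "openin euclideanreal S"
      have "openin (subtopology (ftop M) (?p U)) {x \<in> topspace (subtopology (ftop M) (?p U)). (f \<circ> q) x \<in> S}"
        by (rule openin_continuous_map_preimage[OF fspace_continuous[OF fM f(2)] S])
      then have "openin (ftop M) {x \<in> topspace (subtopology (ftop M) (?p U)). (f \<circ> q) x \<in> S}"
        using fspace_openin[OF fM f(2)] openin_trans_full by blast
      moreover have "{x \<in> topspace (subtopology (ftop M) (?p U)). (f \<circ> q) x \<in> S} = ?p {x \<in> U. f x \<in> S}"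
        by auto
      moreover have U: "U \<subseteq> q ` points M" using f(1) by (simp add: openin_quot_topology)
      ultimately have "openin ?T {x \<in> U. f x \<in> S}" by (auto simp: openin_quot_topology)
      moreover have "topspace (subtopology ?T U) = U" using U by auto
      ultimately show "openin (subtopology ?T U) {x \<in> topspace (subtopology ?T U). f x \<in> S}"
        using f(1) by (simp add: openin_open_subtopology)
    qed simp
    show "fsm (quot_space M q) U g" if "\<And>x. x \<in> U \<Longrightarrow> g x = f x" for g
      using f that fspace_cong[OF fM f(2), of "g \<circ> q"] by (simp add: fsm)
    show "fsm (quot_space M q) V f" if "openin ?T V" "V \<subseteq> U" for V
      using f that fspace_restrict[OF fM f(2), of "?p V"] by (auto simp: fsm openin_quot_topology)
  next
    fix \<U> f
    assume *: "\<And>U. U \<in> \<U> \<Longrightarrow> fsm (quot_space M q) U f"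
    have "?p (\<Union>\<U>) = \<Union>(?p ` \<U>)" by auto
    moreover have "fsm M (\<Union>(?p ` \<U>)) (f \<circ> q)" by (rule fspace_Union[OF fM]) (use * fsm in auto)
    ultimately show "fsm (quot_space M q) (\<Union>\<U>) f" using * by (auto simp: fsm)
  next
    fix W c D h and r :: nat
    assume W: "openin ?T W" and c: "\<And>j. j < r \<Longrightarrow> fsm (quot_space M q) W (c j)" and h: "smooth_on {..<r} D h"
      and D: "\<And>q. q \<in> W \<Longrightarrow> (\<lambda>j\<in>{..<r}. c j q) \<in> D"
    have "fsm M (?p W) (\<lambda>x. h (\<lambda>j\<in>{..<r}. (c j \<circ> q) x))"
    proof (rule smooth_space_compose[OF M _ _ _ h])
      show "openin (ftop M) (?p W)" using W by (simp add: openin_quot_topology)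
      show "(\<lambda>j\<in>{..<r}. (c j \<circ> q) x) \<in> D" if "x \<in> ?p W" for x using D[of "q x"] that by (simp add: o_def)
    qed (use c[unfolded fsm] in \<open>auto simp: o_def\<close>)
    then show "fsm (quot_space M q) W (\<lambda>q. h (\<lambda>j\<in>{..<r}. c j q))"
      using W by (simp add: fsm o_def)
  }
qed

lemma smooth_spaceI_functional:
  assumes "functional_space M"
    and "\<And>W (r::nat) c D h. openin (ftop M) W \<Longrightarrow> \<forall>j<r. fsm M W (c j) \<Longrightarrow> smooth_on {..<r} D h \<Longrightarrow>
        \<forall>q\<in>W. (\<lambda>j\<in>{..<r}. c j q) \<in> D \<Longrightarrow> fsm M W (\<lambda>q. h (\<lambda>j\<in>{..<r}. c j q))"
  shows "smooth_space M"
  unfolding smooth_space_def by (intro conjI allI impI, rule assms(1), elim conjE, rule assms(2))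

section \<open>Smooth maps\<close>

lemma smooth_map_image: "smooth_map M N f \<Longrightarrow> x \<in> points M \<Longrightarrow> f x \<in> points N"
  unfolding smooth_map_def using continuous_map_image_subset_topspace by fastforce

lemma smooth_map_continuous: "smooth_map M N f \<Longrightarrow> continuous_map (ftop M) (ftop N) f"
  by (simp add: smooth_map_def)

lemma smooth_map_fsm: "smooth_map M N f \<Longrightarrow> fsm N V g \<Longrightarrow> fsm M {x \<in> points M. f x \<in> V} (g \<circ> f)"
  by (simp add: smooth_map_def)

lemma smooth_map_preimage_open:
  "smooth_map M N f \<Longrightarrow> openin (ftop N) V \<Longrightarrow> openin (ftop M) {x \<in> points M. f x \<in> V}"
  using openin_continuous_map_preimage smooth_map_continuous by blast

lemma smooth_map_fsm_total:
  assumes "smooth_map M N f" "fsm N V g" "\<And>x. x \<in> points M \<Longrightarrow> f x \<in> V"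
  shows "fsm M (points M) (\<lambda>x. g (f x))"
proof -
  have "{x \<in> points M. f x \<in> V} = points M" using assms(3) by auto
  then show ?thesis using smooth_map_fsm[OF assms(1,2)] by (simp add: o_def)
qed

lemma smooth_map_id: "functional_space M \<Longrightarrow> smooth_map M M (\<lambda>x. x)"
proof -
  assume M: "functional_space M"
  have "{x \<in> points M. x \<in> V} = V" if "fsm M V g" for V g
    using openin_subset[OF fspace_openin[OF M that]] by auto
  then show ?thesis by (simp add: smooth_map_def o_def)
qed

lemma smooth_map_compose:
  assumes "smooth_map M N f" "smooth_map N K g"
  shows "smooth_map M K (\<lambda>x. g (f x))"
proof -
  have "continuous_map (ftop M) (ftop K) (\<lambda>x. g (f x))"
    using continuous_map_compose[of "ftop M" "ftop N" f "ftop K" g] assms by (simp add: smooth_map_def o_def)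
  moreover have "fsm M {x \<in> points M. g (f x) \<in> V} (h \<circ> (\<lambda>x. g (f x)))" if "fsm K V h" for V h
  proof -
    have "{x \<in> points M. f x \<in> {y \<in> points N. g y \<in> V}} = {x \<in> points M. g (f x) \<in> V}"
      using smooth_map_image[OF assms(1)] by auto
    then show ?thesis using smooth_map_fsm[OF assms(1) smooth_map_fsm[OF assms(2) that]] by (simp add: o_def)
  qed
  ultimately show ?thesis by (simp add: smooth_map_def)
qed

lemma smooth_map_cong:
  assumes M: "functional_space M" and f: "smooth_map M N f" and eq: "\<And>x. x \<in> points M \<Longrightarrow> g x = f x"
  shows "smooth_map M N g"
  unfolding smooth_map_def
proof (intro conjI allI impI)
  show "continuous_map (ftop M) (ftop N) g"
    using smooth_map_continuous[OF f] by (rule continuous_map_eq) (simp add: eq)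
  fix V h assume "fsm N V h"
  from smooth_map_fsm[OF f this] have "fsm M {x \<in> points M. f x \<in> V} (h \<circ> g)"
    by (rule fspace_cong[OF M]) (simp add: eq)
  moreover have "{x \<in> points M. f x \<in> V} = {x \<in> points M. g x \<in> V}" using eq by auto
  ultimately show "fsm M {x \<in> points M. g x \<in> V} (h \<circ> g)" by simp
qed

lemma smooth_map_const:
  assumes M: "functional_space M" and "y \<in> points N"
  shows "smooth_map M N (\<lambda>_. y)"
  unfolding smooth_map_def
proof (intro conjI allI impI)
  fix V g
  have "openin (ftop M) {x \<in> points M. y \<in> V}" by (cases "y \<in> V") auto
  then show "fsm M {x \<in> points M. y \<in> V} (g \<circ> (\<lambda>_. y))"
    unfolding o_def by (rule fspace_const[OF M])
qed (use assms in auto)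

lemma smooth_map_local:
  assumes M: "functional_space M"
    and loc: "\<And>x. x \<in> points M \<Longrightarrow> \<exists>U. openin (ftop M) U \<and> x \<in> U \<and> smooth_map (sub_space M U) N f"
  shows "smooth_map M N f"
  unfolding smooth_map_def
proof (intro conjI allI impI)
  define I where "I = {U. openin (ftop M) U \<and> smooth_map (sub_space M U) N f}"
  show "continuous_map (ftop M) (ftop N) f"
  proof (rule pasting_lemma[where I=I and T="\<lambda>U. U" and f="\<lambda>_. f"])
    show "continuous_map (subtopology (ftop M) U) (ftop N) f" if "U \<in> I" for U
      using that smooth_map_continuous by (fastforce simp: I_def)
    show "\<exists>j. j \<in> I \<and> x \<in> j \<and> f x = f x" if "x \<in> points M" for x
      using loc[OF that] by (auto simp: I_def)
  qed (auto simp: I_def)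
  fix V g assume g: "fsm N V g"
  show "fsm M {x \<in> points M. f x \<in> V} (g \<circ> f)"
  proof (rule fspace_local[OF M])
    fix x assume x: "x \<in> {x \<in> points M. f x \<in> V}"
    then obtain U where U: "openin (ftop M) U" "x \<in> U" "smooth_map (sub_space M U) N f" using loc by blast
    have "fsm M {y \<in> points (sub_space M U). f y \<in> V} (g \<circ> f)"
      using smooth_map_fsm[OF U(3) g] functional_space_sub_open_iff[OF M U(1)] by blast
    then show "\<exists>U h. fsm M U h \<and> x \<in> U \<and> U \<subseteq> {x \<in> points M. f x \<in> V} \<and> (\<forall>y\<in>U. (g \<circ> f) y = h y)"
      using U x by (intro exI[of _ "{y \<in> points (sub_space M U). f y \<in> V}"] exI[of _ "g \<circ> f"]) auto
  qed
qed

section \<open>Universal properties of pullbacks and subspaces\<close>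

lemma smooth_map_pull: "functional_space M \<Longrightarrow> smooth_map (pull_space S e M) M e"
  unfolding smooth_map_def
proof (intro conjI allI impI)
  assume M: "functional_space M"
  show cont: "continuous_map (ftop (pull_space S e M)) (ftop M) e"
    using continuous_map_pullback[of "ftop M" "ftop M" id S e] by simp
  fix V g assume "fsm M V g"
  with openin_continuous_map_preimage[OF cont fspace_openin[OF M this]]
  show "fsm (pull_space S e M) {x \<in> points (pull_space S e M). e x \<in> V} (g \<circ> e)"
    unfolding fsm_pull_space by auto
qed

text \<open>A smooth function on the pullback is locally a smooth function of \<open>M\<close> after
  \<open>e\<close>, so a map into the pullback is tested after composition with \<open>e\<close>.
  For subsets such as Spin(n) this takes the place of submanifold charts.\<close>

lemma smooth_map_into_pull:
  assumes N: "functional_space N" and M: "functional_space M"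
    and f: "smooth_map N M (\<lambda>x. e (f x))" "\<And>x. x \<in> points N \<Longrightarrow> f x \<in> S"
  shows "smooth_map N (pull_space S e M) f"
  unfolding smooth_map_def
proof (intro conjI allI impI)
  show cont: "continuous_map (ftop N) (ftop (pull_space S e M)) f"
    unfolding ftop_pull_space
    by (rule continuous_map_pullback') (use f smooth_map_continuous[OF f(1)] in \<open>auto simp: o_def\<close>)
  fix W g assume g: "fsm (pull_space S e M) W g"
  then have W: "openin (pullback_topology S e (ftop M)) W" by (simp add: fsm_pull_space)
  then have W': "openin (ftop N) {x \<in> points N. f x \<in> W}"
    using openin_continuous_map_preimage[OF cont] by simp
  show "fsm N {x \<in> points N. f x \<in> W} (g \<circ> f)"
  proof (rule fspace_local[OF N])
    fix x assume x: "x \<in> {x \<in> points N. f x \<in> W}"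
    then obtain A a where A: "fsm M A a" "e (f x) \<in> A" "\<And>q. q \<in> W \<Longrightarrow> e q \<in> A \<Longrightarrow> g q = a (e q)"
      using g unfolding fsm_pull_space by blast
    let ?U = "{x \<in> points N. f x \<in> W} \<inter> {x \<in> points N. e (f x) \<in> A}"
    have "fsm N {x \<in> points N. e (f x) \<in> A} (a \<circ> (\<lambda>x. e (f x)))"
      by (rule smooth_map_fsm[OF f(1) A(1)])
    moreover have "openin (ftop N) ?U"
      using W' calculation fspace_openin[OF N] by blast
    ultimately have "fsm N ?U (a \<circ> (\<lambda>x. e (f x)))" by (rule fspace_restrict[OF N]) auto
    then show "\<exists>U h. fsm N U h \<and> x \<in> U \<and> U \<subseteq> {x \<in> points N. f x \<in> W} \<and> (\<forall>y\<in>U. (g \<circ> f) y = h y)"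
      using x A by (intro exI[of _ ?U] exI[of _ "a \<circ> (\<lambda>x. e (f x))"]) auto
  qed
qed

lemma points_sub_space: "points (sub_space M S) = points M \<inter> S"
  by simp

lemma smooth_map_sub: "functional_space M \<Longrightarrow> smooth_map (sub_space M S) M (\<lambda>x. x)"
  unfolding sub_space_def by (rule smooth_map_pull)

lemma smooth_map_into_sub:
  assumes "functional_space N" "functional_space M" "smooth_map N M f" "\<And>x. x \<in> points N \<Longrightarrow> f x \<in> S"
  shows "smooth_map N (sub_space M S) f"
  unfolding sub_space_def by (rule smooth_map_into_pull) (use assms in auto)

lemma smooth_map_restrict: "functional_space M \<Longrightarrow> smooth_map M N f \<Longrightarrow> smooth_map (sub_space M S) N f"
  by (rule smooth_map_compose[OF smooth_map_sub])

lemma smooth_map_sub_sub: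
  assumes "smooth_space M" "functional_space N" "smooth_map M N f" "\<And>x. x \<in> points M \<Longrightarrow> x \<in> S \<Longrightarrow> f x \<in> T"
  shows "smooth_map (sub_space M S) (sub_space N T) f"
  by (rule smooth_map_into_sub)
    (use assms in \<open>auto intro: smooth_map_restrict smooth_space_functional smooth_space_sub\<close>)

section \<open>Universal properties of products and powers\<close>

lemma smooth_map_fst: "smooth_map (prod_space M N) M fst" if "functional_space M"
  unfolding smooth_map_def
proof (intro conjI allI impI)
  show "continuous_map (ftop (prod_space M N)) (ftop M) fst" by (simp add: continuous_map_fst)
  fix V g assume g: "fsm M V g"
  have "openin (prod_topology (ftop M) (ftop N)) {x \<in> topspace (prod_topology (ftop M) (ftop N)). fst x \<in> V}"
    by (rule openin_continuous_map_preimage[OF continuous_map_fst fspace_openin[OF that g]])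
  then show "fsm (prod_space M N) {x \<in> points (prod_space M N). fst x \<in> V} (g \<circ> fst)"
    unfolding prod_space_def fspace.simps
    by (rule gen_smooth_generator) (intro disjI1 exI[of _ V] exI[of _ g], use g in simp)
qed

lemma smooth_map_snd: "smooth_map (prod_space M N) N snd" if "functional_space N"
  unfolding smooth_map_def
proof (intro conjI allI impI)
  show "continuous_map (ftop (prod_space M N)) (ftop N) snd" by (simp add: continuous_map_snd)
  fix V g assume g: "fsm N V g"
  have "openin (prod_topology (ftop M) (ftop N)) {x \<in> topspace (prod_topology (ftop M) (ftop N)). snd x \<in> V}"
    by (rule openin_continuous_map_preimage[OF continuous_map_snd fspace_openin[OF that g]])
  then show "fsm (prod_space M N) {x \<in> points (prod_space M N). snd x \<in> V} (g \<circ> snd)"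
    unfolding prod_space_def fspace.simps
    by (rule gen_smooth_generator) (intro disjI2 exI[of _ V] exI[of _ g], use g in simp)
qed

lemma smooth_map_power_proj: "smooth_map (power_space I M) M (\<lambda>q. q i)" if "functional_space M" "i \<in> I"
  unfolding smooth_map_def
proof (intro conjI allI impI)
  show "continuous_map (ftop (power_space I M)) (ftop M) (\<lambda>q. q i)"
    using continuous_map_product_projection[OF that(2), of "\<lambda>_. ftop M"] by simp
  fix V g assume g: "fsm M V g"
  have "openin (product_topology (\<lambda>_. ftop M) I) {q \<in> topspace (product_topology (\<lambda>_. ftop M) I). q i \<in> V}"
    by (rule openin_continuous_map_preimage[OF continuous_map_product_projection[OF that(2)] fspace_openin[OF that(1) g]])
  then show "fsm (power_space I M) {q \<in> points (power_space I M). q i \<in> V} (g \<circ> (\<lambda>q. q i))"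
    unfolding power_space_def fspace.simps
    by (rule gen_smooth_generator) (intro bexI[of _ i] exI[of _ V] exI[of _ g], use g that(2) in simp_all)
qed

text \<open>A map into a space with generated smooth functions is smooth as soon as the generators pull
  back to smooth functions, because the source is closed under smooth composition.\<close>

lemma fsm_gen_smooth_pullback:
  assumes K: "smooth_space K" and cont: "continuous_map (ftop K) T f" and g: "gen_smooth T B W g"
    and gen: "\<And>V c. openin T V \<Longrightarrow> B V c \<Longrightarrow> fsm K {x \<in> points K. f x \<in> V} (c \<circ> f)"
  shows "fsm K {x \<in> points K. f x \<in> W} (g \<circ> f)"
proof (rule fspace_local[OF smooth_space_functional[OF K]])
  fix x assume x: "x \<in> {x \<in> points K. f x \<in> W}"
  then obtain V c D h and r :: nat where V: "openin T V" "f x \<in> V" "V \<subseteq> W" "\<forall>j<r. B V (c j)" "smooth_on {..<r} D h"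
      "\<forall>q\<in>V. (\<lambda>j\<in>{..<r}. c j q) \<in> D \<and> g q = h (\<lambda>j\<in>{..<r}. c j q)"
    using g[unfolded gen_smooth_def, THEN conjunct2, rule_format, of "f x"] by blast
  let ?U = "{x \<in> points K. f x \<in> V}"
  have "fsm K ?U (\<lambda>x. h (\<lambda>j\<in>{..<r}. (c j \<circ> f) x))"
  proof (rule smooth_space_compose_lessThan[OF K _ _ V(5)])
    show "openin (ftop K) ?U" by (rule openin_continuous_map_preimage[OF cont V(1)])
    show "fsm K ?U (c j \<circ> f)" if "j < r" for j by (rule gen[OF V(1) V(4)[rule_format, OF that]])
    show "(\<lambda>j\<in>{..<r}. (c j \<circ> f) q) \<in> D" if "q \<in> ?U" for q
      using V(6)[rule_format, of "f q"] that by (simp add: o_def)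
  qed
  then show "\<exists>U h. fsm K U h \<and> x \<in> U \<and> U \<subseteq> {x \<in> points K. f x \<in> W} \<and> (\<forall>y\<in>U. (g \<circ> f) y = h y)"
    using V x by (intro exI[of _ ?U] exI[of _ "\<lambda>x. h (\<lambda>j\<in>{..<r}. (c j \<circ> f) x)"]) (auto simp del: restrict_apply)
qed

lemma fsm_pullback_factor:
  assumes K: "functional_space K" and e: "smooth_map K M (\<lambda>x. e (f x))" and "fsm M A a"
    and V: "openin (ftop K) {x \<in> points K. f x \<in> V}" and "\<And>q. q \<in> V \<Longrightarrow> e q \<in> A \<and> c q = a (e q)"
  shows "fsm K {x \<in> points K. f x \<in> V} (c \<circ> f)"
proof (rule fspace_cong[OF K fspace_restrict[OF K smooth_map_fsm[OF e assms(3)] V]])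
  show "{x \<in> points K. f x \<in> V} \<subseteq> {x \<in> points K. e (f x) \<in> A}" using assms(5) by auto
qed (use assms(5) in auto)

lemma smooth_map_pair:
  assumes K: "smooth_space K" and f: "smooth_map K M f" and g: "smooth_map K N g"
  shows "smooth_map K (prod_space M N) (\<lambda>x. (f x, g x))"
  unfolding smooth_map_def
proof (intro conjI allI impI)
  show cont: "continuous_map (ftop K) (ftop (prod_space M N)) (\<lambda>x. (f x, g x))"
    using smooth_map_continuous[OF f] smooth_map_continuous[OF g] by (simp add: continuous_map_pairedI)
  fix W h assume "fsm (prod_space M N) W h"
  then have h: "gen_smooth (prod_topology (ftop M) (ftop N))
        (\<lambda>V c. (\<exists>A a. fsm M A a \<and> (\<forall>q\<in>V. fst q \<in> A \<and> c q = a (fst q))) \<or>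
               (\<exists>A a. fsm N A a \<and> (\<forall>q\<in>V. snd q \<in> A \<and> c q = a (snd q)))) W h"
    by (simp add: prod_space_def)
  show "fsm K {x \<in> points K. (f x, g x) \<in> W} (h \<circ> (\<lambda>x. (f x, g x)))"
  proof (rule fsm_gen_smooth_pullback[OF K _ h])
    show "continuous_map (ftop K) (prod_topology (ftop M) (ftop N)) (\<lambda>x. (f x, g x))" using cont by simp
    fix V c
    assume V: "openin (prod_topology (ftop M) (ftop N)) V"
      and *: "(\<exists>A a. fsm M A a \<and> (\<forall>q\<in>V. fst q \<in> A \<and> c q = a (fst q))) \<or>
               (\<exists>A a. fsm N A a \<and> (\<forall>q\<in>V. snd q \<in> A \<and> c q = a (snd q)))"
    have V': "openin (ftop K) {x \<in> points K. (f x, g x) \<in> V}"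
      using openin_continuous_map_preimage[OF cont] V by simp
    from * show "fsm K {x \<in> points K. (f x, g x) \<in> V} (c \<circ> (\<lambda>x. (f x, g x)))"
    proof (elim disjE exE conjE)
      fix A a assume "fsm M A a" "\<forall>q\<in>V. fst q \<in> A \<and> c q = a (fst q)"
      then show ?thesis
        using f by (intro fsm_pullback_factor[OF smooth_space_functional[OF K] _ _ V', of M fst]) auto
    next
      fix A a assume "fsm N A a" "\<forall>q\<in>V. snd q \<in> A \<and> c q = a (snd q)"
      then show ?thesis
        using g by (intro fsm_pullback_factor[OF smooth_space_functional[OF K] _ _ V', of N snd]) auto
    qed
  qed
qed

section \<open>Maps into Euclidean space\<close>

lemma fsm_euclidean_coord: "i \<in> I \<Longrightarrow> fsm (euclidean_fspace I) (points (euclidean_fspace I)) (\<lambda>x. x i)"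
  by (simp add: euclidean_fspace_def smooth_on_coord)

lemma points_euclidean [simp]: "points (euclidean_fspace I) = I \<rightarrow>\<^sub>E UNIV"
  by (simp add: euclidean_fspace_def)

lemma smooth_map_into_euclidean:
  assumes K: "smooth_space K" and I: "finite I" and f: "\<And>i. i \<in> I \<Longrightarrow> fsm K (points K) (\<lambda>x. f x i)"
    and ext: "\<And>x. x \<in> points K \<Longrightarrow> f x \<in> extensional I"
  shows "smooth_map K (euclidean_fspace I) f"
  unfolding smooth_map_def
proof (intro conjI allI impI)
  have eq: "(\<lambda>i\<in>I. f x i) = f x" if "x \<in> points K" for x
    using ext[OF that] by (auto simp: extensional_def fun_eq_iff)
  have "continuous_map (ftop K) euclideanreal (\<lambda>x. f x i)" if "i \<in> I" for i
    using fspace_continuous[OF smooth_space_functional[OF K] f[OF that]] by simp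
  then have "continuous_map (ftop K) (powertop_real I) (\<lambda>x. \<lambda>i\<in>I. f x i)"
    by (intro continuous_map_into_powertop)
  then have "continuous_map (ftop K) (powertop_real I) f"
    by (rule continuous_map_eq) (use eq in auto)
  then show cont: "continuous_map (ftop K) (ftop (euclidean_fspace I)) f"
    by (simp add: euclidean_fspace_def)
  fix V g assume "fsm (euclidean_fspace I) V g"
  then have g: "smooth_on I V g" by (simp add: euclidean_fspace_def)
  have V: "openin (ftop K) {x \<in> points K. f x \<in> V}"
    using openin_continuous_map_preimage[OF cont] smooth_on_imp_openin[OF g] by (simp add: euclidean_fspace_def)
  have "fsm K {x \<in> points K. f x \<in> V} (\<lambda>x. g (\<lambda>i\<in>I. f x i))"
  proof (rule smooth_space_compose[OF K I V _ g])
    show "fsm K {x \<in> points K. f x \<in> V} (\<lambda>x. f x i)" if "i \<in> I" for i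
      by (rule fspace_restrict[OF smooth_space_functional[OF K] f[OF that] V]) auto
  qed (simp add: eq)
  then show "fsm K {x \<in> points K. f x \<in> V} (g \<circ> f)"
    by (rule fspace_cong[OF smooth_space_functional[OF K]]) (simp add: eq)
qed

lemma smooth_map_into_pull_euclidean:
  assumes K: "smooth_space K" and I: "finite I" and f: "\<And>i. i \<in> I \<Longrightarrow> fsm K (points K) (\<lambda>x. e (f x) i)"
    and ext: "\<And>x. x \<in> points K \<Longrightarrow> e (f x) \<in> extensional I" and S: "\<And>x. x \<in> points K \<Longrightarrow> f x \<in> S"
  shows "smooth_map K (pull_space S e (euclidean_fspace I)) f"
  by (intro smooth_map_into_pull smooth_space_functional K smooth_space_euclidean smooth_map_into_euclidean I f ext S)

section \<open>Maps out of quotients\<close>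

lemma smooth_map_quot: "functional_space M \<Longrightarrow> smooth_map M (quot_space M q) q"
  unfolding smooth_map_def by (simp add: continuous_map_quot_topology) (simp add: quot_space_def)

lemma smooth_map_from_quot:
  assumes N: "functional_space N" and f: "smooth_map M N (\<lambda>x. f (q x))"
  shows "smooth_map (quot_space M q) N f"
proof -
  have op: "openin (quot_topology (ftop M) q) {y \<in> q ` points M. f y \<in> V}" if "openin (ftop N) V" for V
  proof -
    have "{x \<in> points M. q x \<in> {y \<in> q ` points M. f y \<in> V}} = {x \<in> points M. f (q x) \<in> V}" by auto
    then show ?thesis using smooth_map_preimage_open[OF f that] by (auto simp: openin_quot_topology)
  qed
  have "continuous_map (quot_topology (ftop M) q) (ftop N) f"
    unfolding continuous_map using smooth_map_image[OF f] op by auto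
  moreover have "fsm (quot_space M q) {y \<in> q ` points M. f y \<in> V} (g \<circ> f)" if g: "fsm N V g" for V g
  proof -
    have "{x \<in> points M. q x \<in> {y \<in> q ` points M. f y \<in> V}} = {x \<in> points M. f (q x) \<in> V}" by auto
    then show ?thesis
      using smooth_map_fsm[OF f g] op[OF fspace_openin[OF N g]] by (simp add: quot_space_def o_def)
  qed
  ultimately show ?thesis by (simp add: smooth_map_def)
qed

lemma fspace_diff:
  assumes M: "functional_space M" and f: "fsm M U f" and g: "fsm M U g"
  shows "fsm M U (\<lambda>x. f x - g x)"
  using fspace_add[OF M f fspace_mult[OF M fspace_const[OF M fspace_openin[OF M f], of "-1"] g]] by simp

lemma fsm_sum:
  assumes "smooth_space M" "openin (ftop M) W" "finite K" "\<And>j. j \<in> K \<Longrightarrow> fsm M W (f j)"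
  shows "fsm M W (\<lambda>x. \<Sum>j\<in>K. f j x)"
  using assms(3,4)
  by (induction K rule: finite_induct)
    (auto intro!: fspace_const[OF smooth_space_functional[OF assms(1)] assms(2)]
      fspace_add[OF smooth_space_functional[OF assms(1)]])

lemma fsm_powr:
  assumes M: "smooth_space M" and f: "fsm M W f" "\<And>q. q \<in> W \<Longrightarrow> f q > 0"
  shows "fsm M W (\<lambda>q. f q powr a)"
proof -
  let ?D = "{y \<in> topspace (powertop_real {0::nat}). y 0 \<in> {0<..}}"
  have D: "openin (powertop_real {0::nat}) ?D"
    by (rule openin_continuous_map_preimage[OF continuous_map_product_projection]) auto
  have "smooth_on {0} ?D (\<lambda>y. 1 * y 0 powr a)"
    unfolding smooth_on_def by (intro conjI allI D Ck_on_powr) auto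
  from smooth_space_compose[OF M _ _ _ this, of W "\<lambda>_. f"] f fspace_openin[OF smooth_space_functional[OF M] f(1)]
  show ?thesis by auto
qed

lemma smooth_map_sub_mono:
  assumes M: "smooth_space M" and f: "smooth_map (sub_space M U) N f" and "W \<subseteq> U"
  shows "smooth_map (sub_space M W) N f"
proof -
  have "smooth_map (sub_space M W) (sub_space M U) (\<lambda>x. x)"
    by (rule smooth_map_into_sub[OF _ _ smooth_map_sub])
      (use assms(3) in \<open>auto intro!: smooth_space_functional smooth_space_sub M\<close>)
  from smooth_map_compose[OF this f] show ?thesis .
qed

text \<open>The open subset \<open>W\<close> carries the structure of a subspace of the quotient,
  not that of a quotient of its preimage. A map out of it can nevertheless be tested on the
  preimage, which is open and saturated; local trivialisations of a quotient are maps of this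
  kind.\<close>

lemma smooth_map_from_quot_sub:
  assumes M: "smooth_space M" and N: "functional_space N" and W: "openin (ftop (quot_space M q)) W"
    and f: "smooth_map (sub_space M {x \<in> points M. q x \<in> W}) N (\<lambda>x. f (q x))"
  shows "smooth_map (sub_space (quot_space M q) W) N f"
proof -
  let ?M = "{x \<in> points M. q x \<in> W}"
  note fM = smooth_space_functional[OF M]
  have Wq: "W \<subseteq> q ` points M" "openin (ftop M) ?M" using W by (auto simp: openin_quot_topology)
  have pre: "{x \<in> points M. q x \<in> {y \<in> points (sub_space (quot_space M q) W). f y \<in> V}} = {x \<in> points (sub_space M ?M). f (q x) \<in> V}" for V
    using Wq by auto
  have op: "openin (quot_topology (ftop M) q) {y \<in> points (sub_space (quot_space M q) W). f y \<in> V}" if V: "openin (ftop N) V" for V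
  proof -
    have "openin (ftop (sub_space M ?M)) {x \<in> points (sub_space M ?M). f (q x) \<in> V}"
      by (rule smooth_map_preimage_open[OF f V])
    then have "openin (ftop M) {x \<in> points (sub_space M ?M). f (q x) \<in> V}"
      using Wq(2) openin_trans_full by (simp only: ftop_sub_space)
    then show ?thesis unfolding openin_quot_topology pre by auto
  qed
  show ?thesis unfolding smooth_map_def
  proof (intro conjI allI impI)
    show "continuous_map (ftop (sub_space (quot_space M q) W)) (ftop N) f"
      unfolding continuous_map
    proof (intro conjI allI impI)
      show "f ` points (sub_space (quot_space M q) W) \<subseteq> points N"
        using smooth_map_image[OF f] Wq by auto
      fix V assume "openin (ftop N) V"
      from op[OF this] W show "openin (ftop (sub_space (quot_space M q) W)) {x \<in> points (sub_space (quot_space M q) W). f x \<in> V}"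
        by (auto simp: openin_open_subtopology)
    qed
    fix V g assume g: "fsm N V g"
    from smooth_map_fsm[OF f g] have "fsm M {x \<in> points (sub_space M ?M). f (q x) \<in> V} (g \<circ> (\<lambda>x. f (q x)))"
      using functional_space_sub_open_iff[OF fM Wq(2)] by blast
    then have "fsm (quot_space M q) {y \<in> points (sub_space (quot_space M q) W). f y \<in> V} (g \<circ> f)"
      using op[OF fspace_openin[OF N g]] unfolding quot_space_def fspace.simps pre[unfolded quot_space_def]
      by (simp add: o_def)
    then show "fsm (sub_space (quot_space M q) W) {y \<in> points (sub_space (quot_space M q) W). f y \<in> V} (g \<circ> f)"
      using functional_space_sub_open_iff[OF smooth_space_functional[OF smooth_space_quot[OF M]] W] by auto
  qed
qed

section \<open>Diffeomorphisms and charts\<close>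

definition diffeomorphic :: "'a fspace \<Rightarrow> 'b fspace \<Rightarrow> bool" where
  "diffeomorphic M N \<longleftrightarrow> (\<exists>f. diffeo M N f)"

lemma diffeoI:
  assumes "smooth_map M N f" "smooth_map N M g" "\<And>x. x \<in> points M \<Longrightarrow> g (f x) = x" "\<And>y. y \<in> points N \<Longrightarrow> f (g y) = y"
  shows "diffeo M N f"
  using assms unfolding diffeo_def by blast

lemma diffeo_compose: "diffeo M N f \<Longrightarrow> diffeo N K g \<Longrightarrow> diffeo M K (\<lambda>x. g (f x))"
proof -
  assume "diffeo M N f" "diffeo N K g"
  then obtain f' g' where f: "smooth_map M N f" "smooth_map N M f'" "\<And>x. x \<in> points M \<Longrightarrow> f' (f x) = x" "\<And>y. y \<in> points N \<Longrightarrow> f (f' y) = y"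
    and g: "smooth_map N K g" "smooth_map K N g'" "\<And>x. x \<in> points N \<Longrightarrow> g' (g x) = x" "\<And>y. y \<in> points K \<Longrightarrow> g (g' y) = y"
    unfolding diffeo_def by blast
  show ?thesis
    by (rule diffeoI[OF smooth_map_compose[OF f(1) g(1)] smooth_map_compose[OF g(2) f(2)]])
      (simp_all add: f g smooth_map_image[OF f(1)] smooth_map_image[OF g(2)])
qed

lemma diffeomorphic_sym: "diffeomorphic M N \<Longrightarrow> diffeomorphic N M"
  unfolding diffeomorphic_def diffeo_def by blast

lemma diffeomorphic_trans [trans]: "diffeomorphic M N \<Longrightarrow> diffeomorphic N K \<Longrightarrow> diffeomorphic M K"
  unfolding diffeomorphic_def using diffeo_compose by blast

lemma diffeo_restrict:
  assumes M: "smooth_space M" and N: "smooth_space N" and f: "diffeo M N f"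
  shows "diffeo (sub_space M {x \<in> points M. f x \<in> W}) (sub_space N W) f"
proof -
  obtain g where g: "smooth_map M N f" "smooth_map N M g" "\<And>x. x \<in> points M \<Longrightarrow> g (f x) = x" "\<And>y. y \<in> points N \<Longrightarrow> f (g y) = y"
    using f unfolding diffeo_def by blast
  show ?thesis
    by (rule diffeoI[of _ _ _ g])
      (use g smooth_map_image[OF g(2)] in \<open>auto intro!: smooth_map_sub_sub M N smooth_space_functional\<close>)
qed

lemma diffeomorphic_sub_sub:
  assumes M: "smooth_space M" and "points M \<inter> A \<inter> B = points M \<inter> C"
  shows "diffeomorphic (sub_space (sub_space M A) B) (sub_space M C)"
proof -
  note f = smooth_space_functional[OF M] smooth_space_functional[OF smooth_space_sub[OF M, of A]]
    smooth_space_functional[OF smooth_space_sub[OF smooth_space_sub[OF M, of A], of B]]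
    smooth_space_functional[OF smooth_space_sub[OF M, of C]]
  have "smooth_map (sub_space (sub_space M A) B) (sub_space M C) (\<lambda>x. x)"
    by (intro smooth_map_into_sub f smooth_map_compose[OF smooth_map_sub smooth_map_sub]) (use assms(2) in auto)
  moreover have "smooth_map (sub_space M C) (sub_space (sub_space M A) B) (\<lambda>x. x)"
    by (intro smooth_map_into_sub f smooth_map_sub) (use assms(2) in auto)
  ultimately show ?thesis unfolding diffeomorphic_def using diffeoI[of _ _ "\<lambda>x. x" "\<lambda>x. x"] by blast
qed

text \<open>The dimension is a parameter: a manifold has one dimension for all its charts, so local
  statements about charts can be glued only for a fixed \<open>m\<close>, and in products the
  dimensions have to be added.\<close>

definition charted :: "nat \<Rightarrow> 'a fspace \<Rightarrow> bool" where
  "charted m M \<longleftrightarrow> (\<forall>x\<in>points M. \<exists>U V.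
        openin (ftop M) U \<and> x \<in> U \<and> openin (powertop_real {..<m}) V \<and>
        diffeomorphic (sub_space M U) (sub_space (euclidean_fspace {..<m}) V))"

lemma smooth_manifold_iff:
  "smooth_manifold M \<longleftrightarrow> functional_space M \<and> Hausdorff_space (ftop M) \<and> second_countable (ftop M) \<and> (\<exists>m. charted m M)"
  unfolding smooth_manifold_def charted_def diffeomorphic_def by simp

lemma smooth_space_diffeomorphic:
  assumes M: "functional_space M" and N: "smooth_space N" and "diffeomorphic M N"
  shows "smooth_space M"
proof (rule smooth_spaceI_functional[OF M])
  obtain f g where f: "smooth_map M N f" "smooth_map N M g" "\<And>x. x \<in> points M \<Longrightarrow> g (f x) = x" "\<And>y. y \<in> points N \<Longrightarrow> f (g y) = y"
    using assms(3) unfolding diffeomorphic_def diffeo_def by blast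
  fix W c D h and r :: nat
  assume W: "openin (ftop M) W" and c: "\<forall>j<r. fsm M W (c j)" and h: "smooth_on {..<r} D h"
    and D: "\<forall>q\<in>W. (\<lambda>j\<in>{..<r}. c j q) \<in> D"
  let ?W = "{y \<in> points N. g y \<in> W}"
  have "fsm N ?W (\<lambda>y. h (\<lambda>j\<in>{..<r}. (c j \<circ> g) y))"
    by (rule smooth_space_compose_lessThan[OF N _ _ h])
      (use smooth_map_preimage_open[OF f(2) W] smooth_map_fsm[OF f(2)] c D in \<open>auto simp: o_def simp del: restrict_apply\<close>)
  from smooth_map_fsm[OF f(1) this]
  have "fsm M {x \<in> points M. f x \<in> ?W} ((\<lambda>y. h (\<lambda>j\<in>{..<r}. (c j \<circ> g) y)) \<circ> f)" .
  moreover have "{x \<in> points M. f x \<in> ?W} = W"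
    using f(3) smooth_map_image[OF f(1)] openin_subset[OF W] by auto
  ultimately have "fsm M W ((\<lambda>y. h (\<lambda>j\<in>{..<r}. (c j \<circ> g) y)) \<circ> f)" by simp
  then show "fsm M W (\<lambda>q. h (\<lambda>j\<in>{..<r}. c j q))"
    by (rule fspace_cong[OF M]) (use f(3) openin_subset[OF W] in \<open>auto simp: subset_iff simp del: restrict_apply\<close>)
qed

lemma smooth_space_local:
  assumes M: "functional_space M"
    and loc: "\<And>x. x \<in> points M \<Longrightarrow> \<exists>U. openin (ftop M) U \<and> x \<in> U \<and> smooth_space (sub_space M U)"
  shows "smooth_space M"
proof (rule smooth_spaceI_functional[OF M])
  fix W c D h and r :: nat
  assume W: "openin (ftop M) W" and c: "\<forall>j<r. fsm M W (c j)" and h: "smooth_on {..<r} D h"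
    and D: "\<forall>q\<in>W. (\<lambda>j\<in>{..<r}. c j q) \<in> D"
  show "fsm M W (\<lambda>q. h (\<lambda>j\<in>{..<r}. c j q))"
  proof (rule fspace_local[OF M])
    fix x assume x: "x \<in> W"
    then obtain U where U: "openin (ftop M) U" "x \<in> U" "smooth_space (sub_space M U)"
      using loc openin_subset[OF W] by blast
    have WU: "openin (ftop M) (W \<inter> U)" using W U by blast
    have "fsm (sub_space M U) (W \<inter> U) (\<lambda>q. h (\<lambda>j\<in>{..<r}. c j q))"
    proof (rule smooth_space_compose_lessThan[OF U(3) _ _ h])
      show "openin (ftop (sub_space M U)) (W \<inter> U)"
        using WU U by (simp add: openin_open_subtopology)
      show "fsm (sub_space M U) (W \<inter> U) (c j)" if "j < r" for j
        using c that WU by (auto simp: functional_space_sub_open_iff[OF M U(1)] intro: fspace_restrict[OF M])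
    qed (use D in auto)
    then show "\<exists>U g. fsm M U g \<and> x \<in> U \<and> U \<subseteq> W \<and> (\<forall>y\<in>U. h (\<lambda>j\<in>{..<r}. c j y) = g y)"
      using x U by (intro exI[of _ "W \<inter> U"] exI[of _ "\<lambda>q. h (\<lambda>j\<in>{..<r}. c j q)"])
        (auto simp: functional_space_sub_open_iff[OF M U(1)])
  qed
qed

lemma functional_space_sub:
  assumes "functional_space M" "openin (ftop M) U"
  shows "functional_space (sub_space M U)"
proof -
  have "openin (subtopology (ftop M) U) W \<longleftrightarrow> W \<subseteq> U \<and> openin (ftop M) W" for W
    using assms(2) by (auto simp: openin_open_subtopology)
  note [simp] = this functional_space_sub_open_iff[OF assms]
  show ?thesis
    unfolding functional_space_def
  proof (intro conjI allI impI; (elim conjE)?)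
    fix W f assume f: "fsm (sub_space M U) W f"
    then show "openin (ftop (sub_space M U)) W" using fspace_openin[OF assms(1)] by auto
    show "continuous_map (subtopology (ftop (sub_space M U)) W) euclideanreal f"
      using f fspace_continuous[OF assms(1), of W f] by (simp add: subtopology_subtopology inf.absorb2)
  next
    fix W f g assume "fsm (sub_space M U) W f" "\<forall>x\<in>W. g x = f x"
    then show "fsm (sub_space M U) W g" using fspace_cong[OF assms(1), of W f g] by simp
  next
    fix W V f assume "fsm (sub_space M U) W f" "openin (ftop (sub_space M U)) V" "V \<subseteq> W"
    then show "fsm (sub_space M U) V f" using fspace_restrict[OF assms(1), of W f V] by simp
  next
    fix \<U> f assume "\<forall>W\<in>\<U>. fsm (sub_space M U) W f"
    then show "fsm (sub_space M U) (\<Union>\<U>) f" using fspace_Union[OF assms(1), of \<U> f] by auto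
  qed (use fspace_const[OF assms(1)] fspace_add[OF assms(1)] fspace_mult[OF assms(1)] in auto)
qed

text \<open>Closure under smooth composition can be checked on an open cover, and on the domain of a
  chart it is carried over from Euclidean space, where it is the chain rule.\<close>

lemma smooth_manifold_smooth_space: "smooth_manifold M \<Longrightarrow> smooth_space M"
  unfolding smooth_manifold_iff charted_def
  by (elim conjE exE, rule smooth_space_local, assumption)
    (meson functional_space_sub smooth_space_diffeomorphic smooth_space_euclidean smooth_space_sub)

lemma charted_local:
  assumes M: "smooth_space M"
    and loc: "\<And>x. x \<in> points M \<Longrightarrow> \<exists>W. openin (ftop M) W \<and> x \<in> W \<and> charted m (sub_space M W)"
  shows "charted m M"
  unfolding charted_def
proof
  fix x assume x: "x \<in> points M"
  then obtain W where W: "openin (ftop M) W" "x \<in> W" "charted m (sub_space M W)" using loc by blast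
  have "x \<in> points (sub_space M W)" using x W by simp
  then obtain U V where U: "openin (ftop (sub_space M W)) U" "x \<in> U" "openin (powertop_real {..<m}) V"
      "diffeomorphic (sub_space (sub_space M W) U) (sub_space (euclidean_fspace {..<m}) V)"
    using W(3) unfolding charted_def by meson
  have U': "openin (ftop M) U" "U \<subseteq> W" using U(1) W(1) openin_trans_full[of "ftop M" W U] openin_imp_subset[of "ftop M" W U] by auto
  have "diffeomorphic (sub_space M U) (sub_space (sub_space M W) U)"
    by (rule diffeomorphic_sym, rule diffeomorphic_sub_sub[OF M]) (use U' in auto)
  also note U(4)
  finally show "\<exists>U V. openin (ftop M) U \<and> x \<in> U \<and> openin (powertop_real {..<m}) V \<and>
        diffeomorphic (sub_space M U) (sub_space (euclidean_fspace {..<m}) V)"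
    using U U' by blast
qed

lemma charted_diffeomorphic:
  assumes M: "smooth_space M" and N: "smooth_space N" and "diffeomorphic M N" "charted m N"
  shows "charted m M"
  unfolding charted_def
proof
  fix x assume x: "x \<in> points M"
  obtain f where f: "diffeo M N f" using assms(3) unfolding diffeomorphic_def by blast
  then have sf: "smooth_map M N f" by (simp add: diffeo_def)
  obtain U V where U: "openin (ftop N) U" "f x \<in> U" "openin (powertop_real {..<m}) V"
      "diffeomorphic (sub_space N U) (sub_space (euclidean_fspace {..<m}) V)"
    using assms(4) smooth_map_image[OF sf x] unfolding charted_def by meson
  let ?U = "{x \<in> points M. f x \<in> U}"
  have "diffeomorphic (sub_space M ?U) (sub_space N U)"
    unfolding diffeomorphic_def using diffeo_restrict[OF M N f] by blast
  also note U(4)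
  finally show "\<exists>U V. openin (ftop M) U \<and> x \<in> U \<and> openin (powertop_real {..<m}) V \<and>
        diffeomorphic (sub_space M U) (sub_space (euclidean_fspace {..<m}) V)"
    using smooth_map_preimage_open[OF sf U(1)] x U by blast
qed

lemma charted_sub:
  assumes M: "smooth_space M" and "charted m M" and W: "openin (ftop M) W"
  shows "charted m (sub_space M W)"
  unfolding charted_def
proof
  fix x assume x: "x \<in> points (sub_space M W)"
  let ?E = "euclidean_fspace {..<m}"
  obtain U V where U: "openin (ftop M) U" "x \<in> U" "openin (powertop_real {..<m}) V"
      "diffeomorphic (sub_space M U) (sub_space ?E V)"
    using assms(2) x unfolding charted_def by (metis Int_iff points_sub_space)
  obtain g where g: "diffeo (sub_space ?E V) (sub_space M U) g"
    using diffeomorphic_sym[OF U(4)] unfolding diffeomorphic_def by blast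
  then have sg: "smooth_map (sub_space ?E V) (sub_space M U) g" by (simp add: diffeo_def)
  have UW: "openin (ftop M) (U \<inter> W)" "openin (ftop (sub_space M U)) (U \<inter> W)" "openin (ftop (sub_space M W)) (U \<inter> W)"
    using U(1) W by (auto simp: openin_open_subtopology)
  define V' where "V' = {y \<in> points (sub_space ?E V). g y \<in> U \<inter> W}"
  have "openin (ftop (sub_space ?E V)) V'" unfolding V'_def by (rule smooth_map_preimage_open[OF sg UW(2)])
  then have V': "openin (powertop_real {..<m}) V'" "V' \<subseteq> V"
    using U(3) openin_trans_full[of "powertop_real {..<m}" V V'] openin_imp_subset[of "powertop_real {..<m}" V V']
    by (auto simp: euclidean_fspace_def)
  note E = smooth_space_euclidean[of "{..<m}"]
  have "diffeomorphic (sub_space (sub_space M W) (U \<inter> W)) (sub_space M (U \<inter> W))"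
    by (rule diffeomorphic_sub_sub[OF M]) auto
  also have "diffeomorphic (sub_space M (U \<inter> W)) (sub_space (sub_space M U) (U \<inter> W))"
    by (rule diffeomorphic_sym, rule diffeomorphic_sub_sub[OF M]) auto
  also have "diffeomorphic (sub_space (sub_space M U) (U \<inter> W)) (sub_space (sub_space ?E V) V')"
    by (rule diffeomorphic_sym)
      (use diffeo_restrict[OF smooth_space_sub[OF E] smooth_space_sub[OF M] g, of "U \<inter> W"]
        in \<open>auto simp: diffeomorphic_def V'_def\<close>)
  also have "diffeomorphic (sub_space (sub_space ?E V) V') (sub_space ?E V')"
    by (rule diffeomorphic_sub_sub[OF E]) (use V' in auto)
  finally show "\<exists>U V. openin (ftop (sub_space M W)) U \<and> x \<in> U \<and> openin (powertop_real {..<m}) V \<and>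
        diffeomorphic (sub_space (sub_space M W) U) (sub_space ?E V)"
    using UW V' U(2) x by (intro exI[of _ "U \<inter> W"] exI[of _ V']) auto
qed

section \<open>Products of manifolds\<close>

lemma smooth_map_compose_fst:
  assumes "smooth_space M" "smooth_map M K f"
  shows "smooth_map (prod_space M N) K (\<lambda>q. f (fst q))"
  by (rule smooth_map_compose[OF smooth_map_fst assms(2)]) (rule smooth_space_functional[OF assms(1)])

lemma smooth_map_compose_snd:
  assumes "smooth_space N" "smooth_map N K f"
  shows "smooth_map (prod_space M N) K (\<lambda>q. f (snd q))"
  by (rule smooth_map_compose[OF smooth_map_snd assms(2)]) (rule smooth_space_functional[OF assms(1)])

lemma smooth_space_prod_space: "smooth_space M \<Longrightarrow> smooth_space N \<Longrightarrow> smooth_space (prod_space M N)"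
  by (simp add: smooth_space_prod smooth_space_functional)

lemma smooth_map_prod_maps:
  assumes "smooth_space M" "smooth_space M'" "smooth_map M N f" "smooth_map M' N' g"
  shows "smooth_map (prod_space M M') (prod_space N N') (\<lambda>(x, y). (f x, g y))"
proof -
  have "smooth_map (prod_space M M') (prod_space N N') (\<lambda>q. (f (fst q), g (snd q)))"
    by (rule smooth_map_pair[OF smooth_space_prod_space[OF assms(1,2)] smooth_map_compose_fst[OF assms(1,3)]
        smooth_map_compose_snd[OF assms(2,4)]])
  then show ?thesis by (simp add: case_prod_beta')
qed

lemma diffeomorphic_prod:
  assumes "smooth_space M" "smooth_space M'" "smooth_space N" "smooth_space N'"
    and "diffeomorphic M N" "diffeomorphic M' N'"
  shows "diffeomorphic (prod_space M M') (prod_space N N')"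
proof -
  obtain f g where f: "smooth_map M N f" "smooth_map N M g" "\<And>x. x \<in> points M \<Longrightarrow> g (f x) = x" "\<And>y. y \<in> points N \<Longrightarrow> f (g y) = y"
    using assms(5) unfolding diffeomorphic_def diffeo_def by blast
  obtain f' g' where f': "smooth_map M' N' f'" "smooth_map N' M' g'" "\<And>x. x \<in> points M' \<Longrightarrow> g' (f' x) = x" "\<And>y. y \<in> points N' \<Longrightarrow> f' (g' y) = y"
    using assms(6) unfolding diffeomorphic_def diffeo_def by blast
  have "diffeo (prod_space M M') (prod_space N N') (\<lambda>(x, y). (f x, f' y))"
    by (rule diffeoI[OF smooth_map_prod_maps smooth_map_prod_maps[of N N' M g M' g']]) (use f f' assms in auto)
  then show ?thesis unfolding diffeomorphic_def by blast
qed

lemma diffeomorphic_prod_sub: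
  assumes M: "smooth_space M" and N: "smooth_space N"
  shows "diffeomorphic (sub_space (prod_space M N) (A \<times> B)) (prod_space (sub_space M A) (sub_space N B))"
proof -
  note f = smooth_space_functional[OF M] smooth_space_functional[OF N]
  note P = smooth_space_prod[OF f]
  note SP = smooth_space_sub[OF P, of "A \<times> B"]
  note fs = smooth_space_functional[OF SP] smooth_space_functional[OF P]
    smooth_space_functional[OF smooth_space_sub[OF M, of A]] smooth_space_functional[OF smooth_space_sub[OF N, of B]]
  have "smooth_map (sub_space (prod_space M N) (A \<times> B)) (prod_space (sub_space M A) (sub_space N B)) (\<lambda>q. (fst q, snd q))"
    by (rule smooth_map_pair[OF SP smooth_map_into_sub smooth_map_into_sub, OF fs(1) f(1) smooth_map_restrict[OF fs(2) smooth_map_fst[OF f(1)]] _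
      fs(1) f(2) smooth_map_restrict[OF fs(2) smooth_map_snd[OF f(2)]]]) auto
  moreover have "smooth_map (prod_space (sub_space M A) (sub_space N B)) (sub_space (prod_space M N) (A \<times> B)) (\<lambda>q. (fst q, snd q))"
    by (rule smooth_map_into_sub[OF _ _ smooth_map_pair[OF _ smooth_map_compose_fst[OF _ smooth_map_sub] smooth_map_compose_snd[OF _ smooth_map_sub]]])
      (auto intro!: smooth_space_functional smooth_space_prod_space smooth_space_sub M N P)
  ultimately show ?thesis unfolding diffeomorphic_def using diffeoI[of _ _ "\<lambda>q. (fst q, snd q)" "\<lambda>q. (fst q, snd q)"] by fastforce
qed

lemma fsm_coord_compose:
  assumes "smooth_map K (euclidean_fspace I) f" "i \<in> I"
  shows "fsm K (points K) (\<lambda>x. f x i)"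
  by (rule smooth_map_fsm_total[OF assms(1) fsm_euclidean_coord[OF assms(2)]]) (use smooth_map_image[OF assms(1)] in blast)

lemma diffeomorphic_euclidean_prod:
  fixes m k :: nat
  assumes V: "openin (powertop_real {..<m}) V" and W: "openin (powertop_real {..<k}) W"
  shows "\<exists>Y. openin (powertop_real {..<m + k}) Y \<and>
    diffeomorphic (prod_space (sub_space (euclidean_fspace {..<m}) V) (sub_space (euclidean_fspace {..<k}) W))
      (sub_space (euclidean_fspace {..<m + k}) Y)"
proof -
  let ?Em = "euclidean_fspace {..<m}" and ?Ek = "euclidean_fspace {..<k}" and ?E = "euclidean_fspace {..<m + k}"
  let ?P = "prod_space (sub_space ?Em V) (sub_space ?Ek W)"
  define p where "p y = (\<lambda>i\<in>{..<m}. y i)" for y :: "nat \<Rightarrow> real"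
  define q where "q y = (\<lambda>i\<in>{..<k}. y (m + i))" for y :: "nat \<Rightarrow> real"
  define c where "c ab = (\<lambda>i\<in>{..<m + k}. if i < m then fst ab i else snd ab (i - m))" for ab :: "(nat \<Rightarrow> real) \<times> (nat \<Rightarrow> real)"
  define Y where "Y = {y \<in> topspace (powertop_real {..<m + k}). p y \<in> V} \<inter> {y \<in> topspace (powertop_real {..<m + k}). q y \<in> W}"
  note sm = smooth_space_euclidean smooth_space_sub smooth_space_prod smooth_space_functional
  have p: "smooth_map ?E ?Em p"
    by (rule smooth_map_into_euclidean) (auto simp: p_def sm intro!: fsm_euclidean_coord simp del: points_euclidean)
  have q: "smooth_map ?E ?Ek q"
    by (rule smooth_map_into_euclidean) (auto simp: q_def sm intro!: fsm_euclidean_coord simp del: points_euclidean)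
  have Y: "openin (powertop_real {..<m + k}) Y"
    using openin_Int[OF smooth_map_preimage_open[OF p, of V] smooth_map_preimage_open[OF q, of W]] V W
    by (simp add: euclidean_fspace_def Y_def)
  have Pf: "smooth_map ?P ?Em fst" "smooth_map ?P ?Ek snd"
    using smooth_map_compose_fst[OF _ smooth_map_sub[of ?Em V]] smooth_map_compose_snd[OF _ smooth_map_sub[of ?Ek W]]
    by (simp_all add: sm)
  have pc: "p (c ab) = fst ab" "q (c ab) = snd ab" if "ab \<in> points ?P" for ab
    using that by (auto simp: p_def q_def c_def PiE_def extensional_def fun_eq_iff)
  have "smooth_map ?P ?E c"
  proof (rule smooth_map_into_euclidean)
    fix i assume "i \<in> {..<m + k}"
    then show "fsm ?P (points ?P) (\<lambda>x. c x i)"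
      using fsm_coord_compose[OF Pf(1), of i] fsm_coord_compose[OF Pf(2), of "i - m"]
      by (cases "i < m") (auto simp: c_def simp del: points_sub_space)
  qed (auto simp: c_def intro!: sm)
  then have c: "smooth_map ?P (sub_space ?E Y) c"
  proof (rule smooth_map_into_sub[rotated 2])
    fix x assume x: "x \<in> points ?P"
    then show "c x \<in> Y" using pc[OF x] by (auto simp: Y_def c_def)
  qed (auto intro!: sm)
  have d: "smooth_map (sub_space ?E Y) ?P (\<lambda>y. (p y, q y))"
    by (rule smooth_map_pair[OF smooth_space_sub[OF smooth_space_euclidean] smooth_map_sub_sub[OF _ _ p] smooth_map_sub_sub[OF _ _ q]])
      (auto simp: Y_def sm)
  have cd: "c (p y, q y) = y" if "y \<in> points (sub_space ?E Y)" for y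
    using that by (auto simp: c_def p_def q_def PiE_def extensional_def fun_eq_iff)
  have "diffeo ?P (sub_space ?E Y) c"
    by (rule diffeoI[OF c d _ cd]) (simp_all add: pc del: points_sub_space)
  then show ?thesis using Y unfolding diffeomorphic_def by blast
qed

lemma charted_prod:
  assumes M: "smooth_space M" and N: "smooth_space N" and "charted m M" "charted k N"
  shows "charted (m + k) (prod_space M N)"
  unfolding charted_def
proof
  fix x assume x: "x \<in> points (prod_space M N)"
  obtain U V where U: "openin (ftop M) U" "fst x \<in> U" "openin (powertop_real {..<m}) V"
      "diffeomorphic (sub_space M U) (sub_space (euclidean_fspace {..<m}) V)"
    using assms(3) x unfolding charted_def by (metis ftop_prod_space mem_Times_iff topspace_prod_topology)
  obtain U' V' where U': "openin (ftop N) U'" "snd x \<in> U'" "openin (powertop_real {..<k}) V'"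
      "diffeomorphic (sub_space N U') (sub_space (euclidean_fspace {..<k}) V')"
    using assms(4) x unfolding charted_def by (metis ftop_prod_space mem_Times_iff topspace_prod_topology)
  obtain Y where Y: "openin (powertop_real {..<m + k}) Y"
      "diffeomorphic (prod_space (sub_space (euclidean_fspace {..<m}) V) (sub_space (euclidean_fspace {..<k}) V'))
      (sub_space (euclidean_fspace {..<m + k}) Y)"
    using diffeomorphic_euclidean_prod[OF U(3) U'(3)] by blast
  have "diffeomorphic (sub_space (prod_space M N) (U \<times> U')) (prod_space (sub_space M U) (sub_space N U'))"
    by (rule diffeomorphic_prod_sub[OF M N])
  also have "diffeomorphic (prod_space (sub_space M U) (sub_space N U'))
      (prod_space (sub_space (euclidean_fspace {..<m}) V) (sub_space (euclidean_fspace {..<k}) V'))"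
    by (intro diffeomorphic_prod smooth_space_sub smooth_space_euclidean M N U U')
  also note Y(2)
  finally show "\<exists>U V. openin (ftop (prod_space M N)) U \<and> x \<in> U \<and> openin (powertop_real {..<m + k}) V \<and>
        diffeomorphic (sub_space (prod_space M N) U) (sub_space (euclidean_fspace {..<m + k}) V)"
    using U U' Y by (intro exI[of _ "U \<times> U'"] exI[of _ Y]) (auto simp: openin_prod_Times_iff mem_Times_iff)
qed

section \<open>Second countability and separation\<close>

lemma second_countable_prod_topology:
  assumes "second_countable X" "second_countable Y"
  shows "second_countable (prod_topology X Y)"
proof -
  obtain A where A: "countable A" "\<forall>V\<in>A. openin X V" "\<forall>U x. openin X U \<and> x \<in> U \<longrightarrow> (\<exists>V\<in>A. x \<in> V \<and> V \<subseteq> U)"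
    using assms(1) unfolding second_countable_def by auto
  obtain B where B: "countable B" "\<forall>V\<in>B. openin Y V" "\<forall>U x. openin Y U \<and> x \<in> U \<longrightarrow> (\<exists>V\<in>B. x \<in> V \<and> V \<subseteq> U)"
    using assms(2) unfolding second_countable_def by auto
  let ?C = "(\<lambda>(U, V). U \<times> V) ` (A \<times> B)"
  have "\<exists>V\<in>?C. z \<in> V \<and> V \<subseteq> W" if W: "openin (prod_topology X Y) W" and zW: "z \<in> W" for W z
  proof -
    obtain U V where UV: "openin X U" "openin Y V" "fst z \<in> U" "snd z \<in> V" "U \<times> V \<subseteq> W"
      using W[unfolded openin_prod_topology_alt, rule_format, of "fst z" "snd z"] zW by auto
    obtain U' where U': "U' \<in> A" "fst z \<in> U'" "U' \<subseteq> U" using A(3) UV(1,3) by meson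
    obtain V' where V': "V' \<in> B" "snd z \<in> V'" "V' \<subseteq> V" using B(3) UV(2,4) by meson
    have "U' \<times> V' \<in> ?C" by (rule image_eqI[of _ _ "(U', V')"]) (use U' V' in auto)
    then show ?thesis using UV(5) U' V' by (intro bexI[of _ "U' \<times> V'"]) (auto simp: mem_Times_iff)
  qed
  moreover have "countable ?C" using A(1) B(1) by blast
  ultimately show ?thesis
    unfolding second_countable_def using A(2) B(2) by (intro exI[of _ ?C]) (auto simp: openin_prod_Times_iff)
qed

lemma second_countable_euclidean: "second_countable (euclidean :: 'a::second_countable_topology topology)"
proof -
  obtain B :: "'a set set" where "countable B" "topological_basis B" using ex_countable_basis by blast
  then show ?thesis
    unfolding second_countable_def topological_basis_def
    by (intro exI[of _ B]) (simp, metis UnionE Union_upper subsetD)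
qed

text \<open>Preimages of disjoint neighbourhoods are disjoint, and they are open in \<open>T\<close>
  because \<open>W\<close> is open. For the quotient \<open>L\<close> the map is once the projection
  to \<open>X\<close> and once a local trivialisation.\<close>

lemma separate_by_map:
  assumes W: "openin T W" "x \<in> W" "y \<in> W" and Y: "Hausdorff_space Y"
    and f: "continuous_map (subtopology T W) Y f" and "f x \<noteq> f y"
  shows "\<exists>U V. openin T U \<and> openin T V \<and> x \<in> U \<and> y \<in> V \<and> disjnt U V"
proof -
  have WT: "topspace (subtopology T W) = W" using openin_subset[OF W(1)] by auto
  have "f x \<in> topspace Y" "f y \<in> topspace Y" using continuous_map_image_subset_topspace[OF f] W WT by auto
  then obtain A B where AB: "openin Y A" "openin Y B" "f x \<in> A" "f y \<in> B" "disjnt A B"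
    using Y assms(6) unfolding Hausdorff_space_def by blast
  have "openin T {z \<in> W. f z \<in> C}" if "openin Y C" for C
    using openin_continuous_map_preimage[OF f that] openin_trans_full[OF _ W(1)] unfolding WT by blast
  then show ?thesis
    using AB W by (intro exI[of _ "{z \<in> W. f z \<in> A}"] exI[of _ "{z \<in> W. f z \<in> B}"]) (auto simp: disjnt_iff)
qed

section \<open>The Lie group U(1)\<close>

abbreviation (input) U1emb :: "complex \<Rightarrow> nat \<Rightarrow> real" where
  "U1emb \<equiv> \<lambda>z. \<lambda>i\<in>{..<2::nat}. if i = 0 then Re z else Im z"

lemma carrier_U1 [simp]: "carrier U1 = {z. cmod z = 1}"
  and mult_U1 [simp]: "z \<otimes>\<^bsub>U1\<^esub> w = z * w"
  and one_U1 [simp]: "\<one>\<^bsub>U1\<^esub> = 1"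
  by (simp_all add: U1_def)

lemma lsp_U1: "lsp U1 = pull_space {z. cmod z = 1} U1emb (euclidean_fspace {..<2})"
  by (simp add: U1_def)

lemma points_U1 [simp]: "points (lsp U1) = {z. cmod z = 1}"
  by (auto simp: lsp_U1 topspace_pullback_topology)

lemma smooth_space_U1: "smooth_space (lsp U1)"
  by (simp add: lsp_U1 smooth_space_pull smooth_space_euclidean)

lemma fsm_U1: "fsm (lsp U1) (points (lsp U1)) Re" "fsm (lsp U1) (points (lsp U1)) Im"
proof -
  have *: "smooth_map (lsp U1) (euclidean_fspace {..<2}) U1emb"
    unfolding lsp_U1 by (intro smooth_map_pull smooth_space_functional smooth_space_euclidean)
  show "fsm (lsp U1) (points (lsp U1)) Re" using fsm_coord_compose[OF *, of 0] by simp
  show "fsm (lsp U1) (points (lsp U1)) Im" using fsm_coord_compose[OF *, of 1] by simp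
qed

lemma smooth_map_into_U1:
  assumes K: "smooth_space K" and "fsm K (points K) (\<lambda>x. Re (f x))" "fsm K (points K) (\<lambda>x. Im (f x))"
    and "\<And>x. x \<in> points K \<Longrightarrow> cmod (f x) = 1"
  shows "smooth_map K (lsp U1) f"
  unfolding lsp_U1
proof (rule smooth_map_into_pull_euclidean[OF K])
  fix i :: nat assume "i \<in> {..<2}"
  then show "fsm K (points K) (\<lambda>x. U1emb (f x) i)" using assms(2,3) by (cases "i = 0") auto
qed (use assms(4) in auto)

lemma fsm_U1_compose:
  assumes "smooth_map K (lsp U1) f"
  shows "fsm K (points K) (\<lambda>x. Re (f x))" "fsm K (points K) (\<lambda>x. Im (f x))"
  using smooth_map_fsm_total[OF assms fsm_U1(1)] smooth_map_fsm_total[OF assms fsm_U1(2)] smooth_map_image[OF assms]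
  by auto

lemma smooth_map_U1_mult:
  assumes K: "smooth_space K" and f: "smooth_map K (lsp U1) f" and g: "smooth_map K (lsp U1) g"
  shows "smooth_map K (lsp U1) (\<lambda>x. f x * g x)"
  using fsm_U1_compose[OF f] fsm_U1_compose[OF g] smooth_map_image[OF f] smooth_map_image[OF g]
  by (intro smooth_map_into_U1 K)
    (auto simp: norm_mult intro!: fspace_diff fspace_add fspace_mult smooth_space_functional[OF K])

lemma smooth_map_U1_cnj:
  assumes K: "smooth_space K" and f: "smooth_map K (lsp U1) f"
  shows "smooth_map K (lsp U1) (\<lambda>x. cnj (f x))"
proof (rule smooth_map_into_U1[OF K])
  have "fsm K (points K) (\<lambda>x. 0 - Im (f x))"
    by (intro fspace_diff smooth_space_functional[OF K] fsm_U1_compose[OF f] fspace_const) auto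
  then show "fsm K (points K) (\<lambda>x. Im (cnj (f x)))" by simp
qed (use fsm_U1_compose[OF f] smooth_map_image[OF f] in auto)

text \<open>The structure of U(1) is pulled back from a space of functions on two indices.
  Identifying its topology with the usual one of the circle makes the Hausdorff property and second
  countability of the complex plane available.\<close>

lemma topology_U1: "ftop (lsp U1) = top_of_set {z. cmod z = 1}"
proof -
  have 1: "continuous_map euclidean (powertop_real {..<2}) U1emb"
    by (intro continuous_map_into_powertop) (auto intro!: continuous_intros)
  have 2: "continuous_map (powertop_real {..<2::nat}) euclidean (\<lambda>y. Complex (y 0) (y 1))"
  proof -
    have "continuous_map (powertop_real {..<2}) euclidean (\<lambda>y::nat\<Rightarrow>real. of_real (y 0) + \<i> * of_real (y 1))"
      using continuous_map_product_projection[of 0 "{..<2::nat}" "\<lambda>_. euclideanreal"]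
        continuous_map_product_projection[of 1 "{..<2::nat}" "\<lambda>_. euclideanreal"]
      by (simp add: continuous_map_atin tendsto_intros)
    then show ?thesis by (simp add: Complex_eq)
  qed
  have "openin (pullback_topology {z. cmod z = 1} U1emb (powertop_real {..<2})) S \<longleftrightarrow> openin (top_of_set {z. cmod z = 1}) S" for S
  proof
    assume "openin (pullback_topology {z. cmod z = 1} U1emb (powertop_real {..<2})) S"
    then obtain O' where O': "openin (powertop_real {..<2}) O'" "S = U1emb -` O' \<inter> {z. cmod z = 1}"
      by (auto simp: openin_pullback_topology)
    have "open (U1emb -` O')" using openin_continuous_map_preimage[OF 1 O'(1)] by (simp add: vimage_def)
    then show "openin (top_of_set {z. cmod z = 1}) S" using O'(2) by (auto simp: openin_open)
  next
    assume "openin (top_of_set {z. cmod z = 1}) S"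
    then obtain O' where O': "open O'" "S = {z. cmod z = 1} \<inter> O'" by (auto simp: openin_open)
    have "openin (powertop_real {..<2::nat}) {y \<in> topspace (powertop_real {..<2::nat}). Complex (y 0) (y 1) \<in> O'}"
      by (rule openin_continuous_map_preimage[OF 2]) (use O' in simp)
    moreover have "S = U1emb -` {y \<in> topspace (powertop_real {..<2}). Complex (y 0) (y 1) \<in> O'} \<inter> {z. cmod z = 1}"
      using O' by (auto simp: complex_eq_iff)
    ultimately show "openin (pullback_topology {z. cmod z = 1} U1emb (powertop_real {..<2})) S"
      unfolding openin_pullback_topology by blast
  qed
  then show ?thesis unfolding lsp_U1 ftop_pull_space topology_eq by (simp add: euclidean_fspace_def)
qed

lemma group_U1: "group U1"
proof (rule groupI)
  fix x assume "x \<in> carrier U1"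
  then have "cnj x \<in> carrier U1" "cnj x \<otimes>\<^bsub>U1\<^esub> x = \<one>\<^bsub>U1\<^esub>"
    by (auto simp: complex_norm_square[symmetric] mult.commute[of "cnj x"])
  then show "\<exists>y\<in>carrier U1. y \<otimes>\<^bsub>U1\<^esub> x = \<one>\<^bsub>U1\<^esub>" by blast
qed (auto simp: norm_mult)

lemma inv_U1: "cmod z = 1 \<Longrightarrow> inv\<^bsub>U1\<^esub> z = cnj z"
  by (rule group.inv_equality[OF group_U1]) (auto simp: complex_norm_square[symmetric] mult.commute[of "cnj z"])

text \<open>Multiplication by \<open>cnj w\<close> rotates \<open>w\<close> to 1, and the half
  circle with positive real part is parametrised by the imaginary part. In the inverse the argument
  of \<open>sqrt\<close> stays positive, so the root is a power with exponent 1/2 and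
  smooth.\<close>

lemma charted_U1: "charted 1 (lsp U1)"
  unfolding charted_def
proof
  fix w assume w: "w \<in> points (lsp U1)"
  let ?E = "euclidean_fspace {..<1::nat}"
  define V where "V = {y \<in> topspace (powertop_real {..<1::nat}). y 0 \<in> {-1<..<1}}"
  define U where "U = {z \<in> points (lsp U1). Re (z * cnj w) \<in> {0<..}}"
  have V: "openin (powertop_real {..<1::nat}) V"
    unfolding V_def by (rule openin_continuous_map_preimage[OF continuous_map_product_projection]) auto
  have id: "smooth_map (lsp U1) (lsp U1) (\<lambda>z. z)" by (intro smooth_map_id smooth_space_functional smooth_space_U1)
  have rot: "smooth_map (lsp U1) (lsp U1) (\<lambda>z. z * cnj w)"
    using w by (intro smooth_map_U1_mult smooth_space_U1 id smooth_map_const smooth_space_functional) auto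
  have "continuous_map (ftop (lsp U1)) euclideanreal (\<lambda>z. Re (z * cnj w))"
    using fspace_continuous[OF smooth_space_functional[OF smooth_space_U1] fsm_U1_compose(1)[OF rot]] by (simp only: subtopology_topspace)
  then have U: "openin (ftop (lsp U1)) U"
    unfolding U_def by (rule openin_continuous_map_preimage) auto
  define f where "f z = (\<lambda>i\<in>{..<1::nat}. Im (z * cnj w))" for z
  define g where "g y = Complex (sqrt (1 - y 0 ^ 2)) (y 0) * w" for y :: "nat \<Rightarrow> real"
  have ww: "w * cnj w = 1" "cnj w * w = 1"
    using w by (auto simp: complex_norm_square[symmetric] mult.commute[of "cnj w"])
  have cw: "cmod (z * cnj w) = 1" if "z \<in> U" for z using that w by (auto simp: U_def norm_mult)
  have re: "Re z = sqrt (1 - Im z ^ 2)" if "cmod z = 1" "Re z > 0" for z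
  proof -
    have "Re z ^ 2 = 1 - Im z ^ 2" using that(1) by (simp add: cmod_def)
    then show ?thesis using that(2) by (metis less_imp_le real_sqrt_unique)
  qed
  have imlt: "Im z ^ 2 < 1" if "cmod z = 1" "Re z > 0" for z
    using that zero_less_power[OF that(2), of 2] unfolding cmod_def real_sqrt_eq_1_iff by linarith
  have fU: "smooth_map (sub_space (lsp U1) U) ?E f"
  proof (rule smooth_map_into_euclidean)
    have "smooth_map (sub_space (lsp U1) U) (lsp U1) (\<lambda>z. z * cnj w)"
      by (intro smooth_map_restrict rot smooth_space_functional smooth_space_U1)
    from fsm_U1_compose(2)[OF this]
    show "fsm (sub_space (lsp U1) U) (points (sub_space (lsp U1) U)) (\<lambda>x. f x i)" if "i \<in> {..<1}" for i
      using that by (simp add: f_def)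
  qed (auto simp: f_def intro!: smooth_space_sub smooth_space_U1)
  have fV: "f z \<in> V" if "z \<in> U" for z
    using imlt[OF cw[OF that]] that abs_square_less_1[of "Im (z * cnj w)"] by (auto simp: V_def f_def U_def abs_less_iff)
  have f: "smooth_map (sub_space (lsp U1) U) (sub_space ?E V) f"
    by (intro smooth_map_into_sub fU smooth_space_functional smooth_space_sub smooth_space_U1 smooth_space_euclidean fV) auto
  have yV: "y 0 ^ 2 < 1" if "y \<in> V" for y using that abs_square_less_1[of "y 0"] by (auto simp: V_def abs_less_iff)
  note SV = smooth_space_sub[OF smooth_space_euclidean[of "{..<1::nat}"], of V]
  have y0: "fsm (sub_space ?E V) (points (sub_space ?E V)) (\<lambda>y. y 0)"
    using fsm_coord_compose[OF smooth_map_sub[OF smooth_space_functional[OF smooth_space_euclidean[of "{..<1::nat}"]], of V], of 0] by simp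
  have "fsm (sub_space ?E V) (points (sub_space ?E V)) (\<lambda>y. (1 - y 0 * y 0) powr (1/2))"
    by (intro fsm_powr fspace_diff fspace_mult fspace_const y0 SV smooth_space_functional[OF SV] openin_topspace)
      (use yV in \<open>auto simp: power2_eq_square\<close>)
  then have sq: "fsm (sub_space ?E V) (points (sub_space ?E V)) (\<lambda>y. sqrt (1 - y 0 ^ 2))"
    by (rule fspace_cong[OF smooth_space_functional[OF SV]])
      (use yV in \<open>auto simp: powr_half_sqrt power2_eq_square less_imp_le\<close>)
  have "smooth_map (sub_space ?E V) (lsp U1) (\<lambda>y. Complex (sqrt (1 - y 0 ^ 2)) (y 0))"
    by (rule smooth_map_into_U1[OF SV]) (use sq y0 yV in \<open>auto simp: cmod_def less_imp_le\<close>)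
  then have "smooth_map (sub_space ?E V) (lsp U1) g"
    unfolding g_def using w
    by (intro smooth_map_U1_mult SV smooth_map_const smooth_space_functional[OF SV]) auto
  then have g: "smooth_map (sub_space ?E V) (sub_space (lsp U1) U) g"
  proof (rule smooth_map_into_sub[rotated 2])
    fix y assume y: "y \<in> points (sub_space ?E V)"
    then have "g y \<in> points (lsp U1)" using smooth_map_image[OF \<open>smooth_map (sub_space ?E V) (lsp U1) g\<close>] by blast
    moreover have "g y * cnj w = Complex (sqrt (1 - y 0 ^ 2)) (y 0)" by (simp add: g_def mult.assoc ww)
    moreover have "Re (Complex (sqrt (1 - y 0 ^ 2)) (y 0)) \<in> {0<..}" using y yV by auto
    ultimately show "g y \<in> U" unfolding U_def mem_Collect_eq by presburger
  qed (intro smooth_space_functional SV smooth_space_U1)+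
  have "diffeo (sub_space (lsp U1) U) (sub_space ?E V) f"
  proof (rule diffeoI[OF f g])
    fix z assume "z \<in> points (sub_space (lsp U1) U)"
    then have z: "z \<in> U" by simp
    have "Complex (sqrt (1 - f z 0 ^ 2)) (f z 0) = z * cnj w"
      using re[OF cw[OF z]] z by (auto simp: f_def U_def complex_eq_iff)
    then show "g (f z) = z" by (simp add: g_def mult.assoc ww)
  next
    fix y assume y: "y \<in> points (sub_space ?E V)"
    have "g y * cnj w = Complex (sqrt (1 - y 0 ^ 2)) (y 0)" by (simp add: g_def mult.assoc ww)
    then show "f (g y) = y" using y by (auto simp: f_def V_def PiE_def extensional_def fun_eq_iff)
  qed
  moreover have "w \<in> U" unfolding U_def mem_Collect_eq ww using w by simp
  ultimately show "\<exists>U V. openin (ftop (lsp U1)) U \<and> w \<in> U \<and> openin (powertop_real {..<1::nat}) V \<and>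
        diffeomorphic (sub_space (lsp U1) U) (sub_space ?E V)"
    using U V unfolding diffeomorphic_def by blast
qed

lemma lie_group_U1: "lie_group U1"
  unfolding lie_group_def
proof (intro conjI)
  show "smooth_manifold (lsp U1)"
    unfolding smooth_manifold_iff topology_U1
    using charted_U1 smooth_space_functional[OF smooth_space_U1]
    by (auto intro!: Hausdorff_space_subtopology second_countable_subtopology second_countable_euclidean)
  note P = smooth_space_prod[OF smooth_space_functional[OF smooth_space_U1] smooth_space_functional[OF smooth_space_U1]]
  have "smooth_map (prod_space (lsp U1) (lsp U1)) (lsp U1) (\<lambda>q. fst q * snd q)"
    by (intro smooth_map_U1_mult P smooth_map_fst smooth_map_snd smooth_space_functional smooth_space_U1)
  then show "smooth_map (prod_space (lsp U1) (lsp U1)) (lsp U1) (\<lambda>(a, b). a \<otimes>\<^bsub>U1\<^esub> b)"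
    by (simp add: case_prod_beta')
  have "smooth_map (lsp U1) (lsp U1) cnj"
    by (intro smooth_map_U1_cnj[where f="\<lambda>z. z"] smooth_map_id smooth_space_functional smooth_space_U1)
  then show "smooth_map (lsp U1) (lsp U1) (\<lambda>a. inv\<^bsub>U1\<^esub> a)"
    by (rule smooth_map_cong[OF smooth_space_functional[OF smooth_space_U1]]) (simp add: inv_U1)
qed (auto simp: group_U1)

text \<open>An action is a homomorphism into \<open>BijGroup E\<close>, whose elements are
  bijections that are extensional on \<open>E\<close>; hence the requirement \<open>ext\<close> and
  the restrictions in the definitions of the actions. Bijectivity comes from the action of the
  inverse element.\<close>

lemma group_actionI:
  assumes G: "group G" and ext: "\<And>g. g \<in> carrier G \<Longrightarrow> a g \<in> extensional E"
    and cl: "\<And>g x. g \<in> carrier G \<Longrightarrow> x \<in> E \<Longrightarrow> a g x \<in> E"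
    and one: "\<And>x. x \<in> E \<Longrightarrow> a \<one>\<^bsub>G\<^esub> x = x"
    and mult: "\<And>g h x. g \<in> carrier G \<Longrightarrow> h \<in> carrier G \<Longrightarrow> x \<in> E \<Longrightarrow> a (g \<otimes>\<^bsub>G\<^esub> h) x = a g (a h x)"
  shows "group_action G E a"
proof -
  interpret group G by (rule G)
  have bij: "bij_betw (a g) E E" if g: "g \<in> carrier G" for g
  proof (rule bij_betw_byWitness[where f'="a (inv\<^bsub>G\<^esub> g)"])
    show "\<forall>x\<in>E. a (inv\<^bsub>G\<^esub> g) (a g x) = x" "\<forall>x\<in>E. a g (a (inv\<^bsub>G\<^esub> g) x) = x"
      using mult[of "inv\<^bsub>G\<^esub> g" g] mult[of g "inv\<^bsub>G\<^esub> g"] g one by auto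
  qed (use cl g in auto)
  have "a \<in> hom G (BijGroup E)"
  proof (rule homI)
    fix g assume "g \<in> carrier G"
    then show "a g \<in> carrier (BijGroup E)" using bij ext by (simp add: BijGroup_def Bij_def)
  next
    fix g h assume g: "g \<in> carrier G" "h \<in> carrier G"
    have "a (g \<otimes>\<^bsub>G\<^esub> h) = compose E (a g) (a h)"
      by (rule extensionalityI[of _ E]) (use ext g mult in \<open>auto simp: compose_def\<close>)
    then show "a (g \<otimes>\<^bsub>G\<^esub> h) = a g \<otimes>\<^bsub>BijGroup E\<^esub> a h"
      using bij ext g by (simp add: BijGroup_def Bij_def)
  qed
  then show ?thesis
    unfolding group_action_def group_hom_def group_hom_axioms_def by (simp add: G group_BijGroup)
qed

lemma group_actionD:
  assumes "group_action G E a"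
  shows "g \<in> carrier G \<Longrightarrow> a g \<in> extensional E"
    and "g \<in> carrier G \<Longrightarrow> x \<in> E \<Longrightarrow> a g x \<in> E"
    and "x \<in> E \<Longrightarrow> a \<one>\<^bsub>G\<^esub> x = x"
    and "g \<in> carrier G \<Longrightarrow> h \<in> carrier G \<Longrightarrow> x \<in> E \<Longrightarrow> a (g \<otimes>\<^bsub>G\<^esub> h) x = a g (a h x)"
proof -
  interpret group_action G E a by (rule assms)
  show "g \<in> carrier G \<Longrightarrow> a g \<in> extensional E"
    using group_hom.hom_closed[OF group_hom] by (simp add: BijGroup_def Bij_def)
  show "g \<in> carrier G \<Longrightarrow> x \<in> E \<Longrightarrow> a g x \<in> E" by (rule element_image) auto
  show "x \<in> E \<Longrightarrow> a \<one>\<^bsub>G\<^esub> x = x" using id_eq_one by (metis restrict_apply')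
  show "g \<in> carrier G \<Longrightarrow> h \<in> carrier G \<Longrightarrow> x \<in> E \<Longrightarrow> a (g \<otimes>\<^bsub>G\<^esub> h) x = a g (a h x)"
    by (rule composition_rule) auto
qed

section \<open>The action of the orientifold group on U(1)\<close>

lemma kappa_U1_closed: "cmod z = 1 \<Longrightarrow> cmod (kappa_U1 \<epsilon> \<gamma> z) = 1"
  by (simp add: kappa_U1_def)

lemma gamma_group_U1:
  assumes "finite_orientifold_group \<Gamma> \<epsilon>"
  shows "gamma_group \<Gamma> U1 (kappa_U1 \<epsilon>)"
proof -
  have \<Gamma>: "group \<Gamma>" and e: "\<epsilon> \<in> hom \<Gamma> \<lparr>carrier = {1, -1}, monoid.mult = (*), one = 1\<rparr>"
    using assms by (auto simp: finite_orientifold_group_def)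
  interpret group \<Gamma> by (rule \<Gamma>)
  have em: "\<epsilon> (g \<otimes>\<^bsub>\<Gamma>\<^esub> h) = \<epsilon> g * \<epsilon> h" if "g \<in> carrier \<Gamma>" "h \<in> carrier \<Gamma>" for g h
    using e that by (auto simp: hom_def)
  have ev: "\<epsilon> g = 1 \<or> \<epsilon> g = -1" if "g \<in> carrier \<Gamma>" for g
    using e that by (auto simp: hom_def Pi_iff)
  have e1: "\<epsilon> \<one>\<^bsub>\<Gamma>\<^esub> = 1" using em[of "\<one>\<^bsub>\<Gamma>\<^esub>" "\<one>\<^bsub>\<Gamma>\<^esub>"] ev[of "\<one>\<^bsub>\<Gamma>\<^esub>"] by auto
  have act: "group_action \<Gamma> (points (lsp U1)) (kappa_U1 \<epsilon>)"
  proof (rule group_actionI[OF \<Gamma>])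
    fix g h z assume "g \<in> carrier \<Gamma>" "h \<in> carrier \<Gamma>" "z \<in> points (lsp U1)"
    then show "kappa_U1 \<epsilon> (g \<otimes>\<^bsub>\<Gamma>\<^esub> h) z = kappa_U1 \<epsilon> g (kappa_U1 \<epsilon> h z)"
      using ev[of g] ev[of h] by (auto simp: kappa_U1_def em)
  qed (auto simp: kappa_U1_def e1)
  have smooth: "smooth_map (lsp U1) (lsp U1) (kappa_U1 \<epsilon> g)" for g
  proof -
    have "smooth_map (lsp U1) (lsp U1) (\<lambda>z. if \<epsilon> g = -1 then cnj z else z)"
      using smooth_map_id[OF smooth_space_functional[OF smooth_space_U1]]
        smooth_map_U1_cnj[OF smooth_space_U1 smooth_map_id[OF smooth_space_functional[OF smooth_space_U1]]]
      by (cases "\<epsilon> g = -1") auto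
    then show ?thesis
      by (rule smooth_map_cong[OF smooth_space_functional[OF smooth_space_U1]]) (simp add: kappa_U1_def)
  qed
  have "kappa_U1 \<epsilon> g \<in> iso U1 U1" if g: "g \<in> carrier \<Gamma>" for g
  proof -
    have inv: "kappa_U1 \<epsilon> g (kappa_U1 \<epsilon> g z) = z" if "cmod z = 1" for z
      using that by (simp add: kappa_U1_def)
    have "bij_betw (kappa_U1 \<epsilon> g) (carrier U1) (carrier U1)"
      by (rule bij_betw_byWitness[where f'="kappa_U1 \<epsilon> g"]) (use inv in \<open>auto simp: kappa_U1_closed\<close>)
    then show ?thesis
      by (auto simp: iso_def hom_def kappa_U1_closed) (auto simp: kappa_U1_def norm_mult)
  qed
  then show ?thesis
    unfolding gamma_group_def smooth_action_def using lie_group_U1 act smooth by blast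
qed

section \<open>The Clifford algebra\<close>

text \<open>The factors over the intersection occur twice on the right and square to 1.\<close>

lemma prod_sym_diff:
  fixes f :: "'a \<Rightarrow> real"
  assumes "finite S" "finite T" "\<And>i. f i * f i = 1"
  shows "prod f (sym_diff S T) = prod f S * prod f T"
proof -
  have 1: "prod f S = prod f (S - T) * prod f (S \<inter> T)"
    using assms by (subst prod.union_disjoint[symmetric]) (auto intro: arg_cong[of _ _ "prod f"])
  have 2: "prod f T = prod f (T - S) * prod f (S \<inter> T)"
    using assms by (subst prod.union_disjoint[symmetric]) (auto intro: arg_cong[of _ _ "prod f"])
  have 3: "prod f (S \<inter> T) * prod f (S \<inter> T) = 1"
    by (simp add: assms(3) flip: prod.distrib)
  have "prod f (sym_diff S T) = prod f (S - T) * prod f (T - S)"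
    using assms by (intro prod.union_disjoint) auto
  also have "\<dots> = prod f (S - T) * prod f (T - S) * (prod f (S \<inter> T) * prod f (S \<inter> T))" by (simp add: 3)
  finally show ?thesis unfolding 1 2 by (simp only: mult_ac)
qed

text \<open>Pairs \<open>j < i\<close> count transpositions and pairs \<open>j = i\<close> the
  squares -1, so both exponents merge into one product over \<open>j \<le> i\<close>. In this form
  the sign is visibly multiplicative in each argument under symmetric difference.\<close>

lemma cl_sign_eq_prod:
  assumes "finite S" "finite T"
  shows "cl_sign S T = (\<Prod>i\<in>S. \<Prod>j\<in>T. if j \<le> i then -1 else 1)"
proof -
  have "{(i, j). i \<in> S \<and> j \<in> T \<and> j \<le> i} = {(i, j). i \<in> S \<and> j \<in> T \<and> j < i} \<union> (\<lambda>i. (i, i)) ` (S \<inter> T)" by auto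
  moreover have "finite {(i, j). i \<in> S \<and> j \<in> T \<and> j < i}"
    by (rule finite_subset[of _ "S \<times> T"]) (use assms in auto)
  moreover have "card ((\<lambda>i. (i, i)) ` (S \<inter> T)) = card (S \<inter> T)" by (rule card_image) (auto simp: inj_on_def)
  ultimately have "card {(i, j). i \<in> S \<and> j \<in> T \<and> j \<le> i} = card {(i, j). i \<in> S \<and> j \<in> T \<and> j < i} + card (S \<inter> T)"
    using assms card_Un_disjoint[of "{(i, j). i \<in> S \<and> j \<in> T \<and> j < i}" "(\<lambda>i. (i, i)) ` (S \<inter> T)"] by auto
  moreover have "{x \<in> S \<times> T. snd x \<le> fst x} = {(i, j). i \<in> S \<and> j \<in> T \<and> j \<le> i}" by auto
  moreover have "(\<Prod>i\<in>S. \<Prod>j\<in>T. if j \<le> i then -1 else 1) = (\<Prod>x\<in>S \<times> T. if snd x \<le> fst x then -1 else (1::real))"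
    by (simp add: prod.cartesian_product case_prod_beta')
  moreover have "\<dots> = (\<Prod>x\<in>{x \<in> S \<times> T. snd x \<le> fst x}. -1)"
    using assms by (intro prod.inter_filter[symmetric]) auto
  ultimately show ?thesis by (simp add: cl_sign_def)
qed

lemma cl_sign_sym_diff_left:
  assumes "finite S" "finite S'" "finite T"
  shows "cl_sign (sym_diff S S') T = cl_sign S T * cl_sign S' T"
proof -
  have "(\<Prod>j\<in>T. if j \<le> i then -1 else 1) * (\<Prod>j\<in>T. if j \<le> i then -1 else 1) = (1::real)" for i :: nat
    unfolding prod.distrib[symmetric] by (rule prod.neutral) auto
  then show ?thesis using assms by (simp add: cl_sign_eq_prod prod_sym_diff)
qed

lemma cl_sign_sym_diff_right:
  assumes "finite S" "finite T" "finite T'"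
  shows "cl_sign S (sym_diff T T') = cl_sign S T * cl_sign S T'"
proof -
  have "(\<Prod>j\<in>sym_diff T T'. if j \<le> i then -1 else 1) = (\<Prod>j\<in>T. if j \<le> i then -1 else 1) * (\<Prod>j\<in>T'. if j \<le> i then -1 else (1::real))" for i :: nat
    using assms by (intro prod_sym_diff) auto
  then show ?thesis using assms by (simp add: cl_sign_eq_prod prod.distrib)
qed

lemma cl_sign_square: "cl_sign S T * cl_sign S T = 1"
  by (simp add: cl_sign_def flip: power_add mult_2)

lemma cl_sign_empty [simp]: "cl_sign {} T = 1" "cl_sign S {} = 1"
  by (simp_all add: cl_sign_def)

text \<open>For distinct indices exactly one of \<open>j \<le> i\<close> and
  \<open>i \<le> j\<close> holds, for equal ones both. The product is the sign by which
  \<open>e\<^sub>S e\<^sub>T\<close> and \<open>e\<^sub>T e\<^sub>S\<close> differ.\<close>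

lemma cl_sign_commute:
  assumes "finite S" "finite T"
  shows "cl_sign S T * cl_sign T S = (\<Prod>i\<in>S. \<Prod>j\<in>T. if j = i then 1 else -1)"
proof -
  have "cl_sign T S = (\<Prod>i\<in>S. \<Prod>j\<in>T. if i \<le> j then -1 else 1)"
    using assms by (simp add: cl_sign_eq_prod prod.swap[of _ S T])
  then have "cl_sign S T * cl_sign T S = (\<Prod>i\<in>S. \<Prod>j\<in>T. (if j \<le> i then -1 else 1) * (if i \<le> j then -1 else 1))"
    using assms by (simp add: cl_sign_eq_prod prod.distrib)
  also have "\<dots> = (\<Prod>i\<in>S. \<Prod>j\<in>T. if j = i then 1 else -1)"
    by (intro prod.cong refl) auto
  finally show ?thesis .
qed

text \<open>A generator \<open>e\<^sub>j\<close> anticommutes with the other generators and commutes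
  with itself. So for even \<open>S\<close> the sign tells whether \<open>j\<close> belongs to
  \<open>S\<close>, which is the test behind the kernel of \<open>Ad\<close> and behind
  \<open>lift_rot\<close>.\<close>

lemma cl_sign_commute_singleton:
  assumes "finite S"
  shows "cl_sign S {j} * cl_sign {j} S = (if j \<in> S then - ((-1) ^ card S) else (-1) ^ card S)"
proof -
  have *: "cl_sign S {j} * cl_sign {j} S = (\<Prod>i\<in>S. if j = i then 1 else -1)"
    using cl_sign_commute[OF assms, of "{j}"] by simp
  show ?thesis
  proof (cases "j \<in> S")
    case True
    have "(\<Prod>i\<in>S. if j = i then 1 else -1) = (\<Prod>i\<in>S - {j}. if j = i then 1 else (-1::real))"
      using assms True by (subst prod.remove[OF assms True]) simp
    also have "\<dots> = (\<Prod>i\<in>S - {j}. -1)" by (rule prod.cong) auto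
    also have "\<dots> = (-1) ^ (card S - 1)" using assms True by simp
    also have "\<dots> = - ((-1) ^ card S)"
      using assms True by (cases "card S") auto
    finally show ?thesis using True * by simp
  next
    case False
    then have "(\<Prod>i\<in>S. if j = i then 1 else -1) = (\<Prod>i\<in>S. (-1::real))" by (intro prod.cong) auto
    then show ?thesis using False * by simp
  qed
qed

lemma cl_elements_eqI:
  assumes "a \<in> cl_elements n" "b \<in> cl_elements n" "\<And>U. U \<subseteq> {..<n} \<Longrightarrow> a U = b U"
  shows "a = b"
  using assms unfolding cl_elements_def by (intro PiE_ext[of a "Pow {..<n}" _ b]) auto

lemma cl_mult_elements [simp]: "cl_mult n a b \<in> cl_elements n"
  by (simp add: cl_mult_def cl_elements_def)

lemma cl_basis_elements [simp]: "cl_basis n T \<in> cl_elements n"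
  by (simp add: cl_basis_def cl_elements_def)

lemma cl_reverse_elements [simp]: "cl_reverse n a \<in> cl_elements n"
  by (simp add: cl_reverse_def cl_elements_def)

lemma cl_mult_apply:
  "U \<subseteq> {..<n} \<Longrightarrow> cl_mult n a b U = (\<Sum>S\<in>Pow {..<n}. cl_sign S (sym_diff S U) * a S * b (sym_diff S U))"
  by (simp add: cl_mult_def)

text \<open>Multiplicativity in each argument makes the sign a 2-cocycle on the group of subsets
  under symmetric difference, and a cocycle twists the group algebra into an associative one. After
  exchanging the sums, the inner one is reindexed by passing from \<open>S\<close> to
  \<open>sym_diff R S\<close>.\<close>

lemma cl_mult_assoc:
  "cl_mult n (cl_mult n a b) c = cl_mult n a (cl_mult n b c)"
proof (rule cl_elements_eqI)
  fix U assume U: "U \<subseteq> {..<n}"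
  let ?P = "Pow {..<n}"
  have "cl_mult n (cl_mult n a b) c U = (\<Sum>S\<in>?P. \<Sum>R\<in>?P. cl_sign S (sym_diff S U) * (cl_sign R (sym_diff R S) * a R * b (sym_diff R S)) * c (sym_diff S U))"
    unfolding cl_mult_apply[OF U] by (intro sum.cong refl) (simp add: cl_mult_apply sum_distrib_left sum_distrib_right)
  also have "\<dots> = (\<Sum>R\<in>?P. \<Sum>S\<in>?P. cl_sign S (sym_diff S U) * (cl_sign R (sym_diff R S) * a R * b (sym_diff R S)) * c (sym_diff S U))"
    by (rule sum.swap)
  also have "\<dots> = (\<Sum>R\<in>?P. \<Sum>Q\<in>?P. cl_sign R (sym_diff R U) * a R * (cl_sign Q (sym_diff Q (sym_diff R U)) * b Q * c (sym_diff Q (sym_diff R U))))"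
  proof (rule sum.cong[OF refl])
    fix R assume R: "R \<in> ?P"
    show "(\<Sum>S\<in>?P. cl_sign S (sym_diff S U) * (cl_sign R (sym_diff R S) * a R * b (sym_diff R S)) * c (sym_diff S U)) =
      (\<Sum>Q\<in>?P. cl_sign R (sym_diff R U) * a R * (cl_sign Q (sym_diff Q (sym_diff R U)) * b Q * c (sym_diff Q (sym_diff R U))))"
    proof (rule sum.reindex_bij_witness[of _ "\<lambda>S. sym_diff R S" "\<lambda>S. sym_diff R S"])
      fix S assume S: "S \<in> ?P"
      show "sym_diff R (sym_diff R S) = S" by blast
      show "sym_diff R (sym_diff R S) = S" by blast
      show "sym_diff R S \<in> ?P" "sym_diff R S \<in> ?P" using R S by auto
      have fin: "finite R" "finite S" "finite U" using R S U finite_subset[OF _ finite_lessThan[of n]] by auto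
      have 1: "sym_diff (sym_diff R S) (sym_diff R U) = sym_diff S U" by blast
      have 2: "sym_diff R S = sym_diff (sym_diff R U) (sym_diff S U)" by blast
      \<comment> \<open>The cocycle identity: the second sign is expanded in its first argument,
        then the two signs of \<open>R\<close> are joined in the second argument.\<close>
      have "cl_sign R (sym_diff R U) * cl_sign (sym_diff R S) (sym_diff S U)
          = cl_sign R (sym_diff R U) * cl_sign R (sym_diff S U) * cl_sign S (sym_diff S U)"
        using fin by (subst cl_sign_sym_diff_left) auto
      also have "cl_sign R (sym_diff R U) * cl_sign R (sym_diff S U) = cl_sign R (sym_diff R S)"
        using fin by (subst 2, subst cl_sign_sym_diff_right) auto
      finally have 3: "cl_sign R (sym_diff R U) * cl_sign (sym_diff R S) (sym_diff S U) = cl_sign R (sym_diff R S) * cl_sign S (sym_diff S U)" .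
      show "cl_sign R (sym_diff R U) * a R * (cl_sign (sym_diff R S) (sym_diff (sym_diff R S) (sym_diff R U)) * b (sym_diff R S) * c (sym_diff (sym_diff R S) (sym_diff R U)))
        = cl_sign S (sym_diff S U) * (cl_sign R (sym_diff R S) * a R * b (sym_diff R S)) * c (sym_diff S U)"
      proof -
        have "cl_sign R (sym_diff R U) * a R * (cl_sign (sym_diff R S) (sym_diff S U) * b (sym_diff R S) * c (sym_diff S U))
          = (cl_sign R (sym_diff R U) * cl_sign (sym_diff R S) (sym_diff S U)) * (a R * b (sym_diff R S) * c (sym_diff S U))"
          by (simp only: mult_ac)
        then show ?thesis unfolding 1 3 by (simp only: mult_ac)
      qed
    qed
  qed
  also have "\<dots> = cl_mult n a (cl_mult n b c) U"
    unfolding cl_mult_apply[OF U]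
  proof (rule sum.cong[OF refl])
    fix R assume R: "R \<in> ?P"
    then have "sym_diff R U \<subseteq> {..<n}" using U by auto
    from cl_mult_apply[OF this]
    show "(\<Sum>Q\<in>?P. cl_sign R (sym_diff R U) * a R * (cl_sign Q (sym_diff Q (sym_diff R U)) * b Q * c (sym_diff Q (sym_diff R U)))) =
       cl_sign R (sym_diff R U) * a R * cl_mult n b c (sym_diff R U)"
      by (simp only: sum_distrib_left)
  qed
  finally show "cl_mult n (cl_mult n a b) c U = cl_mult n a (cl_mult n b c) U" .
qed auto

section \<open>Basis elements, unit and change of sign\<close>

lemma cl_mult_basis_left:
  assumes "T \<subseteq> {..<n}" "U \<subseteq> {..<n}"
  shows "cl_mult n (cl_basis n T) b U = cl_sign T (sym_diff T U) * b (sym_diff T U)"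
proof -
  have "cl_mult n (cl_basis n T) b U = (\<Sum>S\<in>Pow {..<n}. if S = T then cl_sign S (sym_diff S U) * b (sym_diff S U) else 0)"
    unfolding cl_mult_apply[OF assms(2)] by (intro sum.cong) (auto simp: cl_basis_def)
  then show ?thesis using assms(1) by simp
qed

lemma cl_mult_basis_right:
  assumes "T \<subseteq> {..<n}" "U \<subseteq> {..<n}"
  shows "cl_mult n a (cl_basis n T) U = cl_sign (sym_diff U T) T * a (sym_diff U T)"
proof -
  have eq: "sym_diff S U = T \<longleftrightarrow> S = sym_diff U T" for S by blast
  have "cl_mult n a (cl_basis n T) U = (\<Sum>S\<in>Pow {..<n}. if S = sym_diff U T then cl_sign (sym_diff U T) T * a (sym_diff U T) else 0)"
    unfolding cl_mult_apply[OF assms(2)]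
  proof (rule sum.cong[OF refl])
    fix S assume S: "S \<in> Pow {..<n}"
    then have "sym_diff S U \<in> Pow {..<n}" using assms(2) by auto
    then have "cl_basis n T (sym_diff S U) = (if S = sym_diff U T then 1 else 0)"
      unfolding cl_basis_def eq[symmetric] by simp
    moreover have "sym_diff (sym_diff U T) U = T" by blast
    ultimately show "cl_sign S (sym_diff S U) * a S * cl_basis n T (sym_diff S U) = (if S = sym_diff U T then cl_sign (sym_diff U T) T * a (sym_diff U T) else 0)"
      by simp
  qed
  moreover have "sym_diff U T \<in> Pow {..<n}" using assms by auto
  ultimately show ?thesis by simp
qed

lemma cl_mult_one_left: "a \<in> cl_elements n \<Longrightarrow> cl_mult n (cl_basis n {}) a = a"
  by (rule cl_elements_eqI) (auto simp: cl_mult_basis_left)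

lemma cl_mult_one_right: "a \<in> cl_elements n \<Longrightarrow> cl_mult n a (cl_basis n {}) = a"
  by (rule cl_elements_eqI) (auto simp: cl_mult_basis_right)

definition cl_neg :: "nat \<Rightarrow> clifford \<Rightarrow> clifford" where
  "cl_neg n a = (\<lambda>S\<in>Pow {..<n}. - a S)"

lemma cl_neg_elements [simp]: "cl_neg n a \<in> cl_elements n"
  by (simp add: cl_neg_def cl_elements_def)

lemma cl_neg_apply: "U \<subseteq> {..<n} \<Longrightarrow> cl_neg n a U = - a U"
  by (simp add: cl_neg_def)

lemma cl_neg_neg: "a \<in> cl_elements n \<Longrightarrow> cl_neg n (cl_neg n a) = a"
  by (rule cl_elements_eqI) (auto simp: cl_neg_apply)

lemma cl_mult_neg_left: "cl_mult n (cl_neg n a) b = cl_neg n (cl_mult n a b)"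
  by (rule cl_elements_eqI[of _ n]) (auto simp: cl_neg_apply cl_mult_apply sum_negf)

lemma cl_mult_neg_right: "cl_mult n a (cl_neg n b) = cl_neg n (cl_mult n a b)"
proof (rule cl_elements_eqI)
  fix U assume U: "U \<subseteq> {..<n}"
  have "cl_mult n a (cl_neg n b) U = (\<Sum>S\<in>Pow {..<n}. - (cl_sign S (sym_diff S U) * a S * b (sym_diff S U)))"
    unfolding cl_mult_apply[OF U]
  proof (rule sum.cong[OF refl])
    fix S assume "S \<in> Pow {..<n}"
    then have "sym_diff S U \<subseteq> {..<n}" using U by auto
    from cl_neg_apply[OF this, of b]
    show "cl_sign S (sym_diff S U) * a S * cl_neg n b (sym_diff S U) = - (cl_sign S (sym_diff S U) * a S * b (sym_diff S U))" by simp
  qed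
  then show "cl_mult n a (cl_neg n b) U = cl_neg n (cl_mult n a b) U"
    by (simp add: cl_neg_apply[OF U] cl_mult_apply[OF U] sum_negf)
qed auto

lemma cl_reverse_neg: "cl_reverse n (cl_neg n a) = cl_neg n (cl_reverse n a)"
  by (rule cl_elements_eqI[of _ n]) (simp_all, simp add: cl_neg_def cl_reverse_def)

lemma cl_neg_even: "a \<in> cl_even n \<Longrightarrow> cl_neg n a \<in> cl_even n"
  by (auto simp: cl_even_def cl_neg_apply)

section \<open>The groups Spin(n) and Spin$^c$(n)\<close>

lemma carrier_Spin: "carrier (Spin n) = {a \<in> cl_even n. cl_mult n a (cl_reverse n a) = cl_basis n {} \<and>
                 (\<forall>v\<in>cl_vectors n. cl_mult n (cl_mult n a v) (cl_reverse n a) \<in> cl_vectors n)}"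
  and mult_Spin [simp]: "a \<otimes>\<^bsub>Spin n\<^esub> b = cl_mult n a b"
  and one_Spin [simp]: "\<one>\<^bsub>Spin n\<^esub> = cl_basis n {}"
  and lsp_Spin: "lsp (Spin n) = sub_space (euclidean_fspace (Pow {..<n})) (carrier (Spin n))"
  by (simp_all add: Spin_def Let_def)

lemma Spin_elements: "a \<in> carrier (Spin n) \<Longrightarrow> a \<in> cl_elements n"
  by (simp add: carrier_Spin cl_even_def)

lemma points_Spin: "points (lsp (Spin n)) = carrier (Spin n)"
  using Spin_elements by (fastforce simp: lsp_Spin cl_elements_def)

lemma smooth_space_Spin: "smooth_space (lsp (Spin n))"
  by (simp add: lsp_Spin smooth_space_sub smooth_space_euclidean)

lemma cl_neg_Spin: "a \<in> carrier (Spin n) \<Longrightarrow> cl_neg n a \<in> carrier (Spin n)"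
  by (simp add: carrier_Spin cl_neg_even cl_reverse_neg cl_mult_neg_left cl_mult_neg_right cl_neg_neg)

lemma one_in_Spin: "cl_basis n {} \<in> carrier (Spin n)"
proof -
  have "cl_reverse n (cl_basis n {}) = cl_basis n {}"
    by (rule cl_elements_eqI[of _ n]) (simp_all, auto simp: cl_reverse_def cl_basis_def)
  then show ?thesis
    by (auto simp: carrier_Spin cl_even_def cl_mult_one_left cl_mult_one_right cl_vectors_def) (auto simp: cl_basis_def)
qed

lemma spinc_class_eq:
  assumes "g \<in> carrier (Spin n)"
  shows "spinc_class n (g, z) = {(g, z), (cl_neg n g, - z)}"
proof -
  have "spinc_kernel n = {(cl_basis n {}, 1), (cl_neg n (cl_basis n {}), -1)}"
    by (simp add: spinc_kernel_def cl_neg_def)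
  then show ?thesis
    using Spin_elements[OF assms]
    by (auto simp: spinc_class_def r_coset_def cl_mult_one_left cl_mult_neg_left)
qed

lemma carrier_SpinC: "carrier (SpinC n) = spinc_class n ` (carrier (Spin n) \<times> {z. cmod z = 1})"
  by (auto simp: SpinC_def Let_def FactGroup_def RCOSETS_def spinc_class_def DirProd_def)

lemma one_SpinC: "\<one>\<^bsub>SpinC n\<^esub> = spinc_class n (cl_basis n {}, 1)"
  by (simp add: spinc_class_eq[OF one_in_Spin] SpinC_def Let_def FactGroup_def spinc_kernel_def cl_neg_def)

lemma lsp_SpinC: "lsp (SpinC n) = quot_space (prod_space (lsp (Spin n)) (lsp U1)) (spinc_class n)"
  by (simp add: SpinC_def Let_def)

lemma points_SpinC: "points (lsp (SpinC n)) = carrier (SpinC n)"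
  by (simp add: lsp_SpinC carrier_SpinC points_Spin)

text \<open>The product is written as a two-element set because \<open>spinc_class_eq\<close> asks
  for a representative in Spin(n), and closure of Spin(n) under products is deduced from this very
  formula. Once that is known, \<open>mult_SpinC_class\<close> restates it with a class.\<close>

lemma mult_SpinC:
  assumes "g \<in> carrier (Spin n)" "h \<in> carrier (Spin n)"
  shows "spinc_class n (g, z) \<otimes>\<^bsub>SpinC n\<^esub> spinc_class n (h, w) =
    {(cl_mult n g h, z * w), (cl_neg n (cl_mult n g h), - (z * w))}"
  unfolding spinc_class_eq[OF assms(1)] spinc_class_eq[OF assms(2)]
  by (auto simp: SpinC_def Let_def FactGroup_def set_mult_def cl_mult_neg_left cl_mult_neg_right cl_neg_neg)

lemma spinc_class_in_SpinC: "g \<in> carrier (Spin n) \<Longrightarrow> cmod z = 1 \<Longrightarrow> spinc_class n (g, z) \<in> carrier (SpinC n)"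
  by (auto simp: carrier_SpinC)

lemma SpinC_cases:
  assumes "A \<in> carrier (SpinC n)"
  obtains g z where "g \<in> carrier (Spin n)" "cmod z = 1" "A = spinc_class n (g, z)"
  using assms by (auto simp: carrier_SpinC)

lemma spinc_class_neg: "g \<in> carrier (Spin n) \<Longrightarrow> spinc_class n (cl_neg n g, - z) = spinc_class n (g, z)"
  by (auto simp: spinc_class_eq cl_neg_Spin cl_neg_neg Spin_elements)

lemma kappa_SpinC_class:
  assumes "g \<in> carrier (Spin n)" "cmod z = 1"
  shows "kappa_SpinC n \<epsilon> \<gamma> (spinc_class n (g, z)) = spinc_class n (g, kappa_U1 \<epsilon> \<gamma> z)"
proof -
  have "kappa_U1 \<epsilon> \<gamma> (- z) = - kappa_U1 \<epsilon> \<gamma> z" using assms by (simp add: kappa_U1_def)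
  then have "(\<Union>(g, z)\<in>spinc_class n (g, z). spinc_class n (g, kappa_U1 \<epsilon> \<gamma> z)) = spinc_class n (g, kappa_U1 \<epsilon> \<gamma> z)"
    unfolding spinc_class_eq[OF assms(1), of z] using spinc_class_neg[OF assms(1), of "kappa_U1 \<epsilon> \<gamma> z"] by auto
  then show ?thesis using assms by (simp add: kappa_SpinC_def spinc_class_in_SpinC)
qed

text \<open>Well defined, since the two representatives of a class differ by a common sign.\<close>

definition spinc_scalar :: "(clifford \<times> complex) set \<Rightarrow> complex" where
  "spinc_scalar A = the_elem ((\<lambda>(g, z). of_real (g {}) * z) ` A)"

lemma spinc_scalar_class:
  "g \<in> carrier (Spin n) \<Longrightarrow> spinc_scalar (spinc_class n (g, z)) = of_real (g {}) * z"
  by (simp add: spinc_scalar_def spinc_class_eq cl_neg_apply)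

lemma central_U1_eq: "central_U1 n z = spinc_class n (cl_basis n {}, z)"
  by (simp add: central_U1_def)

lemma spinc_scalar_central: "spinc_scalar (central_U1 n z) = z"
  by (simp add: central_U1_eq spinc_scalar_class one_in_Spin) (simp add: cl_basis_def)

lemma central_U1_closed: "cmod z = 1 \<Longrightarrow> central_U1 n z \<in> carrier (SpinC n)"
  by (simp add: central_U1_eq spinc_class_in_SpinC one_in_Spin)

lemma central_U1_mult: "central_U1 n z \<otimes>\<^bsub>SpinC n\<^esub> central_U1 n w = central_U1 n (z * w)"
  using mult_SpinC[OF one_in_Spin one_in_Spin, of n z w]
  by (simp add: central_U1_eq cl_mult_one_left spinc_class_eq[OF one_in_Spin, of _ "z * w"])

lemma central_U1_one: "central_U1 n 1 = \<one>\<^bsub>SpinC n\<^esub>"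
  by (simp add: central_U1_eq one_SpinC)

lemma central_U1_commute:
  "A \<in> carrier (SpinC n) \<Longrightarrow> central_U1 n z \<otimes>\<^bsub>SpinC n\<^esub> A = A \<otimes>\<^bsub>SpinC n\<^esub> central_U1 n z"
  by (erule SpinC_cases) (simp add: central_U1_eq mult_SpinC one_in_Spin cl_mult_one_left cl_mult_one_right Spin_elements mult.commute)

lemma kappa_SpinC_central: "cmod z = 1 \<Longrightarrow> kappa_SpinC n \<epsilon> \<gamma> (central_U1 n z) = central_U1 n (kappa_U1 \<epsilon> \<gamma> z)"
  by (simp add: central_U1_eq kappa_SpinC_class one_in_Spin)

section \<open>Smooth maps into and out of Spin^c(n)\<close>

lemma smooth_map_spinc_class:
  assumes K: "smooth_space K" and "smooth_map K (lsp (Spin n)) g" "smooth_map K (lsp U1) z"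
  shows "smooth_map K (lsp (SpinC n)) (\<lambda>x. spinc_class n (g x, z x))"
  unfolding lsp_SpinC
  by (rule smooth_map_compose[OF smooth_map_pair[OF K assms(2,3)] smooth_map_quot])
    (intro smooth_space_functional smooth_space_prod_space smooth_space_Spin smooth_space_U1)

lemma smooth_map_central_U1:
  assumes K: "smooth_space K" and "smooth_map K (lsp U1) z"
  shows "smooth_map K (lsp (SpinC n)) (\<lambda>x. central_U1 n (z x))"
  unfolding central_U1_eq
  by (intro smooth_map_spinc_class K smooth_map_const smooth_space_functional assms)
    (simp add: points_Spin one_in_Spin)

text \<open>The scalar part of \<open>g\<close> times \<open>z\<close> is invariant under a common
  change of sign, so it descends to the quotient. Being defined on the whole group and left inverse
  to \<open>central_U1\<close>, it turns smooth maps with central values into smooth maps to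
  U(1).\<close>

lemma fsm_spinc_scalar:
  "fsm (lsp (SpinC n)) (points (lsp (SpinC n))) (\<lambda>A. Re (spinc_scalar A))"
  "fsm (lsp (SpinC n)) (points (lsp (SpinC n))) (\<lambda>A. Im (spinc_scalar A))"
proof -
  let ?P = "prod_space (lsp (Spin n)) (lsp U1)"
  note S = smooth_space_functional[OF smooth_space_Spin[of n]]
  note P = smooth_space_functional[OF smooth_space_prod_space[OF smooth_space_Spin[of n] smooth_space_U1]]
  have 1: "smooth_map ?P (lsp U1) snd" by (rule smooth_map_snd[OF smooth_space_functional[OF smooth_space_U1]])
  have "smooth_map ?P (euclidean_fspace (Pow {..<n})) fst"
    using smooth_map_compose_fst[OF smooth_space_Spin, of n "euclidean_fspace (Pow {..<n})" "\<lambda>x. x" "lsp U1"]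
      smooth_map_sub[OF smooth_space_functional[OF smooth_space_euclidean[of "Pow {..<n}"]], of "carrier (Spin n)"]
    by (simp add: lsp_Spin)
  from fsm_coord_compose[OF this, of "{}"]
  have 2: "fsm ?P (points ?P) (\<lambda>x. fst x {})" by simp
  have pre: "{x \<in> points ?P. spinc_class n x \<in> points (lsp (SpinC n))} = points ?P"
    by (auto simp: points_Spin points_SpinC spinc_class_in_SpinC)
  have op: "openin (quot_topology (ftop ?P) (spinc_class n)) (points (lsp (SpinC n)))"
    using openin_topspace[of "ftop (lsp (SpinC n))"] by (simp only: lsp_SpinC ftop_quot_space)
  have "fsm ?P (points ?P) (\<lambda>x. fst x {} * Re (snd x))" "fsm ?P (points ?P) (\<lambda>x. fst x {} * Im (snd x))"
    by (intro fspace_mult[OF P] 2 fsm_U1_compose[OF 1])+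
  note 3 = this
  have "fsm ?P (points ?P) ((\<lambda>A. Re (spinc_scalar A)) \<circ> spinc_class n)"
    by (rule fspace_cong[OF P 3(1)]) (auto simp: points_Spin spinc_scalar_class)
  moreover have "fsm ?P (points ?P) ((\<lambda>A. Im (spinc_scalar A)) \<circ> spinc_class n)"
    by (rule fspace_cong[OF P 3(2)]) (auto simp: points_Spin spinc_scalar_class)
  ultimately
  show "fsm (lsp (SpinC n)) (points (lsp (SpinC n))) (\<lambda>A. Re (spinc_scalar A))"
    "fsm (lsp (SpinC n)) (points (lsp (SpinC n))) (\<lambda>A. Im (spinc_scalar A))"
    using op pre by (simp_all only: lsp_SpinC) (simp_all add: quot_space_def)
qed

text \<open>The assumption is part of every \<open>spin_kappa_structure\<close>, through
  \<open>gamma_group\<close>. Closure of Spin(n) under products, its inverses and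
  \<open>cl_reverse\<close> as a left inverse are all derived from it.\<close>

locale spinc_group =
  fixes n :: nat
  assumes group_SpinC: "group (SpinC n)"
begin

text \<open>The product of \<open>[a, 1]\<close> and \<open>[b, 1]\<close> is some class
  \<open>[c, z]\<close> with \<open>c\<close> in Spin(n). Comparing the two-element sets shows that
  the product of \<open>a\<close> and \<open>b\<close> is \<open>c\<close> or its negative, and
  Spin(n) is closed under sign.\<close>

lemma Spin_mult_closed:
  assumes "a \<in> carrier (Spin n)" "b \<in> carrier (Spin n)"
  shows "cl_mult n a b \<in> carrier (Spin n)"
proof -
  interpret group "SpinC n" by (rule group_SpinC)
  have "spinc_class n (a, 1) \<otimes>\<^bsub>SpinC n\<^esub> spinc_class n (b, 1) \<in> carrier (SpinC n)"
    by (intro m_closed spinc_class_in_SpinC assms) auto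
  then obtain c z where c: "c \<in> carrier (Spin n)"
      "{(cl_mult n a b, 1 * 1), (cl_neg n (cl_mult n a b), - (1 * 1))} = spinc_class n (c, z)"
    unfolding mult_SpinC[OF assms] by (rule SpinC_cases)
  then have "cl_mult n a b = c \<or> cl_mult n a b = cl_neg n c"
    unfolding spinc_class_eq[OF c(1)] by (auto simp: doubleton_eq_iff)
  then show ?thesis using c(1) cl_neg_Spin by auto
qed

text \<open>The inverse of \<open>[a, 1]\<close> has a representative \<open>b\<close> for which
  \<open>b a\<close> is 1 or -1, so \<open>b\<close> or its negative inverts
  \<open>a\<close>.\<close>

lemma group_Spin: "group (Spin n)"
proof (rule groupI)
  fix a assume a: "a \<in> carrier (Spin n)"
  interpret group "SpinC n" by (rule group_SpinC)
  have A: "spinc_class n (a, 1) \<in> carrier (SpinC n)" using a by (intro spinc_class_in_SpinC) auto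
  obtain b z where b: "b \<in> carrier (Spin n)" "inv\<^bsub>SpinC n\<^esub> spinc_class n (a, 1) = spinc_class n (b, z)"
    using inv_closed[OF A] by (rule SpinC_cases)
  have "spinc_class n (b, z) \<otimes>\<^bsub>SpinC n\<^esub> spinc_class n (a, 1) = spinc_class n (cl_basis n {}, 1)"
    using l_inv[OF A] by (simp add: b(2) one_SpinC)
  then have "cl_mult n b a = cl_basis n {} \<or> cl_mult n b a = cl_neg n (cl_basis n {})"
    unfolding mult_SpinC[OF b(1) a] spinc_class_eq[OF one_in_Spin] by (auto simp: doubleton_eq_iff)
  then have "cl_mult n b a = cl_basis n {} \<or> cl_mult n (cl_neg n b) a = cl_basis n {}"
    by (auto simp: cl_mult_neg_left cl_neg_neg)
  then show "\<exists>y\<in>carrier (Spin n). y \<otimes>\<^bsub>Spin n\<^esub> a = \<one>\<^bsub>Spin n\<^esub>" using b(1) cl_neg_Spin by auto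
qed (auto simp: Spin_mult_closed one_in_Spin cl_mult_assoc cl_mult_one_left Spin_elements)

lemma inv_Spin:
  assumes a: "a \<in> carrier (Spin n)"
  shows "inv\<^bsub>Spin n\<^esub> a = cl_reverse n a"
proof -
  interpret group "Spin n" by (rule group_Spin)
  have "cl_mult n a (cl_reverse n a) = cl_basis n {}" using a by (simp add: carrier_Spin)
  then have "cl_mult n (cl_mult n (inv\<^bsub>Spin n\<^esub> a) a) (cl_reverse n a) = inv\<^bsub>Spin n\<^esub> a"
    using inv_closed[OF a] by (simp add: cl_mult_assoc cl_mult_one_right Spin_elements)
  then show ?thesis using l_inv[OF a] by (simp add: cl_mult_one_left)
qed

lemma Spin_rev_mult: "a \<in> carrier (Spin n) \<Longrightarrow> cl_mult n (cl_reverse n a) a = cl_basis n {}"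
  using group.l_inv[OF group_Spin, of a] by (simp add: inv_Spin)

lemma mult_SpinC_class:
  assumes "g \<in> carrier (Spin n)" "h \<in> carrier (Spin n)"
  shows "spinc_class n (g, z) \<otimes>\<^bsub>SpinC n\<^esub> spinc_class n (h, w) = spinc_class n (cl_mult n g h, z * w)"
  by (simp add: mult_SpinC[OF assms] spinc_class_eq[OF Spin_mult_closed[OF assms]])

lemma Ad_neg: "g \<in> carrier (Spin n) \<Longrightarrow> Ad n (cl_neg n g) = Ad n g"
  by (simp add: Ad_def inv_Spin cl_neg_Spin cl_reverse_neg cl_mult_neg_left cl_mult_neg_right cl_neg_neg)

lemma AdC_class: "g \<in> carrier (Spin n) \<Longrightarrow> AdC n (spinc_class n (g, z)) = Ad n g"
  by (simp add: AdC_def spinc_class_eq Ad_neg)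

lemma AdC_central: "AdC n (central_U1 n z) = Ad n (cl_basis n {})"
  by (simp add: central_U1_eq AdC_class one_in_Spin)

lemma Ad_entry:
  "g \<in> carrier (Spin n) \<Longrightarrow> i < n \<Longrightarrow> j < n \<Longrightarrow>
    Ad n g $$ (i, j) = cl_mult n (cl_mult n g (cl_basis n {j})) (cl_reverse n g) {i}"
  by (simp add: Ad_def inv_Spin)

end

definition cl_vec :: "nat \<Rightarrow> (nat \<Rightarrow> real) \<Rightarrow> clifford" where
  "cl_vec n f = (\<lambda>S\<in>Pow {..<n}. if card S = 1 then f (the_elem S) else 0)"

lemma cl_vec_elements [simp]: "cl_vec n f \<in> cl_elements n"
  by (simp add: cl_vec_def cl_elements_def)

lemma cl_basis_vector: "j < n \<Longrightarrow> cl_basis n {j} \<in> cl_vectors n"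
  by (auto simp: cl_vectors_def) (auto simp: cl_basis_def)

context spinc_group
begin

text \<open>The definition of Spin(n) keeps conjugates of vectors among the vectors, so the matrix
  \<open>Ad n g\<close>, which records only coefficients at singletons, loses nothing.\<close>

lemma Ad_vec:
  assumes g: "g \<in> carrier (Spin n)" and j: "j < n"
  shows "cl_mult n (cl_mult n g (cl_basis n {j})) (cl_reverse n g) = cl_vec n (\<lambda>i. Ad n g $$ (i, j))"
proof (rule cl_elements_eqI)
  have v: "cl_mult n (cl_mult n g (cl_basis n {j})) (cl_reverse n g) \<in> cl_vectors n"
    using g cl_basis_vector[OF j] by (simp add: carrier_Spin)
  fix U assume U: "U \<subseteq> {..<n}"
  show "cl_mult n (cl_mult n g (cl_basis n {j})) (cl_reverse n g) U = cl_vec n (\<lambda>i. Ad n g $$ (i, j)) U"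
  proof (cases "card U = 1")
    case True
    then obtain i where "U = {i}" by (auto simp: card_1_singleton_iff)
    then show ?thesis using U Ad_entry[OF g _ j, of i] by (simp add: cl_vec_def)
  next
    case False
    then show ?thesis using U v by (simp add: cl_vectors_def cl_vec_def)
  qed
qed auto

text \<open>An even element commuting with \<open>e\<^sub>j\<close> has no component containing \<open>j\<close>.\<close>

lemma Ad_kernel:
  assumes g: "g \<in> carrier (Spin n)" and id: "\<And>i j. i < n \<Longrightarrow> j < n \<Longrightarrow> Ad n g $$ (i, j) = (if i = j then 1 else 0)"
  shows "g = cl_basis n {} \<or> g = cl_neg n (cl_basis n {})"
proof -
  have ev: "g S = 0" if "S \<subseteq> {..<n}" "odd (card S)" for S using g that by (simp add: carrier_Spin cl_even_def)
  have zero: "g S = 0" if S: "S \<subseteq> {..<n}" "S \<noteq> {}" for S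
  proof (cases "odd (card S)")
    case False
    obtain j where j: "j \<in> S" using S by auto
    then have jn: "j < n" using S by auto
    have fin: "finite S" using S finite_subset by blast
    have "cl_mult n (cl_mult n g (cl_basis n {j})) (cl_reverse n g) = cl_basis n {j}"
      unfolding Ad_vec[OF g jn]
    proof (rule cl_elements_eqI)
      fix U assume U: "U \<subseteq> {..<n}"
      show "cl_vec n (\<lambda>i. Ad n g $$ (i, j)) U = cl_basis n {j} U"
      proof (cases "card U = 1")
        case True
        then obtain i where "U = {i}" by (auto simp: card_1_singleton_iff)
        then show ?thesis using U id[OF _ jn, of i] by (auto simp: cl_vec_def cl_basis_def)
      next
        case False
        then show ?thesis using U by (auto simp: cl_vec_def cl_basis_def)
      qed
    qed auto
    \<comment> \<open>Multiplying by \<open>g\<close> on the right turns the conjugation into the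
      statement that \<open>g\<close> commutes with \<open>e\<^sub>j\<close>.\<close>
    then have "cl_mult n (cl_mult n (cl_mult n g (cl_basis n {j})) (cl_reverse n g)) g = cl_mult n (cl_basis n {j}) g" by simp
    then have "cl_mult n g (cl_basis n {j}) = cl_mult n (cl_basis n {j}) g"
      using Spin_rev_mult[OF g] by (simp add: cl_mult_assoc cl_mult_one_right)
    \<comment> \<open>The coefficient at \<open>sym_diff S {j}\<close> is the one to which
      \<open>g S\<close> contributes, on both sides.\<close>
    then have 1: "cl_mult n g (cl_basis n {j}) (sym_diff S {j}) = cl_mult n (cl_basis n {j}) g (sym_diff S {j})" by simp
    have 2: "sym_diff (sym_diff S {j}) {j} = S" "sym_diff {j} (sym_diff S {j}) = S" by blast+
    have 3: "{j} \<subseteq> {..<n}" "sym_diff S {j} \<subseteq> {..<n}" using S jn by auto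
    have "cl_sign S {j} * g S = cl_sign {j} S * g S"
      using 1 unfolding cl_mult_basis_left[OF 3] cl_mult_basis_right[OF 3] 2 .
    then have "cl_sign S {j} * cl_sign {j} S * g S = (cl_sign {j} S * cl_sign {j} S) * g S"
      by (metis mult.assoc mult.commute)
    \<comment> \<open>\<open>S\<close> is even and contains \<open>j\<close>, so the two signs are
      opposite and \<open>g S\<close> equals its own negative.\<close>
    then show ?thesis using cl_sign_commute_singleton[OF fin, of j] j False by (simp add: cl_sign_square)
  qed (use ev S in simp)
  have g0: "g = (\<lambda>S\<in>Pow {..<n}. if S = {} then g {} else 0)"
    by (rule cl_elements_eqI[of _ n]) (use zero Spin_elements[OF g] in \<open>auto simp: cl_elements_def\<close>)
  \<comment> \<open>Only the scalar part of \<open>g\<close> is left, and \<open>g\<close> times its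
    reversal is 1, so this scalar has square 1.\<close>
  have "cl_mult n g (cl_reverse n g) {} = (\<Sum>S\<in>Pow {..<n}. if S = {} then g {} * g {} else 0)"
    unfolding cl_mult_apply[of "{}" n, OF empty_subsetI]
    by (rule sum.cong) (auto simp: zero cl_reverse_def)
  then have "g {} * g {} = 1" using g by (simp add: carrier_Spin) (simp add: cl_basis_def)
  then have "g {} = 1 \<or> g {} = -1" by (simp add: square_eq_1_iff)
  then show ?thesis
  proof
    assume "g {} = 1"
    then have "g = cl_basis n {}" by (subst g0) (auto simp: cl_basis_def fun_eq_iff)
    then show ?thesis ..
  next
    assume "g {} = -1"
    then have "g = cl_neg n (cl_basis n {})"
      by (subst g0) (auto simp: cl_basis_def cl_neg_def fun_eq_iff)
    then show ?thesis ..
  qed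
qed

text \<open>The sign left open by \<open>Ad_kernel\<close> is absorbed into the U(1) factor, as
  \<open>[-1, z]\<close> and \<open>[1, -z]\<close> are the same class.\<close>

lemma AdC_kernel:
  assumes A: "A \<in> carrier (SpinC n)" and id: "\<And>i j. i < n \<Longrightarrow> j < n \<Longrightarrow> AdC n A $$ (i, j) = (if i = j then 1 else 0)"
  shows "cmod (spinc_scalar A) = 1 \<and> A = central_U1 n (spinc_scalar A)"
proof -
  obtain g z where g: "g \<in> carrier (Spin n)" "cmod z = 1" "A = spinc_class n (g, z)" using A by (rule SpinC_cases)
  have "g = cl_basis n {} \<or> g = cl_neg n (cl_basis n {})"
    using id by (intro Ad_kernel[OF g(1)]) (simp add: g(3) AdC_class g(1))
  then have "A = central_U1 n z \<or> A = central_U1 n (- z)"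
    using spinc_class_neg[OF one_in_Spin, of n "- z"] by (auto simp: g(3) central_U1_eq)
  then show ?thesis using g(2) by (auto simp: spinc_scalar_central)
qed

end

section \<open>Local lifting of rotations\<close>

text \<open>
  For \<open>A = Ad g\<close> with columns \<open>a\<^sub>j = g e\<^sub>j g\<^sup>-\<^sup>1\<close>, the operator \<open>y \<mapsto> (y - a\<^sub>j y e\<^sub>j)/2\<close> sends \<open>g w\<close> to
  \<open>g (w - e\<^sub>j w e\<^sub>j)/2\<close>, and \<open>w \<mapsto> (w - e\<^sub>j w e\<^sub>j)/2\<close> removes from an even \<open>w\<close> all components containing
  \<open>j\<close>. Starting from \<open>1 = g g\<^sup>-\<^sup>1\<close>, all these operators together give \<open>g\<close> times its scalar part.
\<close>

primrec lift_rot :: "nat \<Rightarrow> (nat \<Rightarrow> nat \<Rightarrow> real) \<Rightarrow> nat \<Rightarrow> clifford" where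
  "lift_rot n A 0 = cl_basis n {}"
| "lift_rot n A (Suc j) = (\<lambda>U\<in>Pow {..<n}.
     (lift_rot n A j U - cl_mult n (cl_mult n (cl_vec n (\<lambda>i. A i j)) (lift_rot n A j)) (cl_basis n {j}) U) / 2)"

context spinc_group
begin

lemma lift_rot_eq:
  assumes g: "g \<in> carrier (Spin n)" and A: "\<And>i j. i < n \<Longrightarrow> j < n \<Longrightarrow> A i j = Ad n g $$ (i, j)" and "k \<le> n"
  shows "lift_rot n A k = cl_mult n g (\<lambda>U\<in>Pow {..<n}. if U \<inter> {..<k} = {} then cl_reverse n g U else 0)"
  using \<open>k \<le> n\<close>
proof (induction k)
  case 0
  have "(\<lambda>U\<in>Pow {..<n}. if U \<inter> {..<0} = {} then cl_reverse n g U else 0) = cl_reverse n g"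
    by (auto simp: cl_reverse_def fun_eq_iff)
  then show ?case using g by (simp add: carrier_Spin)
next
  case (Suc j)
  then have j: "j < n" by simp
  define w where "w = (\<lambda>U\<in>Pow {..<n}. if U \<inter> {..<j} = {} then cl_reverse n g U else 0)"
  define w' where "w' = (\<lambda>U\<in>Pow {..<n}. if U \<inter> {..<Suc j} = {} then cl_reverse n g U else 0)"
  have w: "w \<in> cl_elements n" "w' \<in> cl_elements n" by (auto simp: w_def w'_def cl_elements_def)
  \<comment> \<open>Odd components vanish, so the commutation sign with \<open>e\<^sub>j\<close>
    matters on even sets only.\<close>
  have wodd: "w U = 0" if "U \<subseteq> {..<n}" "odd (card U)" for U
    using g that by (auto simp: w_def cl_reverse_def carrier_Spin cl_even_def)
  have "cl_vec n (\<lambda>i. A i j) = cl_mult n (cl_mult n g (cl_basis n {j})) (cl_reverse n g)"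
    unfolding Ad_vec[OF g j]
    by (rule cl_elements_eqI[of _ n]) (use A[OF _ j] in \<open>auto simp: cl_vec_def cl_elements_def card_1_singleton_iff\<close>)
  \<comment> \<open>With \<open>g e\<^sub>j g\<^sup>-\<^sup>1\<close> multiplied onto
    \<open>g w\<close> from the left, the inner factors \<open>g\<^sup>-\<^sup>1 g\<close>
    cancel.\<close>
  then have conj: "cl_mult n (cl_mult n (cl_vec n (\<lambda>i. A i j)) (cl_mult n g w)) (cl_basis n {j})
      = cl_mult n g (cl_mult n (cl_mult n (cl_basis n {j}) w) (cl_basis n {j}))"
    using Spin_rev_mult[OF g] w
    by (simp add: cl_mult_assoc) (simp add: cl_mult_one_left flip: cl_mult_assoc[of n "cl_reverse n g" g])
  have proj: "(w U - cl_mult n (cl_mult n (cl_basis n {j}) w) (cl_basis n {j}) U) / 2 = w' U" if U: "U \<subseteq> {..<n}" for U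
  proof -
    have fin: "finite U" using U finite_subset by blast
    have Uj: "sym_diff U {j} \<subseteq> {..<n}" using U j by auto
    have inv: "sym_diff {j} (sym_diff U {j}) = U" by blast
    have "cl_mult n (cl_mult n (cl_basis n {j}) w) (cl_basis n {j}) U
        = cl_sign (sym_diff U {j}) {j} * (cl_sign {j} U * w U)"
      using cl_mult_basis_right[of "{j}" n U "cl_mult n (cl_basis n {j}) w"]
        cl_mult_basis_left[of "{j}" n "sym_diff U {j}" w, OF _ Uj, unfolded inv] j U by simp
    also have "cl_sign (sym_diff U {j}) {j} = cl_sign U {j} * cl_sign {j} {j}"
      using fin by (intro cl_sign_sym_diff_left) auto
    also have "cl_sign {j} {j} = -1" by (simp add: cl_sign_eq_prod)
    also have "cl_sign U {j} * - 1 * (cl_sign {j} U * w U) = - (cl_sign U {j} * cl_sign {j} U) * w U" by simp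
    finally have eq: "cl_mult n (cl_mult n (cl_basis n {j}) w) (cl_basis n {j}) U = - (cl_sign U {j} * cl_sign {j} U) * w U" .
    \<comment> \<open>For even \<open>U\<close> the coefficient of
      \<open>e\<^sub>j w e\<^sub>j\<close> at \<open>U\<close> is \<open>w U\<close> if
      \<open>j \<in> U\<close> and \<open>- w U\<close> otherwise, so half the difference is 0 or
      \<open>w U\<close>.\<close>
    show ?thesis
    proof (cases "odd (card U)")
      case True
      then have "w U = 0" using wodd U by simp
      moreover have "w' U = 0" using U \<open>w U = 0\<close> by (auto simp: w_def w'_def lessThan_Suc split: if_splits)
      ultimately show ?thesis unfolding eq by simp
    next
      case False
      then show ?thesis unfolding eq cl_sign_commute_singleton[OF fin]
        using U by (auto simp: w_def w'_def lessThan_Suc)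
    qed
  qed
  have IH: "lift_rot n A j = cl_mult n g w" unfolding w_def by (rule Suc.IH) (use j in simp)
  have "lift_rot n A (Suc j) = cl_mult n g w'"
  proof (rule cl_elements_eqI)
    fix U assume U: "U \<subseteq> {..<n}"
    let ?z = "cl_mult n (cl_mult n (cl_basis n {j}) w) (cl_basis n {j})"
    have "lift_rot n A (Suc j) U = (cl_mult n g w U - cl_mult n g ?z U) / 2"
      using U by (simp add: IH conj)
    also have "\<dots> = (\<Sum>S\<in>Pow {..<n}. cl_sign S (sym_diff S U) * g S * ((w (sym_diff S U) - ?z (sym_diff S U)) / 2))"
      unfolding cl_mult_apply[OF U, of g] sum_subtractf[symmetric] sum_divide_distrib
      by (intro sum.cong refl) (simp add: algebra_simps diff_divide_distrib)
    also have "\<dots> = (\<Sum>S\<in>Pow {..<n}. cl_sign S (sym_diff S U) * g S * w' (sym_diff S U))"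
    proof (rule sum.cong[OF refl])
      fix S assume "S \<in> Pow {..<n}"
      then have "sym_diff S U \<subseteq> {..<n}" using U by auto
      from proj[OF this] show "cl_sign S (sym_diff S U) * g S * ((w (sym_diff S U) - ?z (sym_diff S U)) / 2) = cl_sign S (sym_diff S U) * g S * w' (sym_diff S U)" by simp
    qed
    finally show "lift_rot n A (Suc j) U = cl_mult n g w' U" by (simp only: cl_mult_apply[OF U])
  qed (simp add: cl_elements_def, simp)
  then show ?case unfolding w'_def .
qed

text \<open>Of the reversal of \<open>g\<close> only the component at the empty set avoids all
  indices. The result is the same for \<open>g\<close> and its negative, as it must be for a
  function of \<open>Ad n g\<close>, and its scalar part is the square of that of
  \<open>g\<close>.\<close>

lemma lift_rot_total:
  assumes g: "g \<in> carrier (Spin n)" and A: "\<And>i j. i < n \<Longrightarrow> j < n \<Longrightarrow> A i j = Ad n g $$ (i, j)" and U: "U \<subseteq> {..<n}"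
  shows "lift_rot n A n U = g {} * g U"
proof -
  let ?w = "\<lambda>U\<in>Pow {..<n}. if U \<inter> {..<n} = {} then cl_reverse n g U else 0"
  have "lift_rot n A n U = cl_mult n g ?w U"
    using lift_rot_eq[OF g A order_refl] by simp
  also have "\<dots> = (\<Sum>S\<in>Pow {..<n}. if S = U then g {} * g U else 0)"
    unfolding cl_mult_apply[OF U]
  proof (rule sum.cong[OF refl])
    fix S assume S: "S \<in> Pow {..<n}"
    have SU: "sym_diff S U \<in> Pow {..<n}" using S U by auto
    have "sym_diff S U \<inter> {..<n} = {} \<longleftrightarrow> S = U" using S U by blast
    then have "?w (sym_diff S U) = (if S = U then g {} else 0)"
      using SU by (auto simp: cl_reverse_def)
    then show "cl_sign S (sym_diff S U) * g S * ?w (sym_diff S U) = (if S = U then g {} * g U else 0)"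
      by (simp del: restrict_apply)
  qed
  finally show ?thesis using U by simp
qed

end

text \<open>Each coefficient of \<open>lift_rot\<close> is a polynomial in the matrix
  entries.\<close>

lemma fsm_lift_rot:
  assumes K: "smooth_space K" and W: "openin (ftop K) W"
    and A: "\<And>i j. i < n \<Longrightarrow> j < n \<Longrightarrow> fsm K W (\<lambda>x. A x i j)" and "k \<le> n" "U \<subseteq> {..<n}"
  shows "fsm K W (\<lambda>x. lift_rot n (A x) k U)"
  using \<open>k \<le> n\<close> \<open>U \<subseteq> {..<n}\<close>
proof (induction k arbitrary: U)
  case 0
  then show ?case by (simp add: fspace_const[OF smooth_space_functional[OF K] W])
next
  case (Suc k)
  note f = smooth_space_functional[OF K]
  have mult: "fsm K W (\<lambda>x. cl_mult n (a x) (b x) U)"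
    if "U \<subseteq> {..<n}" and ab: "\<And>S. S \<subseteq> {..<n} \<Longrightarrow> fsm K W (\<lambda>x. a x S)" "\<And>S. S \<subseteq> {..<n} \<Longrightarrow> fsm K W (\<lambda>x. b x S)" for a b U
    unfolding cl_mult_apply[OF that(1)]
    using that(1) by (intro fsm_sum K W fspace_mult[OF f] fspace_const[OF f W] ab) auto
  have "fsm K W (\<lambda>x. cl_vec n (\<lambda>i. A x i k) S)" if "S \<subseteq> {..<n}" for S
  proof (cases "card S = 1")
    case True
    then obtain i where "S = {i}" by (auto simp: card_1_singleton_iff)
    then show ?thesis using that A[of i k] Suc.prems by (simp add: cl_vec_def)
  qed (use that in \<open>simp add: cl_vec_def fspace_const[OF f W]\<close>)
  then have "fsm K W (\<lambda>x. cl_mult n (cl_mult n (cl_vec n (\<lambda>i. A x i k)) (lift_rot n (A x) k)) (cl_basis n {k}) U)"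
    using Suc by (intro mult) (auto intro: fspace_const[OF f W])
  then have "fsm K W (\<lambda>x. (1/2) * (lift_rot n (A x) k U - cl_mult n (cl_mult n (cl_vec n (\<lambda>i. A x i k)) (lift_rot n (A x) k)) (cl_basis n {k}) U))"
    using Suc by (intro fspace_mult[OF f] fspace_diff[OF f] fspace_const[OF f W]) auto
  then show ?case using Suc.prems by simp
qed

section \<open>Rotations in coordinate planes\<close>

text \<open>The element \<open>c + s e\<^sub>k e\<^sub>m\<close>, a lift to Spin(n) of a Givens
  rotation: for \<open>c = cos t\<close> and \<open>s = sin t\<close> it rotates the plane of
  \<open>e\<^sub>k\<close> and \<open>e\<^sub>m\<close> by the angle \<open>2 t\<close>.\<close>

definition givens :: "nat \<Rightarrow> nat \<Rightarrow> nat \<Rightarrow> real \<Rightarrow> real \<Rightarrow> clifford" where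
  "givens n k m c s = (\<lambda>U\<in>Pow {..<n}. if U = {} then c else if U = {k, m} then s else 0)"

lemma givens_mult_left:
  assumes p: "k < m" "m < n" and U: "U \<subseteq> {..<n}"
  shows "cl_mult n (givens n k m c s) x U = c * x U + s * cl_sign {k, m} (sym_diff {k, m} U) * x (sym_diff {k, m} U)"
proof -
  have "cl_mult n (givens n k m c s) x U
    = (\<Sum>S\<in>Pow {..<n}. (if S = {} then c * x U else 0) + (if S = {k, m} then s * cl_sign {k, m} (sym_diff {k, m} U) * x (sym_diff {k, m} U) else 0))"
    unfolding cl_mult_apply[OF U] by (rule sum.cong[OF refl]) (use p in \<open>auto simp: givens_def\<close>)
  then show ?thesis using p by (simp add: sum.distrib)
qed

lemma givens_mult_right:
  assumes p: "k < m" "m < n" and U: "U \<subseteq> {..<n}"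
  shows "cl_mult n x (givens n k m c s) U = c * x U + s * cl_sign (sym_diff U {k, m}) {k, m} * x (sym_diff U {k, m})"
proof -
  let ?p = "{k, m}"
  have pU: "sym_diff U ?p \<in> Pow {..<n}" "U \<in> Pow {..<n}" using p U by auto
  have ne: "U \<noteq> sym_diff U ?p" by auto
  have "cl_mult n x (givens n k m c s) U
    = (\<Sum>S\<in>Pow {..<n}. (if S = U then c * x U else 0) + (if S = sym_diff U ?p then s * cl_sign (sym_diff U ?p) ?p * x (sym_diff U ?p) else 0))"
    unfolding cl_mult_apply[OF U]
  proof (rule sum.cong[OF refl])
    fix S assume S: "S \<in> Pow {..<n}"
    have "sym_diff S U \<in> Pow {..<n}" using S U by auto
    moreover have "sym_diff S U = {} \<longleftrightarrow> S = U" by blast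
    moreover have "sym_diff S U = ?p \<longleftrightarrow> S = sym_diff U ?p" by blast
    ultimately have 1: "givens n k m c s (sym_diff S U) = (if S = U then c else if S = sym_diff U ?p then s else 0)"
      unfolding givens_def by (simp only: restrict_apply')
    have 2: "sym_diff (sym_diff U ?p) U = ?p" "sym_diff U U = {}" by blast+
    consider "S = U" | "S = sym_diff U ?p" | "S \<noteq> U" "S \<noteq> sym_diff U ?p" by blast
    then show "cl_sign S (sym_diff S U) * x S * givens n k m c s (sym_diff S U) =
        (if S = U then c * x U else 0) + (if S = sym_diff U ?p then s * cl_sign (sym_diff U ?p) ?p * x (sym_diff U ?p) else 0)"
    proof cases
      case 1
      then show ?thesis unfolding \<open>givens n k m c s (sym_diff S U) = _\<close> using ne by (simp add: 2)
    next
      case 2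
      then show ?thesis unfolding \<open>givens n k m c s (sym_diff S U) = _\<close> using ne \<open>sym_diff (sym_diff U ?p) U = ?p\<close> by simp
    qed (simp add: 1)
  qed
  then show ?thesis using pU by (simp add: sum.distrib)
qed

text \<open>A basis element \<open>e\<^sub>U\<close> commutes with
  \<open>e\<^sub>k e\<^sub>m\<close> if \<open>U\<close> contains none or both of the two indices
  and anticommutes if it contains one. In the first case conjugation multiplies by
  \<open>c\<^sup>2 + s\<^sup>2\<close>; in the second it mixes \<open>U\<close> with
  \<open>sym_diff U {k, m}\<close>, with the double-angle coefficients
  \<open>c\<^sup>2 - s\<^sup>2\<close> and \<open>2 c s\<close>.\<close>

lemma givens_conj:
  assumes p: "k < m" "m < n" and U: "U \<subseteq> {..<n}"
  shows "cl_mult n (cl_mult n (givens n k m c s) x) (givens n k m c (- s)) U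
    = (c * c + s * s * (-1) ^ card (U \<inter> {k, m})) * x U
      + c * s * cl_sign U {k, m} * (1 - (-1) ^ card (U \<inter> {k, m})) * x (sym_diff U {k, m})"
proof -
  let ?p = "{k, m}"
  have fin: "finite U" using U finite_subset by blast
  have pU: "sym_diff U ?p \<subseteq> {..<n}" using p U by auto
  have comm: "sym_diff ?p U = sym_diff U ?p" "sym_diff ?p (sym_diff U ?p) = U" by blast+
  have pp: "cl_sign ?p ?p = -1"
    using p by (simp add: cl_sign_eq_prod)
  have s1: "cl_sign (sym_diff U ?p) ?p = - cl_sign U ?p"
    using fin by (subst cl_sign_sym_diff_left) (auto simp: pp)
  have s2: "cl_sign ?p (sym_diff U ?p) = - cl_sign ?p U"
    using fin by (subst cl_sign_sym_diff_right) (auto simp: pp)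
  define q where "q = cl_sign U ?p * cl_sign ?p U"
  have q: "q = (-1) ^ card (U \<inter> ?p)"
  proof -
    have "q = (\<Prod>i\<in>U. \<Prod>j\<in>?p. if j = i then 1 else -1)"
      using fin by (simp add: q_def cl_sign_commute)
    also have "\<dots> = (\<Prod>i\<in>U. if i \<in> ?p then -1 else 1)"
      using p by (intro prod.cong refl) auto
    also have "\<dots> = (\<Prod>i\<in>{i \<in> U. i \<in> ?p}. -1)" using fin by (intro prod.inter_filter[symmetric])
    finally show ?thesis by (simp add: Int_def)
  qed
  have "cl_sign U ?p * q = (cl_sign U ?p * cl_sign U ?p) * cl_sign ?p U" by (simp only: q_def mult_ac)
  then have q2: "cl_sign U ?p * q = cl_sign ?p U" by (simp add: cl_sign_square)
  have "cl_mult n (cl_mult n (givens n k m c s) x) (givens n k m c (- s)) U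
     = c * (c * x U + s * (- cl_sign ?p U) * x (sym_diff U ?p))
       + (- s) * (- cl_sign U ?p) * (c * x (sym_diff U ?p) + s * cl_sign ?p U * x U)"
    unfolding givens_mult_right[OF p U] givens_mult_left[OF p U] givens_mult_left[OF p pU] comm s1 s2 ..
  also have "\<dots> = (c * c + s * s * q) * x U + c * s * (cl_sign U ?p - cl_sign U ?p * q) * x (sym_diff U ?p)"
    unfolding q2 unfolding q_def by (simp add: algebra_simps)
  finally show ?thesis by (simp add: q right_diff_distrib mult.assoc)
qed

lemma givens_reverse:
  assumes p: "k < m" "m < n"
  shows "cl_reverse n (givens n k m c s) = givens n k m c (- s)"
  using p by (auto simp: cl_reverse_def givens_def fun_eq_iff)

lemma givens_Spin:
  assumes p: "k < m" "m < n" and cs: "c * c + s * s = 1"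
  shows "givens n k m c s \<in> carrier (Spin n)"
proof -
  let ?p = "{k, m}"
  have el: "givens n k m c s \<in> cl_elements n" for c s by (simp add: givens_def cl_elements_def)
  have "givens n k m c s \<in> cl_even n"
    using el p by (auto simp: cl_even_def) (auto simp: givens_def)
  moreover have "cl_mult n (givens n k m c s) (givens n k m c (- s)) = cl_basis n {}"
  proof (rule cl_elements_eqI)
    fix U assume U: "U \<subseteq> {..<n}"
    have pU: "sym_diff U ?p \<subseteq> {..<n}" using p U by auto
    have e: "sym_diff U ?p = {} \<longleftrightarrow> U = ?p" by blast
    \<comment> \<open>The product with the reversal is read as the conjugate of 1, so that
      \<open>givens_conj\<close> covers it.\<close>
    have "cl_mult n (givens n k m c s) (givens n k m c (- s)) U
      = cl_mult n (cl_mult n (givens n k m c s) (cl_basis n {})) (givens n k m c (- s)) U"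
      by (simp add: cl_mult_one_right[OF el])
    also have "\<dots> = cl_basis n {} U"
    proof -
      have b: "cl_basis n {} U = (if U = {} then 1 else 0)" "cl_basis n {} (sym_diff U ?p) = (if U = ?p then 1 else 0)"
        unfolding e[symmetric] using U pU by (auto simp: cl_basis_def)
      show ?thesis unfolding givens_conj[OF p U] b using p cs by auto
    qed
    finally show "cl_mult n (givens n k m c s) (givens n k m c (- s)) U = cl_basis n {} U" .
  qed auto
  moreover have "cl_mult n (cl_mult n (givens n k m c s) v) (givens n k m c (- s)) \<in> cl_vectors n" if v: "v \<in> cl_vectors n" for v
  proof -
    have "cl_mult n (cl_mult n (givens n k m c s) v) (givens n k m c (- s)) U = 0" if U: "U \<subseteq> {..<n}" "card U \<noteq> 1" for U
    proof -
      have fin: "finite U" using U finite_subset by blast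
      have pU: "sym_diff U ?p \<subseteq> {..<n}" using p U by auto
      have vU: "v U = 0" using v U by (simp add: cl_vectors_def)
      \<comment> \<open>If \<open>U\<close> contains one of the two indices, then
        \<open>sym_diff U {k, m}\<close> has as many elements as \<open>U\<close> and both
        coefficients of \<open>v\<close> vanish; otherwise the second coefficient is multiplied by
        0.\<close>
      show ?thesis
      proof (cases "card (U \<inter> ?p) = 1")
        case True
        have "card U = card (U - ?p) + card (U \<inter> ?p)" using fin by (metis add.commute card_Int_Diff)
        moreover have "card ?p = card (?p - U) + card (U \<inter> ?p)" by (metis Int_commute add.commute card_Int_Diff finite.emptyI finite_insert)
        moreover have "card (sym_diff U ?p) = card (U - ?p) + card (?p - U)" using fin by (intro card_Un_disjoint) auto
        ultimately have "card (sym_diff U ?p) = card U" using True p by simp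
        then have "v (sym_diff U ?p) = 0" using v U pU unfolding cl_vectors_def by simp
        then show ?thesis unfolding givens_conj[OF p U(1)] vU by simp
      next
        case False
        have "card (U \<inter> ?p) \<le> card ?p" by (intro card_mono) auto
        then have "card (U \<inter> ?p) = 0 \<or> card (U \<inter> ?p) = 2" proof -
          have "card ?p = 2" using p by simp
          then show ?thesis using False \<open>card (U \<inter> ?p) \<le> card ?p\<close> by linarith
        qed
        then have "even (card (U \<inter> ?p))" by presburger
        then show ?thesis unfolding givens_conj[OF p U(1)] vU by simp
      qed
    qed
    then show ?thesis unfolding cl_vectors_def by simp
  qed
  ultimately show ?thesis by (simp add: carrier_Spin givens_reverse[OF p])
qed

lemma (in spinc_group) Ad_givens:
  assumes p: "k < m" "m < n" and cs: "c * c + s * s = 1" and ij: "i < n" "j < n"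
  shows "Ad n (givens n k m c s) $$ (i, j) =
    (if i = k then if j = k then c * c - s * s else if j = m then - (2 * c * s) else 0
     else if i = m then if j = m then c * c - s * s else if j = k then 2 * c * s else 0
     else if i = j then 1 else 0)"
proof -
  let ?p = "{k, m}"
  have U: "{i} \<subseteq> {..<n}" "sym_diff {i} ?p \<in> Pow {..<n}" using ij p by auto
  have b: "cl_basis n {j} {i} = (if i = j then 1 else 0)"
    "cl_basis n {j} (sym_diff {i} ?p) = (if sym_diff {i} ?p = {j} then 1 else 0)"
    using U ij by (auto simp: cl_basis_def)
  have "Ad n (givens n k m c s) $$ (i, j) = (c * c + s * s * (-1) ^ card ({i} \<inter> ?p)) * (if i = j then 1 else 0)
      + c * s * cl_sign {i} ?p * (1 - (-1) ^ card ({i} \<inter> ?p)) * (if sym_diff {i} ?p = {j} then 1 else 0)"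
    unfolding Ad_entry[OF givens_Spin[OF p cs] ij] givens_reverse[OF p] givens_conj[OF p U(1)] b ..
  moreover have "sym_diff {k} ?p = {m}" "sym_diff {m} ?p = {k}" using p by auto
  moreover have "cl_sign {k} ?p = -1" "cl_sign {m} ?p = 1" using p by (auto simp: cl_sign_eq_prod)
  ultimately show ?thesis using p cs by auto
qed

section \<open>Principal bundles\<close>

lemma smooth_space_lie: "lie_group G \<Longrightarrow> smooth_space (lsp G)"
  by (simp add: lie_group_def smooth_manifold_smooth_space)

lemma smooth_map_lie_mult:
  assumes K: "smooth_space K" and G: "lie_group G" and "smooth_map K (lsp G) f" "smooth_map K (lsp G) g"
  shows "smooth_map K (lsp G) (\<lambda>x. f x \<otimes>\<^bsub>G\<^esub> g x)"
proof -
  have "smooth_map (prod_space (lsp G) (lsp G)) (lsp G) (\<lambda>(a, b). a \<otimes>\<^bsub>G\<^esub> b)"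
    using G by (simp add: lie_group_def)
  from smooth_map_compose[OF smooth_map_pair[OF K assms(3,4)] this] show ?thesis by simp
qed

lemma smooth_map_lie_inv:
  assumes G: "lie_group G" and "smooth_map K (lsp G) f"
  shows "smooth_map K (lsp G) (\<lambda>x. inv\<^bsub>G\<^esub> (f x))"
  by (rule smooth_map_compose[OF assms(2)]) (use G in \<open>simp add: lie_group_def\<close>)

locale principal =
  fixes X :: "'x fspace" and G :: "'g lie" and P :: "('c, 'x, 'g, 'p) pbundle"
  assumes prin: "principal_bundle X G P" and lie: "lie_group G" and base: "smooth_space X"
begin

lemma group_G: "group G" using lie by (simp add: lie_group_def)

lemma points_G: "points (lsp G) = carrier G" using lie by (simp add: lie_group_def)

lemma smooth_G: "smooth_space (lsp G)" by (rule smooth_space_lie[OF lie])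

lemma smooth_P: "smooth_space (tot P)"
  using prin by (simp add: principal_bundle_def smooth_manifold_smooth_space)

lemma smooth_proj: "smooth_map (tot P) X (proj P)"
  using prin by (simp add: principal_bundle_def)

lemma proj_closed: "p \<in> points (tot P) \<Longrightarrow> proj P p \<in> points X"
  by (rule smooth_map_image[OF smooth_proj])

lemma ract_smooth: "smooth_map (prod_space (tot P) (lsp G)) (tot P) (\<lambda>(p, g). ract P p g)"
  using prin by (simp add: principal_bundle_def)

lemma ract_closed: "p \<in> points (tot P) \<Longrightarrow> g \<in> carrier G \<Longrightarrow> ract P p g \<in> points (tot P)"
  using smooth_map_image[OF ract_smooth, of "(p, g)"] by (simp add: points_G)

lemma smooth_map_ract:
  assumes K: "smooth_space K" and "smooth_map K (tot P) f" "smooth_map K (lsp G) g"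
  shows "smooth_map K (tot P) (\<lambda>x. ract P (f x) (g x))"
  using smooth_map_compose[OF smooth_map_pair[OF K assms(2,3)] ract_smooth] by simp

lemma ract_one: "p \<in> points (tot P) \<Longrightarrow> ract P p \<one>\<^bsub>G\<^esub> = p"
  using prin by (simp add: principal_bundle_def)

lemma ract_mult:
  "p \<in> points (tot P) \<Longrightarrow> g \<in> carrier G \<Longrightarrow> h \<in> carrier G \<Longrightarrow> ract P (ract P p g) h = ract P p (g \<otimes>\<^bsub>G\<^esub> h)"
  using prin by (simp add: principal_bundle_def)

lemma proj_ract: "p \<in> points (tot P) \<Longrightarrow> g \<in> carrier G \<Longrightarrow> proj P (ract P p g) = proj P p"
  using prin by (simp add: principal_bundle_def)

text \<open>A local trivialisation together with its inverse \<open>\<tau>\<close>, which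
  \<open>diffeo\<close> hides behind an existential quantifier.\<close>

definition triv :: "'x set \<Rightarrow> ('p \<Rightarrow> 'x \<times> 'g) \<Rightarrow> ('x \<times> 'g \<Rightarrow> 'p) \<Rightarrow> bool" where
  "triv U \<psi> \<tau> \<longleftrightarrow> openin (ftop X) U \<and>
    smooth_map (sub_space (tot P) {p \<in> points (tot P). proj P p \<in> U}) (prod_space (sub_space X U) (lsp G)) \<psi> \<and>
    smooth_map (prod_space (sub_space X U) (lsp G)) (sub_space (tot P) {p \<in> points (tot P). proj P p \<in> U}) \<tau> \<and>
    (\<forall>p\<in>points (tot P). proj P p \<in> U \<longrightarrow> \<tau> (\<psi> p) = p \<and> fst (\<psi> p) = proj P p \<and> snd (\<psi> p) \<in> carrier G \<and>
      (\<forall>g\<in>carrier G. \<psi> (ract P p g) = (proj P p, snd (\<psi> p) \<otimes>\<^bsub>G\<^esub> g))) \<and>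
    (\<forall>y\<in>U. \<forall>g\<in>carrier G. \<psi> (\<tau> (y, g)) = (y, g) \<and> \<tau> (y, g) \<in> points (tot P) \<and> proj P (\<tau> (y, g)) = y)"

lemma
  assumes "triv U \<psi> \<tau>"
  shows trivD: "openin (ftop X) U"
    "smooth_map (sub_space (tot P) {p \<in> points (tot P). proj P p \<in> U}) (prod_space (sub_space X U) (lsp G)) \<psi>"
    "smooth_map (prod_space (sub_space X U) (lsp G)) (sub_space (tot P) {p \<in> points (tot P). proj P p \<in> U}) \<tau>"
    "\<And>p. p \<in> points (tot P) \<Longrightarrow> proj P p \<in> U \<Longrightarrow> \<tau> (\<psi> p) = p"
    "\<And>y g. y \<in> U \<Longrightarrow> g \<in> carrier G \<Longrightarrow> \<psi> (\<tau> (y, g)) = (y, g)"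
    "\<And>p. p \<in> points (tot P) \<Longrightarrow> proj P p \<in> U \<Longrightarrow> fst (\<psi> p) = proj P p \<and> snd (\<psi> p) \<in> carrier G"
    "\<And>p g. p \<in> points (tot P) \<Longrightarrow> proj P p \<in> U \<Longrightarrow> g \<in> carrier G \<Longrightarrow> \<psi> (ract P p g) = (proj P p, snd (\<psi> p) \<otimes>\<^bsub>G\<^esub> g)"
    "\<And>y g. y \<in> U \<Longrightarrow> g \<in> carrier G \<Longrightarrow> \<tau> (y, g) \<in> points (tot P) \<and> proj P (\<tau> (y, g)) = y"
  using assms by (simp_all add: triv_def)

lemma local_triv:
  assumes "x \<in> points X"
  shows "\<exists>U \<psi> \<tau>. x \<in> U \<and> triv U \<psi> \<tau>"
proof -
  obtain U \<psi> where U: "openin (ftop X) U" "x \<in> U"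
    and d: "diffeo (sub_space (tot P) {p \<in> points (tot P). proj P p \<in> U}) (prod_space (sub_space X U) (lsp G)) \<psi>"
    and t: "\<forall>p\<in>points (tot P). proj P p \<in> U \<longrightarrow> fst (\<psi> p) = proj P p \<and>
           (\<forall>g\<in>carrier G. \<psi> (ract P p g) = (proj P p, snd (\<psi> p) \<otimes>\<^bsub>G\<^esub> g))"
    using prin assms unfolding principal_bundle_def by meson
  let ?PU = "{p \<in> points (tot P). proj P p \<in> U}"
  have UX: "U \<subseteq> points X" using U(1) openin_subset by blast
  obtain \<tau> where s: "smooth_map (sub_space (tot P) ?PU) (prod_space (sub_space X U) (lsp G)) \<psi>"
      "smooth_map (prod_space (sub_space X U) (lsp G)) (sub_space (tot P) ?PU) \<tau>"
    and inv: "\<And>p. p \<in> points (sub_space (tot P) ?PU) \<Longrightarrow> \<tau> (\<psi> p) = p"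
      "\<And>z. z \<in> points (prod_space (sub_space X U) (lsp G)) \<Longrightarrow> \<psi> (\<tau> z) = z"
    using d unfolding diffeo_def by blast
  have c: "\<psi> (\<tau> (y, g)) = (y, g) \<and> \<tau> (y, g) \<in> points (tot P) \<and> proj P (\<tau> (y, g)) = y" if "y \<in> U" "g \<in> carrier G" for y g
  proof -
    have z: "(y, g) \<in> points (prod_space (sub_space X U) (lsp G))" using that UX by (auto simp: points_G)
    from smooth_map_image[OF s(2) z] have 1: "\<tau> (y, g) \<in> points (tot P)" "proj P (\<tau> (y, g)) \<in> U" by auto
    then show ?thesis using inv(2)[OF z] t by (metis fst_conv)
  qed
  have "snd (\<psi> p) \<in> carrier G" if "p \<in> points (tot P)" "proj P p \<in> U" for p
    using smooth_map_image[OF s(1), of p] that by (auto simp: points_G mem_Times_iff)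
  then show ?thesis using U s inv(1) c t unfolding triv_def by (intro exI[of _ U] exI[of _ \<psi>] exI[of _ \<tau>]) simp
qed

text \<open>In a local trivialisation the condition becomes an equation in the group, which has
  exactly one solution.\<close>

lemma fibre_ex1:
  assumes p: "p \<in> points (tot P)" and q: "q \<in> points (tot P)" and eq: "proj P p = proj P q"
  shows "\<exists>!g. g \<in> carrier G \<and> ract P p g = q"
proof -
  interpret group G by (rule group_G)
  obtain U \<psi> \<tau> where xU: "proj P p \<in> U" and tr: "triv U \<psi> \<tau>" using local_triv[OF proj_closed[OF p]] by blast
  note loc = xU trivD[OF tr]
  note U = loc(1,5,7,8)
  have a: "snd (\<psi> p) \<in> carrier G" "snd (\<psi> q) \<in> carrier G" using U p q eq by auto
  have iff: "ract P p g = q \<longleftrightarrow> snd (\<psi> p) \<otimes>\<^bsub>G\<^esub> g = snd (\<psi> q)" if g: "g \<in> carrier G" for g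
  proof -
    have "ract P p g = q \<longleftrightarrow> \<psi> (ract P p g) = \<psi> q"
      using U(2)[of "ract P p g"] U(2)[of q] U(1) eq p q g by (metis proj_ract ract_closed)
    also have "\<dots> \<longleftrightarrow> snd (\<psi> p) \<otimes>\<^bsub>G\<^esub> g = snd (\<psi> q)"
      using U(4)[OF p U(1) g] U(3)[OF q] U(1) eq by (auto simp: prod_eq_iff)
    finally show ?thesis .
  qed
  have "snd (\<psi> p) \<otimes>\<^bsub>G\<^esub> (inv\<^bsub>G\<^esub> snd (\<psi> p) \<otimes>\<^bsub>G\<^esub> snd (\<psi> q)) = snd (\<psi> q)"
    using a by (simp add: m_assoc[symmetric])
  then show ?thesis
    using a iff by (metis (no_types, lifting) inv_closed inv_solve_left m_closed)
qed

definition pdiv :: "'p \<Rightarrow> 'p \<Rightarrow> 'g" where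
  "pdiv p q = (THE g. g \<in> carrier G \<and> ract P p g = q)"

lemma pdiv:
  assumes "p \<in> points (tot P)" "q \<in> points (tot P)" "proj P p = proj P q"
  shows "pdiv p q \<in> carrier G" "ract P p (pdiv p q) = q"
  using theI'[OF fibre_ex1[OF assms]] by (simp_all add: pdiv_def)

lemma pdiv_unique:
  assumes "p \<in> points (tot P)" "g \<in> carrier G"
  shows "pdiv p (ract P p g) = g"
  unfolding pdiv_def using fibre_ex1[of p "ract P p g"] assms
  by (intro the1_equality) (auto simp: ract_closed proj_ract)

lemma pdiv_ract_right:
  assumes "p \<in> points (tot P)" "q \<in> points (tot P)" "proj P p = proj P q" "g \<in> carrier G"
  shows "pdiv p (ract P q g) = pdiv p q \<otimes>\<^bsub>G\<^esub> g"
  by (metis assms group.is_monoid group_G monoid.m_closed pdiv pdiv_unique ract_mult)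

text \<open>In a local trivialisation this translation function of the bundle is the inverse of the
  group component of \<open>f x\<close> times that of \<open>g x\<close>, hence smooth in a Lie
  group.\<close>

lemma smooth_map_pdiv:
  assumes K: "smooth_space K" and f: "smooth_map K (tot P) f" and g: "smooth_map K (tot P) g"
    and eq: "\<And>x. x \<in> points K \<Longrightarrow> proj P (f x) = proj P (g x)"
  shows "smooth_map K (lsp G) (\<lambda>x. pdiv (f x) (g x))"
proof (rule smooth_map_local[OF smooth_space_functional[OF K]])
  interpret group G by (rule group_G)
  fix x assume x: "x \<in> points K"
  have fx: "proj P (f x) \<in> points X" using smooth_map_image[OF f x] by (rule proj_closed)
  obtain U \<psi> \<tau> where xU: "proj P (f x) \<in> U" and tr: "triv U \<psi> \<tau>" using local_triv[OF fx] by blast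
  note loc = xU trivD[OF tr]
  note U = loc(2,1) and \<psi> = loc(3) and t = loc(7,8)
  let ?PU = "{p \<in> points (tot P). proj P p \<in> U}"
  let ?W = "{y \<in> points K. proj P (f y) \<in> U}"
  let ?K = "sub_space K ?W"
  note sK = smooth_space_sub[OF K, of ?W]
  have W: "openin (ftop K) ?W"
    by (rule smooth_map_preimage_open[OF smooth_map_compose[OF f smooth_proj] U(1)])
  have sub: "smooth_map ?K (lsp G) (\<lambda>y. snd (\<psi> (h y)))"
    if h: "smooth_map K (tot P) h" and hW: "\<And>y. y \<in> ?W \<Longrightarrow> proj P (h y) \<in> U" for h
  proof -
    have "smooth_map ?K (sub_space (tot P) ?PU) h"
      by (rule smooth_map_sub_sub[OF K smooth_space_functional[OF smooth_P] h])
        (use hW smooth_map_image[OF h] in auto)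
    from smooth_map_compose[OF this \<psi>]
    show ?thesis by (rule smooth_map_compose[OF _ smooth_map_snd[OF smooth_space_functional[OF smooth_G]]])
  qed
  have "smooth_map ?K (lsp G) (\<lambda>y. inv\<^bsub>G\<^esub> snd (\<psi> (f y)) \<otimes>\<^bsub>G\<^esub> snd (\<psi> (g y)))"
    by (intro smooth_map_lie_mult smooth_map_lie_inv sK lie sub f g) (use eq in auto)
  then have "smooth_map ?K (lsp G) (\<lambda>y. pdiv (f y) (g y))"
  proof (rule smooth_map_cong[OF smooth_space_functional[OF sK]])
    fix y assume "y \<in> points ?K"
    then have y: "y \<in> points K" "proj P (f y) \<in> U" by auto
    note p = smooth_map_image[OF f y(1)] smooth_map_image[OF g y(1)] eq[OF y(1)]
    have "\<psi> (g y) = (proj P (f y), snd (\<psi> (f y)) \<otimes>\<^bsub>G\<^esub> pdiv (f y) (g y))"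
      using t(2)[OF p(1) y(2) pdiv(1)[OF p]] pdiv(2)[OF p] by simp
    then have "snd (\<psi> (g y)) = snd (\<psi> (f y)) \<otimes>\<^bsub>G\<^esub> pdiv (f y) (g y)" by simp
    then show "pdiv (f y) (g y) = inv\<^bsub>G\<^esub> snd (\<psi> (f y)) \<otimes>\<^bsub>G\<^esub> snd (\<psi> (g y))"
      using t(1)[OF p(1) y(2)] pdiv(1)[OF p] by (simp add: m_assoc[symmetric])
  qed
  then show "\<exists>U. openin (ftop K) U \<and> x \<in> U \<and> smooth_map (sub_space K U) (lsp G) (\<lambda>x. pdiv (f x) (g x))"
    using W x U(2) by blast
qed

lemma local_section:
  assumes "x \<in> points X"
  shows "\<exists>U s. openin (ftop X) U \<and> x \<in> U \<and> smooth_map (sub_space X U) (tot P) s \<and>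
    (\<forall>y\<in>U. s y \<in> points (tot P) \<and> proj P (s y) = y)"
proof -
  interpret group G by (rule group_G)
  obtain U \<psi> \<tau> where xU: "x \<in> U" and tr: "triv U \<psi> \<tau>" using local_triv[OF assms] by blast
  note loc = xU trivD[OF tr]
  note U = loc(2,1) and \<tau> = loc(4) and t = loc(9)
  note sU = smooth_space_sub[OF base, of U]
  have "smooth_map (sub_space X U) (prod_space (sub_space X U) (lsp G)) (\<lambda>y. (y, \<one>\<^bsub>G\<^esub>))"
    by (rule smooth_map_pair[OF sU smooth_map_id smooth_map_const])
      (simp_all add: smooth_space_functional[OF sU] points_G)
  from smooth_map_compose[OF smooth_map_compose[OF this \<tau>] smooth_map_sub[OF smooth_space_functional[OF smooth_P]]]
  have "smooth_map (sub_space X U) (tot P) (\<lambda>y. \<tau> (y, \<one>\<^bsub>G\<^esub>))" .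
  then show ?thesis using U t by (intro exI[of _ U] exI[of _ "\<lambda>y. \<tau> (y, \<one>\<^bsub>G\<^esub>)"]) simp
qed

end

lemma semi_equivariant_bundle_principal:
  assumes "semi_equivariant_bundle \<Gamma> X \<rho> G \<theta> P" "smooth_space X"
  shows "principal X G P"
  using assms by (simp add: principal_def semi_equivariant_bundle_def gamma_group_def)

section \<open>Transport of bundle structures\<close>

lemma smooth_manifold_diffeo:
  assumes M: "smooth_manifold M" and N: "smooth_space N" and f: "diffeo M N f"
  shows "smooth_manifold N"
proof -
  obtain g where g: "smooth_map M N f" "smooth_map N M g" "\<And>x. x \<in> points M \<Longrightarrow> g (f x) = x" "\<And>y. y \<in> points N \<Longrightarrow> f (g y) = y"
    using f unfolding diffeo_def by blast
  have "ftop M homeomorphic_space ftop N"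
    unfolding homeomorphic_space_def homeomorphic_maps_def
    by (intro exI[of _ f] exI[of _ g] conjI smooth_map_continuous g ballI)
  moreover have "diffeomorphic N M" by (rule diffeomorphic_sym) (use f in \<open>auto simp: diffeomorphic_def\<close>)
  ultimately show ?thesis
    using M charted_diffeomorphic[OF N smooth_manifold_smooth_space[OF M]] smooth_space_functional[OF N]
      homeomorphic_Hausdorff_space homeomorphic_space_second_countability
    unfolding smooth_manifold_iff by blast
qed

text \<open>Every point of \<open>Q\<close> has the form \<open>f p\<close>, so each axiom reduces
  to the one for \<open>P\<close>. Extensionality of the action concerns values outside the total
  space and is a separate hypothesis. The lemma gives the tensor product, a quotient, its bundle
  structure.\<close>

lemma semi_equivariant_bundle_transport:
  assumes B: "semi_equivariant_bundle \<Gamma> X \<rho> G \<theta> P" and X: "smooth_space X"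
    and Q: "smooth_space (tot Q)" and f: "diffeo (tot P) (tot Q) f"
    and proj: "\<And>p. p \<in> points (tot P) \<Longrightarrow> proj Q (f p) = proj P p"
    and ract: "\<And>p g. p \<in> points (tot P) \<Longrightarrow> g \<in> carrier G \<Longrightarrow> ract Q (f p) g = f (ract P p g)"
    and gact: "\<And>\<gamma> p. \<gamma> \<in> carrier \<Gamma> \<Longrightarrow> p \<in> points (tot P) \<Longrightarrow> gact Q \<gamma> (f p) = f (gact P \<gamma> p)"
    and ext: "\<And>\<gamma>. \<gamma> \<in> carrier \<Gamma> \<Longrightarrow> gact Q \<gamma> \<in> extensional (points (tot Q))"
  shows "semi_equivariant_bundle \<Gamma> X \<rho> G \<theta> Q"
proof -
  interpret principal X G P by (rule semi_equivariant_bundle_principal[OF B X])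
  obtain g where g: "smooth_map (tot P) (tot Q) f" "smooth_map (tot Q) (tot P) g"
      "\<And>x. x \<in> points (tot P) \<Longrightarrow> g (f x) = x" "\<And>y. y \<in> points (tot Q) \<Longrightarrow> f (g y) = y"
    using f unfolding diffeo_def by blast
  note fQ = smooth_space_functional[OF Q]
  have gP: "g q \<in> points (tot P)" if "q \<in> points (tot Q)" for q using smooth_map_image[OF g(2) that] .
  have fP: "f p \<in> points (tot Q)" if "p \<in> points (tot P)" for p using smooth_map_image[OF g(1) that] .
  have cases: thesis if "q \<in> points (tot Q)" "\<And>p. p \<in> points (tot P) \<Longrightarrow> q = f p \<Longrightarrow> thesis" for q thesis
    using that gP g(4) by metis
  have act: "smooth_action \<Gamma> (tot P) (gact P)" using B by (simp add: semi_equivariant_bundle_def)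
  note actD = group_actionD[OF conjunct1[OF act[unfolded smooth_action_def]]]
  have G: "group \<Gamma>" using act by (simp add: smooth_action_def group_action_def group_hom_def)
  have ga: "gact P \<gamma> p \<in> points (tot P)" if "\<gamma> \<in> carrier \<Gamma>" "p \<in> points (tot P)" for \<gamma> p
    using actD(2) that by blast
  have "principal_bundle X G Q"
    unfolding principal_bundle_def
  proof (intro conjI ballI)
    show "smooth_manifold (tot Q)"
      by (rule smooth_manifold_diffeo[OF _ Q f]) (use prin in \<open>simp add: principal_bundle_def\<close>)
    show "smooth_map (tot Q) X (proj Q)"
      by (rule smooth_map_cong[OF fQ smooth_map_compose[OF g(2) smooth_proj]]) (metis cases g(3) proj)
    have "smooth_map (prod_space (tot Q) (lsp G)) (tot Q) (\<lambda>z. f (ract P (g (fst z)) (snd z)))"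
      by (rule smooth_map_compose[OF _ g(1)], rule smooth_map_ract[OF smooth_space_prod_space[OF Q smooth_G]
            smooth_map_compose_fst[OF Q g(2)] smooth_map_snd[OF smooth_space_functional[OF smooth_G]]])
    then show "smooth_map (prod_space (tot Q) (lsp G)) (tot Q) (\<lambda>(q, h). ract Q q h)"
    proof (rule smooth_map_cong[OF smooth_space_functional[OF smooth_space_prod_space[OF Q smooth_G]]])
      fix z assume "z \<in> points (prod_space (tot Q) (lsp G))"
      then have z: "fst z \<in> points (tot Q)" "snd z \<in> carrier G" by (auto simp: points_G)
      then show "(case z of (q, h) \<Rightarrow> ract Q q h) = f (ract P (g (fst z)) (snd z))"
        using ract[OF gP[OF z(1)] z(2)] g(4)[OF z(1)] by (simp add: case_prod_beta')
    qed
  next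
    fix q assume "q \<in> points (tot Q)"
    then obtain p where p: "p \<in> points (tot P)" "q = f p" by (rule cases)
    interpret group G by (rule group_G)
    show "ract Q q \<one>\<^bsub>G\<^esub> = q" using p by (simp add: ract ract_one)
    fix h assume h: "h \<in> carrier G"
    show "proj Q (ract Q q h) = proj Q q" using p h by (simp add: ract proj ract_closed proj_ract)
    fix k assume k: "k \<in> carrier G"
    show "ract Q (ract Q q h) k = ract Q q (h \<otimes>\<^bsub>G\<^esub> k)" using p h k by (simp add: ract ract_closed ract_mult)
  next
    fix x assume x: "x \<in> points X"
    obtain U \<psi> where U: "openin (ftop X) U" "x \<in> U"
      and d: "diffeo (sub_space (tot P) {p \<in> points (tot P). proj P p \<in> U}) (prod_space (sub_space X U) (lsp G)) \<psi>"
      and t: "\<forall>p\<in>points (tot P). proj P p \<in> U \<longrightarrow> fst (\<psi> p) = proj P p \<and>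
             (\<forall>g\<in>carrier G. \<psi> (ract P p g) = (proj P p, snd (\<psi> p) \<otimes>\<^bsub>G\<^esub> g))"
      using prin x unfolding principal_bundle_def by meson
    have dg: "diffeo (tot Q) (tot P) g" by (rule diffeoI[OF g(2,1,4,3)])
    let ?PU = "{p \<in> points (tot P). proj P p \<in> U}"
    have eq: "{q \<in> points (tot Q). g q \<in> ?PU} = {q \<in> points (tot Q). proj Q q \<in> U}"
      using gP g(4) proj by (metis (mono_tags, lifting) mem_Collect_eq)
    have "diffeo (sub_space (tot Q) {q \<in> points (tot Q). proj Q q \<in> U}) (prod_space (sub_space X U) (lsp G)) (\<lambda>q. \<psi> (g q))"
      using diffeo_compose[OF diffeo_restrict[OF Q smooth_P dg, of ?PU] d] unfolding eq .
    moreover have "fst (\<psi> (g q)) = proj Q q \<and> (\<forall>h\<in>carrier G. \<psi> (g (ract Q q h)) = (proj Q q, snd (\<psi> (g q)) \<otimes>\<^bsub>G\<^esub> h))"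
      if q: "q \<in> points (tot Q)" "proj Q q \<in> U" for q
    proof -
      obtain p where p: "p \<in> points (tot P)" "q = f p" using q(1) by (rule cases)
      then show ?thesis using t q(2) by (simp add: proj g(3) ract ract_closed)
    qed
    ultimately show "\<exists>U \<psi>. openin (ftop X) U \<and> x \<in> U \<and>
        diffeo (sub_space (tot Q) {p \<in> points (tot Q). proj Q p \<in> U}) (prod_space (sub_space X U) (lsp G)) \<psi> \<and>
        (\<forall>p\<in>points (tot Q). proj Q p \<in> U \<longrightarrow> fst (\<psi> p) = proj Q p \<and>
           (\<forall>g\<in>carrier G. \<psi> (ract Q p g) = (proj Q p, snd (\<psi> p) \<otimes>\<^bsub>G\<^esub> g)))"
      using U by (intro exI[of _ U] exI[of _ "\<lambda>q. \<psi> (g q)"]) simp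
  qed
  moreover have "smooth_action \<Gamma> (tot Q) (gact Q)"
    unfolding smooth_action_def
  proof (intro conjI ballI group_actionI G ext)
    fix \<gamma> q assume \<gamma>: "\<gamma> \<in> carrier \<Gamma>" and "q \<in> points (tot Q)"
    then show "gact Q \<gamma> q \<in> points (tot Q)" by (metis cases gact ga fP)
  next
    fix q assume "q \<in> points (tot Q)"
    then show "gact Q \<one>\<^bsub>\<Gamma>\<^esub> q = q" by (metis cases gact actD(3) group.is_monoid[OF G] monoid.one_closed)
  next
    fix \<gamma> \<delta> q assume \<gamma>: "\<gamma> \<in> carrier \<Gamma>" "\<delta> \<in> carrier \<Gamma>" and "q \<in> points (tot Q)"
    then obtain p where p: "p \<in> points (tot P)" "q = f p" using cases by blast
    have "\<gamma> \<otimes>\<^bsub>\<Gamma>\<^esub> \<delta> \<in> carrier \<Gamma>" using \<gamma> G by (simp add: group.is_monoid monoid.m_closed)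
    then show "gact Q (\<gamma> \<otimes>\<^bsub>\<Gamma>\<^esub> \<delta>) q = gact Q \<gamma> (gact Q \<delta> q)"
      using p \<gamma> by (simp add: gact actD(4) ga)
  next
    fix \<gamma> assume \<gamma>: "\<gamma> \<in> carrier \<Gamma>"
    then have "smooth_map (tot P) (tot P) (gact P \<gamma>)" using act by (simp add: smooth_action_def)
    from smooth_map_compose[OF smooth_map_compose[OF g(2) this] g(1)]
    show "smooth_map (tot Q) (tot Q) (gact Q \<gamma>)"
      by (rule smooth_map_cong[OF fQ]) (metis cases gact g(3) \<gamma>)
  qed
  moreover have "proj Q (gact Q \<gamma> q) = \<rho> \<gamma> (proj Q q)" if \<gamma>: "\<gamma> \<in> carrier \<Gamma>" and q: "q \<in> points (tot Q)" for \<gamma> q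
  proof -
    obtain p where p: "p \<in> points (tot P)" "q = f p" using q by (rule cases)
    then show ?thesis using \<gamma> B by (simp add: gact proj ga semi_equivariant_bundle_def)
  qed
  moreover have "gact Q \<gamma> (ract Q q h) = ract Q (gact Q \<gamma> q) (\<theta> \<gamma> h)"
    if \<gamma>: "\<gamma> \<in> carrier \<Gamma>" and q: "q \<in> points (tot Q)" and h: "h \<in> carrier G" for \<gamma> q h
  proof -
    obtain p where p: "p \<in> points (tot P)" "q = f p" using q by (rule cases)
    have "\<theta> \<gamma> \<in> iso G G" using B \<gamma> by (simp add: semi_equivariant_bundle_def gamma_group_def)
    then have "\<theta> \<gamma> h \<in> carrier G" using h by (auto simp: iso_def hom_def)
    then show ?thesis using \<gamma> h p B
      by (simp add: gact ract ract_closed ga) (simp add: semi_equivariant_bundle_def)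
  qed
  ultimately show ?thesis using B by (simp add: semi_equivariant_bundle_def)
qed

section \<open>Oriented orthonormal frames\<close>

text \<open>The vector \<open>(\<alpha>, \<beta>)\<close> is turned onto the nonnegative first axis
  by a rotation through its polar angle \<open>a\<close>. Since \<open>Ad\<close> doubles angles,
  \<open>c\<close> and \<open>s\<close> are taken at \<open>a / 2\<close>.\<close>

lemma half_angle_ex:
  fixes \<alpha> \<beta> :: real
  obtains c s where "c * c + s * s = 1" "(c * c - s * s) * \<alpha> + 2 * c * s * \<beta> \<ge> 0"
    "- (2 * c * s) * \<alpha> + (c * c - s * s) * \<beta> = 0"
proof -
  obtain r a where ra: "\<alpha> = r * cos a" "\<beta> = r * sin a" "r \<ge> 0"
  proof (cases "\<alpha> = 0 \<and> \<beta> = 0")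
    case True
    then show ?thesis using that[of 0 0] by simp
  next
    case False
    define r where "r = sqrt (\<alpha>\<^sup>2 + \<beta>\<^sup>2)"
    have r: "r > 0" "r\<^sup>2 = \<alpha>\<^sup>2 + \<beta>\<^sup>2" using False by (auto simp: r_def sum_power2_gt_zero_iff)
    have "(\<alpha> / r)\<^sup>2 + (\<beta> / r)\<^sup>2 = 1"
      unfolding power_divide add_divide_distrib[symmetric] r(2)[symmetric] using r(1) by simp
    then obtain a where "\<alpha> / r = cos a" "\<beta> / r = sin a" using sincos_total_2pi by metis
    then show ?thesis using that[of r a] r by (simp add: field_simps)
  qed
  define c s where "c = cos (a / 2)" and "s = sin (a / 2)"
  have a2: "2 * (a / 2) = a" by simp
  have C: "c * c - s * s = cos a" "2 * c * s = sin a"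
    using cos_double[of "a / 2"] sin_double[of "a / 2"] unfolding a2 by (simp_all add: c_def s_def power2_eq_square)
  have "cos a * (r * cos a) + sin a * (r * sin a) = r * (cos a * cos a + sin a * sin a)" by (simp only: distrib_left mult_ac)
  then have "cos a * (r * cos a) + sin a * (r * sin a) = r" by (simp only: sin_cos_squared_add3 mult_1_right)
  then show ?thesis
    using that[of c s] ra unfolding C by (simp add: c_def s_def)
qed

locale metric_bundle =
  fixes \<Gamma> :: "'c monoid" and X :: "'x fspace" and \<rho> n and V :: "('c, 'x, 'v) vbundle"
  assumes vb: "oriented_isometric_vector_bundle \<Gamma> X \<rho> n V" and baseV: "smooth_space X"
begin

lemma ovb: "oriented_vector_bundle X n V" and fm: "fibre_metric X V"
  using vb by (simp_all add: oriented_isometric_vector_bundle_def)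

lemma smooth_V: "smooth_space (vtot V)"
  using ovb by (simp add: oriented_vector_bundle_def smooth_manifold_smooth_space)

lemma fibre_add: "x \<in> points X \<Longrightarrow> v \<in> fibre V x \<Longrightarrow> w \<in> fibre V x \<Longrightarrow> vadd V v w \<in> fibre V x"
  and fibre_scale: "x \<in> points X \<Longrightarrow> v \<in> fibre V x \<Longrightarrow> vscale V a v \<in> fibre V x"
  using ovb by (simp_all add: oriented_vector_bundle_def)

lemma
  assumes "x \<in> points X" "u \<in> fibre V x" "v \<in> fibre V x" "w \<in> fibre V x"
  shows metric_sym: "vmetric V v w = vmetric V w v"
    and metric_add: "vmetric V (vadd V u v) w = vmetric V u w + vmetric V v w"
    and metric_scale: "vmetric V (vscale V a v) w = a * vmetric V v w"
  using fm assms unfolding fibre_metric_def by blast+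

definition orthonormal :: "(nat \<Rightarrow> 'v) \<Rightarrow> bool" where
  "orthonormal f \<longleftrightarrow> (\<forall>i<n. \<forall>j<n. vmetric V (f i) (f j) = (if i = j then 1 else 0))"

text \<open>What a local trivialisation of \<open>V\<close> gives on a single fibre. Expansions in a
  frame and comparisons of orientation are computed in such coordinates.\<close>

definition fibre_coord :: "'x \<Rightarrow> ('v \<Rightarrow> nat \<Rightarrow> real) \<Rightarrow> bool" where
  "fibre_coord x \<psi> \<longleftrightarrow> inj_on \<psi> (fibre V x) \<and>
    (\<forall>v\<in>fibre V x. \<psi> v \<in> extensional {..<n} \<and> (\<forall>a. \<forall>i<n. \<psi> (vscale V a v) i = a * \<psi> v i) \<and>
      (\<forall>w\<in>fibre V x. \<forall>i<n. \<psi> (vadd V v w) i = \<psi> v i + \<psi> w i)) \<and>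
    vorient V x = {f \<in> {..<n} \<rightarrow>\<^sub>E fibre V x. det (mat n n (\<lambda>(i, j). \<psi> (f j) i)) > 0}"

lemma
  assumes "fibre_coord x \<psi>"
  shows fibre_coordD: "inj_on \<psi> (fibre V x)"
    "\<And>v w i. v \<in> fibre V x \<Longrightarrow> w \<in> fibre V x \<Longrightarrow> i < n \<Longrightarrow> \<psi> (vadd V v w) i = \<psi> v i + \<psi> w i"
    "\<And>v a i. v \<in> fibre V x \<Longrightarrow> i < n \<Longrightarrow> \<psi> (vscale V a v) i = a * \<psi> v i"
    "\<And>v. v \<in> fibre V x \<Longrightarrow> \<psi> v \<in> extensional {..<n}"
    "vorient V x = {f \<in> {..<n} \<rightarrow>\<^sub>E fibre V x. det (mat n n (\<lambda>(i, j). \<psi> (f j) i)) > 0}"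
  using assms by (simp_all add: fibre_coord_def)

lemma fibre_triv:
  assumes "x \<in> points X"
  shows "\<exists>\<psi>. fibre_coord x \<psi>"
proof -
  obtain U \<psi> where U: "openin (ftop X) U" "x \<in> U"
    and d: "diffeo (sub_space (vtot V) {v \<in> points (vtot V). vproj V v \<in> U}) (prod_space (sub_space X U) (euclidean_fspace {..<n})) \<psi>"
    and t0: "\<forall>y\<in>U. (\<forall>v\<in>fibre V y. fst (\<psi> v) = y) \<and>
           (\<forall>v\<in>fibre V y. \<forall>w\<in>fibre V y. \<forall>i<n.
              snd (\<psi> (vadd V v w)) i = snd (\<psi> v) i + snd (\<psi> w) i) \<and>
           (\<forall>v\<in>fibre V y. \<forall>a. \<forall>i<n. snd (\<psi> (vscale V a v)) i = a * snd (\<psi> v) i) \<and>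
           vorient V y = {f \<in> {..<n} \<rightarrow>\<^sub>E fibre V y. det (mat n n (\<lambda>(i, j). snd (\<psi> (f j)) i)) > 0}"
    using ovb[unfolded oriented_vector_bundle_def, THEN conjunct2, THEN conjunct2, THEN conjunct2, THEN conjunct2,
        THEN bspec, OF assms] by (elim exE conjE) (rule that)
  note t = bspec[OF t0 U(2)]
  have sub: "v \<in> points (sub_space (vtot V) {v \<in> points (vtot V). vproj V v \<in> U})" if "v \<in> fibre V x" for v
    using that U(2) by (auto simp: fibre_def)
  obtain g where g: "\<And>v. v \<in> fibre V x \<Longrightarrow> g (\<psi> v) = v"
    using d sub unfolding diffeo_def by blast
  have "inj_on (\<lambda>v. snd (\<psi> v)) (fibre V x)"
  proof (rule inj_onI)
    fix v w assume "v \<in> fibre V x" "w \<in> fibre V x" "snd (\<psi> v) = snd (\<psi> w)"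
    then have "\<psi> v = \<psi> w" using t by (simp add: prod_eq_iff)
    then show "v = w" using g \<open>v \<in> fibre V x\<close> \<open>w \<in> fibre V x\<close> by metis
  qed
  moreover have "snd (\<psi> v) \<in> extensional {..<n}" if "v \<in> fibre V x" for v
    using smooth_map_image[OF _ sub[OF that], of "prod_space (sub_space X U) (euclidean_fspace {..<n})" \<psi>] d
    by (auto simp: diffeo_def PiE_def mem_Times_iff)
  ultimately show ?thesis using t by (intro exI[of _ "\<lambda>v. snd (\<psi> v)"]) (auto simp: fibre_coord_def)
qed

lemma frame_fibre: "x \<in> points X \<Longrightarrow> f \<in> vorient V x \<Longrightarrow> i < n \<Longrightarrow> f i \<in> fibre V x"
  using fibre_triv[of x] by (auto simp: fibre_coord_def)

section \<open>Expansion of vectors in a frame\<close>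

lemma comb_fibre:
  assumes x: "x \<in> points X" and "\<And>i. i \<in> set is \<Longrightarrow> f i \<in> fibre V x" and "z \<in> fibre V x"
  shows "foldr (\<lambda>i. vadd V (vscale V (c i) (f i))) is (vscale V 0 z) \<in> fibre V x"
  using assms(2) by (induction "is") (auto intro!: fibre_add fibre_scale x assms(3))

lemma metric_comb:
  assumes x: "x \<in> points X" and "\<And>i. i \<in> set is \<Longrightarrow> f i \<in> fibre V x" and z: "z \<in> fibre V x" and w: "w \<in> fibre V x"
  shows "vmetric V (foldr (\<lambda>i. vadd V (vscale V (c i) (f i))) is (vscale V 0 z)) w = (\<Sum>i\<leftarrow>is. c i * vmetric V (f i) w)"
  using assms(2)
proof (induction "is")
  case Nil
  then show ?case using metric_scale[OF x z z w, of 0] by simp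
next
  case (Cons i "is")
  have fi: "f i \<in> fibre V x" using Cons by simp
  have S: "foldr (\<lambda>i. vadd V (vscale V (c i) (f i))) is (vscale V 0 z) \<in> fibre V x"
    by (rule comb_fibre[OF x _ z]) (use Cons in simp)
  show ?case
    using Cons metric_add[OF x fibre_scale[OF x fi] S w] metric_scale[OF x fi fi w] by simp
qed

text \<open>A positive determinant makes the coordinate matrix of the frame invertible, so the
  coefficients are solved from the coordinates of \<open>v\<close>. The sum starts from
  \<open>vscale V 0 z\<close>, in the shape of \<open>frame_mult\<close>, with \<open>z\<close> free
  so that different vectors can be expanded from the same start.\<close>

lemma frame_expand_ex:
  assumes x: "x \<in> points X" and f: "f \<in> vorient V x" and v: "v \<in> fibre V x" and z: "z \<in> fibre V x"
  shows "\<exists>c. v = foldr (\<lambda>i. vadd V (vscale V (c i) (f i))) [0..<n] (vscale V 0 z)"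
proof -
  obtain \<psi> where co: "fibre_coord x \<psi>" using fibre_triv[OF x] by blast
  note \<psi> = fibre_coordD[OF co]
  define M where "M = mat n n (\<lambda>(i, j). \<psi> (f j) i)"
  have M: "M \<in> carrier_mat n n" "det M \<noteq> 0" using f \<psi>(5) by (auto simp: M_def)
  obtain B where B: "B \<in> carrier_mat n n" "M * B = 1\<^sub>m n"
    using det_non_zero_imp_unit[OF M, of undefined] by (auto simp: Units_def ring_mat_def)
  define y where "y = vec n (\<psi> v)"
  define u where "u = B *\<^sub>v y"
  define c where "c i = u $ i" for i
  have u: "u \<in> carrier_vec n" using B(1) by (simp add: u_def y_def)
  have "M *\<^sub>v u = y"
    using M(1) B by (simp add: u_def y_def assoc_mult_mat_vec[symmetric, of M n n B n])
  note Mu = this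
  have My: "(\<Sum>j<n. M $$ (i, j) * c j) = \<psi> v i" if "i < n" for i
  proof -
    have "(\<Sum>j<n. M $$ (i, j) * c j) = (M *\<^sub>v u) $ i"
      using that M(1) u by (simp add: c_def scalar_prod_def lessThan_atLeast0)
    then show ?thesis using that by (simp add: Mu y_def)
  qed
  have comb: "\<psi> (foldr (\<lambda>i. vadd V (vscale V (c i) (f i))) is (vscale V 0 z)) i = (\<Sum>j\<leftarrow>is. c j * \<psi> (f j) i)"
    if "i < n" "set is \<subseteq> {..<n}" for i "is"
    using that(2)
  proof (induction "is")
    case (Cons j js)
    then have fj: "f j \<in> fibre V x" using frame_fibre[OF x f] by simp
    have S: "foldr (\<lambda>i. vadd V (vscale V (c i) (f i))) js (vscale V 0 z) \<in> fibre V x"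
      by (rule comb_fibre[OF x _ z]) (use Cons frame_fibre[OF x f] in auto)
    show ?case using Cons \<psi>(2)[OF fibre_scale[OF x fj] S that(1)] \<psi>(3)[OF fj that(1)] by simp
  qed (use \<psi>(3)[OF z that(1)] in simp)
  let ?S = "foldr (\<lambda>i. vadd V (vscale V (c i) (f i))) [0..<n] (vscale V 0 z)"
  have S: "?S \<in> fibre V x" by (rule comb_fibre[OF x _ z]) (use frame_fibre[OF x f] in auto)
  have "\<psi> ?S = \<psi> v"
  proof (rule extensionalityI[OF \<psi>(4)[OF S] \<psi>(4)[OF v]])
    fix i assume "i \<in> {..<n}"
    then have i: "i < n" by simp
    have "\<psi> ?S i = (\<Sum>j<n. c j * \<psi> (f j) i)"
      using comb[OF i, of "[0..<n]"] by (simp add: interv_sum_list_conv_sum_set_nat lessThan_atLeast0)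
    also have "\<dots> = (\<Sum>j<n. M $$ (i, j) * c j)" using i by (intro sum.cong) (auto simp: M_def)
    finally show "\<psi> ?S i = \<psi> v i" using My[OF i] by simp
  qed
  then have "v = ?S" using \<psi>(1) S v by (metis inj_onD)
  then show ?thesis by blast
qed

lemma metric_comb_upt:
  assumes x: "x \<in> points X" and f: "f \<in> vorient V x" and z: "z \<in> fibre V x" and w: "w \<in> fibre V x"
  shows "vmetric V (foldr (\<lambda>i. vadd V (vscale V (c i) (f i))) [0..<n] (vscale V 0 z)) w = (\<Sum>i<n. c i * vmetric V (f i) w)"
  using metric_comb[OF x _ z w, of "[0..<n]" f c] frame_fibre[OF x f]
  by (simp add: interv_sum_list_conv_sum_set_nat lessThan_atLeast0)

text \<open>Inner products with an orthonormal frame are the coefficients of the expansion. Both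
  vectors are expanded from the same term \<open>vscale V 0 v\<close>, so equal coefficients give
  literally equal sums.\<close>

lemma frame_eqI:
  assumes x: "x \<in> points X" and f: "f \<in> vorient V x" "orthonormal f" and v: "v \<in> fibre V x" and w: "w \<in> fibre V x"
    and eq: "\<And>i. i < n \<Longrightarrow> vmetric V (f i) v = vmetric V (f i) w"
  shows "v = w"
proof -
  have *: "vmetric V (f j) u = c j"
    if u: "u \<in> fibre V x" "u = foldr (\<lambda>i. vadd V (vscale V (c i) (f i))) [0..<n] (vscale V 0 v)" and j: "j < n" for u c j
  proof -
    note fj = frame_fibre[OF x f(1) j]
    have "vmetric V u (f j) = (\<Sum>i<n. c i * vmetric V (f i) (f j))"
      unfolding u(2) by (rule metric_comb_upt[OF x f(1) v fj])
    also have "\<dots> = (\<Sum>i<n. if i = j then c i else 0)"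
      using f(2) j by (intro sum.cong) (auto simp: orthonormal_def)
    finally show ?thesis using j metric_sym[OF x fj fj u(1)] by simp
  qed
  obtain c where c: "v = foldr (\<lambda>i. vadd V (vscale V (c i) (f i))) [0..<n] (vscale V 0 v)"
    using frame_expand_ex[OF x f(1) v v] by blast
  obtain d where d: "w = foldr (\<lambda>i. vadd V (vscale V (d i) (f i))) [0..<n] (vscale V 0 v)"
    using frame_expand_ex[OF x f(1) w v] by blast
  have "c i = d i" if "i < n" for i using *[OF v c that] *[OF w d that] eq[OF that] by simp
  then have "foldr (\<lambda>i. vadd V (vscale V (c i) (f i))) [0..<n] (vscale V 0 v) = foldr (\<lambda>i. vadd V (vscale V (d i) (f i))) [0..<n] (vscale V 0 v)"
    by (intro foldr_cong) auto
  then show ?thesis using c d by simp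
qed

lemma frame_mult_fibre:
  assumes x: "x \<in> points X" and f: "f \<in> vorient V x" and j: "j < n"
  shows "frame_mult n V f A j \<in> fibre V x"
  using comb_fibre[OF x, of "[0..<n]" f "f j"] frame_fibre[OF x f] j by (simp add: frame_mult_def)

lemma metric_frame_mult:
  assumes x: "x \<in> points X" and f: "f \<in> vorient V x" and j: "j < n" and w: "w \<in> fibre V x"
  shows "vmetric V (frame_mult n V f A j) w = (\<Sum>i<n. A $$ (i, j) * vmetric V (f i) w)"
  using metric_comb_upt[OF x f frame_fibre[OF x f j] w, of "\<lambda>i. A $$ (i, j)"] j by (simp add: frame_mult_def)

text \<open>Orthonormality leaves one term of the sum. Read backwards, the rotation between two
  frames is expressed by inner products, which depend smoothly on the base point.\<close>

lemma metric_frame_mult_entry: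
  assumes x: "x \<in> points X" and f: "f \<in> vorient V x" "orthonormal f" and j: "j < n" and i: "i < n"
  shows "vmetric V (f i) (frame_mult n V f A j) = A $$ (i, j)"
proof -
  note fi = frame_fibre[OF x f(1) i]
  have "vmetric V (f i) (frame_mult n V f A j) = (\<Sum>k<n. A $$ (k, j) * vmetric V (f k) (f i))"
    using metric_frame_mult[OF x f(1) j fi] metric_sym[OF x fi fi frame_mult_fibre[OF x f(1) j]] by simp
  also have "\<dots> = (\<Sum>k<n. if k = i then A $$ (k, j) else 0)"
    using f(2) i by (intro sum.cong) (auto simp: orthonormal_def)
  finally show ?thesis using i by simp
qed

text \<open>Both coordinate determinants are positive, and multiplying the last vector by
  \<open>a\<close> multiplies the determinant by \<open>a\<close>.\<close>

lemma orientation_last: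
  assumes x: "x \<in> points X" and f: "f \<in> vorient V x" and f': "f' \<in> vorient V x" and k: "n = Suc k"
    and eq: "\<And>j. j < k \<Longrightarrow> f j = f' j" and last: "f' k = vscale V a (f k)"
  shows "a > 0"
proof -
  obtain \<psi> where co: "fibre_coord x \<psi>" using fibre_triv[OF x] by blast
  note \<psi> = fibre_coordD(3,5)[OF co]
  let ?M = "mat n n (\<lambda>(i, j). \<psi> (f j) i)" and ?M' = "mat n n (\<lambda>(i, j). \<psi> (f' j) i)"
  have fk: "f k \<in> fibre V x" using frame_fibre[OF x f] k by simp
  \<comment> \<open>Frame vectors are columns of the coordinate matrix; transposing makes the last
    one a row, to which \<open>multrow\<close> applies.\<close>
  have "transpose_mat ?M' = multrow k a (transpose_mat ?M)"
    by (rule eq_matI) (use eq last k \<psi>(1)[OF fk] in \<open>auto simp: less_Suc_eq\<close>)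
  then have "det (transpose_mat ?M') = a * det (transpose_mat ?M)"
    using det_multrow[of k n "transpose_mat ?M" a] k by simp
  then have "det ?M' = a * det ?M"
    using det_transpose[of ?M n] det_transpose[of ?M' n] by simp
  then show ?thesis using f f' \<psi>(2) by (auto simp: zero_less_mult_iff)
qed

text \<open>The vectors \<open>k\<close> and \<open>m\<close> of the new frame are described by
  inner products with a test vector; with the target vector in its place this is what
  \<open>frames_transitive\<close> compares.\<close>

lemma givens_frame:
  assumes S: "group (SpinC n)" and x: "x \<in> points X" and f: "f \<in> vorient V x" "orthonormal f"
    and p: "k < m" "m < n" and cs: "c * c + s * s = 1"
  defines "f' \<equiv> frame_mult n V f (Ad n (givens n k m c s))"
  shows "\<And>j. j < n \<Longrightarrow> j \<noteq> k \<Longrightarrow> j \<noteq> m \<Longrightarrow> f' j = f j"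
    and "\<And>w. w \<in> fibre V x \<Longrightarrow> vmetric V (f' k) w = (c * c - s * s) * vmetric V (f k) w + 2 * c * s * vmetric V (f m) w"
    and "\<And>w. w \<in> fibre V x \<Longrightarrow> vmetric V (f' m) w = - (2 * c * s) * vmetric V (f k) w + (c * c - s * s) * vmetric V (f m) w"
proof -
  interpret spinc_group n by (rule spinc_group.intro[OF S])
  note A = Ad_givens[OF p cs]
  show "f' j = f j" if j: "j < n" "j \<noteq> k" "j \<noteq> m" for j
  proof (rule frame_eqI[OF x f])
    show "f' j \<in> fibre V x" unfolding f'_def by (rule frame_mult_fibre[OF x f(1) j(1)])
    show "f j \<in> fibre V x" by (rule frame_fibre[OF x f(1) j(1)])
    show "vmetric V (f i) (f' j) = vmetric V (f i) (f j)" if "i < n" for i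
      unfolding f'_def metric_frame_mult_entry[OF x f j(1) that] A[OF that j(1)]
      using f(2) that j p by (auto simp: orthonormal_def)
  qed
  have km: "k < n" "m < n" "k \<noteq> m" using p by auto
  have two: "(\<Sum>i<n. (if i = k then a else if i = m then b else 0) * g i) = a * g k + b * g m" for a b and g :: "nat \<Rightarrow> real"
  proof -
    have "(\<Sum>i<n. (if i = k then a else if i = m then b else 0) * g i) = (\<Sum>i<n. (if i = k then a * g k else 0) + (if i = m then b * g m else 0))"
      using km by (intro sum.cong) auto
    then show ?thesis using km by (simp add: sum.distrib)
  qed
  show "vmetric V (f' k) w = (c * c - s * s) * vmetric V (f k) w + 2 * c * s * vmetric V (f m) w" if w: "w \<in> fibre V x" for w
  proof -
    have "vmetric V (f' k) w = (\<Sum>i<n. (if i = k then c * c - s * s else if i = m then 2 * c * s else 0) * vmetric V (f i) w)"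
      unfolding f'_def metric_frame_mult[OF x f(1) km(1) w]
      using km A by (intro sum.cong refl arg_cong2[of _ _ _ _ "(*)"]) auto
    then show ?thesis unfolding two .
  qed
  show "vmetric V (f' m) w = - (2 * c * s) * vmetric V (f k) w + (c * c - s * s) * vmetric V (f m) w" if w: "w \<in> fibre V x" for w
  proof -
    have "vmetric V (f' m) w = (\<Sum>i<n. (if i = k then - (2 * c * s) else if i = m then c * c - s * s else 0) * vmetric V (f i) w)"
      unfolding f'_def metric_frame_mult[OF x f(1) km(2) w]
      using km A by (intro sum.cong refl arg_cong2[of _ _ _ _ "(*)"]) auto
    then show ?thesis unfolding two .
  qed
qed

text \<open>Successive plane rotations carry any frame to a given one, vector by vector. The sign of the last
  vector cannot be adjusted by a rotation; there the orientation decides.\<close>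

lemma frames_transitive:
  assumes S: "group (SpinC n)" and x: "x \<in> points X"
    and Fs: "\<And>f. f \<in> Fs \<Longrightarrow> f \<in> vorient V x \<and> orthonormal f"
    and cl: "\<And>f g. f \<in> Fs \<Longrightarrow> g \<in> carrier (Spin n) \<Longrightarrow> frame_mult n V f (Ad n g) \<in> Fs"
    and ne: "Fs \<noteq> {}" and f': "f' \<in> vorient V x" "orthonormal f'"
  shows "f' \<in> Fs"
proof -
  note fib' = frame_fibre[OF x f'(1)]
  have "\<exists>f\<in>Fs. \<forall>j<k. f j = f' j" if "k \<le> n" for k
    using that
  proof (induction k)
    case 0
    then show ?case using ne by auto
  next
    case (Suc k)
    then have k: "k < n" by simp
    \<comment> \<open>Rotations in the plane of \<open>k\<close> and \<open>m\<close> remove the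
      component of \<open>f' k\<close> along \<open>f m\<close>, one \<open>m\<close> at a time, and
      leave the vectors before \<open>k\<close> alone. Each rotation also makes the component along
      \<open>f k\<close> nonnegative; at \<open>m = Suc k\<close>, before the first one, nothing is
      claimed about its sign.\<close>
    have inner: "\<exists>f\<in>Fs. (\<forall>j<k. f j = f' j) \<and> (\<forall>i. k < i \<and> i < m \<longrightarrow> vmetric V (f i) (f' k) = 0) \<and> (m > Suc k \<longrightarrow> vmetric V (f k) (f' k) \<ge> 0)"
      if "Suc k \<le> m" "m \<le> n" for m
      using that
    proof (induction m rule: dec_induct)
      case base
      obtain f where "f \<in> Fs" "\<forall>j<k. f j = f' j" using Suc by auto
      then show ?case by (intro bexI[of _ f]) auto
    next
      case (step m)
      then have m: "k < m" "m < n" by auto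
      obtain f where f: "f \<in> Fs" "\<And>j. j < k \<Longrightarrow> f j = f' j" "\<And>i. k < i \<Longrightarrow> i < m \<Longrightarrow> vmetric V (f i) (f' k) = 0"
        using step by auto
      note fO = conjunct1[OF Fs[OF f(1)]] conjunct2[OF Fs[OF f(1)]]
      obtain c s where cs: "c * c + s * s = 1" "(c * c - s * s) * vmetric V (f k) (f' k) + 2 * c * s * vmetric V (f m) (f' k) \<ge> 0"
          "- (2 * c * s) * vmetric V (f k) (f' k) + (c * c - s * s) * vmetric V (f m) (f' k) = 0"
        by (rule half_angle_ex)
      note gf = givens_frame[OF S x fO m cs(1)]
      let ?f = "frame_mult n V f (Ad n (givens n k m c s))"
      have "?f \<in> Fs" by (rule cl[OF f(1) givens_Spin[OF m cs(1)]])
      moreover have "?f j = f' j" if "j < k" for j using gf(1)[of j] f(2)[OF that] that m by simp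
      moreover have "vmetric V (?f i) (f' k) = 0" if i: "k < i" "i < Suc m" for i
      proof (cases "i = m")
        case True
        then show ?thesis using gf(3)[OF fib'[OF k]] cs(3) by simp
      next
        case False
        then show ?thesis using gf(1)[of i] f(3)[of i] i m by simp
      qed
      moreover have "vmetric V (?f k) (f' k) \<ge> 0" using gf(2)[OF fib'[OF k]] cs(2) by simp
      ultimately show ?case by (intro bexI[of _ ?f]) auto
    qed
    obtain f where f: "f \<in> Fs" "\<And>j. j < k \<Longrightarrow> f j = f' j" "\<And>i. k < i \<Longrightarrow> i < n \<Longrightarrow> vmetric V (f i) (f' k) = 0"
      "n > Suc k \<Longrightarrow> vmetric V (f k) (f' k) \<ge> 0"
      using inner[of n] k by auto
    note fO = conjunct1[OF Fs[OF f(1)]] conjunct2[OF Fs[OF f(1)]]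
    note fib = frame_fibre[OF x fO(1)]
    define a where "a = vmetric V (f k) (f' k)"
    have prod: "vmetric V (f i) (f' k) = (if i = k then a else 0)" if i: "i < n" for i
      using f'(2) f(2)[of i] f(3)[of i] i k by (cases i k rule: linorder_cases) (auto simp: orthonormal_def a_def)
    have scale: "vmetric V (f i) (vscale V b (f k)) = (if i = k then b else 0)" if i: "i < n" for i b
      using metric_scale[OF x fib[OF k] fib[OF k] fib[OF i]] metric_sym[OF x fib[OF i] fib[OF i] fibre_scale[OF x fib[OF k]]]
        fO(2) i k by (auto simp: orthonormal_def)
    \<comment> \<open>All other components of \<open>f' k\<close> vanish: those before
      \<open>k\<close> by orthonormality of \<open>f'\<close>, those after \<open>k\<close> by the
      rotations.\<close>
    have fk: "f' k = vscale V a (f k)"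
      by (rule frame_eqI[OF x fO fib'[OF k] fibre_scale[OF x fib[OF k]]]) (simp add: prod scale)
    have "1 = vmetric V (f' k) (f' k)" using f'(2) k by (simp add: orthonormal_def)
    also have "\<dots> = vmetric V (vscale V a (f k)) (f' k)" using fk by simp
    also have "\<dots> = a * a" using metric_scale[OF x fib[OF k] fib[OF k] fib'[OF k]] by (simp add: a_def)
    finally have "a * a = 1" by simp
    \<comment> \<open>If there is a vector after \<open>k\<close>, the rotations have fixed the
      sign. At the last index, \<open>n = Suc k\<close>, no rotation was available and the
      orientation excludes \<open>a = -1\<close>.\<close>
    moreover have "a \<ge> 0"
    proof (cases "n > Suc k")
      case True
      then show ?thesis using f(4) by (simp add: a_def)
    next
      case False
      then have "n = Suc k" using k by simp
      from orientation_last[OF x fO(1) f'(1) this f(2) fk] show ?thesis by simp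
    qed
    ultimately have "a = 1" by (metis abs_of_nonneg abs_square_eq_1 power2_eq_square)
    then have "f k = f' k"
      by (intro frame_eqI[OF x fO fib[OF k] fib'[OF k]]) (use prod fO(2) k in \<open>auto simp: orthonormal_def\<close>)
    then show ?case using f(1,2) by (intro bexI[of _ f]) (auto simp: less_Suc_eq)
  qed
  then obtain f where f: "f \<in> Fs" "\<forall>j<n. f j = f' j" by blast
  have "f \<in> extensional {..<n}" "f' \<in> extensional {..<n}"
    using Fs[OF f(1)] f'(1) fibre_triv[OF x] by (auto simp: fibre_coord_def PiE_iff)
  then have "f = f'" using f(2) by (intro extensionalityI[of f "{..<n}" f']) auto
  then show ?thesis using f(1) by simp
qed

section \<open>Smoothness of inner products of frames\<close>

lemma points_Fr: "points (tot (Fr X \<rho> n V)) \<subseteq> {(x, f). x \<in> points X \<and> f \<in> vorient V x \<and> orthonormal f}"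
  by (auto simp: Fr_def Let_def orthonormal_def)

lemma smooth_map_Fr_component:
  assumes F: "smooth_map K (tot (Fr X \<rho> n V)) F" and i: "i < n"
  shows "smooth_map K (vtot V) (\<lambda>x. snd (F x) i)"
proof -
  let ?pw = "power_space {..<n} (vtot V)"
  have pw: "smooth_space ?pw" by (rule smooth_space_power[OF smooth_space_functional[OF smooth_V]])
  have "smooth_map (tot (Fr X \<rho> n V)) (prod_space X ?pw) (\<lambda>z. z)"
    unfolding Fr_def Let_def pbundle.simps
    by (rule smooth_map_sub[OF smooth_space_functional[OF smooth_space_prod_space[OF baseV pw]]])
  from smooth_map_compose[OF F this]
  have "smooth_map K (prod_space X ?pw) F" .
  from smooth_map_compose[OF this smooth_map_snd[OF smooth_space_functional[OF pw]]]
  have "smooth_map K ?pw (\<lambda>x. snd (F x))" .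
  from smooth_map_compose[OF this smooth_map_power_proj[OF smooth_space_functional[OF smooth_V]]] i
  show ?thesis by simp
qed

text \<open>The metric is a smooth function only on pairs of vectors over one base point, so the two
  frame vectors are first combined to a map into that subset \<open>D\<close>.\<close>

lemma fsm_frame_metric:
  assumes K: "smooth_space K" and F: "smooth_map K (tot (Fr X \<rho> n V)) F" and F': "smooth_map K (tot (Fr X \<rho> n V)) F'"
    and eq: "\<And>x. x \<in> points K \<Longrightarrow> fst (F x) = fst (F' x)" and ij: "i < n" "j < n"
  shows "fsm K (points K) (\<lambda>x. vmetric V (snd (F x) i) (snd (F' x) j))"
proof -
  let ?VV = "prod_space (vtot V) (vtot V)"
  define D where "D = {(v, w). v \<in> points (vtot V) \<and> w \<in> points (vtot V) \<and> vproj V v = vproj V w}"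
  have m: "fsm (sub_space ?VV D) D (\<lambda>(v, w). vmetric V v w)"
    using fm by (simp add: fibre_metric_def Let_def D_def)
  have VV: "smooth_space ?VV" by (intro smooth_space_prod_space smooth_V)
  have inD: "(snd (F x) i, snd (F' x) j) \<in> D" if x: "x \<in> points K" for x
  proof -
    have "F x \<in> {(x, f). x \<in> points X \<and> f \<in> vorient V x \<and> orthonormal f}"
      "F' x \<in> {(x, f). x \<in> points X \<and> f \<in> vorient V x \<and> orthonormal f}"
      by (rule subsetD[OF points_Fr smooth_map_image[OF F x]], rule subsetD[OF points_Fr smooth_map_image[OF F' x]])
    then have "snd (F x) i \<in> fibre V (fst (F x))" "snd (F' x) j \<in> fibre V (fst (F x))"
      using eq[OF x] ij by (auto intro!: frame_fibre)
    then show ?thesis by (simp add: D_def fibre_def)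
  qed
  have "smooth_map K (sub_space ?VV D) (\<lambda>x. (snd (F x) i, snd (F' x) j))"
    by (intro smooth_map_into_sub smooth_space_functional K VV smooth_map_pair smooth_map_Fr_component F F' ij inD)
  from smooth_map_fsm_total[OF this m inD] show ?thesis by simp
qed

end

section \<open>Spin$^\kappa$-structures\<close>

locale spin_struct =
  fixes \<Gamma> :: "'c monoid" and \<epsilon> :: "'c \<Rightarrow> int"
    and X :: "'x fspace" and \<rho> :: "'c \<Rightarrow> 'x \<Rightarrow> 'x"
    and n :: nat and V :: "('c, 'x, 'v) vbundle"
    and P :: "('c, 'x, 'p) spinc_bundle" and \<phi> :: "'p \<Rightarrow> 'x \<times> (nat \<Rightarrow> 'v)"
  assumes orient: "orientifold \<Gamma> \<epsilon> X \<rho>"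
    and vbun: "oriented_isometric_vector_bundle \<Gamma> X \<rho> n V"
    and str: "spin_kappa_structure \<Gamma> \<epsilon> X \<rho> n V P \<phi>"
begin

lemma manifold_X: "smooth_manifold X" using orient by (simp add: orientifold_def)

lemma smooth_X: "smooth_space X" by (rule smooth_manifold_smooth_space[OF manifold_X])

lemma seb: "semi_equivariant_bundle \<Gamma> X \<rho> (SpinC n) (kappa_SpinC n \<epsilon>) P"
  using str by (simp add: spin_kappa_structure_def)

end

sublocale spin_struct \<subseteq> principal X "SpinC n" P
  by (rule semi_equivariant_bundle_principal[OF seb smooth_X])

sublocale spin_struct \<subseteq> spinc_group n
  by (rule spinc_group.intro[OF group_G])

sublocale spin_struct \<subseteq> metric_bundle \<Gamma> X \<rho> n V
  by (rule metric_bundle.intro[OF vbun smooth_X])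

context spin_struct
begin

lemma action_P: "smooth_action \<Gamma> (tot P) (gact P)" and gamma_SpinC: "gamma_group \<Gamma> (SpinC n) (kappa_SpinC n \<epsilon>)"
  using seb by (simp_all add: semi_equivariant_bundle_def)

lemmas gact_P = group_actionD[OF conjunct1[OF action_P[unfolded smooth_action_def]]]

lemma smooth_gact: "\<gamma> \<in> carrier \<Gamma> \<Longrightarrow> smooth_map (tot P) (tot P) (gact P \<gamma>)"
  using action_P by (simp add: smooth_action_def)

lemma group_\<Gamma>: "group \<Gamma>"
  using orient by (simp add: orientifold_def finite_orientifold_group_def)

lemma proj_gact: "\<gamma> \<in> carrier \<Gamma> \<Longrightarrow> p \<in> points (tot P) \<Longrightarrow> proj P (gact P \<gamma> p) = \<rho> \<gamma> (proj P p)"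
  using seb by (simp add: semi_equivariant_bundle_def)

lemma gact_ract: "\<gamma> \<in> carrier \<Gamma> \<Longrightarrow> p \<in> points (tot P) \<Longrightarrow> g \<in> carrier (SpinC n) \<Longrightarrow>
    gact P \<gamma> (ract P p g) = ract P (gact P \<gamma> p) (kappa_SpinC n \<epsilon> \<gamma> g)"
  using seb by (simp add: semi_equivariant_bundle_def)

lemma kappa_bij: "\<gamma> \<in> carrier \<Gamma> \<Longrightarrow> kappa_SpinC n \<epsilon> \<gamma> ` carrier (SpinC n) = carrier (SpinC n)"
  using gamma_SpinC by (auto simp: gamma_group_def iso_def bij_betw_def)

lemma phi_smooth: "smooth_map (tot P) (tot (Fr X \<rho> n V)) \<phi>"
  using str by (simp add: spin_kappa_structure_def)

lemma phi_fst: "p \<in> points (tot P) \<Longrightarrow> fst (\<phi> p) = proj P p"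
  using str by (simp add: spin_kappa_structure_def Fr_def Let_def)

lemma phi_frame: "p \<in> points (tot P) \<Longrightarrow> snd (\<phi> p) \<in> vorient V (proj P p) \<and> orthonormal (snd (\<phi> p))"
  using subsetD[OF points_Fr smooth_map_image[OF phi_smooth]] phi_fst by (metis (mono_tags, lifting) case_prodE mem_Collect_eq fst_conv snd_conv)

lemma phi_gact: "\<gamma> \<in> carrier \<Gamma> \<Longrightarrow> p \<in> points (tot P) \<Longrightarrow> \<phi> (gact P \<gamma> p) = gact (Fr X \<rho> n V) \<gamma> (\<phi> p)"
  using str by (simp add: spin_kappa_structure_def)

lemma phi_ract_Fr: "p \<in> points (tot P) \<Longrightarrow> g \<in> carrier (SpinC n) \<Longrightarrow> \<phi> (ract P p g) = ract (Fr X \<rho> n V) (\<phi> p) (AdC n g)"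
  using str by (simp add: spin_kappa_structure_def)

lemma phi_ract: "p \<in> points (tot P) \<Longrightarrow> g \<in> carrier (SpinC n) \<Longrightarrow>
    \<phi> (ract P p g) = (proj P p, frame_mult n V (snd (\<phi> p)) (AdC n g))"
  using phi_fst by (simp add: phi_ract_Fr) (simp add: Fr_def Let_def case_prod_beta')

lemma phi_central:
  assumes p: "p \<in> points (tot P)" and z: "cmod z = 1"
  shows "\<phi> (ract P p (central_U1 n z)) = \<phi> p"
proof -
  have "AdC n (central_U1 n z) = AdC n \<one>\<^bsub>SpinC n\<^esub>" by (simp add: AdC_central flip: central_U1_one)
  moreover have "\<one>\<^bsub>SpinC n\<^esub> \<in> carrier (SpinC n)" using group.is_monoid[OF group_G] by (rule monoid.one_closed)
  ultimately show ?thesis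
    using phi_ract_Fr[OF p central_U1_closed[OF z]] phi_ract_Fr[OF p, of "\<one>\<^bsub>SpinC n\<^esub>"] ract_one[OF p] by simp
qed

text \<open>If \<open>h\<close> fixes the frame of \<open>p\<close>, then the inner products of this
  frame with itself are the entries of \<open>AdC n h\<close>, so \<open>AdC n h\<close> is the
  identity matrix and \<open>h\<close> lies in the kernel.\<close>

lemma phi_kernel:
  assumes p: "p \<in> points (tot P)" and h: "h \<in> carrier (SpinC n)" and eq: "\<phi> (ract P p h) = \<phi> p"
  shows "cmod (spinc_scalar h) = 1 \<and> h = central_U1 n (spinc_scalar h)"
proof (rule AdC_kernel[OF h])
  fix i j assume ij: "i < n" "j < n"
  have f: "snd (\<phi> p) \<in> vorient V (proj P p)" "orthonormal (snd (\<phi> p))" using phi_frame[OF p] by auto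
  have "frame_mult n V (snd (\<phi> p)) (AdC n h) = snd (\<phi> p)" using phi_ract[OF p h] eq by (metis snd_conv)
  then have "AdC n h $$ (i, j) = vmetric V (snd (\<phi> p) i) (snd (\<phi> p) j)"
    using metric_frame_mult_entry[OF proj_closed[OF p] f ij(2,1), of "AdC n h"] by simp
  then show "AdC n h $$ (i, j) = (if i = j then 1 else 0)" using f(2) ij by (simp add: orthonormal_def)
qed

text \<open>This is surjectivity of Spin(n) onto the rotations of a fibre. The frames that Spin(n)
  reaches from \<open>\<phi> p\<close> form a nonempty set closed under the rotations
  \<open>Ad n g\<close>, to which \<open>frames_transitive\<close> applies.\<close>

lemma phi_transitive:
  assumes p: "p \<in> points (tot P)" and f': "f' \<in> vorient V (proj P p)" "orthonormal f'"
  shows "\<exists>g\<in>carrier (Spin n). \<phi> (ract P p (spinc_class n (g, 1))) = (proj P p, f')"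
proof -
  define Fs where "Fs = {f. \<exists>g\<in>carrier (Spin n). \<phi> (ract P p (spinc_class n (g, 1))) = (proj P p, f)}"
  have cl1: "spinc_class n (g, 1) \<in> carrier (SpinC n)" if "g \<in> carrier (Spin n)" for g
    using that by (intro spinc_class_in_SpinC) auto
  have "f' \<in> Fs"
  proof (rule frames_transitive[OF group_G proj_closed[OF p] _ _ _ f'])
    fix f assume "f \<in> Fs"
    then obtain g where g: "g \<in> carrier (Spin n)" "\<phi> (ract P p (spinc_class n (g, 1))) = (proj P p, f)"
      by (auto simp: Fs_def)
    then show "f \<in> vorient V (proj P p) \<and> orthonormal f"
      using phi_frame[OF ract_closed[OF p cl1[OF g(1)]]] proj_ract[OF p cl1[OF g(1)]] by simp
    fix h assume h: "h \<in> carrier (Spin n)"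
    have gh: "cl_mult n g h \<in> carrier (Spin n)" by (rule Spin_mult_closed[OF g(1) h])
    have "\<phi> (ract P p (spinc_class n (cl_mult n g h, 1))) = \<phi> (ract P (ract P p (spinc_class n (g, 1))) (spinc_class n (h, 1)))"
      using mult_SpinC_class[OF g(1) h, of 1 1] by (simp add: ract_mult[OF p cl1[OF g(1)] cl1[OF h]])
    also have "\<dots> = (proj P p, frame_mult n V f (Ad n h))"
      using phi_ract[OF ract_closed[OF p cl1[OF g(1)]] cl1[OF h]] g(2) proj_ract[OF p cl1[OF g(1)]]
      by (simp add: AdC_class[OF h])
    finally show "frame_mult n V f (Ad n h) \<in> Fs" using gh by (auto simp: Fs_def)
  next
    have "fst (\<phi> (ract P p (spinc_class n (cl_basis n {}, 1)))) = proj P p"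
      using p by (simp add: phi_fst ract_closed cl1 one_in_Spin proj_ract)
    then have "snd (\<phi> (ract P p (spinc_class n (cl_basis n {}, 1)))) \<in> Fs"
      unfolding Fs_def using one_in_Spin by (metis (mono_tags, lifting) mem_Collect_eq prod.collapse)
    then show "Fs \<noteq> {}" by blast
  qed
  then show ?thesis by (simp add: Fs_def)
qed

lemma gact_ract_central: "\<gamma> \<in> carrier \<Gamma> \<Longrightarrow> p \<in> points (tot P) \<Longrightarrow> cmod z = 1 \<Longrightarrow>
    gact P \<gamma> (ract P p (central_U1 n z)) = ract P (gact P \<gamma> p) (central_U1 n (kappa_U1 \<epsilon> \<gamma> z))"
  by (simp add: gact_ract central_U1_closed kappa_SpinC_central)

end

locale spin_pair = S1: spin_struct \<Gamma> \<epsilon> X \<rho> n V P \<phi> + S2: spin_struct \<Gamma> \<epsilon> X \<rho> n V P' \<phi>'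
  for \<Gamma> :: "'c monoid" and \<epsilon> :: "'c \<Rightarrow> int"
    and X :: "'x fspace" and \<rho> :: "'c \<Rightarrow> 'x \<Rightarrow> 'x"
    and n :: nat and V :: "('c, 'x, 'v) vbundle"
    and P :: "('c, 'x, 'p) spinc_bundle" and \<phi> :: "'p \<Rightarrow> 'x \<times> (nat \<Rightarrow> 'v)"
    and P' :: "('c, 'x, 'q) spinc_bundle" and \<phi>' :: "'q \<Rightarrow> 'x \<times> (nat \<Rightarrow> 'v)"
begin

definition matching :: "'x set \<Rightarrow> ('x \<Rightarrow> 'p) \<Rightarrow> ('x \<Rightarrow> 'q) \<Rightarrow> bool" where
  "matching U s s' \<longleftrightarrow> openin (ftop X) U \<and> smooth_map (sub_space X U) (tot P) s \<and> smooth_map (sub_space X U) (tot P') s' \<and>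
    (\<forall>y\<in>U. s y \<in> points (tot P) \<and> proj P (s y) = y \<and> s' y \<in> points (tot P') \<and> proj P' (s' y) = y \<and> \<phi> (s y) = \<phi>' (s' y))"

text \<open>The section of \<open>P\<close> is corrected by a lift to Spin(n) of the rotation between the two frames.\<close>

lemma matching_ex:
  assumes x: "x \<in> points X"
  shows "\<exists>U s s'. x \<in> U \<and> matching U s s'"
proof -
  obtain U1 s where s: "openin (ftop X) U1" "x \<in> U1" "smooth_map (sub_space X U1) (tot P) s"
      "\<forall>y\<in>U1. s y \<in> points (tot P) \<and> proj P (s y) = y"
    using S1.local_section[OF x] by blast
  obtain U2 s1 where s1: "openin (ftop X) U2" "x \<in> U2" "smooth_map (sub_space X U2) (tot P') s1"
      "\<forall>y\<in>U2. s1 y \<in> points (tot P') \<and> proj P' (s1 y) = y"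
    using S2.local_section[OF x] by blast
  define U where "U = U1 \<inter> U2"
  have U: "openin (ftop X) U" "x \<in> U" "U \<subseteq> U1" "U \<subseteq> U2" using s s1 by (auto simp: U_def)
  let ?K = "sub_space X U"
  have K: "smooth_space ?K" by (rule smooth_space_sub[OF S1.smooth_X])
  note fK = smooth_space_functional[OF K]
  have ptK: "points ?K = U" using openin_subset[OF U(1)] by auto
  have one: "spinc_class n (g, 1) \<in> carrier (SpinC n)" if "g \<in> carrier (Spin n)" for g
    using that by (intro spinc_class_in_SpinC) auto
  have sx: "s x \<in> points (tot P)" "proj P (s x) = x" "s1 x \<in> points (tot P')" "proj P' (s1 x) = x"
    using s s1 by auto
  \<comment> \<open>A constant element moves the section of \<open>P'\<close> so that the frames
    agree at \<open>x\<close>. The rotation between the frames is then the identity at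
    \<open>x\<close>, and nearby it is in the range of the lifting formula.\<close>
  obtain g0 where g0: "g0 \<in> carrier (Spin n)" "\<phi>' (ract P' (s1 x) (spinc_class n (g0, 1))) = (x, snd (\<phi> (s x)))"
    using S2.phi_transitive[OF sx(3), of "snd (\<phi> (s x))"] S1.phi_frame[OF sx(1)] sx by auto
  define s' where "s' y = ract P' (s1 y) (spinc_class n (g0, 1))" for y
  have smU: "smooth_map ?K (tot P) s" "smooth_map ?K (tot P') s1"
    using smooth_map_sub_mono[OF S1.smooth_X] s(3) s1(3) U by blast+
  have sm': "smooth_map ?K (tot P') s'"
    unfolding s'_def by (rule S2.smooth_map_ract[OF K smU(2) smooth_map_const[OF fK]])
      (simp add: S1.points_G one[OF g0(1)])
  have sU: "s y \<in> points (tot P)" "proj P (s y) = y" "s' y \<in> points (tot P')" "proj P' (s' y) = y" if "y \<in> U" for y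
    using that s(4) s1(4) U one[OF g0(1)] by (auto simp: s'_def S2.ract_closed S2.proj_ract)
  have match_x: "\<phi> (s x) = \<phi>' (s' x)"
    using g0(2) S1.phi_fst[OF sx(1)] sx(2) by (simp add: s'_def prod_eq_iff)
  \<comment> \<open>The matrix of the rotation from the frame of \<open>s y\<close> to that of
    \<open>s' y\<close>, read off from inner products.\<close>
  define A where "A y i j = vmetric V (snd (\<phi> (s y)) i) (snd (\<phi>' (s' y)) j)" for y i j
  define N where "N y = lift_rot n (A y) n" for y
  have A: "fsm ?K (points ?K) (\<lambda>y. A y i j)" if "i < n" "j < n" for i j
    unfolding A_def
    by (rule S1.fsm_frame_metric[OF K smooth_map_compose[OF smU(1) S1.phi_smooth] smooth_map_compose[OF sm' S2.phi_smooth] _ that])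
      (use sU in \<open>auto simp: ptK S1.phi_fst S2.phi_fst\<close>)
  have N: "fsm ?K (points ?K) (\<lambda>y. N y S)" if "S \<subseteq> {..<n}" for S
    unfolding N_def by (rule fsm_lift_rot[OF K openin_topspace A order_refl that])
  \<comment> \<open>For either lift \<open>g\<close> of the rotation at \<open>y\<close>,
    \<open>N y\<close> is \<open>g\<close> times its scalar part.\<close>
  have key: "N y S = g {} * g S"
    if y: "y \<in> U" and g: "g \<in> carrier (Spin n)" "\<phi> (ract P (s y) (spinc_class n (g, 1))) = \<phi>' (s' y)" and S: "S \<subseteq> {..<n}" for y g S
  proof -
    have "A y i j = Ad n g $$ (i, j)" if ij: "i < n" "j < n" for i j
    proof -
      have "snd (\<phi>' (s' y)) = frame_mult n V (snd (\<phi> (s y))) (Ad n g)"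
        using S1.phi_ract[OF sU(1)[OF y] one[OF g(1)]] g(2) S1.AdC_class[OF g(1), of 1] by (metis snd_conv)
      then show ?thesis
        using S1.metric_frame_mult_entry[OF _ _ _ ij(2,1), of y "snd (\<phi> (s y))" "Ad n g"]
          S1.phi_frame[OF sU(1)[OF y]] sU(2)[OF y] openin_subset[OF U(1)] y by (auto simp: A_def)
    qed
    then show ?thesis unfolding N_def by (intro S1.lift_rot_total[OF g(1) _ S]) auto
  qed
  have lift: "\<exists>g\<in>carrier (Spin n). \<phi> (ract P (s y) (spinc_class n (g, 1))) = \<phi>' (s' y)" if y: "y \<in> U" for y
  proof -
    have "\<phi>' (s' y) = (proj P (s y), snd (\<phi>' (s' y)))" using S2.phi_fst[OF sU(3)[OF y]] sU[OF y] by (simp add: prod_eq_iff)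
    then show ?thesis
      using S1.phi_transitive[OF sU(1)[OF y], of "snd (\<phi>' (s' y))"] S2.phi_frame[OF sU(3)[OF y]] sU[OF y] by simp
  qed
  have Nx: "N x {} = 1"
  proof -
    have "\<phi> (ract P (s x) (spinc_class n (cl_basis n {}, 1))) = \<phi>' (s' x)"
      using match_x S1.ract_one[OF sx(1)] by (simp add: one_SpinC)
    from key[OF U(2) one_in_Spin this, of "{}"] show ?thesis by (simp add: cl_basis_def)
  qed
  \<comment> \<open>A lift can be recovered where its scalar part is nonzero. Since
    \<open>N x {} = 1\<close>, the set \<open>W\<close> is a neighbourhood of
    \<open>x\<close>.\<close>
  define W where "W = {y \<in> points ?K. N y {} \<in> {0<..}}"
  have "continuous_map (ftop ?K) euclideanreal (\<lambda>y. N y {})"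
    using fspace_continuous[OF fK N[of "{}"]] by (simp only: subtopology_topspace empty_subsetI)
  then have "openin (ftop ?K) W" unfolding W_def by (rule openin_continuous_map_preimage) auto
  then have W: "openin (ftop X) W" "W \<subseteq> U" using U(1) openin_trans_full[of "ftop X" U W] by (auto simp: W_def)
  have xW: "x \<in> W" using U(2) Nx by (simp only: W_def ptK) simp
  let ?KW = "sub_space X W"
  have KW: "smooth_space ?KW" by (rule smooth_space_sub[OF S1.smooth_X])
  note fKW = smooth_space_functional[OF KW]
  have ptKW: "points ?KW = W" using openin_subset[OF W(1)] by auto
  \<comment> \<open>The scalar part of \<open>N y\<close> is \<open>(g {})\<^sup>2\<close>. Dividing
    \<open>N y\<close> by its square root leaves the one of \<open>g\<close> and its negative that
    has positive scalar part, a choice that depends smoothly on \<open>y\<close>.\<close>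
  define \<sigma> where "\<sigma> y = (\<lambda>S\<in>Pow {..<n}. N y S * N y {} powr (-1/2))" for y
  have \<sigma>: "\<sigma> y \<in> carrier (Spin n) \<and> \<phi> (ract P (s y) (spinc_class n (\<sigma> y, 1))) = \<phi>' (s' y)" if y: "y \<in> W" for y
  proof -
    have yU: "y \<in> U" using y W by auto
    obtain g where g: "g \<in> carrier (Spin n)" "\<phi> (ract P (s y) (spinc_class n (g, 1))) = \<phi>' (s' y)" using lift[OF yU] by blast
    note gN = key[OF yU g]
    have pos: "g {} * g {} > 0" using y gN[of "{}"] by (simp add: W_def)
    then have g0: "g {} \<noteq> 0" by auto
    have pw: "(g {} * g {}) powr (-1/2) = 1 / \<bar>g {}\<bar>"
      using pos by (simp add: powr_minus powr_half_sqrt real_sqrt_mult_self inverse_eq_divide)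
    have \<sigma>S: "\<sigma> y S = (if g {} > 0 then g S else - g S)" if "S \<subseteq> {..<n}" for S
    proof -
      have "\<sigma> y S = N y S * N y {} powr (-1/2)" using that by (simp add: \<sigma>_def)
      also have "\<dots> = g {} * g S * (1 / \<bar>g {}\<bar>)" by (simp only: gN[OF that] gN[OF empty_subsetI] pw)
      finally show ?thesis using g0 by (auto simp: abs_if)
    qed
    have el: "\<sigma> y \<in> cl_elements n" by (simp add: \<sigma>_def cl_elements_def)
    have "\<sigma> y = g \<or> \<sigma> y = cl_neg n g"
    proof (cases "g {} > 0")
      case True
      have "\<sigma> y = g" by (rule cl_elements_eqI[OF el Spin_elements[OF g(1)]]) (simp add: \<sigma>S True)
      then show ?thesis ..
    next
      case False
      have "\<sigma> y = cl_neg n g" by (rule cl_elements_eqI[OF el cl_neg_elements]) (simp add: \<sigma>S False cl_neg_apply)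
      then show ?thesis ..
    qed
    then have 1: "\<sigma> y \<in> carrier (Spin n)" "Ad n (\<sigma> y) = Ad n g"
      using g(1) cl_neg_Spin S1.Ad_neg by auto
    have "AdC n (spinc_class n (\<sigma> y, 1)) = AdC n (spinc_class n (g, 1))"
      using 1 by (simp add: S1.AdC_class g(1))
    then show ?thesis using 1 g S1.phi_ract[OF sU(1)[OF yU] one] by simp
  qed
  have smW: "smooth_map ?KW (tot P) s" "smooth_map ?KW (tot P') s'"
    using smooth_map_sub_mono[OF S1.smooth_X] smU sm' W(2) by blast+
  have NW: "fsm ?KW (points ?KW) (\<lambda>y. N y S)" if "S \<subseteq> {..<n}" for S
  proof -
    have "fsm ?K (points ?K) (\<lambda>y. N y S)" by (rule N[OF that])
    then have "fsm X U (\<lambda>y. N y S)"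
      using functional_space_sub_open_iff[OF smooth_space_functional[OF S1.smooth_X] U(1)] unfolding ptK by blast
    then have "fsm X W (\<lambda>y. N y S)"
      using fspace_restrict[OF smooth_space_functional[OF S1.smooth_X] _ W] by blast
    then show ?thesis
      using functional_space_sub_open_iff[OF smooth_space_functional[OF S1.smooth_X] W(1)] unfolding ptKW by blast
  qed
  have pw: "fsm ?KW (points ?KW) (\<lambda>y. N y {} powr (-1/2))"
    by (rule fsm_powr[OF KW NW]) (auto simp: ptKW W_def simp del: points_sub_space)
  have "smooth_map ?KW (euclidean_fspace (Pow {..<n})) \<sigma>"
  proof (rule smooth_map_into_euclidean[OF KW])
    fix S assume "S \<in> Pow {..<n}"
    then show "fsm ?KW (points ?KW) (\<lambda>y. \<sigma> y S)"
      using fspace_mult[OF fKW NW[of S] pw] by (simp add: \<sigma>_def)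
  qed (auto simp: \<sigma>_def)
  then have sm\<sigma>: "smooth_map ?KW (lsp (Spin n)) \<sigma>"
    unfolding lsp_Spin
    by (rule smooth_map_into_sub[OF fKW smooth_space_functional[OF smooth_space_euclidean]]) (use \<sigma> ptKW in blast)
  define s2 where "s2 y = ract P (s y) (spinc_class n (\<sigma> y, 1))" for y
  have "smooth_map ?KW (tot P) s2"
    unfolding s2_def
    by (intro S1.smooth_map_ract[OF KW smW(1)] smooth_map_spinc_class[OF KW sm\<sigma>] smooth_map_const[OF fKW]) simp
  moreover have "s2 y \<in> points (tot P) \<and> proj P (s2 y) = y \<and> \<phi> (s2 y) = \<phi>' (s' y)" if y: "y \<in> W" for y
    using \<sigma>[OF y] sU(1,2)[of y] y W(2) one by (auto simp: s2_def S1.ract_closed S1.proj_ract)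
  ultimately have "matching W s2 s'"
    unfolding matching_def using W smW(2) sU(3,4) by auto
  then show ?thesis using xW by blast
qed

section \<open>The fibre product of \<open>P\<close> and \<open>P'\<close> over the frame
  bundle\<close>

definition E :: "('p \<times> 'q) set" where
  "E = {(p, p'). p \<in> points (tot P) \<and> p' \<in> points (tot P') \<and> \<phi> p = \<phi>' p'}"

abbreviation ES :: "('p \<times> 'q) fspace" where
  "ES \<equiv> sub_space (prod_space (tot P) (tot P')) E"

definition orb :: "'p \<times> 'q \<Rightarrow> ('p \<times> 'q) set" where
  "orb a = (\<lambda>g. (ract P (fst a) g, ract P' (snd a) g)) ` carrier (SpinC n)"

lemma E_iff: "(p, p') \<in> E \<longleftrightarrow> p \<in> points (tot P) \<and> p' \<in> points (tot P') \<and> \<phi> p = \<phi>' p'"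
  by (simp add: E_def)

lemma E_proj: "(p, p') \<in> E \<Longrightarrow> proj P' p' = proj P p"
  using S1.phi_fst S2.phi_fst by (metis E_iff)

lemma smooth_ES: "smooth_space ES"
  by (intro smooth_space_sub smooth_space_prod_space S1.smooth_P S2.smooth_P)

lemma points_ES: "points ES = E"
  by (auto simp: E_def)

lemma E_ract: "(p, p') \<in> E \<Longrightarrow> g \<in> carrier (SpinC n) \<Longrightarrow> (ract P p g, ract P' p' g) \<in> E"
  by (simp add: E_iff S1.ract_closed S2.ract_closed S1.phi_ract_Fr S2.phi_ract_Fr)

lemma E_central: "(p, p') \<in> E \<Longrightarrow> cmod z = 1 \<Longrightarrow> (p, ract P' p' (central_U1 n z)) \<in> E"
  by (simp add: E_iff S2.ract_closed central_U1_closed S2.phi_central)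

lemma E_gact: "(p, p') \<in> E \<Longrightarrow> \<gamma> \<in> carrier \<Gamma> \<Longrightarrow> (gact P \<gamma> p, gact P' \<gamma> p') \<in> E"
  by (simp add: E_iff S1.gact_P S2.gact_P S1.phi_gact S2.phi_gact)

lemma one_SpinC_closed: "\<one>\<^bsub>SpinC n\<^esub> \<in> carrier (SpinC n)"
  using S1.group_G by (simp add: group.is_monoid monoid.one_closed)

lemma orb_self: "(p, p') \<in> E \<Longrightarrow> (p, p') \<in> orb (p, p')"
  unfolding orb_def using S1.ract_one S2.ract_one one_SpinC_closed
  by (intro image_eqI[of _ _ "\<one>\<^bsub>SpinC n\<^esub>"]) (auto simp: E_iff)

lemma orb_ract:
  assumes a: "(p, p') \<in> E" and g: "g \<in> carrier (SpinC n)"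
  shows "orb (ract P p g, ract P' p' g) = orb (p, p')"
proof -
  interpret group "SpinC n" by (rule S1.group_G)
  have "orb (ract P p g, ract P' p' g) = (\<lambda>h. (ract P p h, ract P' p' h)) ` ((\<lambda>h. g \<otimes>\<^bsub>SpinC n\<^esub> h) ` carrier (SpinC n))"
    unfolding orb_def image_image
    by (rule image_cong) (use a g in \<open>auto simp: E_iff S1.ract_mult S2.ract_mult\<close>)
  also have "(\<lambda>h. g \<otimes>\<^bsub>SpinC n\<^esub> h) ` carrier (SpinC n) = carrier (SpinC n)"
    using g by (simp add: surj_const_mult)
  finally show ?thesis by (simp add: orb_def)
qed

lemma orb_cases:
  assumes "(p, p') \<in> E" "b \<in> orb (p, p')"
  shows "\<exists>g\<in>carrier (SpinC n). b = (ract P p g, ract P' p' g)"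
  using assms by (auto simp: orb_def)

text \<open>The element of U(1) by which two points of \<open>E\<close> over the same base point differ modulo the diagonal action.\<close>

definition zeta :: "'p \<times> 'q \<Rightarrow> 'p \<times> 'q \<Rightarrow> complex" where
  "zeta a b = spinc_scalar (inv\<^bsub>SpinC n\<^esub> (S1.pdiv (fst a) (fst b)) \<otimes>\<^bsub>SpinC n\<^esub> S2.pdiv (snd a) (snd b))"

text \<open>Let \<open>k\<close> and \<open>k'\<close> carry \<open>q\<close> to \<open>p\<close>
  and \<open>q'\<close> to \<open>p'\<close>. Since \<open>q\<close> and \<open>q'\<close> have the
  same frame, so have \<open>q' k\<close> and \<open>q k = p\<close>, and \<open>p\<close> has the
  frame of \<open>p' = q' k'\<close>. Hence \<open>k\<^sup>-\<^sup>1 k'\<close> fixes the frame of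
  \<open>q' k\<close>, lies in the kernel of \<open>Ad\<^sup>c\<close> and is central, so it may be
  moved in front of \<open>k\<close>.\<close>

lemma zeta_central:
  assumes a: "(q, q') \<in> E" and b: "(p, p') \<in> E" and eq: "proj P q = proj P p"
  shows "cmod (zeta (q, q') (p, p')) = 1"
    and "inv\<^bsub>SpinC n\<^esub> (S1.pdiv q p) \<otimes>\<^bsub>SpinC n\<^esub> S2.pdiv q' p' = central_U1 n (zeta (q, q') (p, p'))"
    and "ract P' (ract P' q' (central_U1 n (zeta (q, q') (p, p')))) (S1.pdiv q p) = p'"
proof -
  interpret group "SpinC n" by (rule S1.group_G)
  have pts: "q \<in> points (tot P)" "p \<in> points (tot P)" "q' \<in> points (tot P')" "p' \<in> points (tot P')"
    "\<phi> q = \<phi>' q'" "\<phi> p = \<phi>' p'" "proj P' q' = proj P' p'"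
    using a b E_proj[OF a] E_proj[OF b] eq by (auto simp: E_iff)
  let ?k = "S1.pdiv q p" and ?k' = "S2.pdiv q' p'"
  have k: "?k \<in> carrier (SpinC n)" "ract P q ?k = p" using S1.pdiv[OF pts(1,2) eq] by auto
  have k': "?k' \<in> carrier (SpinC n)" "ract P' q' ?k' = p'" using S2.pdiv[OF pts(3,4,7)] by auto
  let ?h = "inv\<^bsub>SpinC n\<^esub> ?k \<otimes>\<^bsub>SpinC n\<^esub> ?k'"
  have h: "?h \<in> carrier (SpinC n)" using k k' by simp
  have kh: "?k \<otimes>\<^bsub>SpinC n\<^esub> ?h = ?k'" using k k' by (simp add: m_assoc[symmetric])
  have qk: "ract P' q' ?k \<in> points (tot P')" using pts k by (simp add: S2.ract_closed)
  have "\<phi>' (ract P' (ract P' q' ?k) ?h) = \<phi>' p'"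
    using pts k h kh k' by (simp add: S2.ract_mult)
  also have "\<dots> = \<phi> (ract P q ?k)" using pts k by simp
  also have "\<dots> = \<phi>' (ract P' q' ?k)"
    unfolding S1.phi_ract_Fr[OF pts(1) k(1)] S2.phi_ract_Fr[OF pts(3) k(1)] pts(5) ..
  finally have "cmod (spinc_scalar ?h) = 1 \<and> ?h = central_U1 n (spinc_scalar ?h)"
    by (rule S2.phi_kernel[OF qk h])
  then show 1: "cmod (zeta (q, q') (p, p')) = 1" "?h = central_U1 n (zeta (q, q') (p, p'))"
    by (auto simp: zeta_def)
  have "ract P' (ract P' q' (central_U1 n (zeta (q, q') (p, p')))) ?k = ract P' q' (central_U1 n (zeta (q, q') (p, p')) \<otimes>\<^bsub>SpinC n\<^esub> ?k)"
    using pts k 1(1) by (simp add: S2.ract_mult central_U1_closed)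
  also have "\<dots> = ract P' q' (?k \<otimes>\<^bsub>SpinC n\<^esub> ?h)" using 1(2) k by (simp add: central_U1_commute)
  finally show "ract P' (ract P' q' (central_U1 n (zeta (q, q') (p, p')))) ?k = p'" using kh k' by simp
qed

text \<open>Translating by the inverse of \<open>S1.pdiv q p\<close> moves the first component to
  \<open>q\<close>; the second one becomes \<open>q'\<close> times an element of U(1). This is the
  normal form of an orbit on which the local trivialisations of \<open>L\<close> rest.\<close>

lemma orb_zeta:
  assumes a: "(q, q') \<in> E" and b: "(p, p') \<in> E" and eq: "proj P q = proj P p"
  shows "orb (p, p') = orb (q, ract P' q' (central_U1 n (zeta (q, q') (p, p'))))"
proof -
  have pts: "q \<in> points (tot P)" "p \<in> points (tot P)" using a b by (auto simp: E_iff)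
  note z = zeta_central[OF a b eq]
  have "(p, p') = (ract P q (S1.pdiv q p), ract P' (ract P' q' (central_U1 n (zeta (q, q') (p, p')))) (S1.pdiv q p))"
    using z(3) S1.pdiv(2)[OF pts eq] by simp
  then show ?thesis using orb_ract[OF E_central[OF a z(1)] S1.pdiv(1)[OF pts eq]] by simp
qed

text \<open>Both translation elements are multiplied by \<open>g\<close> on the right, so their
  ratio is conjugated by \<open>g\<close>, which fixes a central element.\<close>

lemma zeta_ract:
  assumes a: "(q, q') \<in> E" and b: "(p, p') \<in> E" and eq: "proj P q = proj P p" and g: "g \<in> carrier (SpinC n)"
  shows "zeta (q, q') (ract P p g, ract P' p' g) = zeta (q, q') (p, p')"
proof -
  interpret group "SpinC n" by (rule S1.group_G)
  have pts: "q \<in> points (tot P)" "p \<in> points (tot P)" "q' \<in> points (tot P')" "p' \<in> points (tot P')" "proj P' q' = proj P' p'"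
    using a b E_proj[OF a] E_proj[OF b] eq by (auto simp: E_iff)
  note k = S1.pdiv(1)[OF pts(1,2) eq] S2.pdiv(1)[OF pts(3,4,5)]
  note z = zeta_central[OF a b eq]
  let ?k = "S1.pdiv q p" and ?k' = "S2.pdiv q' p'"
  have "inv\<^bsub>SpinC n\<^esub> (?k \<otimes>\<^bsub>SpinC n\<^esub> g) \<otimes>\<^bsub>SpinC n\<^esub> (?k' \<otimes>\<^bsub>SpinC n\<^esub> g)
      = inv\<^bsub>SpinC n\<^esub> g \<otimes>\<^bsub>SpinC n\<^esub> ((inv\<^bsub>SpinC n\<^esub> ?k \<otimes>\<^bsub>SpinC n\<^esub> ?k') \<otimes>\<^bsub>SpinC n\<^esub> g)"
    using k g by (simp add: inv_mult_group m_assoc)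
  also have "\<dots> = inv\<^bsub>SpinC n\<^esub> g \<otimes>\<^bsub>SpinC n\<^esub> (g \<otimes>\<^bsub>SpinC n\<^esub> central_U1 n (zeta (q, q') (p, p')))"
    unfolding z(2) using central_U1_commute[OF g] by simp
  also have "\<dots> = central_U1 n (zeta (q, q') (p, p'))"
    using g central_U1_closed[OF z(1)] by (simp add: m_assoc[symmetric])
  finally show ?thesis
    unfolding zeta_def fst_conv snd_conv S1.pdiv_ract_right[OF pts(1,2) eq g] S2.pdiv_ract_right[OF pts(3,4,5) g]
    by (simp add: spinc_scalar_central zeta_def)
qed

lemma zeta_mult:
  assumes a: "(q, q') \<in> E" and b: "(p, p') \<in> E" and eq: "proj P q = proj P p" and w: "cmod w = 1"
  shows "zeta (q, q') (p, ract P' p' (central_U1 n w)) = zeta (q, q') (p, p') * w"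
proof -
  interpret group "SpinC n" by (rule S1.group_G)
  have pts: "q \<in> points (tot P)" "p \<in> points (tot P)" "q' \<in> points (tot P')" "p' \<in> points (tot P')" "proj P' q' = proj P' p'"
    using a b E_proj[OF a] E_proj[OF b] eq by (auto simp: E_iff)
  note k = S1.pdiv(1)[OF pts(1,2) eq] S2.pdiv(1)[OF pts(3,4,5)]
  note z = zeta_central[OF a b eq]
  have "inv\<^bsub>SpinC n\<^esub> (S1.pdiv q p) \<otimes>\<^bsub>SpinC n\<^esub> (S2.pdiv q' p' \<otimes>\<^bsub>SpinC n\<^esub> central_U1 n w)
      = central_U1 n (zeta (q, q') (p, p') * w)"
    using k central_U1_closed[OF w] z(2) by (simp add: m_assoc[symmetric] central_U1_mult)
  then show ?thesis
    unfolding zeta_def[of _ "(p, ract P' p' (central_U1 n w))"] fst_conv snd_conv S2.pdiv_ract_right[OF pts(3,4,5) central_U1_closed[OF w]]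
    by (simp add: spinc_scalar_central)
qed

lemma zeta_self: "(q, q') \<in> E \<Longrightarrow> zeta (q, q') (q, q') = 1"
proof -
  interpret group "SpinC n" by (rule S1.group_G)
  assume a: "(q, q') \<in> E"
  then have pd: "S1.pdiv q q = \<one>\<^bsub>SpinC n\<^esub>" "S2.pdiv q' q' = \<one>\<^bsub>SpinC n\<^esub>"
    using S1.pdiv_unique[of q "\<one>\<^bsub>SpinC n\<^esub>"] S2.pdiv_unique[of q' "\<one>\<^bsub>SpinC n\<^esub>"] one_SpinC_closed
    by (auto simp: E_iff S1.ract_one S2.ract_one)
  have "inv\<^bsub>SpinC n\<^esub> \<one>\<^bsub>SpinC n\<^esub> \<otimes>\<^bsub>SpinC n\<^esub> \<one>\<^bsub>SpinC n\<^esub> = central_U1 n 1" by (simp add: central_U1_one)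
  then show ?thesis by (simp only: zeta_def fst_conv snd_conv pd spinc_scalar_central)
qed

text \<open>U(1) acts on the values of an isomorphism, the second components of its graph. The
  projection is constant on an orbit, so an arbitrary element may represent it. The action of the
  orientifold group is restricted to the total space because group actions consist of extensional
  maps.\<close>

definition L :: "('c, 'x, complex, ('p \<times> 'q) set) pbundle" where
  "L = \<lparr>tot = quot_space ES orb,
        proj = (\<lambda>A. proj P (fst (SOME a. a \<in> A))),
        ract = (\<lambda>A z. (\<lambda>(p, p'). (p, ract P' p' (central_U1 n z))) ` A),
        gact = (\<lambda>\<gamma>. \<lambda>A\<in>orb ` E. (\<lambda>(p, p'). (gact P \<gamma> p, gact P' \<gamma> p')) ` A)\<rparr>"

lemma tot_L: "tot L = quot_space ES orb" by (simp add: L_def)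

lemma points_L: "points (tot L) = orb ` E"
  unfolding tot_L using points_ES by simp

lemma smooth_L: "smooth_space (tot L)"
  unfolding tot_L by (rule smooth_space_quot[OF smooth_ES])

lemma some_orb: "a \<in> E \<Longrightarrow> (SOME b. b \<in> orb a) \<in> orb a"
  by (rule someI[of _ a]) (use orb_self[of "fst a" "snd a"] in auto)

lemma proj_L: "(p, p') \<in> E \<Longrightarrow> proj L (orb (p, p')) = proj P p"
  using orb_cases[OF _ some_orb[of "(p, p')"]] by (auto simp: L_def E_iff S1.proj_ract)

lemma ract_L:
  assumes a: "(p, p') \<in> E" and z: "cmod z = 1"
  shows "ract L (orb (p, p')) z = orb (p, ract P' p' (central_U1 n z))"
proof -
  have "ract P' (ract P' p' g) (central_U1 n z) = ract P' (ract P' p' (central_U1 n z)) g" if "g \<in> carrier (SpinC n)" for g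
    using that a z central_U1_closed[OF z, of n] by (simp add: E_iff S2.ract_mult central_U1_commute)
  then show ?thesis by (simp add: L_def orb_def image_image cong: image_cong)
qed

text \<open>The actions on \<open>P\<close> and \<open>P'\<close> are twisted by the same
  automorphism \<open>kappa_SpinC n \<epsilon> \<gamma>\<close>. It permutes Spin^c(n), so the image
  of an orbit is an orbit.\<close>

lemma gact_L:
  assumes a: "(p, p') \<in> E" and \<gamma>: "\<gamma> \<in> carrier \<Gamma>"
  shows "gact L \<gamma> (orb (p, p')) = orb (gact P \<gamma> p, gact P' \<gamma> p')"
proof -
  have "gact L \<gamma> (orb (p, p')) = (\<lambda>g. (gact P \<gamma> (ract P p g), gact P' \<gamma> (ract P' p' g))) ` carrier (SpinC n)"
    using a by (simp add: L_def) (simp add: orb_def image_image)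
  also have "\<dots> = (\<lambda>g. (ract P (gact P \<gamma> p) g, ract P' (gact P' \<gamma> p') g)) ` (kappa_SpinC n \<epsilon> \<gamma> ` carrier (SpinC n))"
    unfolding image_image by (rule image_cong) (use a \<gamma> in \<open>auto simp: E_iff S1.gact_ract S2.gact_ract\<close>)
  finally show ?thesis by (simp add: S1.kappa_bij[OF \<gamma>] orb_def)
qed

lemma L_cases:
  assumes "A \<in> points (tot L)"
  obtains p p' where "(p, p') \<in> E" "A = orb (p, p')"
  using assms by (auto simp: points_L)

lemma smooth_orb: "smooth_map ES (tot L) orb"
  unfolding tot_L by (rule smooth_map_quot[OF smooth_space_functional[OF smooth_ES]])

lemma smooth_ES_fst: "smooth_map ES (tot P) fst" and smooth_ES_snd: "smooth_map ES (tot P') snd"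
proof -
  note f = smooth_space_functional[OF S1.smooth_P] smooth_space_functional[OF S2.smooth_P]
    smooth_space_functional[OF smooth_space_prod_space[OF S1.smooth_P S2.smooth_P]]
  show "smooth_map ES (tot P) fst" by (rule smooth_map_restrict[OF f(3) smooth_map_fst[OF f(1)]])
  show "smooth_map ES (tot P') snd" by (rule smooth_map_restrict[OF f(3) smooth_map_snd[OF f(2)]])
qed

lemma smooth_into_ES:
  assumes K: "smooth_space K" and "smooth_map K (tot P) f" "smooth_map K (tot P') g"
    and "\<And>x. x \<in> points K \<Longrightarrow> (f x, g x) \<in> E"
  shows "smooth_map K ES (\<lambda>x. (f x, g x))"
  by (rule smooth_map_into_sub[OF smooth_space_functional[OF K] smooth_space_functional[OF smooth_space_prod_space[OF S1.smooth_P S2.smooth_P]]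
        smooth_map_pair[OF K assms(2,3)] assms(4)])

lemma smooth_proj_L: "smooth_map (tot L) X (proj L)"
  unfolding tot_L
proof (rule smooth_map_from_quot[OF smooth_space_functional[OF S1.smooth_X]])
  show "smooth_map ES X (\<lambda>a. proj L (orb a))"
    by (rule smooth_map_cong[OF smooth_space_functional[OF smooth_ES] smooth_map_compose[OF smooth_ES_fst S1.smooth_proj]])
      (auto simp: points_ES proj_L simp del: points_sub_space)
qed

section \<open>Local trivialisations of \<open>L\<close>\<close>

definition over :: "'x set \<Rightarrow> ('p \<times> 'q) set set" where
  "over U = {A \<in> points (tot L). proj L A \<in> U}"

text \<open>The pair \<open>(s, s')\<close> serves as a reference isomorphism over each base point,
  and the U(1) coordinate is the deviation from it. By \<open>zeta_ract\<close> all elements of an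
  orbit give the same value.\<close>

definition tri :: "('x \<Rightarrow> 'p) \<Rightarrow> ('x \<Rightarrow> 'q) \<Rightarrow> ('p \<times> 'q) set \<Rightarrow> 'x \<times> complex" where
  "tri s s' A = (proj L A, zeta (s (proj L A), s' (proj L A)) (SOME a. a \<in> A))"

definition tri_inv :: "('x \<Rightarrow> 'p) \<Rightarrow> ('x \<Rightarrow> 'q) \<Rightarrow> 'x \<times> complex \<Rightarrow> ('p \<times> 'q) set" where
  "tri_inv s s' yz = orb (s (fst yz), ract P' (s' (fst yz)) (central_U1 n (snd yz)))"

context
  fixes U s s' assumes match: "matching U s s'"
begin

lemma openU: "openin (ftop X) U" and U_sub: "U \<subseteq> points X" and s_smooth: "smooth_map (sub_space X U) (tot P) s"
  and s'_smooth: "smooth_map (sub_space X U) (tot P') s'"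
  using match openin_subset by (auto simp: matching_def)

lemma s_E: "y \<in> U \<Longrightarrow> (s y, s' y) \<in> E" and s_proj: "y \<in> U \<Longrightarrow> proj P (s y) = y"
  and s'_proj: "y \<in> U \<Longrightarrow> proj P' (s' y) = y"
  using match by (auto simp: matching_def E_iff)

lemma over_open: "openin (ftop (tot L)) (over U)"
  unfolding over_def by (rule smooth_map_preimage_open[OF smooth_proj_L openU])

lemma tri_orb:
  assumes a: "(p, p') \<in> E" and "proj P p \<in> U"
  shows "tri s s' (orb (p, p')) = (proj P p, zeta (s (proj P p), s' (proj P p)) (p, p'))"
proof -
  obtain g where g: "g \<in> carrier (SpinC n)" "(SOME b. b \<in> orb (p, p')) = (ract P p g, ract P' p' g)"
    using orb_cases[OF a some_orb[OF a]] by blast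
  show ?thesis
    using zeta_ract[OF s_E[OF assms(2)] a _ g(1)] s_proj[OF assms(2)] by (simp add: tri_def proj_L[OF a] g(2))
qed

lemma tri_closed:
  assumes "A \<in> over U"
  shows "fst (tri s s' A) = proj L A" "cmod (snd (tri s s' A)) = 1"
proof -
  obtain p p' where p: "(p, p') \<in> E" "A = orb (p, p')" "proj P p \<in> U"
    using assms by (auto simp: over_def proj_L elim!: L_cases)
  show "fst (tri s s' A) = proj L A" by (simp add: tri_def)
  show "cmod (snd (tri s s' A)) = 1"
    using zeta_central(1)[OF s_E[OF p(3)] p(1)] s_proj[OF p(3)] by (simp add: p(2) tri_orb[OF p(1,3)])
qed

lemma tri_inv_tri: "A \<in> over U \<Longrightarrow> tri_inv s s' (tri s s' A) = A"
proof -
  assume "A \<in> over U"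
  then obtain p p' where p: "(p, p') \<in> E" "A = orb (p, p')" "proj P p \<in> U"
    by (auto simp: over_def proj_L elim!: L_cases)
  have "tri_inv s s' (tri s s' A) = orb (s (proj P p), ract P' (s' (proj P p)) (central_U1 n (zeta (s (proj P p), s' (proj P p)) (p, p'))))"
    by (simp add: p(2) tri_orb[OF p(1,3)] tri_inv_def)
  also have "\<dots> = A" unfolding p(2) by (rule orb_zeta[OF s_E[OF p(3)] p(1) s_proj[OF p(3)], symmetric])
  finally show ?thesis .
qed

lemma tri_inv_E: "y \<in> U \<Longrightarrow> cmod z = 1 \<Longrightarrow> (s y, ract P' (s' y) (central_U1 n z)) \<in> E"
  by (rule E_central[OF s_E])

lemma tri_inv_over: "y \<in> U \<Longrightarrow> cmod z = 1 \<Longrightarrow> tri_inv s s' (y, z) \<in> over U"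
  using tri_inv_E[of y z] by (simp add: tri_inv_def over_def proj_L s_proj points_L)

lemma tri_tri_inv: "y \<in> U \<Longrightarrow> cmod z = 1 \<Longrightarrow> tri s s' (tri_inv s s' (y, z)) = (y, z)"
  using tri_inv_E[of y z] zeta_mult[OF s_E s_E, of y y z] zeta_self[OF s_E, of y]
  by (simp add: tri_inv_def tri_orb s_proj)

text \<open>The universal property of the quotient moves the question to the open preimage in
  \<open>ES\<close>, where \<open>zeta\<close> is composed of translation functions, group
  operations and \<open>spinc_scalar\<close>.\<close>

lemma smooth_tri: "smooth_map (sub_space (tot L) (over U)) (prod_space (sub_space X U) (lsp U1)) (tri s s')"
proof -
  let ?W = "{a \<in> points ES. orb a \<in> over U}"
  let ?K = "sub_space ES ?W"
  have K: "smooth_space ?K" by (rule smooth_space_sub[OF smooth_ES])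
  note fK = smooth_space_functional[OF K]
  have XU: "smooth_space (sub_space X U)" by (rule smooth_space_sub[OF S1.smooth_X])
  have pt: "(fst a, snd a) \<in> E" "proj P (fst a) \<in> U" if "a \<in> points ?K" for a
  proof -
    from that have a: "a \<in> E" "orb a \<in> over U" using points_ES by auto
    then show "(fst a, snd a) \<in> E" "proj P (fst a) \<in> U" using proj_L[of "fst a" "snd a"] by (auto simp: over_def)
  qed
  have f1: "smooth_map ?K (tot P) fst" and f2: "smooth_map ?K (tot P') snd"
    by (intro smooth_map_restrict smooth_space_functional smooth_ES smooth_ES_fst smooth_ES_snd)+
  have pr: "smooth_map ?K (sub_space X U) (\<lambda>a. proj P (fst a))"
    by (rule smooth_map_into_sub[OF fK smooth_space_functional[OF S1.smooth_X] smooth_map_compose[OF f1 S1.smooth_proj] pt(2)])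
  have d1: "smooth_map ?K (lsp (SpinC n)) (\<lambda>a. S1.pdiv (s (proj P (fst a))) (fst a))"
    by (rule S1.smooth_map_pdiv[OF K smooth_map_compose[OF pr s_smooth] f1]) (simp add: s_proj pt(2) del: points_sub_space)
  have d2: "smooth_map ?K (lsp (SpinC n)) (\<lambda>a. S2.pdiv (s' (proj P (fst a))) (snd a))"
    by (rule S2.smooth_map_pdiv[OF K smooth_map_compose[OF pr s'_smooth] f2])
      (simp add: s'_proj pt(2) E_proj[OF pt(1)] del: points_sub_space)
  have h: "smooth_map ?K (lsp (SpinC n)) (\<lambda>a. inv\<^bsub>SpinC n\<^esub> (S1.pdiv (s (proj P (fst a))) (fst a)) \<otimes>\<^bsub>SpinC n\<^esub> S2.pdiv (s' (proj P (fst a))) (snd a))"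
    by (intro smooth_map_lie_mult smooth_map_lie_inv K S1.lie d1 d2)
  have hc: "(inv\<^bsub>SpinC n\<^esub> (S1.pdiv (s (proj P (fst a))) (fst a)) \<otimes>\<^bsub>SpinC n\<^esub> S2.pdiv (s' (proj P (fst a))) (snd a)) \<in> points (lsp (SpinC n))"
    if "a \<in> points ?K" for a using smooth_map_image[OF h that] .
  have z1: "cmod (zeta (s (proj P (fst a)), s' (proj P (fst a))) (fst a, snd a)) = 1" if "a \<in> points ?K" for a
    by (rule zeta_central(1)[OF s_E[OF pt(2)[OF that]] pt(1)[OF that] s_proj[OF pt(2)[OF that]]])
  have "smooth_map ?K (lsp U1) (\<lambda>a. zeta (s (proj P (fst a)), s' (proj P (fst a))) (fst a, snd a))"
  proof (rule smooth_map_into_U1[OF K _ _ z1])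
    show "fsm ?K (points ?K) (\<lambda>a. Re (zeta (s (proj P (fst a)), s' (proj P (fst a))) (fst a, snd a)))"
      unfolding zeta_def fst_conv snd_conv by (rule smooth_map_fsm_total[OF h fsm_spinc_scalar(1) hc])
    show "fsm ?K (points ?K) (\<lambda>a. Im (zeta (s (proj P (fst a)), s' (proj P (fst a))) (fst a, snd a)))"
      unfolding zeta_def fst_conv snd_conv by (rule smooth_map_fsm_total[OF h fsm_spinc_scalar(2) hc])
  qed
  from smooth_map_pair[OF K pr this]
  have "smooth_map ?K (prod_space (sub_space X U) (lsp U1)) (\<lambda>a. (proj P (fst a), zeta (s (proj P (fst a)), s' (proj P (fst a))) (fst a, snd a)))" .
  then have "smooth_map ?K (prod_space (sub_space X U) (lsp U1)) (\<lambda>a. tri s s' (orb a))"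
    by (rule smooth_map_cong[OF fK]) (use tri_orb[OF pt(1) pt(2)] in \<open>auto simp del: points_sub_space\<close>)
  then show ?thesis
    using over_open unfolding tot_L
    by (intro smooth_map_from_quot_sub smooth_ES smooth_space_functional smooth_space_prod_space XU smooth_space_U1)
qed

lemma smooth_tri_inv: "smooth_map (prod_space (sub_space X U) (lsp U1)) (sub_space (tot L) (over U)) (tri_inv s s')"
proof -
  have XU: "smooth_space (sub_space X U)" by (rule smooth_space_sub[OF S1.smooth_X])
  let ?K = "prod_space (sub_space X U) (lsp U1)"
  have K: "smooth_space ?K" by (intro smooth_space_prod_space XU smooth_space_U1)
  have pt: "fst a \<in> U" "cmod (snd a) = 1" if "a \<in> points ?K" for a using that by auto
  have z: "smooth_map ?K (lsp U1) snd" by (rule smooth_map_snd[OF smooth_space_functional[OF smooth_space_U1]])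
  have "smooth_map ?K ES (\<lambda>a. (s (fst a), ract P' (s' (fst a)) (central_U1 n (snd a))))"
    by (rule smooth_into_ES[OF K smooth_map_compose_fst[OF XU s_smooth]
          S2.smooth_map_ract[OF K smooth_map_compose_fst[OF XU s'_smooth] smooth_map_central_U1[OF K z]]])
      (simp add: tri_inv_E pt del: ftop_prod_space)
  from smooth_map_compose[OF this smooth_orb]
  have "smooth_map ?K (tot L) (tri_inv s s')" by (simp add: tri_inv_def[abs_def])
  then show ?thesis
    by (rule smooth_map_into_sub[OF smooth_space_functional[OF K] smooth_space_functional[OF smooth_L]])
      (use tri_inv_over pt in \<open>metis prod.collapse\<close>)
qed

lemma diffeo_tri: "diffeo (sub_space (tot L) (over U)) (prod_space (sub_space X U) (lsp U1)) (tri s s')"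
  by (rule diffeoI[OF smooth_tri smooth_tri_inv]) (use tri_inv_tri tri_tri_inv in auto)

lemma tri_ract:
  assumes "A \<in> over U" "cmod z = 1"
  shows "tri s s' (ract L A z) = (proj L A, snd (tri s s' A) * z)"
proof -
  obtain p p' where p: "(p, p') \<in> E" "A = orb (p, p')" "proj P p \<in> U"
    using assms(1) by (auto simp: over_def proj_L elim!: L_cases)
  show ?thesis
    using zeta_mult[OF s_E[OF p(3)] p(1) _ assms(2)] s_proj[OF p(3)] E_central[OF p(1) assms(2)] assms(2)
    by (simp add: p(2) ract_L[OF p(1)] proj_L p(1) tri_orb p(3))
qed

end

section \<open>\<open>L\<close> as a manifold and principal bundle\<close>

lemma ract_L_closed: "A \<in> points (tot L) \<Longrightarrow> cmod z = 1 \<Longrightarrow> ract L A z \<in> points (tot L) \<and> proj L (ract L A z) = proj L A"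
  using E_central by (auto elim!: L_cases simp: ract_L proj_L) (auto simp: points_L)

text \<open>The source is a product with a quotient, to which the universal property of the quotient
  does not apply directly. Smoothness is checked locally, where a trivialisation turns the action
  into multiplication in U(1).\<close>

lemma smooth_ract_L: "smooth_map (prod_space (tot L) (lsp U1)) (tot L) (\<lambda>(A, z). ract L A z)"
proof (rule smooth_map_local)
  let ?P = "prod_space (tot L) (lsp U1)"
  have P: "smooth_space ?P" by (intro smooth_space_prod_space smooth_L smooth_space_U1)
  then show "functional_space ?P" by (rule smooth_space_functional)
  fix b assume b: "b \<in> points ?P"
  have pb: "proj L (fst b) \<in> points X" using b smooth_map_image[OF smooth_proj_L] by auto
  obtain U s s' where U: "proj L (fst b) \<in> U" "matching U s s'" using matching_ex[OF pb] by blast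
  let ?W = "{a \<in> points ?P. fst a \<in> over U}"
  let ?K = "sub_space ?P ?W"
  have W: "openin (ftop ?P) ?W"
    by (rule smooth_map_preimage_open[OF smooth_map_fst[OF smooth_space_functional[OF smooth_L]] over_open[OF U(2)]])
  have K: "smooth_space ?K" by (rule smooth_space_sub[OF P])
  note fK = smooth_space_functional[OF K]
  have f1: "smooth_map ?K (sub_space (tot L) (over U)) fst"
    by (rule smooth_map_sub_sub[OF P smooth_space_functional[OF smooth_L] smooth_map_fst[OF smooth_space_functional[OF smooth_L]]]) auto
  have f2: "smooth_map ?K (lsp U1) snd"
    by (rule smooth_map_restrict[OF smooth_space_functional[OF P] smooth_map_snd[OF smooth_space_functional[OF smooth_space_U1]]])
  have XU: "smooth_space (sub_space X U)" by (rule smooth_space_sub[OF S1.smooth_X])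
  have t: "smooth_map ?K (prod_space (sub_space X U) (lsp U1)) (\<lambda>a. tri s s' (fst a))"
    by (rule smooth_map_compose[OF f1 smooth_tri[OF U(2)]])
  have t1: "smooth_map ?K (sub_space X U) (\<lambda>a. fst (tri s s' (fst a)))"
    by (rule smooth_map_compose[OF t smooth_map_fst[OF smooth_space_functional[OF XU]]])
  have t2: "smooth_map ?K (lsp U1) (\<lambda>a. snd (tri s s' (fst a)))"
    by (rule smooth_map_compose[OF t smooth_map_snd[OF smooth_space_functional[OF smooth_space_U1]]])
  have "smooth_map ?K (prod_space (sub_space X U) (lsp U1)) (\<lambda>a. (fst (tri s s' (fst a)), snd (tri s s' (fst a)) * snd a))"
    by (rule smooth_map_pair[OF K t1 smooth_map_U1_mult[OF K t2 f2]])
  from smooth_map_compose[OF smooth_map_compose[OF this smooth_tri_inv[OF U(2)]] smooth_map_sub[OF smooth_space_functional[OF smooth_L]]]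
  have "smooth_map ?K (tot L) (\<lambda>a. tri_inv s s' (fst (tri s s' (fst a)), snd (tri s s' (fst a)) * snd a))" .
  then have "smooth_map ?K (tot L) (\<lambda>(A, z). ract L A z)"
  proof (rule smooth_map_cong[OF fK])
    fix a assume "a \<in> points ?K"
    then have a: "fst a \<in> over U" "cmod (snd a) = 1" by (auto simp: mem_Times_iff)
    have "ract L (fst a) (snd a) \<in> over U" using a ract_L_closed by (auto simp: over_def)
    from tri_inv_tri[OF U(2) this]
    show "(case a of (A, z) \<Rightarrow> ract L A z) = tri_inv s s' (fst (tri s s' (fst a)), snd (tri s s' (fst a)) * snd a)"
      using tri_ract[OF U(2) a] tri_closed(1)[OF U(2) a(1)] by (simp add: case_prod_beta')
  qed
  moreover have "b \<in> ?W" using b U(1) by (auto simp: over_def)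
  ultimately show "\<exists>W. openin (ftop ?P) W \<and> b \<in> W \<and> smooth_map (sub_space ?P W) (tot L) (\<lambda>(A, z). ract L A z)"
    using W by blast
qed

text \<open>Points over different base points are separated by the projection, since
  \<open>X\<close> is Hausdorff; points of one fibre lie in the domain of one trivialisation and
  have different images there.\<close>

lemma Hausdorff_L: "Hausdorff_space (ftop (tot L))"
  unfolding Hausdorff_space_def
proof (intro allI impI, elim conjE)
  fix A B assume A: "A \<in> points (tot L)" and B: "B \<in> points (tot L)" and AB: "A \<noteq> B"
  have HX: "Hausdorff_space (ftop X)" using S1.manifold_X by (simp add: smooth_manifold_iff)
  have HU1: "Hausdorff_space (ftop (lsp U1))"
    using lie_group_U1 by (simp add: lie_group_def smooth_manifold_iff)
  show "\<exists>U V. openin (ftop (tot L)) U \<and> openin (ftop (tot L)) V \<and> A \<in> U \<and> B \<in> V \<and> disjnt U V"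
  proof (cases "proj L A = proj L B")
    case False
    have "continuous_map (subtopology (ftop (tot L)) (points (tot L))) (ftop X) (proj L)"
      using smooth_map_continuous[OF smooth_proj_L] by simp
    from separate_by_map[OF openin_topspace A B HX this False] show ?thesis .
  next
    case True
    obtain U s s' where U: "proj L A \<in> U" "matching U s s'"
      using matching_ex[OF smooth_map_image[OF smooth_proj_L A]] by blast
    have o: "A \<in> over U" "B \<in> over U" using A B U(1) True by (auto simp: over_def)
    have ne: "tri s s' A \<noteq> tri s s' B" using tri_inv_tri[OF U(2)] o AB by metis
    have H: "Hausdorff_space (ftop (prod_space (sub_space X U) (lsp U1)))"
      using HX HU1 by (simp add: Hausdorff_space_prod_topology Hausdorff_space_subtopology)
    have "continuous_map (subtopology (ftop (tot L)) (over U)) (ftop (prod_space (sub_space X U) (lsp U1))) (tri s s')"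
      using smooth_map_continuous[OF smooth_tri[OF U(2)]] by (simp only: ftop_sub_space)
    from separate_by_map[OF over_open[OF U(2)] o H this ne] show ?thesis .
  qed
qed

text \<open>Second countability passes to images under open continuous maps, and the quotient map of
  a group action by homeomorphisms is open.\<close>

lemma second_countable_L: "second_countable (ftop (tot L))"
proof (rule second_countable_open_map_image[OF smooth_map_continuous[OF smooth_orb]])
  have "second_countable (ftop (tot P))" "second_countable (ftop (tot P'))"
    using S1.prin S2.prin by (auto simp: principal_bundle_def smooth_manifold_iff)
  then show "second_countable (ftop ES)"
    by (simp add: second_countable_subtopology second_countable_prod_topology)
  show "orb ` points ES = points (tot L)" by (simp add: tot_L)
  show "open_map (ftop ES) (ftop (tot L)) orb"
    unfolding open_map_def
  proof (intro allI impI)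
    fix W assume W: "openin (ftop ES) W"
    have WE: "W \<subseteq> E" using openin_subset[OF W] points_ES by blast
    have act: "openin (ftop ES) {a \<in> points ES. (ract P (fst a) g, ract P' (snd a) g) \<in> W}" if g: "g \<in> carrier (SpinC n)" for g
    proof (rule smooth_map_preimage_open[OF smooth_into_ES[OF smooth_ES] W])
      have c: "smooth_map ES (lsp (SpinC n)) (\<lambda>_. g)"
        by (rule smooth_map_const[OF smooth_space_functional[OF smooth_ES]]) (simp add: S1.points_G g)
      show "smooth_map ES (tot P) (\<lambda>a. ract P (fst a) g)" by (rule S1.smooth_map_ract[OF smooth_ES smooth_ES_fst c])
      show "smooth_map ES (tot P') (\<lambda>a. ract P' (snd a) g)" by (rule S2.smooth_map_ract[OF smooth_ES smooth_ES_snd c])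
      show "(ract P (fst a) g, ract P' (snd a) g) \<in> E" if "a \<in> points ES" for a
        using that E_ract[of "fst a" "snd a", OF _ g] points_ES by auto
    qed
    \<comment> \<open>The saturation of \<open>W\<close> is the union of its translates, each the
      preimage of \<open>W\<close> under the action of one group element and hence open.\<close>
    have eq: "{a \<in> points ES. orb a \<in> orb ` W} = (\<Union>g\<in>carrier (SpinC n). {a \<in> points ES. (ract P (fst a) g, ract P' (snd a) g) \<in> W})"
    proof (rule equalityI; rule subsetI)
      fix a assume a: "a \<in> {a \<in> points ES. orb a \<in> orb ` W}"
      then obtain w where w: "w \<in> W" "orb a = orb w" by blast
      have "w \<in> orb a" using orb_self[of "fst w" "snd w"] w WE by auto
      then obtain g where "g \<in> carrier (SpinC n)" "w = (ract P (fst a) g, ract P' (snd a) g)"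
        by (auto simp: orb_def)
      then show "a \<in> (\<Union>g\<in>carrier (SpinC n). {a \<in> points ES. (ract P (fst a) g, ract P' (snd a) g) \<in> W})" using w a by auto
    next
      fix a assume "a \<in> (\<Union>g\<in>carrier (SpinC n). {a \<in> points ES. (ract P (fst a) g, ract P' (snd a) g) \<in> W})"
      then obtain g where g: "g \<in> carrier (SpinC n)" "a \<in> points ES" "(ract P (fst a) g, ract P' (snd a) g) \<in> W" by blast
      have "orb a = orb (ract P (fst a) g, ract P' (snd a) g)"
        using orb_ract[of "fst a" "snd a", OF _ g(1)] g(2) points_ES by auto
      then show "a \<in> {a \<in> points ES. orb a \<in> orb ` W}" using g by auto
    qed
    have op: "openin (ftop ES) (\<Union>g\<in>carrier (SpinC n). {a \<in> points ES. (ract P (fst a) g, ract P' (snd a) g) \<in> W})"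
      using act by (intro openin_Union) auto
    show "openin (ftop (tot L)) (orb ` W)"
      unfolding tot_L ftop_quot_space openin_quot_topology eq
      using op image_mono[OF WE, of orb] unfolding points_ES by blast
  qed
qed

lemma manifold_L: "smooth_manifold (tot L)"
proof -
  obtain m where m: "charted m X" using S1.manifold_X by (auto simp: smooth_manifold_iff)
  have "charted (m + 1) (tot L)"
  proof (rule charted_local[OF smooth_L])
    fix A assume A: "A \<in> points (tot L)"
    obtain U s s' where U: "proj L A \<in> U" "matching U s s'"
      using matching_ex[OF smooth_map_image[OF smooth_proj_L A]] by blast
    have XU: "smooth_space (sub_space X U)" by (rule smooth_space_sub[OF S1.smooth_X])
    have "charted (m + 1) (prod_space (sub_space X U) (lsp U1))"
      by (intro charted_prod XU smooth_space_U1 charted_sub[OF S1.smooth_X m openU[OF U(2)]] charted_U1)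
    moreover have "diffeomorphic (sub_space (tot L) (over U)) (prod_space (sub_space X U) (lsp U1))"
      using diffeo_tri[OF U(2)] by (auto simp: diffeomorphic_def)
    ultimately have "charted (m + 1) (sub_space (tot L) (over U))"
      by (intro charted_diffeomorphic[OF smooth_space_sub[OF smooth_L] smooth_space_prod_space[OF XU smooth_space_U1]])
    then show "\<exists>W. openin (ftop (tot L)) W \<and> A \<in> W \<and> charted (m + 1) (sub_space (tot L) W)"
      using over_open[OF U(2)] A U(1) by (intro exI[of _ "over U"]) (auto simp: over_def)
  qed
  then show ?thesis
    unfolding smooth_manifold_iff using Hausdorff_L second_countable_L smooth_space_functional[OF smooth_L] by blast
qed

lemma principal_L: "principal_bundle X U1 L"
  unfolding principal_bundle_def
proof (intro conjI ballI manifold_L smooth_proj_L smooth_ract_L)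
  fix A assume A: "A \<in> points (tot L)"
  obtain p p' where p: "(p, p') \<in> E" "A = orb (p, p')" using A by (rule L_cases)
  show "ract L A \<one>\<^bsub>U1\<^esub> = A" using p S2.ract_one by (simp add: ract_L central_U1_one E_iff)
  fix z assume z: "z \<in> carrier U1"
  show "proj L (ract L A z) = proj L A" using ract_L_closed[OF A] z by simp
  fix w assume w: "w \<in> carrier U1"
  show "ract L (ract L A z) w = ract L A (z \<otimes>\<^bsub>U1\<^esub> w)"
    using p z w E_central[OF p(1)]
    by (simp add: ract_L norm_mult) (simp add: E_iff S2.ract_mult central_U1_closed central_U1_mult)
next
  fix x assume x: "x \<in> points X"
  obtain U s s' where U: "x \<in> U" "matching U s s'" using matching_ex[OF x] by blast
  then show "\<exists>U \<psi>. openin (ftop X) U \<and> x \<in> U \<and>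
        diffeo (sub_space (tot L) {p \<in> points (tot L). proj L p \<in> U}) (prod_space (sub_space X U) (lsp U1)) \<psi> \<and>
        (\<forall>p\<in>points (tot L). proj L p \<in> U \<longrightarrow> fst (\<psi> p) = proj L p \<and>
           (\<forall>g\<in>carrier U1. \<psi> (ract L p g) = (proj L p, snd (\<psi> p) \<otimes>\<^bsub>U1\<^esub> g)))"
    using diffeo_tri[OF U(2)] openU[OF U(2)] tri_closed(1)[OF U(2)] tri_ract[OF U(2)]
    by (intro exI[of _ U] exI[of _ "tri s s'"]) (auto simp: over_def)
qed

lemma semi_equivariant_L: "semi_equivariant_bundle \<Gamma> X \<rho> U1 (kappa_U1 \<epsilon>) L"
proof -
  have ga: "gact L \<gamma> A \<in> points (tot L)" if \<gamma>: "\<gamma> \<in> carrier \<Gamma>" and A: "A \<in> points (tot L)" for \<gamma> A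
    using A by (rule L_cases) (use E_gact[OF _ \<gamma>] in \<open>auto simp: gact_L \<gamma> points_L\<close>)
  have mon: "monoid \<Gamma>" using S1.group_\<Gamma> by (rule group.is_monoid)
  have "smooth_action \<Gamma> (tot L) (gact L)"
    unfolding smooth_action_def
  proof (intro conjI ballI group_actionI S1.group_\<Gamma> ga)
    show "gact L \<gamma> \<in> extensional (points (tot L))" for \<gamma> unfolding points_L by (simp add: L_def)
  next
    fix A assume "A \<in> points (tot L)"
    then show "gact L \<one>\<^bsub>\<Gamma>\<^esub> A = A"
      by (rule L_cases) (simp add: gact_L monoid.one_closed[OF mon] E_iff S1.gact_P S2.gact_P)
  next
    fix \<gamma> \<delta> A assume \<gamma>: "\<gamma> \<in> carrier \<Gamma>" "\<delta> \<in> carrier \<Gamma>" and "A \<in> points (tot L)"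
    from this(3) obtain p p' where p: "(p, p') \<in> E" "A = orb (p, p')" by (rule L_cases)
    have pts: "p \<in> points (tot P)" "p' \<in> points (tot P')" using p by (auto simp: E_iff)
    show "gact L (\<gamma> \<otimes>\<^bsub>\<Gamma>\<^esub> \<delta>) A = gact L \<gamma> (gact L \<delta> A)"
      using p(1) \<gamma> E_gact[OF p(1) \<gamma>(2)] pts
      by (simp add: p(2) gact_L monoid.m_closed[OF mon] S1.gact_P(4) S2.gact_P(4))
  next
    fix \<gamma> assume \<gamma>: "\<gamma> \<in> carrier \<Gamma>"
    have "smooth_map ES ES (\<lambda>a. (gact P \<gamma> (fst a), gact P' \<gamma> (snd a)))"
      by (rule smooth_into_ES[OF smooth_ES smooth_map_compose[OF smooth_ES_fst S1.smooth_gact[OF \<gamma>]]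
            smooth_map_compose[OF smooth_ES_snd S2.smooth_gact[OF \<gamma>]]])
        (use E_gact[OF _ \<gamma>] points_ES in auto)
    from smooth_map_compose[OF this smooth_orb]
    have "smooth_map ES (tot L) (\<lambda>a. gact L \<gamma> (orb a))"
      by (rule smooth_map_cong[OF smooth_space_functional[OF smooth_ES]])
        (auto simp: points_ES gact_L \<gamma> simp del: points_sub_space)
    then show "smooth_map (tot L) (tot L) (gact L \<gamma>)"
      using smooth_map_from_quot[OF smooth_space_functional[OF smooth_L], of ES "gact L \<gamma>" orb] by (simp add: tot_L)
  qed
  moreover have "proj L (gact L \<gamma> A) = \<rho> \<gamma> (proj L A)" if \<gamma>: "\<gamma> \<in> carrier \<Gamma>" and A: "A \<in> points (tot L)" for \<gamma> A
    using A by (rule L_cases) (use E_gact[OF _ \<gamma>] in \<open>auto simp: gact_L \<gamma> proj_L E_iff S1.proj_gact\<close>)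
  moreover have "gact L \<gamma> (ract L A z) = ract L (gact L \<gamma> A) (kappa_U1 \<epsilon> \<gamma> z)"
    if \<gamma>: "\<gamma> \<in> carrier \<Gamma>" and A: "A \<in> points (tot L)" and z: "z \<in> carrier U1" for \<gamma> A z
  proof -
    obtain p p' where p: "(p, p') \<in> E" "A = orb (p, p')" using A by (rule L_cases)
    have p': "p' \<in> points (tot P')" using p by (simp add: E_iff)
    show ?thesis
      using p(1) \<gamma> z E_gact[OF p(1) \<gamma>] E_central[OF p(1), of z] kappa_U1_closed[of z \<epsilon> \<gamma>] p'
      by (simp add: p(2) ract_L gact_L S2.gact_ract_central S2.gact_P)
  qed
  moreover have "gamma_group \<Gamma> U1 (kappa_U1 \<epsilon>)"
    by (rule gamma_group_U1[OF conjunct1[OF S1.orient[unfolded orientifold_def]]])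
  ultimately show ?thesis using principal_L by (simp add: semi_equivariant_bundle_def)
qed

end

section \<open>The tensor product\<close>

context spin_pair
begin

definition FP :: "('p \<times> ('p \<times> 'q) set) set" where
  "FP = fibre_product P L"

definition cls :: "'p \<times> ('p \<times> 'q) set \<Rightarrow> ('p \<times> ('p \<times> 'q) set) set" where
  "cls a = tensor_rel n P L `` {a}"

abbreviation FPS :: "('p \<times> ('p \<times> 'q) set) fspace" where
  "FPS \<equiv> sub_space (prod_space (tot P) (tot L)) FP"

abbreviation Q :: "('c, 'x, ('p \<times> ('p \<times> 'q) set) set) spinc_bundle" where
  "Q \<equiv> tensor_bundle n P L"

lemma FP_iff: "(p, l) \<in> FP \<longleftrightarrow> p \<in> points (tot P) \<and> l \<in> points (tot L) \<and> proj P p = proj L l"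
  by (simp add: FP_def fibre_product_def)

lemma FP_orb: "(p, p') \<in> E \<Longrightarrow> (p, orb (p, p')) \<in> FP"
  by (auto simp: FP_iff points_L proj_L E_iff)

text \<open>The element that carries \<open>a\<close> to \<open>p\<close> moves a given element of
  the orbit to one with first component \<open>p\<close>. Together with \<open>orb_unique\<close>
  this says that orbits are graphs of functions on a fibre of \<open>P\<close>.\<close>

lemma FP_cases:
  assumes "(p, l) \<in> FP"
  obtains p' where "(p, p') \<in> E" "l = orb (p, p')"
proof -
  obtain a a' where a: "(a, a') \<in> E" "l = orb (a, a')" "proj P p = proj P a" "p \<in> points (tot P)" "a \<in> points (tot P)"
    using assms by (auto simp: FP_iff proj_L E_iff elim!: L_cases)
  note k = S1.pdiv[OF a(5,4) a(3)[symmetric]]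
  have "(p, ract P' a' (S1.pdiv a p)) \<in> E" using E_ract[OF a(1) k(1)] k(2) by simp
  moreover have "l = orb (p, ract P' a' (S1.pdiv a p))" using orb_ract[OF a(1) k(1)] k(2) a(2) by simp
  ultimately show ?thesis by (rule that)
qed

text \<open>The structure group acts freely on \<open>P\<close>, so only the unit fixes the first
  component.\<close>

lemma orb_unique: "(p, p') \<in> E \<Longrightarrow> (p, p'') \<in> orb (p, p') \<Longrightarrow> p'' = p'"
proof -
  assume E: "(p, p') \<in> E" and o: "(p, p'') \<in> orb (p, p')"
  obtain g where g: "g \<in> carrier (SpinC n)" "p = ract P p g" "p'' = ract P' p' g"
    using orb_cases[OF E o] by auto
  have p: "p \<in> points (tot P)" "p' \<in> points (tot P')" using E by (auto simp: E_iff)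
  have "g = \<one>\<^bsub>SpinC n\<^esub>"
    using S1.pdiv_unique[OF p(1) g(1)] S1.pdiv_unique[OF p(1) one_SpinC_closed] S1.ract_one[OF p(1)] g(2) by metis
  then show "p'' = p'" using g(3) S2.ract_one p(2) by simp
qed

text \<open>The value at \<open>p\<close> of the isomorphism of fibres whose graph is
  \<open>l\<close>.\<close>

definition ev :: "'p \<Rightarrow> ('p \<times> 'q) set \<Rightarrow> 'q" where
  "ev p l = (THE p'. (p, p') \<in> l)"

lemma ev_orb: "(p, p') \<in> E \<Longrightarrow> ev p (orb (p, p')) = p'"
  unfolding ev_def using orb_self orb_unique by (intro the_equality)

section \<open>Tensor classes\<close>

lemma mult_cnj: "cmod z = 1 \<Longrightarrow> z * cnj z = 1" "cmod z = 1 \<Longrightarrow> cnj z * z = 1"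
  using complex_norm_square[of z] by (simp_all add: mult.commute)

lemma ract_P_central_cancel:
  "p \<in> points (tot P) \<Longrightarrow> cmod z = 1 \<Longrightarrow> ract P (ract P p (central_U1 n z)) (central_U1 n (cnj z)) = p"
  "p \<in> points (tot P) \<Longrightarrow> cmod z = 1 \<Longrightarrow> ract P (ract P p (central_U1 n (cnj z))) (central_U1 n z) = p"
  by (simp_all add: S1.ract_mult central_U1_closed central_U1_mult mult_cnj central_U1_one S1.ract_one)

lemma FP_tensor:
  "(p, l) \<in> FP \<Longrightarrow> cmod z = 1 \<Longrightarrow> (ract P p (central_U1 n z), l) \<in> FP"
  "(p, l) \<in> FP \<Longrightarrow> cmod z = 1 \<Longrightarrow> (p, ract L l z) \<in> FP"
  using ract_L_closed by (auto simp: FP_iff S1.ract_closed central_U1_closed S1.proj_ract)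

text \<open>In \<open>tensor_rel\<close> the first pair carries \<open>z\<close> on \<open>p\<close>
  and the second one on \<open>l\<close>. Undoing \<open>z\<close> by its inverse
  \<open>cnj z\<close> shows that the image of one pair is a full orbit of the antidiagonal action
  of U(1), so the images under the relation are equivalence classes.\<close>

lemma cls_eq:
  assumes "(p, l) \<in> FP"
  shows "cls (p, l) = (\<lambda>z. (ract P p (central_U1 n (cnj z)), ract L l z)) ` {z. cmod z = 1}"
proof (rule equalityI; rule subsetI)
  fix b assume "b \<in> cls (p, l)"
  then obtain p0 z where p0: "(p0, l) \<in> FP" "cmod z = 1" "p = ract P p0 (central_U1 n z)" "b = (p0, ract L l z)"
    by (auto simp: cls_def tensor_rel_def FP_def)
  then have "p0 = ract P p (central_U1 n (cnj z))"
    by (simp add: ract_P_central_cancel FP_iff)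
  then show "b \<in> (\<lambda>z. (ract P p (central_U1 n (cnj z)), ract L l z)) ` {z. cmod z = 1}"
    using p0 by (intro image_eqI[of _ _ z]) auto
next
  fix b assume "b \<in> (\<lambda>z. (ract P p (central_U1 n (cnj z)), ract L l z)) ` {z. cmod z = 1}"
  then obtain z where z: "cmod z = 1" "b = (ract P p (central_U1 n (cnj z)), ract L l z)" by auto
  let ?p = "ract P p (central_U1 n (cnj z))"
  have "(?p, l) \<in> FP" using FP_tensor(1)[OF assms, of "cnj z"] z by simp
  moreover have "ract P ?p (central_U1 n z) = p" using assms z by (simp add: ract_P_central_cancel FP_iff)
  ultimately have "((p, l), b) \<in> tensor_rel n P L"
    unfolding tensor_rel_def FP_def using z by (intro CollectI exI[of _ ?p] exI[of _ l] exI[of _ z]) auto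
  then show "b \<in> cls (p, l)" by (simp add: cls_def)
qed

lemma L_ract_mult: "l \<in> points (tot L) \<Longrightarrow> cmod z = 1 \<Longrightarrow> cmod w = 1 \<Longrightarrow> ract L (ract L l z) w = ract L l (z * w)"
  using principal_L by (simp add: principal_bundle_def)

lemma L_ract_one: "l \<in> points (tot L) \<Longrightarrow> ract L l 1 = l"
  using principal_L by (simp add: principal_bundle_def)

lemma cls_self: "(p, l) \<in> FP \<Longrightarrow> (p, l) \<in> cls (p, l)"
  by (simp add: cls_eq) (rule image_eqI[of _ _ 1], simp_all add: FP_iff central_U1_one S1.ract_one L_ract_one)

lemma cls_tensor:
  assumes a: "(p, l) \<in> FP" and z: "cmod z = 1"
  shows "cls (ract P p (central_U1 n (cnj z)), ract L l z) = cls (p, l)"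
proof -
  have pl: "p \<in> points (tot P)" "l \<in> points (tot L)" using a by (auto simp: FP_iff)
  have F: "(ract P p (central_U1 n (cnj z)), ract L l z) \<in> FP"
    using FP_tensor(2)[OF FP_tensor(1)[OF a], of "cnj z" z] z by simp
  have "cls (ract P p (central_U1 n (cnj z)), ract L l z)
      = (\<lambda>w. (ract P p (central_U1 n (cnj w)), ract L l w)) ` ((\<lambda>w. z * w) ` {w. cmod w = 1})"
    unfolding cls_eq[OF F] image_image
    by (rule image_cong) (use pl z in \<open>auto simp: S1.ract_mult central_U1_closed central_U1_mult L_ract_mult\<close>)
  also have "(\<lambda>w. z * w) ` {w. cmod w = 1} = {w. cmod w = 1}"
  proof (rule equalityI; rule subsetI)
    fix w assume "w \<in> {w. cmod w = 1}"
    then show "w \<in> (\<lambda>w. z * w) ` {w. cmod w = 1}"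
      using z mult_cnj[OF z] by (intro image_eqI[of _ _ "cnj z * w"]) (auto simp: norm_mult simp flip: mult.assoc)
  qed (use z in \<open>auto simp: norm_mult\<close>)
  finally show ?thesis using cls_eq[OF a] by simp
qed

lemma smooth_FPS: "smooth_space FPS"
  by (intro smooth_space_sub smooth_space_prod_space S1.smooth_P smooth_L)

lemma points_FPS: "points FPS = FP"
  by (auto simp: FP_iff)

lemma tot_Q: "tot Q = quot_space FPS cls"
  by (simp add: tensor_bundle_def Let_def FP_def cls_def[abs_def])

lemma points_Q: "points (tot Q) = cls ` FP"
  unfolding tot_Q using points_FPS by simp

lemma smooth_Q: "smooth_space (tot Q)"
  unfolding tot_Q by (rule smooth_space_quot[OF smooth_FPS])

lemma cls_cases:
  assumes "(p, l) \<in> FP" "b \<in> cls (p, l)"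
  shows "\<exists>z. cmod z = 1 \<and> b = (ract P p (central_U1 n (cnj z)), ract L l z)"
  using assms by (auto simp: cls_eq)

lemma the_elem_cls:
  assumes a: "(p, l) \<in> FP" and f: "\<And>z. cmod z = 1 \<Longrightarrow> f (ract P p (central_U1 n (cnj z)), ract L l z) = c"
  shows "the_elem (f ` cls (p, l)) = c"
proof -
  have "f b = c" if "b \<in> cls (p, l)" for b using cls_cases[OF a that] f by auto
  then have "f ` cls (p, l) = {c}"
    using cls_self[OF a] by (auto simp: image_iff intro!: bexI[of _ "(p, l)"])
  then show ?thesis by simp
qed

lemma proj_Q: "(p, l) \<in> FP \<Longrightarrow> proj Q (cls (p, l)) = proj P p"
  unfolding tensor_bundle_def Let_def pbundle.simps
  by (rule the_elem_cls) (simp_all add: FP_iff S1.proj_ract central_U1_closed)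

lemma tensor_map_cls: "(p, l) \<in> FP \<Longrightarrow> tensor_map \<phi> (cls (p, l)) = \<phi> p"
  unfolding tensor_map_def
  by (rule the_elem_cls) (simp_all add: FP_iff S1.phi_central)

text \<open>The operations of \<open>tensor_bundle\<close> are unions over all representatives; when
  the summand is constant along the antidiagonal orbit, the union is the common value.\<close>

lemma UN_cls:
  assumes a: "(p, l) \<in> FP" and f: "\<And>z. cmod z = 1 \<Longrightarrow> f (ract P p (central_U1 n (cnj z)), ract L l z) = c"
  shows "(\<Union>b\<in>cls (p, l). f b) = c"
proof -
  have "f b = c" if "b \<in> cls (p, l)" for b using cls_cases[OF a that] f by auto
  then show ?thesis using cls_self[OF a] by auto
qed

lemma FP_ract: "(p, l) \<in> FP \<Longrightarrow> g \<in> carrier (SpinC n) \<Longrightarrow> (ract P p g, l) \<in> FP"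
  by (simp add: FP_iff S1.ract_closed S1.proj_ract)

lemma ract_Q:
  assumes a: "(p, l) \<in> FP" and g: "g \<in> carrier (SpinC n)"
  shows "ract Q (cls (p, l)) g = cls (ract P p g, l)"
proof -
  have "(\<Union>b\<in>cls (p, l). (\<lambda>(p, l). cls (ract P p g, l)) b) = cls (ract P p g, l)"
  proof (rule UN_cls[OF a])
    fix z :: complex assume z: "cmod z = 1"
    have "ract P (ract P p (central_U1 n (cnj z))) g = ract P (ract P p g) (central_U1 n (cnj z))"
      using a g z central_U1_closed[of "cnj z" n] by (simp add: FP_iff S1.ract_mult central_U1_commute)
    then show "(case (ract P p (central_U1 n (cnj z)), ract L l z) of (p, l) \<Rightarrow> cls (ract P p g, l)) = cls (ract P p g, l)"
      using cls_tensor[OF FP_ract[OF a g] z] by simp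
  qed
  then show ?thesis by (simp add: tensor_bundle_def Let_def cls_def case_prod_beta')
qed

lemma gact_L_action:
  assumes "\<gamma> \<in> carrier \<Gamma>" "l \<in> points (tot L)"
  shows "gact L \<gamma> l \<in> points (tot L)" "proj L (gact L \<gamma> l) = \<rho> \<gamma> (proj L l)"
    "cmod z = 1 \<Longrightarrow> gact L \<gamma> (ract L l z) = ract L (gact L \<gamma> l) (kappa_U1 \<epsilon> \<gamma> z)"
proof -
  have "group_action \<Gamma> (points (tot L)) (gact L)"
    using semi_equivariant_L by (simp add: semi_equivariant_bundle_def smooth_action_def)
  from group_actionD(2)[OF this] assms show "gact L \<gamma> l \<in> points (tot L)" by blast
  show "proj L (gact L \<gamma> l) = \<rho> \<gamma> (proj L l)"
    "cmod z = 1 \<Longrightarrow> gact L \<gamma> (ract L l z) = ract L (gact L \<gamma> l) (kappa_U1 \<epsilon> \<gamma> z)"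
    using semi_equivariant_L assms by (simp_all add: semi_equivariant_bundle_def)
qed

lemma FP_gact: "(p, l) \<in> FP \<Longrightarrow> \<gamma> \<in> carrier \<Gamma> \<Longrightarrow> (gact P \<gamma> p, gact L \<gamma> l) \<in> FP"
  by (simp add: FP_iff S1.gact_P gact_L_action S1.proj_gact)

lemma gact_Q:
  assumes a: "(p, l) \<in> FP" and \<gamma>: "\<gamma> \<in> carrier \<Gamma>"
  shows "gact Q \<gamma> (cls (p, l)) = cls (gact P \<gamma> p, gact L \<gamma> l)"
proof -
  have "(\<Union>b\<in>cls (p, l). (\<lambda>(p, l). cls (gact P \<gamma> p, gact L \<gamma> l)) b) = cls (gact P \<gamma> p, gact L \<gamma> l)"
  proof (rule UN_cls[OF a])
    fix z :: complex assume z: "cmod z = 1"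
    \<comment> \<open>Inversion in U(1) commutes with \<open>kappa_U1\<close>, so the antidiagonal
      orbit of a pair is carried to that of its image.\<close>
    have k: "kappa_U1 \<epsilon> \<gamma> (cnj z) = cnj (kappa_U1 \<epsilon> \<gamma> z)" using z by (simp add: kappa_U1_def)
    have "gact P \<gamma> (ract P p (central_U1 n (cnj z))) = ract P (gact P \<gamma> p) (central_U1 n (cnj (kappa_U1 \<epsilon> \<gamma> z)))"
      using a \<gamma> z S1.gact_ract_central[of \<gamma> p "cnj z"] by (simp add: FP_iff S1.gact_P k)
    moreover have "gact L \<gamma> (ract L l z) = ract L (gact L \<gamma> l) (kappa_U1 \<epsilon> \<gamma> z)"
      using a \<gamma> z gact_L_action(3) by (simp add: FP_iff)
    ultimately show "(case (ract P p (central_U1 n (cnj z)), ract L l z) of (p, l) \<Rightarrow> cls (gact P \<gamma> p, gact L \<gamma> l)) = cls (gact P \<gamma> p, gact L \<gamma> l)"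
      using cls_tensor[OF FP_gact[OF a \<gamma>] kappa_U1_closed[OF z]] by simp
  qed
  moreover have "cls (p, l) \<in> fibre_product P L // tensor_rel n P L"
    using a by (auto simp: quotient_def FP_def cls_def)
  ultimately show ?thesis by (simp add: tensor_bundle_def Let_def cls_def case_prod_beta')
qed

lemma gact_Q_extensional: "gact Q \<gamma> \<in> extensional (points (tot Q))"
proof -
  have "points (tot Q) = fibre_product P L // tensor_rel n P L"
    unfolding points_Q by (auto simp: quotient_def FP_def cls_def)
  then show ?thesis by (simp add: tensor_bundle_def Let_def)
qed

section \<open>The isomorphism of \<open>P'\<close> with the tensor product\<close>

definition iso_map :: "'q \<Rightarrow> ('p \<times> ('p \<times> 'q) set) set" where
  "iso_map p' = (let p = SOME p. (p, p') \<in> E in cls (p, orb (p, p')))"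

definition iso_inv :: "('p \<times> ('p \<times> 'q) set) set \<Rightarrow> 'q" where
  "iso_inv B = (\<lambda>(p, l). ev p l) (SOME b. b \<in> B)"

text \<open>Two points of \<open>P\<close> with the frame of \<open>p'\<close> differ by some
  \<open>w\<close> in U(1). Passing from \<open>p\<close> to \<open>p w\<close> changes the orbit of
  \<open>(p, p')\<close> by \<open>cnj w\<close>, and the two factors cancel in the tensor class. So
  the choice in \<open>iso_map\<close> does not matter.\<close>

lemma iso_map_eq:
  assumes a: "(p, p') \<in> E"
  shows "iso_map p' = cls (p, orb (p, p'))"
proof -
  define q where "q = (SOME p. (p, p') \<in> E)"
  have q: "(q, p') \<in> E" unfolding q_def by (rule someI[of "\<lambda>p. (p, p') \<in> E", OF a])
  have pts: "p \<in> points (tot P)" "q \<in> points (tot P)" "p' \<in> points (tot P')" and eq: "proj P p = proj P q"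
    using a q E_proj[OF a] E_proj[OF q] by (auto simp: E_iff)
  note k = S1.pdiv[OF pts(1,2) eq]
  have "\<phi> (ract P p (S1.pdiv p q)) = \<phi> p" using a q k by (simp add: E_iff)
  from S1.phi_kernel[OF pts(1) k(1) this] obtain w where w: "cmod w = 1" "S1.pdiv p q = central_U1 n w" by metis
  have qp: "q = ract P p (central_U1 n w)" using k(2) w(2) by simp
  have c: "central_U1 n w \<in> carrier (SpinC n)" by (rule central_U1_closed[OF w(1)])
  have "orb (q, p') = orb (p, ract P' p' (central_U1 n (cnj w)))"
    using orb_ract[OF E_central[OF a, of "cnj w"] c] w pts
    by (simp add: qp S2.ract_mult central_U1_closed central_U1_mult mult_cnj central_U1_one S2.ract_one)
  also have "\<dots> = ract L (orb (p, p')) (cnj w)" using ract_L[OF a, of "cnj w"] w by simp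
  finally have "cls (q, orb (q, p')) = cls (ract P p (central_U1 n (cnj (cnj w))), ract L (orb (p, p')) (cnj w))"
    by (simp add: qp)
  also have "\<dots> = cls (p, orb (p, p'))" using cls_tensor[OF FP_orb[OF a], of "cnj w"] w by simp
  finally show ?thesis by (simp add: iso_map_def q_def Let_def)
qed

text \<open>\<open>matching_ex\<close> gives one pair of \<open>E\<close> over the base point of
  \<open>p'\<close>, and the element that carries its second component to \<open>p'\<close> carries
  the pair to one ending in \<open>p'\<close>.\<close>

lemma E_ex:
  assumes p': "p' \<in> points (tot P')"
  shows "\<exists>p. (p, p') \<in> E"
proof -
  obtain U s s' where U: "proj P' p' \<in> U" "matching U s s'" using matching_ex[OF S2.proj_closed[OF p']] by blast
  have "(s (proj P' p'), s' (proj P' p')) \<in> E" by (rule s_E[OF U(2,1)])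
  moreover have s': "s' (proj P' p') \<in> points (tot P')" "proj P' (s' (proj P' p')) = proj P' p'"
    using U by (auto simp: matching_def)
  ultimately show ?thesis
    using E_ract[OF _ S2.pdiv(1)[OF s'(1) p' s'(2)]] S2.pdiv(2)[OF s'(1) p' s'(2)] by metis
qed

text \<open>Translating \<open>p\<close> by the inverse of \<open>z\<close> and multiplying the
  isomorphism by \<open>z\<close> leaves the value unchanged, because the isomorphisms are
  equivariant and U(1) is central.\<close>

lemma ev_tensor:
  assumes a: "(p, l) \<in> FP" and b: "b \<in> cls (p, l)"
  shows "(\<lambda>(p, l). ev p l) b = ev p l"
proof -
  obtain p' where p': "(p, p') \<in> E" "l = orb (p, p')" using a by (rule FP_cases)
  obtain z where z: "cmod z = 1" "b = (ract P p (central_U1 n (cnj z)), ract L l z)" using cls_cases[OF a b] by blast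
  have pts: "p' \<in> points (tot P')" using p' by (simp add: E_iff)
  have c: "central_U1 n (cnj z) \<in> carrier (SpinC n)" using z by (simp add: central_U1_closed)
  have "ract L l z = orb (p, ract P' p' (central_U1 n z))" using ract_L[OF p'(1) z(1)] p'(2) by simp
  also have "\<dots> = orb (ract P p (central_U1 n (cnj z)), ract P' (ract P' p' (central_U1 n z)) (central_U1 n (cnj z)))"
    by (rule orb_ract[OF E_central[OF p'(1) z(1)] c, symmetric])
  also have "ract P' (ract P' p' (central_U1 n z)) (central_U1 n (cnj z)) = p'"
    using pts z by (simp add: S2.ract_mult central_U1_closed central_U1_mult mult_cnj central_U1_one S2.ract_one)
  finally have eq: "ract L l z = orb (ract P p (central_U1 n (cnj z)), p')" .
  have "ract P' (ract P' p' (central_U1 n z)) (central_U1 n (cnj z)) = p'"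
    using pts z by (simp add: S2.ract_mult central_U1_closed central_U1_mult mult_cnj central_U1_one S2.ract_one)
  then have "(ract P p (central_U1 n (cnj z)), p') \<in> E"
    using E_ract[OF E_central[OF p'(1) z(1)] c] by simp
  from ev_orb[OF this] eq z(2) ev_orb[OF p'(1)] p'(2) show ?thesis by simp
qed

lemma iso_inv_cls: "(p, l) \<in> FP \<Longrightarrow> iso_inv (cls (p, l)) = ev p l"
  unfolding iso_inv_def by (rule ev_tensor, assumption, rule someI[of _ "(p, l)"], rule cls_self)

lemma iso_inv_map: "p' \<in> points (tot P') \<Longrightarrow> iso_inv (iso_map p') = p'"
  using E_ex[of p'] by (auto simp: iso_map_eq iso_inv_cls FP_orb ev_orb)

lemma iso_map_inv: "B \<in> points (tot Q) \<Longrightarrow> iso_map (iso_inv B) = B"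
proof -
  assume "B \<in> points (tot Q)"
  then obtain p l where pl: "(p, l) \<in> FP" "B = cls (p, l)" by (auto simp: points_Q)
  obtain p' where p': "(p, p') \<in> E" "l = orb (p, p')" using pl(1) by (rule FP_cases)
  show ?thesis using p' pl by (simp add: iso_inv_cls ev_orb iso_map_eq)
qed

lemma smooth_cls: "smooth_map FPS (tot Q) cls"
  unfolding tot_Q by (rule smooth_map_quot[OF smooth_space_functional[OF smooth_FPS]])

lemma smooth_iso_map: "smooth_map (tot P') (tot Q) iso_map"
proof (rule smooth_map_local[OF smooth_space_functional[OF S2.smooth_P]])
  fix p' assume p': "p' \<in> points (tot P')"
  obtain U s s' where U: "proj P' p' \<in> U" and m: "matching U s s'" using matching_ex[OF S2.proj_closed[OF p']] by blast
  let ?W = "{a \<in> points (tot P'). proj P' a \<in> U}"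
  let ?K = "sub_space (tot P') ?W"
  have W: "openin (ftop (tot P')) ?W" by (rule smooth_map_preimage_open[OF S2.smooth_proj openU[OF m]])
  have K: "smooth_space ?K" by (rule smooth_space_sub[OF S2.smooth_P])
  note fK = smooth_space_functional[OF K]
  have pt: "a \<in> points (tot P')" "proj P' a \<in> U" if "a \<in> points ?K" for a using that by auto
  have i: "smooth_map ?K (tot P') (\<lambda>a. a)" by (rule smooth_map_sub[OF smooth_space_functional[OF S2.smooth_P]])
  have pr: "smooth_map ?K (sub_space X U) (proj P')"
    by (rule smooth_map_into_sub[OF fK smooth_space_functional[OF S1.smooth_X] smooth_map_compose[OF i S2.smooth_proj] pt(2)])
  have s'pt: "s' y \<in> points (tot P')" if "y \<in> U" for y using s_E[OF m that] by (simp add: E_iff)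
  have d: "smooth_map ?K (lsp (SpinC n)) (\<lambda>a. S2.pdiv (s' (proj P' a)) a)"
    by (rule S2.smooth_map_pdiv[OF K smooth_map_compose[OF pr s'_smooth[OF m]] i])
      (rule s'_proj[OF m pt(2)])
  \<comment> \<open>A smooth local choice of a partner in \<open>P\<close>: \<open>a\<close> is a
    value of \<open>s'\<close> times a group element, and the same element applied to
    \<open>s\<close> gives a point with the frame of \<open>a\<close>.\<close>
  define t where "t a = ract P (s (proj P' a)) (S2.pdiv (s' (proj P' a)) a)" for a
  have t: "smooth_map ?K (tot P) t"
    unfolding t_def by (rule S1.smooth_map_ract[OF K smooth_map_compose[OF pr s_smooth[OF m]] d])
  have tE: "(t a, a) \<in> E" if "a \<in> points ?K" for a
  proof -
    note a = pt[OF that]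
    note k = S2.pdiv[OF s'pt[OF a(2)] a(1) s'_proj[OF m a(2)]]
    show ?thesis using E_ract[OF s_E[OF m a(2)] k(1)] k(2) by (simp add: t_def)
  qed
  have "smooth_map ?K ES (\<lambda>a. (t a, a))" by (rule smooth_into_ES[OF K t i tE])
  from smooth_map_pair[OF K t smooth_map_compose[OF this smooth_orb]]
  have "smooth_map ?K (prod_space (tot P) (tot L)) (\<lambda>a. (t a, orb (t a, a)))" .
  then have "smooth_map ?K FPS (\<lambda>a. (t a, orb (t a, a)))"
    by (rule smooth_map_into_sub[OF fK smooth_space_functional[OF smooth_space_prod_space[OF S1.smooth_P smooth_L]]])
      (rule FP_orb[OF tE])
  from smooth_map_compose[OF this smooth_cls]
  have "smooth_map ?K (tot Q) iso_map"
    by (rule smooth_map_cong[OF fK]) (rule iso_map_eq[OF tE])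
  then show "\<exists>W. openin (ftop (tot P')) W \<and> p' \<in> W \<and> smooth_map (sub_space (tot P') W) (tot Q) iso_map"
    using W p' U by blast
qed

lemma smooth_iso_inv: "smooth_map (tot Q) (tot P') iso_inv"
  unfolding tot_Q
proof (rule smooth_map_from_quot[OF smooth_space_functional[OF S2.smooth_P]],
    rule smooth_map_local[OF smooth_space_functional[OF smooth_FPS]])
  note fP = smooth_space_functional[OF smooth_space_prod_space[OF S1.smooth_P smooth_L]]
  fix b assume "b \<in> points FPS"
  then have b: "(fst b, snd b) \<in> FP" using points_FPS by auto
  have "proj P (fst b) \<in> points X" by (rule S1.proj_closed) (use b[unfolded FP_iff] in blast)
  then obtain U s s' where U: "proj P (fst b) \<in> U" and m: "matching U s s'" using matching_ex by blast
  have F1: "smooth_map FPS (tot P) fst" and F2: "smooth_map FPS (tot L) snd"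
    by (rule smooth_map_restrict[OF fP smooth_map_fst[OF smooth_space_functional[OF S1.smooth_P]]],
        rule smooth_map_restrict[OF fP smooth_map_snd[OF smooth_space_functional[OF smooth_L]]])
  let ?W = "{a \<in> points FPS. proj P (fst a) \<in> U}"
  let ?K = "sub_space FPS ?W"
  have W: "openin (ftop FPS) ?W"
    by (rule smooth_map_preimage_open[OF smooth_map_compose[OF F1 S1.smooth_proj] openU[OF m]])
  have K: "smooth_space ?K" by (rule smooth_space_sub[OF smooth_FPS])
  note fK = smooth_space_functional[OF K]
  have pt: "(fst a, snd a) \<in> FP" "proj P (fst a) \<in> U" "snd a \<in> over U" if "a \<in> points ?K" for a
  proof -
    have "a \<in> FP" "proj P (fst a) \<in> U" using that points_FPS by auto
    then show "(fst a, snd a) \<in> FP" "proj P (fst a) \<in> U" "snd a \<in> over U"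
      using FP_iff[of "fst a" "snd a"] by (auto simp: over_def)
  qed
  have f1: "smooth_map ?K (tot P) fst"
    by (rule smooth_map_restrict[OF smooth_space_functional[OF smooth_FPS] F1])
  have f2: "smooth_map ?K (sub_space (tot L) (over U)) snd"
    by (rule smooth_map_into_sub[OF fK smooth_space_functional[OF smooth_L] smooth_map_restrict[OF smooth_space_functional[OF smooth_FPS] F2] pt(3)])
  have pr: "smooth_map ?K (sub_space X U) (\<lambda>a. proj P (fst a))"
    by (rule smooth_map_into_sub[OF fK smooth_space_functional[OF S1.smooth_X] smooth_map_compose[OF f1 S1.smooth_proj] pt(2)])
  have d: "smooth_map ?K (lsp (SpinC n)) (\<lambda>a. S1.pdiv (s (proj P (fst a))) (fst a))"
    by (rule S1.smooth_map_pdiv[OF K smooth_map_compose[OF pr s_smooth[OF m]] f1])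
      (rule s_proj[OF m pt(2)])
  have z: "smooth_map ?K (lsp U1) (\<lambda>a. snd (tri s s' (snd a)))"
    by (rule smooth_map_compose[OF smooth_map_compose[OF f2 smooth_tri[OF m]] smooth_map_snd[OF smooth_space_functional[OF smooth_space_U1]]])
  \<comment> \<open>An explicit formula replaces the definite description in \<open>ev\<close>: the
    value is \<open>s'\<close> times the U(1) coordinate of the isomorphism times the group element
    that carries \<open>s\<close> to the given point of \<open>P\<close>.\<close>
  have "smooth_map ?K (tot P') (\<lambda>a. ract P' (ract P' (s' (proj P (fst a))) (central_U1 n (snd (tri s s' (snd a))))) (S1.pdiv (s (proj P (fst a))) (fst a)))"
    by (intro S2.smooth_map_ract[OF K] S2.smooth_map_ract[OF K smooth_map_compose[OF pr s'_smooth[OF m]]] smooth_map_central_U1[OF K z] d)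
  then have "smooth_map ?K (tot P') (\<lambda>a. iso_inv (cls a))"
  proof (rule smooth_map_cong[OF fK])
    fix a assume "a \<in> points ?K"
    note a = pt[OF this]
    obtain p' where p': "(fst a, p') \<in> E" "snd a = orb (fst a, p')" using a(1) by (rule FP_cases)
    have "iso_inv (cls a) = p'" using iso_inv_cls[OF a(1)] ev_orb[OF p'(1)] p'(2) by (metis prod.collapse)
    also have "\<dots> = ract P' (ract P' (s' (proj P (fst a))) (central_U1 n (snd (tri s s' (snd a))))) (S1.pdiv (s (proj P (fst a))) (fst a))"
      using zeta_central(3)[OF s_E[OF m a(2)] p'(1) s_proj[OF m a(2)]] tri_orb[OF m p'(1) a(2)] p'(2) by simp
    finally show "iso_inv (cls a) = \<dots>" .
  qed
  then show "\<exists>W. openin (ftop FPS) W \<and> b \<in> W \<and> smooth_map (sub_space FPS W) (tot P') (\<lambda>a. iso_inv (cls a))"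
  proof (intro exI conjI)
    show "b \<in> ?W" using b U points_FPS by auto
  qed (rule W)
qed

lemma diffeo_iso_map: "diffeo (tot P') (tot Q) iso_map"
  by (rule diffeoI[OF smooth_iso_map smooth_iso_inv iso_inv_map iso_map_inv])

lemma iso_map_properties:
  assumes p': "p' \<in> points (tot P')"
  shows "proj Q (iso_map p') = proj P' p'"
    and "g \<in> carrier (SpinC n) \<Longrightarrow> ract Q (iso_map p') g = iso_map (ract P' p' g)"
    and "\<gamma> \<in> carrier \<Gamma> \<Longrightarrow> gact Q \<gamma> (iso_map p') = iso_map (gact P' \<gamma> p')"
    and "tensor_map \<phi> (iso_map p') = \<phi>' p'"
proof -
  obtain p where p: "(p, p') \<in> E" using E_ex[OF p'] by blast
  note F = FP_orb[OF p]
  show "proj Q (iso_map p') = proj P' p'" using E_proj[OF p] by (simp add: iso_map_eq[OF p] proj_Q[OF F])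
  show "tensor_map \<phi> (iso_map p') = \<phi>' p'" using p by (simp add: iso_map_eq[OF p] tensor_map_cls[OF F]) (simp add: E_iff)
  show "ract Q (iso_map p') g = iso_map (ract P' p' g)" if g: "g \<in> carrier (SpinC n)"
    using iso_map_eq[OF E_ract[OF p g]] orb_ract[OF p g] by (simp add: iso_map_eq[OF p] ract_Q[OF F g])
  show "gact Q \<gamma> (iso_map p') = iso_map (gact P' \<gamma> p')" if \<gamma>: "\<gamma> \<in> carrier \<Gamma>"
    using iso_map_eq[OF E_gact[OF p \<gamma>]] gact_L[OF p \<gamma>] by (simp add: iso_map_eq[OF p] gact_Q[OF F \<gamma>])
qed

text \<open>The bundle axioms are transported from \<open>P'\<close> along \<open>iso_map\<close>,
  and the frame map equals \<open>\<phi>'\<close> after \<open>iso_inv\<close>, so each condition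
  follows from the corresponding one for \<open>P'\<close>.\<close>

lemma structure_Q: "spin_kappa_structure \<Gamma> \<epsilon> X \<rho> n V Q (tensor_map \<phi>)"
  unfolding spin_kappa_structure_def
proof (intro conjI ballI)
  note inv = iso_map_inv smooth_map_image[OF smooth_iso_inv]
  show "semi_equivariant_bundle \<Gamma> X \<rho> (SpinC n) (kappa_SpinC n \<epsilon>) Q"
    by (rule semi_equivariant_bundle_transport[OF S2.seb S2.smooth_X smooth_Q diffeo_iso_map])
      (simp_all only: iso_map_properties gact_Q_extensional)
  show "smooth_map (tot Q) (tot (Fr X \<rho> n V)) (tensor_map \<phi>)"
    by (rule smooth_map_cong[OF smooth_space_functional[OF smooth_Q] smooth_map_compose[OF smooth_iso_inv S2.phi_smooth]])
      (metis inv iso_map_properties(4))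
  fix B assume B: "B \<in> points (tot Q)"
  define p' where "p' = iso_inv B"
  have p': "p' \<in> points (tot P')" "B = iso_map p'" using inv[OF B] by (auto simp: p'_def)
  show "proj (Fr X \<rho> n V) (tensor_map \<phi> B) = proj Q B"
    using S2.str p' by (simp add: iso_map_properties spin_kappa_structure_def)
  fix g assume g: "g \<in> carrier (SpinC n)"
  show "tensor_map \<phi> (ract Q B g) = ract (Fr X \<rho> n V) (tensor_map \<phi> B) (AdC n g)"
    using g p' by (simp add: iso_map_properties S2.ract_closed S2.phi_ract_Fr)
next
  fix \<gamma> B assume \<gamma>: "\<gamma> \<in> carrier \<Gamma>" and B: "B \<in> points (tot Q)"
  define p' where "p' = iso_inv B"
  have p': "p' \<in> points (tot P')" "B = iso_map p'"
    using iso_map_inv[OF B] smooth_map_image[OF smooth_iso_inv B] by (auto simp: p'_def)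
  show "tensor_map \<phi> (gact Q \<gamma> B) = gact (Fr X \<rho> n V) \<gamma> (tensor_map \<phi> B)"
    using \<gamma> p' by (simp add: iso_map_properties S2.gact_P S2.phi_gact)
qed

lemma isomorphic_Q: "spin_kappa_isomorphic \<Gamma> n P' \<phi>' Q (tensor_map \<phi>)"
  unfolding spin_kappa_isomorphic_def
  using diffeo_iso_map iso_map_properties by (intro exI[of _ iso_map]) simp

end

theorem corollary34:
  fixes \<Gamma> :: "'c monoid" and \<epsilon> :: "'c \<Rightarrow> int"
    and X :: "'x fspace" and \<rho> :: "'c \<Rightarrow> 'x \<Rightarrow> 'x"
    and n :: nat and V :: "('c, 'x, 'v) vbundle"
    and P :: "('c, 'x, 'p) spinc_bundle" and \<phi> :: "'p \<Rightarrow> 'x \<times> (nat \<Rightarrow> 'v)"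
    and P' :: "('c, 'x, 'q) spinc_bundle" and \<phi>' :: "'q \<Rightarrow> 'x \<times> (nat \<Rightarrow> 'v)"
  assumes "finite_orientifold_group \<Gamma> \<epsilon>"
    and "orientifold \<Gamma> \<epsilon> X \<rho>"
    and "oriented_isometric_vector_bundle \<Gamma> X \<rho> n V"
    and "spin_kappa_structure \<Gamma> \<epsilon> X \<rho> n V P \<phi>"
    and "spin_kappa_structure \<Gamma> \<epsilon> X \<rho> n V P' \<phi>'"
  shows "\<exists>L :: ('c, 'x, complex, ('p \<times> 'q) set) pbundle.
           semi_equivariant_bundle \<Gamma> X \<rho> U1 (kappa_U1 \<epsilon>) L \<and>
           spin_kappa_structure \<Gamma> \<epsilon> X \<rho> n V (tensor_bundle n P L) (tensor_map \<phi>) \<and>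
           spin_kappa_isomorphic \<Gamma> n P' \<phi>' (tensor_bundle n P L) (tensor_map \<phi>)"
proof -
  interpret spin_pair \<Gamma> \<epsilon> X \<rho> n V P \<phi> P' \<phi>'
    using assms by (intro spin_pair.intro spin_struct.intro)
  show ?thesis using semi_equivariant_L structure_Q isomorphic_Q by blast
qed

end
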